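(* Let $G$ be a second countable locally compact Hausdorff groupoid with a Haar system, $H$ a closed wide subgroupoid of $G$ with Haar system $\{\lambda_H^u\}_{u\in G^0}$, and $\mu$ a full equivariant $r_{G^0}$-system on $G/H$. (i) If $\sigma$ and $\sigma'$ are unitarily equivalent continuous unitary representations of $H$, then $\left(\mathrm{ind}_H^G(\sigma),\mu\right)$ and $\left(\mathrm{ind}_H^G(\sigma'),\mu\right)$ are equivalent representations of $G$. (ii) If $\{\sigma_i\}_{i\in I}$ is any family of continuous unitary representations of $H$, then $\left(\mathrm{ind}_H^G\left(\bigoplus_{i\in I}\sigma_i\right),\mu\right)$ is equivalent to $\bigoplus_{i\in I}\left(\mathrm{ind}_H^G(\sigma_i),\mu\right)$.
   Context: Groupoids. For a groupoid $G$: $r(x)=xx^{-1}$, $d(x)=x^{-1}x$, unit space $G^0$, $G^2=\{(x,y):d(x)=r(y)\}$, $G^u=r^{-1}(u)$. A Haar system on $G$ is a family $\{\lambda^u\}_{u\in G^0}$ of positive Radon measures on $G$ with $\mathrm{supp}\,\lambda^u=G^u$, $u\mapsto\int f\,d\lambda^u$ continuous for $f\in C_c(G)$, and $\int f(xy)\,d\lambda^{d(x)}(y)=\int f(y)\,d\lambda^{r(x)}(y)$. A subgroupoid is wide if its unit space is $G^0$. $G/H$ is the space of cosets $xH=\{xh:h\in H, r(h)=d(x)\}$ with quotient topology (locally compact Hausdorff), quotient map $q_H$, moment map $r_{G^0}(xH)=r(x)$ and left action $g\cdot xH=gxH$. A full equivariant $r_{G^0}$-system on $G/H$ is a family $\mu=\{\mu^u\}_{u\in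 G^0}$ of positive Radon measures on $G/H$ with $\mathrm{supp}\,\mu^u=r_{G^0}^{-1}(u)$, $u\mapsto\int f\,d\mu^u$ continuous for $f\in C_c(G/H)$, and $\int f(x\cdot y)\,d\mu^{d(x)}(y)=\int f(y)\,d\mu^{r(x)}(y)$ for $x\in G$. Hilbert bundles and representations. A continuous field of Hilbert spaces (continuous Hilbert bundle) over $G^0$ is a family $\{\mathcal H_u\}_{u\in G^0}$ with a linear subspace $\Gamma\subset\prod_u\mathcal H_u$ such that $\{\xi(u):\xi\in\Gamma\}$ is dense in $\mathcal H_u$, $u\mapsto\|\xi(u)\|$ is continuous for $\xi\in\Gamma$, and $\Gamma$ is closed under locally uniform approximation. The total space $\mathcal H=\bigsqcup_u\mathcal H_u$, with projection $p$, has the topology generated by the sets $\{h:\ p(h)\in V,\ \|h-\xi(p(h))\|<\epsilon\}$ ($V\subset G^0$ open, $\epsilon>0$, $\xi\in\Gamma$); $C_0(G^0,\mathcal H)$ is the space of continuous sections vanishing at infinity, with sup norm. A continuous unitary representation $(\mathcal H^\pi,\pi)$ of $G$ consists of a continuous Hilbert bundle $\mathcal H^\pi$ over $G^0$ and unitaries $\pi(x):\mathcal H^\pi_{d(x)}\to\mathcal H^\pi_{r(x)}$ with $\pi(u)=\mathrm{id}$ for $u\in G^0$, $\pi(x)\pi(y)=\pi(xy)$ on $G^2$, $\pi(x^{-1})=\pi(x)^{-1}$, and $x\mapsto\langle\pi(x)\xi(d(x)),\eta(r(x))\rangle$ continuous for $\xi,\eta\in C_0(G^0,\mathcal H^\pi)$.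 $\mathrm{Mor}(\pi,\pi')$ is the vector space of bundle morphisms (continuous, fibre-preserving, fibrewise bounded linear) $T:\mathcal H^\pi\to\mathcal H^{\pi'}$ with $T_{r(x)}\pi(x)=\pi'(x)T_{d(x)}$ for all $x\in G$; $\pi,\pi'$ are (unitarily) equivalent if some $T\in \mathrm{Mor}(\pi,\pi')$ has every $T_u$ unitary. The direct sum of Hilbert bundles $\mathcal H^{i}$, $i\in I$, is the Hilbert bundle with fibres the Hilbert space direct sums $\bigoplus_i\mathcal H^{i}_u$ and topology determined by the sections having only finitely many nonzero components, each a continuous section of the corresponding $\mathcal H^{i}$; the direct sum $\bigoplus_i\sigma_i$ acts on it componentwise. Induced representation. Let $(\mathcal H^\sigma,\sigma)$ be a continuous unitary representation of $H$. $C(G,\mathcal H^\sigma)$ is the set of continuous $f:G\to\mathcal H^\sigma$ with $f(x)\in\mathcal H^\sigma_{d(x)}$, and $$\mathcal F_0^\sigma(G)=\{f\in C(G,\mathcal H^\sigma): q_H(\mathrm{supp} f)\text{ compact},\ f(x\xi)=\sigma(\xi^{-1})f(x)\ \text{for } (x,\xi)\in G^2,\ \xi\in H\}.$$ For $f,g\in\mathcal F_0^\sigma(G)$ put $\langle f,g\rangle(u)=\int_{G/H}\langle f(x),g(x)\rangle_{\mathcal H^\sigma_{d(x)}}d\mu^u(xH)$ and $\|f\|=\sup_u\sqrt{\langle f,f\rangle(u)}$; $\mathcal F^\sigma(G)=\mathcal F^\sigma(G,\mu)$ is the completion, a Hilbert $C_0(G^0)$-module with $(bf)(x)=b(r(x))f(x)$.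 It determines a continuous Hilbert bundle $\bar{\mathcal F}^\sigma_G$ over $G^0$ with fibres $\mathcal F^u=\mathcal F^\sigma(G)/\{f:\langle f,f\rangle(u)=0\}$, equivalently the completion of $\{f|_{G^u}:f\in\mathcal F_0^\sigma(G)\}$ in the norm $\sqrt{\langle f,f\rangle(u)}$, and with the topology determined by the sections $t_F(u)=F+\{f:\langle f,f\rangle(u)=0\}$, $F\in\mathcal F^\sigma(G)$. The induced representation $(\mathrm{ind}_H^G(\sigma),\mu)$ is the continuous unitary representation $L$ of $G$ on $\bar{\mathcal F}^\sigma_G$ with $L(x):\mathcal F^{d(x)}\to\mathcal F^{r(x)}$, $(L(x)f)(y)=f(x^{-1}y)$. *)

theory Defs
  imports "HOL-Analysis.Analysis" "HOL-Algebra.Module" "HOL-Algebra.AbelCoset"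
begin

section \<open>Topological groupoids\<close>

text \<open>The underlying set of a groupoid is the \<^const>\<open>topspace\<close> of its topology; multiplication is a
  total HOL function of which only the values on composable pairs matter.\<close>

record 'g groupoid_data =
  gtop :: "'g topology"
  gmul :: "'g \<Rightarrow> 'g \<Rightarrow> 'g"
  ginv :: "'g \<Rightarrow> 'g"

abbreviation arrows :: "'g groupoid_data \<Rightarrow> 'g set" where
  "arrows G \<equiv> topspace (gtop G)"

definition rng_of :: "'g groupoid_data \<Rightarrow> 'g \<Rightarrow> 'g" where
  "rng_of G x = gmul G x (ginv G x)"

definition dom_of :: "'g groupoid_data \<Rightarrow> 'g \<Rightarrow> 'g" where
  "dom_of G x = gmul G (ginv G x) x"

definition unit_space :: "'g groupoid_data \<Rightarrow> 'g set" where
  "unit_space G = rng_of G ` arrows G"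

definition unit_top :: "'g groupoid_data \<Rightarrow> 'g topology" where
  "unit_top G = subtopology (gtop G) (unit_space G)"

definition composable :: "'g groupoid_data \<Rightarrow> ('g \<times> 'g) set" where
  "composable G = {(x, y). x \<in> arrows G \<and> y \<in> arrows G \<and> dom_of G x = rng_of G y}"

definition range_fibre :: "'g groupoid_data \<Rightarrow> 'g \<Rightarrow> 'g set" where
  "range_fibre G u = {x \<in> arrows G. rng_of G x = u}"

definition groupoid :: "'g groupoid_data \<Rightarrow> bool" where
  "groupoid G \<longleftrightarrow>
     (\<forall>x\<in>arrows G. ginv G x \<in> arrows G \<and> ginv G (ginv G x) = x) \<and>
     (\<forall>(x, y)\<in>composable G. gmul G x y \<in> arrows G) \<and>
     (\<forall>x y z. (x, y) \<in> composable G \<longrightarrow> (y, z) \<in> composable G \<longrightarrow>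
        (gmul G x y, z) \<in> composable G \<and> (x, gmul G y z) \<in> composable G \<and>
        gmul G (gmul G x y) z = gmul G x (gmul G y z)) \<and>
     (\<forall>(x, y)\<in>composable G. gmul G (ginv G x) (gmul G x y) = y \<and>
        gmul G (gmul G x y) (ginv G y) = x)"

definition topological_groupoid :: "'g groupoid_data \<Rightarrow> bool" where
  "topological_groupoid G \<longleftrightarrow>
     groupoid G \<and>
     continuous_map (gtop G) (gtop G) (ginv G) \<and>
     continuous_map (subtopology (prod_topology (gtop G) (gtop G)) (composable G)) (gtop G)
       (\<lambda>(x, y). gmul G x y)"

definition restrict_groupoid :: "'g groupoid_data \<Rightarrow> 'g set \<Rightarrow> 'g groupoid_data" where
  "restrict_groupoid G H = G\<lparr>gtop := subtopology (gtop G) H\<rparr>"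

definition subgroupoid :: "'g groupoid_data \<Rightarrow> 'g set \<Rightarrow> bool" where
  "subgroupoid G H \<longleftrightarrow>
     H \<subseteq> arrows G \<and>
     (\<forall>x\<in>H. ginv G x \<in> H) \<and>
     (\<forall>x\<in>H. \<forall>y\<in>H. (x, y) \<in> composable G \<longrightarrow> gmul G x y \<in> H)"

definition wide_subgroupoid :: "'g groupoid_data \<Rightarrow> 'g set \<Rightarrow> bool" where
  "wide_subgroupoid G H \<longleftrightarrow>
     subgroupoid G H \<and> unit_space (restrict_groupoid G H) = unit_space G"


section \<open>Radon measures, Haar systems and equivariant systems\<close>

definition Cc :: "'a topology \<Rightarrow> ('a \<Rightarrow> complex) set" where
  "Cc X = {f. continuous_map X euclidean f \<and>
              compactin X (X closure_of {x \<in> topspace X. f x \<noteq> 0})}"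

definition borel_of :: "'a topology \<Rightarrow> 'a measure" where
  "borel_of X = sigma (topspace X) {U. openin X U}"

definition radon_measure :: "'a topology \<Rightarrow> 'a measure \<Rightarrow> bool" where
  "radon_measure X M \<longleftrightarrow>
     sets M = sets (borel_of X) \<and>
     (\<forall>K. compactin X K \<longrightarrow> emeasure M K < \<infinity>) \<and>
     (\<forall>A\<in>sets M. emeasure M A = (INF U\<in>{U. openin X U \<and> A \<subseteq> U}. emeasure M U)) \<and>
     (\<forall>U. openin X U \<longrightarrow>
        emeasure M U = (SUP K\<in>{K. compactin X K \<and> K \<subseteq> U}. emeasure M K))"

definition measure_support :: "'a topology \<Rightarrow> 'a measure \<Rightarrow> 'a set" where
  "measure_support X M =
     {x \<in> topspace X. \<forall>U. openin X U \<and> x \<in> U \<longrightarrow> emeasure M U > 0}"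

text \<open>In the invariance conditions the integral over \<open>y\<close> is written over the support of the
  measure, because \<open>x y\<close> is only meaningful there.\<close>

definition haar_system :: "'g groupoid_data \<Rightarrow> ('g \<Rightarrow> 'g measure) \<Rightarrow> bool" where
  "haar_system G lam \<longleftrightarrow>
     (\<forall>u\<in>unit_space G. radon_measure (gtop G) (lam u) \<and>
        measure_support (gtop G) (lam u) = range_fibre G u) \<and>
     (\<forall>f\<in>Cc (gtop G). continuous_map (unit_top G) euclidean (\<lambda>u. LINT y|lam u. f y)) \<and>
     (\<forall>f\<in>Cc (gtop G). \<forall>x\<in>arrows G.
        (LINT y:range_fibre G (dom_of G x)|lam (dom_of G x). f (gmul G x y)) =
        (LINT y|lam (rng_of G x). f y))"

definition coset :: "'g groupoid_data \<Rightarrow> 'g set \<Rightarrow> 'g \<Rightarrow> 'g set" where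
  "coset G H x = {gmul G x h | h. h \<in> H \<and> rng_of G h = dom_of G x}"

definition quotient_topology :: "'a topology \<Rightarrow> ('a \<Rightarrow> 'b) \<Rightarrow> 'b topology" where
  "quotient_topology X q =
     topology (\<lambda>V. V \<subseteq> q ` topspace X \<and> openin X {x \<in> topspace X. q x \<in> V})"

lemma openin_quotient_topology:
  "openin (quotient_topology X q) V \<longleftrightarrow>
     V \<subseteq> q ` topspace X \<and> openin X {x \<in> topspace X. q x \<in> V}"
proof -
  have "istopology (\<lambda>V. V \<subseteq> q ` topspace X \<and> openin X {x \<in> topspace X. q x \<in> V})"
    unfolding istopology_def
  proof (intro conjI allI impI)
    fix S T assume "S \<subseteq> q ` topspace X \<and> openin X {x \<in> topspace X. q x \<in> S}"
      "T \<subseteq> q ` topspace X \<and> openin X {x \<in> topspace X. q x \<in> T}"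
    then have "openin X ({x \<in> topspace X. q x \<in> S} \<inter> {x \<in> topspace X. q x \<in> T})" by auto
    moreover have "{x \<in> topspace X. q x \<in> S} \<inter> {x \<in> topspace X. q x \<in> T} =
      {x \<in> topspace X. q x \<in> S \<inter> T}" by auto
    ultimately show "openin X {x \<in> topspace X. q x \<in> S \<inter> T}" by simp
  next
    fix \<K> assume "\<forall>K\<in>\<K>. K \<subseteq> q ` topspace X \<and> openin X {x \<in> topspace X. q x \<in> K}"
    then have "openin X (\<Union>K\<in>\<K>. {x \<in> topspace X. q x \<in> K})" by blast
    moreover have "(\<Union>K\<in>\<K>. {x \<in> topspace X. q x \<in> K}) = {x \<in> topspace X. q x \<in> \<Union>\<K>}" by auto
    ultimately show "openin X {x \<in> topspace X. q x \<in> \<Union>\<K>}" by simp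
  qed blast+
  then show ?thesis by (simp add: quotient_topology_def)
qed

lemma topspace_quotient_topology [simp]: "topspace (quotient_topology X q) = q ` topspace X"
proof -
  have "{x \<in> topspace X. q x \<in> q ` topspace X} = topspace X" by auto
  then have "openin (quotient_topology X q) (q ` topspace X)"
    by (simp add: openin_quotient_topology)
  then show ?thesis
    by (meson openin_quotient_topology openin_subset openin_topspace subset_antisym)
qed

lemma quotient_map_quotient_topology: "quotient_map X (quotient_topology X q) q"
  by (simp add: quotient_map_def openin_quotient_topology)

definition coset_space :: "'g groupoid_data \<Rightarrow> 'g set \<Rightarrow> 'g set topology" where
  "coset_space G H = quotient_topology (gtop G) (coset G H)"

text \<open>The moment map: all elements of the coset \<open>xH\<close> have range \<open>r(x)\<close>.\<close>

definition coset_rng :: "'g groupoid_data \<Rightarrow> 'g set \<Rightarrow> 'g" where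
  "coset_rng G C = the_elem (rng_of G ` C)"

definition coset_fibre :: "'g groupoid_data \<Rightarrow> 'g set \<Rightarrow> 'g \<Rightarrow> 'g set set" where
  "coset_fibre G H u = {C \<in> topspace (coset_space G H). coset_rng G C = u}"

definition full_equivariant_system ::
  "'g groupoid_data \<Rightarrow> 'g set \<Rightarrow> ('g \<Rightarrow> 'g set measure) \<Rightarrow> bool" where
  "full_equivariant_system G H \<mu> \<longleftrightarrow>
     (\<forall>u\<in>unit_space G. radon_measure (coset_space G H) (\<mu> u) \<and>
        measure_support (coset_space G H) (\<mu> u) = coset_fibre G H u) \<and>
     (\<forall>f\<in>Cc (coset_space G H).
        continuous_map (unit_top G) euclidean (\<lambda>u. LINT C|\<mu> u. f C)) \<and>
     (\<forall>f\<in>Cc (coset_space G H). \<forall>x\<in>arrows G.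
        (LINT C:coset_fibre G H (dom_of G x)|\<mu> (dom_of G x). f (gmul G x ` C)) =
        (LINT C|\<mu> (rng_of G x). f C))"


section \<open>Complex Hilbert spaces with explicit carrier\<close>

text \<open>The fibres of a bundle vary with the base point, so they are carrier-based: a \<^const>\<open>module\<close>
  over the field of complex numbers with an inner product, linear in the first argument. The fields
  \<^const>\<open>mult\<close> and \<^const>\<open>one\<close> inherited from the ring record play no role.\<close>

definition complex_ring :: "complex ring" where
  "complex_ring = \<lparr>carrier = UNIV, mult = (*), one = 1, zero = 0, add = (+)\<rparr>"

record 'v inner_module = "(complex, 'v) module" +
  ip :: "'v \<Rightarrow> 'v \<Rightarrow> complex"

definition vnorm :: "'v inner_module \<Rightarrow> 'v \<Rightarrow> real" where
  "vnorm V v = sqrt (Re (ip V v v))"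

text \<open>The value \<open>0\<close> off the carrier is what \<^locale>\<open>Metric_space\<close> requires (its distance has to be
  nonnegative and symmetric on the whole type).\<close>

definition vdist :: "'v inner_module \<Rightarrow> 'v \<Rightarrow> 'v \<Rightarrow> real" where
  "vdist V v w = (if v \<in> carrier V \<and> w \<in> carrier V then vnorm V (v \<ominus>\<^bsub>V\<^esub> w) else 0)"

definition hilbert_space :: "'v inner_module \<Rightarrow> bool" where
  "hilbert_space V \<longleftrightarrow>
     module complex_ring V \<and>
     (\<forall>v\<in>carrier V. \<forall>w\<in>carrier V. ip V w v = cnj (ip V v w)) \<and>
     (\<forall>v\<in>carrier V. \<forall>v'\<in>carrier V. \<forall>w\<in>carrier V.
        ip V (v \<oplus>\<^bsub>V\<^esub> v') w = ip V v w + ip V v' w) \<and>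
     (\<forall>c. \<forall>v\<in>carrier V. \<forall>w\<in>carrier V. ip V (c \<odot>\<^bsub>V\<^esub> v) w = c * ip V v w) \<and>
     (\<forall>v\<in>carrier V. Re (ip V v v) \<ge> 0 \<and> (ip V v v = 0 \<longrightarrow> v = \<zero>\<^bsub>V\<^esub>)) \<and>
     Metric_space.mcomplete (carrier V) (vdist V)"

definition linear_map :: "'v inner_module \<Rightarrow> 'w inner_module \<Rightarrow> ('v \<Rightarrow> 'w) \<Rightarrow> bool" where
  "linear_map V W T \<longleftrightarrow>
     T \<in> carrier V \<rightarrow> carrier W \<and>
     (\<forall>v\<in>carrier V. \<forall>v'\<in>carrier V. T (v \<oplus>\<^bsub>V\<^esub> v') = T v \<oplus>\<^bsub>W\<^esub> T v') \<and>
     (\<forall>c. \<forall>v\<in>carrier V. T (c \<odot>\<^bsub>V\<^esub> v) = c \<odot>\<^bsub>W\<^esub> T v)"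

definition bounded_linear_map :: "'v inner_module \<Rightarrow> 'w inner_module \<Rightarrow> ('v \<Rightarrow> 'w) \<Rightarrow> bool" where
  "bounded_linear_map V W T \<longleftrightarrow>
     linear_map V W T \<and> (\<exists>K. \<forall>v\<in>carrier V. vnorm W (T v) \<le> K * vnorm V v)"

definition unitary_map :: "'v inner_module \<Rightarrow> 'w inner_module \<Rightarrow> ('v \<Rightarrow> 'w) \<Rightarrow> bool" where
  "unitary_map V W T \<longleftrightarrow>
     linear_map V W T \<and> bij_betw T (carrier V) (carrier W) \<and>
     (\<forall>v\<in>carrier V. \<forall>w\<in>carrier V. ip W (T v) (T w) = ip V v w)"

definition with_ip :: "(complex, 'v) module \<Rightarrow> ('v \<Rightarrow> 'v \<Rightarrow> complex) \<Rightarrow> 'v inner_module" where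
  "with_ip M b = \<lparr>carrier = carrier M, mult = mult M, one = one M, zero = zero M, add = add M,
     smult = module.smult M, ip = b\<rparr>"

text \<open>The quotient of a complex vector space by a subspace. Scaling a coset is followed by adding the
  subspace again, which only matters for the scalar \<open>0\<close>.\<close>

definition quotient_space :: "(complex, 'v) module \<Rightarrow> 'v set \<Rightarrow> (complex, 'v set) module" where
  "quotient_space V N =
     \<lparr>carrier = a_rcosets\<^bsub>V\<^esub> N, mult = undefined, one = undefined, zero = N, add = set_add V,
      smult = (\<lambda>c A. \<Union>a\<in>A. N +>\<^bsub>V\<^esub> (c \<odot>\<^bsub>V\<^esub> a))\<rparr>"

definition hilbert_sum :: "'i set \<Rightarrow> ('i \<Rightarrow> 'v inner_module) \<Rightarrow> ('i \<Rightarrow> 'v) inner_module" where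
  "hilbert_sum I V =
     \<lparr>carrier = {v \<in> (\<Pi>\<^sub>E i\<in>I. carrier (V i)). (\<lambda>i. (vnorm (V i) (v i))\<^sup>2) summable_on I},
      mult = undefined, one = undefined,
      zero = (\<lambda>i\<in>I. \<zero>\<^bsub>V i\<^esub>),
      add = (\<lambda>v w. \<lambda>i\<in>I. v i \<oplus>\<^bsub>V i\<^esub> w i),
      smult = (\<lambda>c v. \<lambda>i\<in>I. c \<odot>\<^bsub>V i\<^esub> v i),
      ip = (\<lambda>v w. infsum (\<lambda>i. ip (V i) (v i) (w i)) I)\<rparr>"


section \<open>Continuous Hilbert bundles\<close>

text \<open>A continuous field of Hilbert spaces over a base \<open>X\<close>: the fibres and the distinguished space
  \<open>\<Gamma>\<close> of sections. Sections are extensional functions on \<^term>\<open>topspace X\<close>.\<close>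

record ('b, 'v) hbundle =
  fib :: "'b \<Rightarrow> 'v inner_module"
  gam :: "('b \<Rightarrow> 'v) set"

definition all_sections :: "'b topology \<Rightarrow> ('b \<Rightarrow> 'v inner_module) \<Rightarrow> ('b \<Rightarrow> 'v) set" where
  "all_sections X V = (\<Pi>\<^sub>E u\<in>topspace X. carrier (V u))"

definition locally_uniform_closure ::
  "'b topology \<Rightarrow> ('b \<Rightarrow> 'v inner_module) \<Rightarrow> ('b \<Rightarrow> 'v) set \<Rightarrow> ('b \<Rightarrow> 'v) set" where
  "locally_uniform_closure X V \<Lambda> =
     {s \<in> all_sections X V. \<forall>u\<in>topspace X. \<forall>\<epsilon>>0. \<exists>U \<xi>. openin X U \<and> u \<in> U \<and> \<xi> \<in> \<Lambda> \<and>
        (\<forall>w\<in>U. vnorm (V w) (s w \<ominus>\<^bsub>V w\<^esub> \<xi> w) < \<epsilon>)}"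

definition hilbert_bundle :: "'b topology \<Rightarrow> ('b, 'v) hbundle \<Rightarrow> bool" where
  "hilbert_bundle X E \<longleftrightarrow>
     (\<forall>u\<in>topspace X. hilbert_space (fib E u)) \<and>
     gam E \<subseteq> all_sections X (fib E) \<and>
     (\<lambda>u\<in>topspace X. \<zero>\<^bsub>fib E u\<^esub>) \<in> gam E \<and>
     (\<forall>\<xi>\<in>gam E. \<forall>\<eta>\<in>gam E. (\<lambda>u\<in>topspace X. \<xi> u \<oplus>\<^bsub>fib E u\<^esub> \<eta> u) \<in> gam E) \<and>
     (\<forall>c. \<forall>\<xi>\<in>gam E. (\<lambda>u\<in>topspace X. c \<odot>\<^bsub>fib E u\<^esub> \<xi> u) \<in> gam E) \<and>
     (\<forall>u\<in>topspace X. \<forall>h\<in>carrier (fib E u). \<forall>\<epsilon>>0. \<exists>\<xi>\<in>gam E.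
        vnorm (fib E u) (h \<ominus>\<^bsub>fib E u\<^esub> \<xi> u) < \<epsilon>) \<and>
     (\<forall>\<xi>\<in>gam E. continuous_map X euclidean (\<lambda>u. vnorm (fib E u) (\<xi> u))) \<and>
     locally_uniform_closure X (fib E) (gam E) \<subseteq> gam E"

text \<open>The total space consists of the pairs \<open>(u, h)\<close> with \<open>h\<close> in the fibre over \<open>u\<close>.\<close>

definition total_top :: "'b topology \<Rightarrow> ('b, 'v) hbundle \<Rightarrow> ('b \<times> 'v) topology" where
  "total_top X E = topology_generated_by
     {{(u, h). u \<in> U \<and> h \<in> carrier (fib E u) \<and> vnorm (fib E u) (h \<ominus>\<^bsub>fib E u\<^esub> \<xi> u) < \<epsilon>}
      | U \<epsilon> \<xi>. openin X U \<and> \<epsilon> > 0 \<and> \<xi> \<in> gam E}"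

definition continuous_sections :: "'b topology \<Rightarrow> ('b, 'v) hbundle \<Rightarrow> ('b \<Rightarrow> 'v) set" where
  "continuous_sections X E =
     {s \<in> all_sections X (fib E). continuous_map X (total_top X E) (\<lambda>u. (u, s u))}"

definition C0_sections :: "'b topology \<Rightarrow> ('b, 'v) hbundle \<Rightarrow> ('b \<Rightarrow> 'v) set" where
  "C0_sections X E =
     {s \<in> continuous_sections X E. \<forall>\<epsilon>>0. \<exists>K. compactin X K \<and>
        (\<forall>u\<in>topspace X - K. vnorm (fib E u) (s u) < \<epsilon>)}"

definition bundle_morphism ::
  "'b topology \<Rightarrow> ('b, 'v) hbundle \<Rightarrow> ('b, 'w) hbundle \<Rightarrow> ('b \<Rightarrow> 'v \<Rightarrow> 'w) \<Rightarrow> bool" where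
  "bundle_morphism X E F T \<longleftrightarrow>
     (\<forall>u\<in>topspace X. bounded_linear_map (fib E u) (fib F u) (T u)) \<and>
     continuous_map (total_top X E) (total_top X F) (\<lambda>(u, h). (u, T u h))"

definition bundle_sum ::
  "'b topology \<Rightarrow> 'i set \<Rightarrow> ('i \<Rightarrow> ('b, 'v) hbundle) \<Rightarrow> ('b, 'i \<Rightarrow> 'v) hbundle" where
  "bundle_sum X I E =
     (let V = (\<lambda>u. hilbert_sum I (\<lambda>i. fib (E i) u)) in
      \<lparr>fib = V,
       gam = locally_uniform_closure X V
         {(\<lambda>u\<in>topspace X. \<lambda>i\<in>I. s i u) | s.
            (\<forall>i\<in>I. s i \<in> continuous_sections X (E i)) \<and>
            finite {i \<in> I. \<exists>u\<in>topspace X. s i u \<noteq> \<zero>\<^bsub>fib (E i) u\<^esub>}}\<rparr>)"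


section \<open>Continuous unitary representations\<close>

record ('g, 'v) groupoid_rep =
  bnd :: "('g, 'v) hbundle"
  act :: "'g \<Rightarrow> 'v \<Rightarrow> 'v"

definition continuous_unitary_rep :: "'g groupoid_data \<Rightarrow> ('g, 'v) groupoid_rep \<Rightarrow> bool" where
  "continuous_unitary_rep G \<pi> \<longleftrightarrow>
     (let V = fib (bnd \<pi>) in
      hilbert_bundle (unit_top G) (bnd \<pi>) \<and>
      (\<forall>x\<in>arrows G. unitary_map (V (dom_of G x)) (V (rng_of G x)) (act \<pi> x)) \<and>
      (\<forall>u\<in>unit_space G. \<forall>h\<in>carrier (V u). act \<pi> u h = h) \<and>
      (\<forall>(x, y)\<in>composable G. \<forall>h\<in>carrier (V (dom_of G y)).
         act \<pi> x (act \<pi> y h) = act \<pi> (gmul G x y) h) \<and>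
      (\<forall>x\<in>arrows G. \<forall>h\<in>carrier (V (rng_of G x)).
         act \<pi> (ginv G x) h = inv_into (carrier (V (dom_of G x))) (act \<pi> x) h) \<and>
      (\<forall>\<xi>\<in>C0_sections (unit_top G) (bnd \<pi>). \<forall>\<eta>\<in>C0_sections (unit_top G) (bnd \<pi>).
         continuous_map (gtop G) euclidean
           (\<lambda>x. ip (V (rng_of G x)) (act \<pi> x (\<xi> (dom_of G x))) (\<eta> (rng_of G x)))))"

definition Mor ::
  "'g groupoid_data \<Rightarrow> ('g, 'v) groupoid_rep \<Rightarrow> ('g, 'w) groupoid_rep \<Rightarrow> ('g \<Rightarrow> 'v \<Rightarrow> 'w) set" where
  "Mor G \<pi> \<pi>' =
     {T. bundle_morphism (unit_top G) (bnd \<pi>) (bnd \<pi>') T \<and>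
         (\<forall>x\<in>arrows G. \<forall>h\<in>carrier (fib (bnd \<pi>) (dom_of G x)).
            T (rng_of G x) (act \<pi> x h) = act \<pi>' x (T (dom_of G x) h))}"

definition equivalent_reps ::
  "'g groupoid_data \<Rightarrow> ('g, 'v) groupoid_rep \<Rightarrow> ('g, 'w) groupoid_rep \<Rightarrow> bool" where
  "equivalent_reps G \<pi> \<pi>' \<longleftrightarrow>
     (\<exists>T\<in>Mor G \<pi> \<pi>'. \<forall>u\<in>unit_space G. unitary_map (fib (bnd \<pi>) u) (fib (bnd \<pi>') u) (T u))"

definition rep_sum ::
  "'g groupoid_data \<Rightarrow> 'i set \<Rightarrow> ('i \<Rightarrow> ('g, 'v) groupoid_rep) \<Rightarrow> ('g, 'i \<Rightarrow> 'v) groupoid_rep" where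
  "rep_sum G I \<sigma> =
     \<lparr>bnd = bundle_sum (unit_top G) I (\<lambda>i. bnd (\<sigma> i)),
      act = (\<lambda>x h. \<lambda>i\<in>I. act (\<sigma> i) x (h i))\<rparr>"


section \<open>Induced representations\<close>

definition equivariant_sections ::
  "'g groupoid_data \<Rightarrow> 'g set \<Rightarrow> ('g, 'v) groupoid_rep \<Rightarrow> ('g \<Rightarrow> 'v) set" where
  "equivariant_sections G H \<sigma> =
     (let V = fib (bnd \<sigma>) in
      {f \<in> (\<Pi>\<^sub>E x\<in>arrows G. carrier (V (dom_of G x))).
         continuous_map (gtop G) (total_top (unit_top G) (bnd \<sigma>)) (\<lambda>x. (dom_of G x, f x)) \<and>
         compactin (coset_space G H)
           (coset G H ` (gtop G closure_of {x \<in> arrows G. f x \<noteq> \<zero>\<^bsub>V (dom_of G x)\<^esub>})) \<and>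
         (\<forall>(x, h)\<in>composable G. h \<in> H \<longrightarrow> f (gmul G x h) = act \<sigma> (ginv G h) (f x))})"

definition F0_space ::
  "'g groupoid_data \<Rightarrow> 'g set \<Rightarrow> ('g, 'v) groupoid_rep \<Rightarrow> (complex, 'g \<Rightarrow> 'v) module" where
  "F0_space G H \<sigma> =
     (let V = fib (bnd \<sigma>) in
      \<lparr>carrier = equivariant_sections G H \<sigma>, mult = undefined, one = undefined,
       zero = (\<lambda>x\<in>arrows G. \<zero>\<^bsub>V (dom_of G x)\<^esub>),
       add = (\<lambda>f g. \<lambda>x\<in>arrows G. f x \<oplus>\<^bsub>V (dom_of G x)\<^esub> g x),
       smult = (\<lambda>c f. \<lambda>x\<in>arrows G. c \<odot>\<^bsub>V (dom_of G x)\<^esub> f x)\<rparr>)"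

text \<open>The integrand \<open>\<langle>f(x), g(x)\<rangle>\<close> depends only on the coset \<open>xH\<close>, so it is evaluated at a chosen
  representative.\<close>

definition F0_ip ::
  "'g groupoid_data \<Rightarrow> ('g \<Rightarrow> 'g set measure) \<Rightarrow> ('g, 'v) groupoid_rep
     \<Rightarrow> ('g \<Rightarrow> 'v) \<Rightarrow> ('g \<Rightarrow> 'v) \<Rightarrow> 'g \<Rightarrow> complex" where
  "F0_ip G \<mu> \<sigma> f g u =
     (LINT C|\<mu> u. (let x = (SOME x. x \<in> C) in ip (fib (bnd \<sigma>) (dom_of G x)) (f x) (g x)))"

definition F0_norm ::
  "'g groupoid_data \<Rightarrow> ('g \<Rightarrow> 'g set measure) \<Rightarrow> ('g, 'v) groupoid_rep \<Rightarrow> ('g \<Rightarrow> 'v) \<Rightarrow> real" where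
  "F0_norm G \<mu> \<sigma> f = (SUP u\<in>unit_space G. sqrt (Re (F0_ip G \<mu> \<sigma> f f u)))"

text \<open>The completion \<open>\<F>\<^sup>\<sigma>(G, \<mu>)\<close> is the space of Cauchy sequences modulo null sequences.\<close>

definition F_cauchy ::
  "'g groupoid_data \<Rightarrow> 'g set \<Rightarrow> ('g \<Rightarrow> 'g set measure) \<Rightarrow> ('g, 'v) groupoid_rep
     \<Rightarrow> (complex, nat \<Rightarrow> 'g \<Rightarrow> 'v) module" where
  "F_cauchy G H \<mu> \<sigma> =
     (let F0 = F0_space G H \<sigma> in
      \<lparr>carrier = {s. (\<forall>n. s n \<in> carrier F0) \<and>
         (\<forall>\<epsilon>>0. \<exists>N. \<forall>m\<ge>N. \<forall>n\<ge>N. F0_norm G \<mu> \<sigma> (s m \<ominus>\<^bsub>F0\<^esub> s n) < \<epsilon>)},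
       mult = undefined, one = undefined,
       zero = (\<lambda>n. \<zero>\<^bsub>F0\<^esub>),
       add = (\<lambda>s t n. s n \<oplus>\<^bsub>F0\<^esub> t n),
       smult = (\<lambda>c s n. c \<odot>\<^bsub>F0\<^esub> s n)\<rparr>)"

definition F_null ::
  "'g groupoid_data \<Rightarrow> 'g set \<Rightarrow> ('g \<Rightarrow> 'g set measure) \<Rightarrow> ('g, 'v) groupoid_rep
     \<Rightarrow> (nat \<Rightarrow> 'g \<Rightarrow> 'v) set" where
  "F_null G H \<mu> \<sigma> =
     {s \<in> carrier (F_cauchy G H \<mu> \<sigma>). (\<lambda>n. F0_norm G \<mu> \<sigma> (s n)) \<longlonglongrightarrow> 0}"

definition F_space ::
  "'g groupoid_data \<Rightarrow> 'g set \<Rightarrow> ('g \<Rightarrow> 'g set measure) \<Rightarrow> ('g, 'v) groupoid_rep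
     \<Rightarrow> (complex, (nat \<Rightarrow> 'g \<Rightarrow> 'v) set) module" where
  "F_space G H \<mu> \<sigma> = quotient_space (F_cauchy G H \<mu> \<sigma>) (F_null G H \<mu> \<sigma>)"

definition F_ip ::
  "'g groupoid_data \<Rightarrow> ('g \<Rightarrow> 'g set measure) \<Rightarrow> ('g, 'v) groupoid_rep
     \<Rightarrow> (nat \<Rightarrow> 'g \<Rightarrow> 'v) set \<Rightarrow> (nat \<Rightarrow> 'g \<Rightarrow> 'v) set \<Rightarrow> 'g \<Rightarrow> complex" where
  "F_ip G \<mu> \<sigma> A B u = the_elem ((\<lambda>(s, t). lim (\<lambda>n. F0_ip G \<mu> \<sigma> (s n) (t n) u)) ` (A \<times> B))"

definition F_kernel ::
  "'g groupoid_data \<Rightarrow> 'g set \<Rightarrow> ('g \<Rightarrow> 'g set measure) \<Rightarrow> ('g, 'v) groupoid_rep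
     \<Rightarrow> 'g \<Rightarrow> (nat \<Rightarrow> 'g \<Rightarrow> 'v) set set" where
  "F_kernel G H \<mu> \<sigma> u = {A \<in> carrier (F_space G H \<mu> \<sigma>). F_ip G \<mu> \<sigma> A A u = 0}"

definition F_fibre ::
  "'g groupoid_data \<Rightarrow> 'g set \<Rightarrow> ('g \<Rightarrow> 'g set measure) \<Rightarrow> ('g, 'v) groupoid_rep
     \<Rightarrow> 'g \<Rightarrow> (nat \<Rightarrow> 'g \<Rightarrow> 'v) set set inner_module" where
  "F_fibre G H \<mu> \<sigma> u =
     with_ip (quotient_space (F_space G H \<mu> \<sigma>) (F_kernel G H \<mu> \<sigma> u))
       (\<lambda>P Q. the_elem ((\<lambda>(A, B). F_ip G \<mu> \<sigma> A B u) ` (P \<times> Q)))"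

definition F_section ::
  "'g groupoid_data \<Rightarrow> 'g set \<Rightarrow> ('g \<Rightarrow> 'g set measure) \<Rightarrow> ('g, 'v) groupoid_rep
     \<Rightarrow> (nat \<Rightarrow> 'g \<Rightarrow> 'v) set \<Rightarrow> 'g \<Rightarrow> (nat \<Rightarrow> 'g \<Rightarrow> 'v) set set" where
  "F_section G H \<mu> \<sigma> A =
     (\<lambda>u\<in>unit_space G. F_kernel G H \<mu> \<sigma> u +>\<^bsub>F_space G H \<mu> \<sigma>\<^esub> A)"

definition ind_bundle ::
  "'g groupoid_data \<Rightarrow> 'g set \<Rightarrow> ('g \<Rightarrow> 'g set measure) \<Rightarrow> ('g, 'v) groupoid_rep
     \<Rightarrow> ('g, (nat \<Rightarrow> 'g \<Rightarrow> 'v) set set) hbundle" where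
  "ind_bundle G H \<mu> \<sigma> =
     \<lparr>fib = F_fibre G H \<mu> \<sigma>,
      gam = locally_uniform_closure (unit_top G) (F_fibre G H \<mu> \<sigma>)
        (F_section G H \<mu> \<sigma> ` carrier (F_space G H \<mu> \<sigma>))\<rparr>"

text \<open>The image in the fibre over \<open>u\<close> of an equivariant section \<open>f\<close>, i.e. the element represented by
  \<open>f\<close> restricted to \<open>G\<^sup>u\<close>.\<close>

definition F0_class ::
  "'g groupoid_data \<Rightarrow> 'g set \<Rightarrow> ('g \<Rightarrow> 'g set measure) \<Rightarrow> ('g, 'v) groupoid_rep
     \<Rightarrow> ('g \<Rightarrow> 'v) \<Rightarrow> 'g \<Rightarrow> (nat \<Rightarrow> 'g \<Rightarrow> 'v) set set" where
  "F0_class G H \<mu> \<sigma> f u =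
     F_section G H \<mu> \<sigma> (F_null G H \<mu> \<sigma> +>\<^bsub>F_cauchy G H \<mu> \<sigma>\<^esub> (\<lambda>n. f)) u"

text \<open>The operator \<open>L(x)\<close>, \<open>(L(x)f)(y) = f(x\<inverse>y)\<close>, is given on the restrictions of equivariant
  sections to the range fibre over \<open>d(x)\<close>, with result the restriction of an equivariant section to
  the range fibre over \<open>r(x)\<close>, and is extended by continuity: its graph is the closure of the set of
  pairs of classes of \<open>(f, g)\<close> with \<open>g(y) = f(x\<inverse>y)\<close> on the range fibre over \<open>r(x)\<close>.\<close>

definition ind_act ::
  "'g groupoid_data \<Rightarrow> 'g set \<Rightarrow> ('g \<Rightarrow> 'g set measure) \<Rightarrow> ('g, 'v) groupoid_rep
     \<Rightarrow> 'g \<Rightarrow> (nat \<Rightarrow> 'g \<Rightarrow> 'v) set set \<Rightarrow> (nat \<Rightarrow> 'g \<Rightarrow> 'v) set set" where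
  "ind_act G H \<mu> \<sigma> x P =
     (let V = F_fibre G H \<mu> \<sigma>; d = dom_of G x; r = rng_of G x in
      THE Q. Q \<in> carrier (V r) \<and>
        (\<exists>f g. (\<forall>n. f n \<in> equivariant_sections G H \<sigma> \<and> g n \<in> equivariant_sections G H \<sigma> \<and>
                  (\<forall>y\<in>range_fibre G r. g n y = f n (gmul G (ginv G x) y))) \<and>
               (\<lambda>n. vnorm (V d) (F0_class G H \<mu> \<sigma> (f n) d \<ominus>\<^bsub>V d\<^esub> P)) \<longlonglongrightarrow> 0 \<and>
               (\<lambda>n. vnorm (V r) (F0_class G H \<mu> \<sigma> (g n) r \<ominus>\<^bsub>V r\<^esub> Q)) \<longlonglongrightarrow> 0))"

definition ind_rep ::
  "'g groupoid_data \<Rightarrow> 'g set \<Rightarrow> ('g \<Rightarrow> 'g set measure) \<Rightarrow> ('g, 'v) groupoid_rep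
     \<Rightarrow> ('g, (nat \<Rightarrow> 'g \<Rightarrow> 'v) set set) groupoid_rep" where
  "ind_rep G H \<mu> \<sigma> = \<lparr>bnd = ind_bundle G H \<mu> \<sigma>, act = ind_act G H \<mu> \<sigma>\<rparr>"

end

theory Submission
  imports Defs
begin

text \<open>Equivariant sections are dense in every fibre of an induced bundle, and the inner product at \<open>u\<close> of the
  classes of \<open>f\<close> and \<open>g\<close> is the integral of \<open>\<langle>f(x), g(x)\<rangle>\<close> over the cosets in the fibre of \<open>u\<close>. Hence a map from
  equivariant sections to sections of another Hilbert bundle that respects these integrals and left
  translations and has fibrewise dense values yields a unitary equivalence (\<open>equivalent_ind_repI\<close>): equality
  of Gram matrices gives the fibrewise unitaries (\<open>unitary_extension\<close>), which are continuous because the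
  topology of a total space is generated by sections (\<open>unitary_bundle_morphism\<close>), and they intertwine
  because they do so on a dense set. It is enough to define the map on a dense class of sections.

  If \<open>T\<close> is a unitary intertwiner from \<open>\<sigma>\<close> to \<open>\<sigma>'\<close>, the map \<open>f \<mapsto> T \<circ> f\<close> has these properties
  (\<open>equivalent_ind_rep\<close>). For a direct sum, a section with finitely many nonzero components is mapped to the
  tuple of the classes of its components; such sections are dense, since an equivariant section lives on a
  compact set modulo \<open>H\<close>, where its tails are uniformly small (\<open>asm_approx\<close>, \<open>ind_rep_sum\<close>).

  The work lies in showing that induced representations are what they should be. Fibres are complete,
  because a rapidly convergent sequence at \<open>u\<close> can be lifted to a Cauchy sequence of sections (\<open>hilb_FF\<close>).
  The operator \<open>L(x)\<close> is the closure of the translation of sections whose translate, given on a single range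
  fibre, extends to an equivariant section; it is a unitary if there are enough of them (\<open>TP_dense\<close>,
  \<open>ind_act\<close>). They are produced by averaging: for \<open>a\<close> of compact support and a continuous section \<open>\<xi>\<close>, the
  section \<open>x \<mapsto> \<integral> a(xh) \<sigma>(h) \<xi>(d(h)) d\<lambda>(h)\<close> is equivariant, its translate arises from a Tietze extension of
  the translate of \<open>a\<close> (\<open>avg_translate\<close>), and its values are arbitrary up to small errors (\<open>avg_enough\<close>). A
  partition of unity on the coset space glues such sections. The integrals are weak ones, obtained as limits
  of finite sums; approximation by such sums rests on weakly continuous unitary representations being strongly
  continuous (\<open>continuous_unitary_rep_imp_hrep\<close>).\<close>

text \<open>The norm of a difference; unlike \<^const>\<open>vdist\<close> it does not test membership in the carrier, so that
  the algebraic laws apply to it directly.\<close>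

abbreviation ndist where "ndist V v w \<equiv> vnorm V (v \<ominus>\<^bsub>V\<^esub> w)"

section \<open>Semi-inner product spaces with explicit carrier\<close>

lemma complex_ring_simps [simp]:
 "carrier complex_ring = UNIV" "x \<otimes>\<^bsub>complex_ring\<^esub> y = x * y" "\<one>\<^bsub>complex_ring\<^esub> = 1"
 "\<zero>\<^bsub>complex_ring\<^esub> = 0" "x \<oplus>\<^bsub>complex_ring\<^esub> y = x + y"
 by (simp_all add: complex_ring_def)

lemma cring_complex_ring: "cring complex_ring"
proof (intro cringI abelian_groupI comm_monoidI)
 fix x :: complex
 show "\<exists>y\<in>carrier complex_ring. y \<oplus>\<^bsub>complex_ring\<^esub> x = \<zero>\<^bsub>complex_ring\<^esub>"
  by (intro bexI[of _ "- x"]) auto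
qed (auto simp: algebra_simps)

locale semi_inner = module complex_ring V for V :: "'v inner_module" (structure) +
 assumes ip_cnj: "v \<in> carrier V ==> w \<in> carrier V ==> ip V w v = cnj (ip V v w)"
  and ip_add: "v \<in> carrier V ==> v' \<in> carrier V ==> w \<in> carrier V ==>
   ip V (v \<oplus> v') w = ip V v w + ip V v' w"
  and ip_smult: "v \<in> carrier V ==> w \<in> carrier V ==> ip V (c \<odot> v) w = c * ip V v w"
  and ip_nonneg: "v \<in> carrier V ==> Re (ip V v v) \<ge> 0"
begin

lemma smultC [simp, intro]: "v \<in> carrier V ==> c \<odot> v \<in> carrier V"
 by (rule smult_closed) auto

lemma minus_one_smult: "v \<in> carrier V ==> (-1) \<odot> v = \<ominus> v"
proof -
 assume v: "v \<in> carrier V"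
 have "(-1) \<odot> v \<oplus> v = ((-1) \<oplus>\<^bsub>complex_ring\<^esub> 1) \<odot> v"
  using v smult_l_distr[of "-1" 1 v] smult_one[of v] by simp
 also have "\<dots> = \<zero>"
  using v smult_l_null by simp
 finally show ?thesis
  using v by (metis M.minus_equality smultC)
qed

lemma zero_smult: "v \<in> carrier V ==> 0 \<odot> v = \<zero>"
 using smult_l_null by simp

lemma smult_add_right: "v \<in> carrier V ==> w \<in> carrier V ==> c \<odot> (v \<oplus> w) = c \<odot> v \<oplus> c \<odot> w"
 by (rule smult_r_distr) auto

lemma smult_minus_right: "v \<in> carrier V ==> w \<in> carrier V ==> c \<odot> (v \<ominus> w) = c \<odot> v \<ominus> c \<odot> w"
 by (simp add: a_minus_def smult_add_right smult_r_minus)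

lemma ip_zero_left [simp]: "w \<in> carrier V ==> ip V \<zero> w = 0"
 using ip_smult[of \<zero> w 0] smult_r_null by simp

lemma ip_zero_right [simp]: "w \<in> carrier V ==> ip V w \<zero> = 0"
 using ip_cnj[of \<zero> w] by simp

lemma ip_add_right: "v \<in> carrier V ==> w \<in> carrier V ==> w' \<in> carrier V ==>
  ip V v (w \<oplus> w') = ip V v w + ip V v w'"
 using ip_cnj[of "w \<oplus> w'" v] ip_cnj[of w v] ip_cnj[of w' v] by (simp add: ip_add)

lemma ip_smult_right: "v \<in> carrier V ==> w \<in> carrier V ==> ip V v (c \<odot> w) = cnj c * ip V v w"
 using ip_cnj[of "c \<odot> w" v] ip_cnj[of w v] by (simp add: ip_smult)

lemma ip_neg_left: "v \<in> carrier V ==> w \<in> carrier V ==> ip V (\<ominus> v) w = - ip V v w"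
 using ip_smult[of v w "-1"] by (simp add: minus_one_smult)

lemma ip_neg_right: "v \<in> carrier V ==> w \<in> carrier V ==> ip V v (\<ominus> w) = - ip V v w"
 using ip_smult_right[of v w "-1"] by (simp add: minus_one_smult)

lemma ip_diff_left: "v \<in> carrier V ==> v' \<in> carrier V ==> w \<in> carrier V ==>
  ip V (v \<ominus> v') w = ip V v w - ip V v' w"
 by (simp add: a_minus_def ip_add ip_neg_left)

lemma ip_diff_right: "v \<in> carrier V ==> w \<in> carrier V ==> w' \<in> carrier V ==>
  ip V v (w \<ominus> w') = ip V v w - ip V v w'"
 by (simp add: a_minus_def ip_add_right ip_neg_right)

lemmas ip_simps = ip_add ip_add_right ip_smult ip_smult_right ip_diff_left ip_diff_right
 ip_neg_left ip_neg_right

lemma vnorm_nonneg: "v \<in> carrier V ==> 0 \<le> vnorm V v"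
 by (simp add: vnorm_def ip_nonneg)

lemma ip_self: "v \<in> carrier V ==> ip V v v = of_real ((vnorm V v)\<^sup>2)"
proof -
 assume v: "v \<in> carrier V"
 have "Im (ip V v v) = 0"
  using ip_cnj[OF v v] by (metis cnj.simps(2) equal_neg_zero)
 then show ?thesis
  using ip_nonneg[OF v] by (simp add: vnorm_def complex_eq_iff)
qed

lemma Re_ip_self: "v \<in> carrier V ==> Re (ip V v v) = (vnorm V v)\<^sup>2"
 by (simp add: ip_self)

lemma vnorm_zero [simp]: "vnorm V \<zero> = 0"
 by (simp add: vnorm_def)

lemma vnorm_smult: "v \<in> carrier V ==> vnorm V (c \<odot> v) = cmod c * vnorm V v"
proof -
 assume v: "v \<in> carrier V"
 have "(vnorm V (c \<odot> v))\<^sup>2 = Re (c * cnj c * ip V v v)"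
  using v Re_ip_self[of "c \<odot> v"] by (simp add: ip_simps mult_ac)
 also have "\<dots> = (cmod c * vnorm V v)\<^sup>2"
  using v by (simp add: ip_self complex_norm_square[symmetric] power_mult_distrib
    flip: of_real_power of_real_mult)
 finally show ?thesis
  using v by (simp add: vnorm_nonneg)
qed

lemma vnorm_neg: "v \<in> carrier V ==> vnorm V (\<ominus> v) = vnorm V v"
 using vnorm_smult[of v "-1"] by (simp add: minus_one_smult)

lemma vnorm_add_sq: "v \<in> carrier V ==> w \<in> carrier V ==>
  (vnorm V (v \<oplus> w))\<^sup>2 = (vnorm V v)\<^sup>2 + (vnorm V w)\<^sup>2 + 2 * Re (ip V v w)"
 using Re_ip_self[of "v \<oplus> w"] ip_cnj[of v w] by (simp add: ip_simps Re_ip_self)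

lemma vnorm_diff_sq: "v \<in> carrier V ==> w \<in> carrier V ==>
  (vnorm V (v \<ominus> w))\<^sup>2 = (vnorm V v)\<^sup>2 + (vnorm V w)\<^sup>2 - 2 * Re (ip V v w)"
 using Re_ip_self[of "v \<ominus> w"] ip_cnj[of v w] by (simp add: ip_simps Re_ip_self)

lemma Cauchy_Schwarz: 
 assumes v: "v \<in> carrier V" and w: "w \<in> carrier V"
 shows "cmod (ip V v w) \<le> vnorm V v * vnorm V w"
proof -
 define b where "b = cmod (ip V v w)"
 have *: "0 \<le> (vnorm V v)\<^sup>2 - 2 * t * b\<^sup>2 + t\<^sup>2 * b\<^sup>2 * (vnorm V w)\<^sup>2" for t
 proof -
  let ?c = "of_real t * ip V v w"
  have "0 \<le> (vnorm V (v \<ominus> ?c \<odot> w))\<^sup>2" by simp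
  also have "\<dots> = (vnorm V v)\<^sup>2 + (cmod ?c)\<^sup>2 * (vnorm V w)\<^sup>2 - 2 * Re (cnj ?c * ip V v w)"
   using v w by (simp add: vnorm_diff_sq vnorm_smult ip_smult_right power_mult_distrib)
  also have "cnj ?c * ip V v w = of_real (t * b\<^sup>2)"
   using complex_norm_square[of "ip V v w"] by (simp add: b_def mult_ac)
  also have "(cmod ?c)\<^sup>2 = t\<^sup>2 * b\<^sup>2"
   by (simp add: b_def norm_mult power_mult_distrib)
  finally show ?thesis by (simp add: algebra_simps)
 qed
 have "b\<^sup>2 \<le> (vnorm V v)\<^sup>2 * (vnorm V w)\<^sup>2"
 proof (cases "vnorm V w = 0")
  case True
  show ?thesis
  proof (rule ccontr)
   assume "\<not> ?thesis"
   then have b: "b\<^sup>2 > 0" using True by simp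
   have "0 \<le> (vnorm V v)\<^sup>2 - 2 * (((vnorm V v)\<^sup>2 + 1) / b\<^sup>2) * b\<^sup>2"
    using *[of "((vnorm V v)\<^sup>2 + 1) / b\<^sup>2"] True by simp
   also have "\<dots> = (vnorm V v)\<^sup>2 - 2 * ((vnorm V v)\<^sup>2 + 1)"
    using b by simp
   finally have "0 \<le> (vnorm V v)\<^sup>2 - 2 * ((vnorm V v)\<^sup>2 + 1)" .
   moreover have "x - 2 * (x + 1) < 0" if "0 \<le> x" for x :: real using that by simp
   ultimately show False by (metis not_less zero_le_power2)
  qed
 next
  case False
  then have w0: "(vnorm V w)\<^sup>2 > 0" by simp
  define t where "t = 1 / (vnorm V w)\<^sup>2"
  have t: "t * (vnorm V w)\<^sup>2 = 1" "t > 0" using w0 by (simp_all add: t_def)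
  have "t\<^sup>2 * b\<^sup>2 * (vnorm V w)\<^sup>2 = t * b\<^sup>2 * (t * (vnorm V w)\<^sup>2)"
   by (simp only: power2_eq_square mult_ac)
  then have "t\<^sup>2 * b\<^sup>2 * (vnorm V w)\<^sup>2 = t * b\<^sup>2"
   by (simp only: t(1) mult_1_right)
  then have "t * b\<^sup>2 \<le> (vnorm V v)\<^sup>2"
   using *[of t] by linarith
  then have "(vnorm V w)\<^sup>2 * (t * b\<^sup>2) \<le> (vnorm V w)\<^sup>2 * (vnorm V v)\<^sup>2"
   by (rule mult_left_mono) simp
  moreover have "(vnorm V w)\<^sup>2 * (t * b\<^sup>2) = b\<^sup>2"
   using t(1) by (metis mult.assoc mult.commute mult_1)
  ultimately show ?thesis by (simp only: mult.commute)
 qed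
 then have "b\<^sup>2 \<le> (vnorm V v * vnorm V w)\<^sup>2" by (simp add: power_mult_distrib)
 then show ?thesis
  unfolding b_def by (rule power2_le_imp_le) (use v w in \<open>simp add: vnorm_nonneg\<close>)
qed

lemma vnorm_triangle:
 assumes v: "v \<in> carrier V" and w: "w \<in> carrier V"
 shows "vnorm V (v \<oplus> w) \<le> vnorm V v + vnorm V w"
proof (rule power2_le_imp_le)
 have "Re (ip V v w) \<le> vnorm V v * vnorm V w"
  using Cauchy_Schwarz[OF v w] complex_Re_le_cmod order_trans by blast
 then show "(vnorm V (v \<oplus> w))\<^sup>2 \<le> (vnorm V v + vnorm V w)\<^sup>2"
  using v w by (simp add: vnorm_add_sq power2_sum)
qed (use v w in \<open>simp add: vnorm_nonneg\<close>)

lemma diff_add_diff: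
 "v \<in> carrier V ==> z \<in> carrier V ==> w \<in> carrier V ==> (v \<ominus> z) \<oplus> (z \<ominus> w) = v \<ominus> w"
 by (simp add: a_minus_def a_assoc) (metis M.a_assoc M.a_inv_closed M.l_neg M.l_zero)

lemma diff_diff_diff:
 "v \<in> carrier V ==> z \<in> carrier V ==> v' \<in> carrier V ==> z' \<in> carrier V ==>
  (v \<oplus> z) \<ominus> (v' \<oplus> z') = (v \<ominus> v') \<oplus> (z \<ominus> z')"
 by (simp add: a_minus_def minus_add a_ac)

lemma diff_self [simp]: "v \<in> carrier V ==> v \<ominus> v = \<zero>"
 by (simp add: a_minus_def r_neg)

lemma diff_add_cancel': "v \<in> carrier V ==> w \<in> carrier V ==> w \<oplus> (v \<ominus> w) = v"
 by (simp add: a_minus_def M.a_lcomm r_neg)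

lemma diff_zero [simp]: "v \<in> carrier V ==> v \<ominus> \<zero> = v"
 by (simp add: a_minus_def)

lemma vnorm_diff_triangle:
 "v \<in> carrier V ==> z \<in> carrier V ==> w \<in> carrier V ==>
  vnorm V (v \<ominus> w) \<le> vnorm V (v \<ominus> z) + vnorm V (z \<ominus> w)"
 using vnorm_triangle[of "v \<ominus> z" "z \<ominus> w"] by (simp add: diff_add_diff)

lemma vnorm_diff_commute:
 "v \<in> carrier V ==> w \<in> carrier V ==> vnorm V (v \<ominus> w) = vnorm V (w \<ominus> v)"
 using vnorm_neg[of "v \<ominus> w"] by (simp add: a_minus_def minus_add M.a_comm)

lemma vnorm_le_add_diff:
 "v \<in> carrier V ==> w \<in> carrier V ==> vnorm V v \<le> vnorm V w + vnorm V (v \<ominus> w)"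
 using vnorm_triangle[of w "v \<ominus> w"] by (simp add: diff_add_cancel')

lemma abs_vnorm_diff:
 "v \<in> carrier V ==> w \<in> carrier V ==> \<bar>vnorm V v - vnorm V w\<bar> \<le> vnorm V (v \<ominus> w)"
 using vnorm_le_add_diff[of v w] vnorm_le_add_diff[of w v] vnorm_diff_commute[of v w] by simp

lemma ip_eq_0_of_vnorm_eq_0:
 "v \<in> carrier V ==> w \<in> carrier V ==> vnorm V v = 0 ==> ip V v w = 0"
 using Cauchy_Schwarz[of v w] by simp

lemma vnorm_eq_0_iff_ip: "v \<in> carrier V ==> vnorm V v = 0 \<longleftrightarrow> ip V v v = 0"
 by (simp add: ip_self)

lemma ip_diff_bound:
 assumes "v \<in> carrier V" "v' \<in> carrier V" "w \<in> carrier V" "w' \<in> carrier V"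
 shows "cmod (ip V v w - ip V v' w') \<le> vnorm V (v \<ominus> v') * vnorm V w + vnorm V v' * vnorm V (w \<ominus> w')"
proof -
 have "ip V v w - ip V v' w' = ip V (v \<ominus> v') w + ip V v' (w \<ominus> w')"
  using assms by (simp add: ip_simps)
 then have "cmod (ip V v w - ip V v' w') \<le> cmod (ip V (v \<ominus> v') w) + cmod (ip V v' (w \<ominus> w'))"
  by (simp add: norm_triangle_ineq)
 then show ?thesis
  using Cauchy_Schwarz[of "v \<ominus> v'" w] Cauchy_Schwarz[of v' "w \<ominus> w'"] assms by simp
qed

lemma tendsto_ip:
 assumes s: "!!n. s n \<in> carrier V" "v \<in> carrier V" "(\<lambda>n. vnorm V (s n \<ominus> v)) \<longlonglongrightarrow> 0"
  and t: "!!n. t n \<in> carrier V" "w \<in> carrier V" "(\<lambda>n. vnorm V (t n \<ominus> w)) \<longlonglongrightarrow> 0"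
 shows "(\<lambda>n. ip V (s n) (t n)) \<longlonglongrightarrow> ip V v w"
proof (rule LIM_zero_cancel, rule Lim_null_comparison)
 have "cmod (ip V (s n) (t n) - ip V v w)
   \<le> vnorm V (s n \<ominus> v) * (vnorm V w + vnorm V (t n \<ominus> w)) + vnorm V v * vnorm V (t n \<ominus> w)" for n
 proof -
  have "vnorm V (s n \<ominus> v) * vnorm V (t n) \<le> vnorm V (s n \<ominus> v) * (vnorm V w + vnorm V (t n \<ominus> w))"
   using s t by (intro mult_left_mono vnorm_le_add_diff vnorm_nonneg) auto
  then show ?thesis
   using ip_diff_bound[of "s n" v "t n" w] s t by simp
 qed
 then show "\<forall>\<^sub>F n in sequentially. cmod (ip V (s n) (t n) - ip V v w)
   \<le> vnorm V (s n \<ominus> v) * (vnorm V w + vnorm V (t n \<ominus> w)) + vnorm V v * vnorm V (t n \<ominus> w)"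
  by (simp add: always_eventually)
 have "(\<lambda>n. vnorm V (s n \<ominus> v) * (vnorm V w + vnorm V (t n \<ominus> w)) + vnorm V v * vnorm V (t n \<ominus> w))
   \<longlonglongrightarrow> 0 * (vnorm V w + 0) + vnorm V v * 0"
  using s t by (intro tendsto_intros)
 then show "(\<lambda>n. vnorm V (s n \<ominus> v) * (vnorm V w + vnorm V (t n \<ominus> w)) + vnorm V v * vnorm V (t n \<ominus> w))
   \<longlonglongrightarrow> 0" by simp
qed

lemma tendsto_vnorm_diff:
 assumes s: "!!n. s n \<in> carrier V" "v \<in> carrier V" "(\<lambda>n. vnorm V (s n \<ominus> v)) \<longlonglongrightarrow> 0"
  and w: "w \<in> carrier V"
 shows "(\<lambda>n. vnorm V (s n \<ominus> w)) \<longlonglongrightarrow> vnorm V (v \<ominus> w)"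
proof (rule LIM_zero_cancel, rule Lim_null_comparison[OF always_eventually assms(3)])
 show "\<forall>n. norm (vnorm V (s n \<ominus> w) - vnorm V (v \<ominus> w)) \<le> vnorm V (s n \<ominus> v)"
 proof
  fix n
  show "norm (vnorm V (s n \<ominus> w) - vnorm V (v \<ominus> w)) \<le> vnorm V (s n \<ominus> v)"
   using vnorm_diff_triangle[of "s n" v w] vnorm_diff_triangle[of v "s n" w]
    vnorm_diff_commute[of v "s n"] s w by simp
 qed
qed

end

section \<open>Hilbert spaces and extension of isometries\<close>

locale hilb = semi_inner +
 assumes ip_definite: "v \<in> carrier V ==> ip V v v = 0 ==> v = \<zero>"
  and complete: "!!s. (!!n. s n \<in> carrier V) ==>
   (!!e. e > 0 ==> \<exists>N. \<forall>m\<ge>N. \<forall>n\<ge>N. vnorm V (s m \<ominus> s n) < e) ==>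
   \<exists>v\<in>carrier V. (\<lambda>n. vnorm V (s n \<ominus> v)) \<longlonglongrightarrow> 0"
begin

lemma vnorm_eq_0D: "v \<in> carrier V ==> vnorm V v = 0 ==> v = \<zero>"
 by (rule ip_definite) (simp_all add: ip_self)

lemma eq_of_vnorm_diff:
 assumes v: "v \<in> carrier V" and w: "w \<in> carrier V" and "vnorm V (v \<ominus> w) = 0"
 shows "v = w"
proof -
 have "v \<ominus> w = \<zero>" using assms by (intro vnorm_eq_0D) auto
 then show ?thesis using diff_add_cancel'[OF v w] w by simp
qed

lemma limit_unique:
 assumes "!!n. s n \<in> carrier V" "v \<in> carrier V" "w \<in> carrier V"
  "(\<lambda>n. vnorm V (s n \<ominus> v)) \<longlonglongrightarrow> 0" "(\<lambda>n. vnorm V (s n \<ominus> w)) \<longlonglongrightarrow> 0"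
 shows "v = w"
proof -
 have "vnorm V (v \<ominus> w) = 0"
  using tendsto_vnorm_diff[of s v w] assms LIMSEQ_unique by blast
 then show ?thesis using assms eq_of_vnorm_diff by blast
qed

end

lemma (in semi_inner) Metric_space_vdist:
 assumes "!!v. v \<in> carrier V ==> ip V v v = 0 ==> v = \<zero>"
 shows "Metric_space (carrier V) (vdist V)"
proof
 fix x y z
 show "0 \<le> vdist V x y" by (simp add: vdist_def vnorm_nonneg)
 show "vdist V x y = vdist V y x" by (simp add: vdist_def vnorm_diff_commute)
 show "vdist V x y = 0 \<longleftrightarrow> x = y" if "x \<in> carrier V" "y \<in> carrier V"
 proof
  assume "vdist V x y = 0"
  then have "ip V (x \<ominus> y) (x \<ominus> y) = 0"
   using that by (simp add: vdist_def vnorm_eq_0_iff_ip)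
  then have "x \<ominus> y = \<zero>" using that assms by blast
  then show "x = y" using diff_add_cancel'[OF that] that by simp
 qed (use that in \<open>simp add: vdist_def\<close>)
 show "vdist V x z \<le> vdist V x y + vdist V y z"
  if "x \<in> carrier V" "y \<in> carrier V" "z \<in> carrier V"
  using that by (simp add: vdist_def vnorm_diff_triangle)
qed

lemma hilbert_space_iff_hilb: "hilbert_space V \<longleftrightarrow> hilb V"
proof
 assume V: "hilbert_space V"
 note V' = V[unfolded hilbert_space_def]
 interpret module complex_ring V using V' by blast
 interpret semi_inner V
 proof
  show "ip V w v = cnj (ip V v w)" if "v \<in> carrier V" "w \<in> carrier V" for v w
   using V' that by blast
  show "ip V (v \<oplus>\<^bsub>V\<^esub> v') w = ip V v w + ip V v' w"
   if "v \<in> carrier V" "v' \<in> carrier V" "w \<in> carrier V" for v v' w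
   using V' that by blast
  show "ip V (c \<odot>\<^bsub>V\<^esub> v) w = c * ip V v w" if "v \<in> carrier V" "w \<in> carrier V" for c v w
   using V' that by blast
  show "0 \<le> Re (ip V v v)" if "v \<in> carrier V" for v
   using V' that by blast
 qed
 interpret Metric_space "carrier V" "vdist V"
  by (intro Metric_space_vdist) (use V' in blast)
 have mc: "mcomplete" using V' by blast
 show "hilb V"
 proof
  show "v = \<zero>\<^bsub>V\<^esub>" if "v \<in> carrier V" "ip V v v = 0" for v
   using V' that by blast
  fix s :: "nat \<Rightarrow> 'a" assume s: "!!n. s n \<in> carrier V"
   and C: "!!e. e > 0 ==> \<exists>N. \<forall>m\<ge>N. \<forall>n\<ge>N. ndist V (s m) (s n) < e"
  have "MCauchy s"
   unfolding MCauchy_def using s C by (fastforce simp: vdist_def)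
  then obtain v where "limitin mtopology s v sequentially"
   using mc mcomplete_def by blast
  then have v: "v \<in> carrier V" and "(\<lambda>n. vdist V (s n) v) \<longlonglongrightarrow> 0"
   by (auto simp: limitin_metric_dist_null)
  then show "\<exists>v\<in>carrier V. (\<lambda>n. ndist V (s n) v) \<longlonglongrightarrow> 0"
   using s by (auto simp: vdist_def)
 qed
next
 assume "hilb V"
 then interpret hilb V .
 interpret Metric_space "carrier V" "vdist V"
  by (intro Metric_space_vdist ip_definite)
 have "mcomplete"
  unfolding mcomplete_def
 proof (intro allI impI)
  fix s :: "nat \<Rightarrow> 'a" assume "MCauchy s"
  then have s: "!!n. s n \<in> carrier V"
   and C: "!!e. e > 0 ==> \<exists>N. \<forall>m\<ge>N. \<forall>n\<ge>N. ndist V (s m) (s n) < e"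
   by (auto simp: MCauchy_def vdist_def image_subset_iff)
  obtain v where "v \<in> carrier V" "(\<lambda>n. ndist V (s n) v) \<longlonglongrightarrow> 0"
   using complete[OF s C] by blast
  then show "\<exists>x. limitin mtopology s x sequentially"
   using s by (intro exI[of _ v]) (auto simp: limitin_metric_dist_null vdist_def)
 qed
 moreover have "module complex_ring V" ..
 ultimately show "hilbert_space V"
  unfolding hilbert_space_def
  by (intro conjI ballI allI impI) (assumption | rule ip_cnj ip_add ip_smult ip_nonneg ip_definite)+
qed

text \<open>A map that preserves inner products is automatically linear: the square of the norm of the
 defect of additivity, or of homogeneity, is a combination of inner products, and it vanishes for
 the identity map.\<close>

lemma ip_preserving_imp_linear_map:
 assumes "semi_inner V" "hilb W"
  and T: "!!v. v \<in> carrier V ==> T v \<in> carrier W"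
  and iso: "!!v w. v \<in> carrier V ==> w \<in> carrier V ==> ip W (T v) (T w) = ip V v w"
 shows "linear_map V W T"
proof -
 interpret V: semi_inner V by fact
 interpret W: hilb W by fact
 have "T (v \<oplus>\<^bsub>V\<^esub> v') = T v \<oplus>\<^bsub>W\<^esub> T v'" if v: "v \<in> carrier V" "v' \<in> carrier V" for v v'
 proof (rule W.eq_of_vnorm_diff)
  have "ip W (T (v \<oplus>\<^bsub>V\<^esub> v') \<ominus>\<^bsub>W\<^esub> (T v \<oplus>\<^bsub>W\<^esub> T v')) (T (v \<oplus>\<^bsub>V\<^esub> v') \<ominus>\<^bsub>W\<^esub> (T v \<oplus>\<^bsub>W\<^esub> T v')) = 0"
   using v by (simp add: W.ip_simps T iso V.ip_simps)
  then show "ndist W (T (v \<oplus>\<^bsub>V\<^esub> v')) (T v \<oplus>\<^bsub>W\<^esub> T v') = 0"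
   by (simp add: vnorm_def)
 qed (use v T in auto)
 moreover have "T (c \<odot>\<^bsub>V\<^esub> v) = c \<odot>\<^bsub>W\<^esub> T v" if v: "v \<in> carrier V" for c v
 proof (rule W.eq_of_vnorm_diff)
  have "ip W (T (c \<odot>\<^bsub>V\<^esub> v) \<ominus>\<^bsub>W\<^esub> (c \<odot>\<^bsub>W\<^esub> T v)) (T (c \<odot>\<^bsub>V\<^esub> v) \<ominus>\<^bsub>W\<^esub> (c \<odot>\<^bsub>W\<^esub> T v)) = 0"
   using v by (simp add: W.ip_simps T iso V.ip_simps)
  then show "ndist W (T (c \<odot>\<^bsub>V\<^esub> v)) (c \<odot>\<^bsub>W\<^esub> T v) = 0"
   by (simp add: vnorm_def)
 qed (use v T in auto)
 ultimately show ?thesis using T by (auto simp: linear_map_def)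
qed

lemma vnorm_diff_eq_of_ip_eq:
 assumes "semi_inner V" "semi_inner W"
  and "a \<in> carrier V" "b \<in> carrier V" "a' \<in> carrier W" "b' \<in> carrier W"
  and "ip V a a = ip W a' a'" "ip V a b = ip W a' b'" "ip V b b = ip W b' b'"
 shows "ndist V a b = ndist W a' b'"
proof -
 interpret V: semi_inner V by fact
 interpret W: semi_inner W by fact
 have "ip V b a = ip W b' a'"
  using assms V.ip_cnj[of a b] W.ip_cnj[of a' b'] by simp
 then have "ip V (a \<ominus>\<^bsub>V\<^esub> b) (a \<ominus>\<^bsub>V\<^esub> b) = ip W (a' \<ominus>\<^bsub>W\<^esub> b') (a' \<ominus>\<^bsub>W\<^esub> b')"
  using assms by (simp add: V.ip_simps W.ip_simps)
 then show ?thesis by (simp add: vnorm_def)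
qed

text \<open>Two families in Hilbert spaces that have dense range and the same Gram matrix are matched by a
 unitary map: matching them is isometric, so it extends to limits, and the extension is linear because it
 preserves inner products. All the unitaries below are obtained in this way.\<close>

lemma unitary_extension:
 assumes "hilb V" "hilb W"
  and p: "!!a. a \<in> A ==> p a \<in> carrier V" and q: "!!a. a \<in> A ==> q a \<in> carrier W"
  and iso: "!!a b. a \<in> A ==> b \<in> A ==> ip W (q a) (q b) = ip V (p a) (p b)"
  and densV: "!!v e. v \<in> carrier V ==> e > 0 ==> \<exists>a\<in>A. ndist V (p a) v < e"
  and densW: "!!w e. w \<in> carrier W ==> e > 0 ==> \<exists>a\<in>A. ndist W (q a) w < e"
 obtains T where "unitary_map V W T" "!!a. a \<in> A ==> T (p a) = q a"
proof -
 interpret V: hilb V by fact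
 interpret W: hilb W by fact
 have norm_eq: "ndist W (q a) (q b) = ndist V (p a) (p b)" if "a \<in> A" "b \<in> A" for a b
  using that p q iso
  by (intro vnorm_diff_eq_of_ip_eq V.semi_inner_axioms W.semi_inner_axioms) auto
 have seqV: "\<exists>a. (\<forall>n. a n \<in> A) \<and> (\<lambda>n. ndist V (p (a n)) v) \<longlonglongrightarrow> 0"
  if v: "v \<in> carrier V" for v
 proof -
  have "\<exists>a. \<forall>n. a n \<in> A \<and> ndist V (p (a n)) v < inverse (real (Suc n))"
   by (rule choice, rule allI) (use densV[OF v] in \<open>simp add: Bex_def\<close>)
  then obtain a where a: "!!n. a n \<in> A"
   "!!n. ndist V (p (a n)) v < inverse (real (Suc n))" by blast
  have "(\<lambda>n. ndist V (p (a n)) v) \<longlonglongrightarrow> 0"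
   by (rule tendsto_sandwich[OF _ _ tendsto_const LIMSEQ_inverse_real_of_nat])
    (use a p v in \<open>auto simp: V.vnorm_nonneg less_imp_le intro!: always_eventually\<close>)
  then show ?thesis using a by blast
 qed
 have seqW: "\<exists>a. (\<forall>n. a n \<in> A) \<and> (\<lambda>n. ndist W (q (a n)) v) \<longlonglongrightarrow> 0"
  if v: "v \<in> carrier W" for v
 proof -
  have "\<exists>a. \<forall>n. a n \<in> A \<and> ndist W (q (a n)) v < inverse (real (Suc n))"
   by (rule choice, rule allI) (use densW[OF v] in \<open>simp add: Bex_def\<close>)
  then obtain a where a: "!!n. a n \<in> A"
   "!!n. ndist W (q (a n)) v < inverse (real (Suc n))" by blast
  have "(\<lambda>n. ndist W (q (a n)) v) \<longlonglongrightarrow> 0"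
   by (rule tendsto_sandwich[OF _ _ tendsto_const LIMSEQ_inverse_real_of_nat])
    (use a q v in \<open>auto simp: W.vnorm_nonneg less_imp_le intro!: always_eventually\<close>)
  then show ?thesis using a by blast
 qed
 have convC: "\<exists>N. \<forall>m\<ge>N. \<forall>n\<ge>N. ndist U (s m) (s n) < e"
  if U: "semi_inner U" and s: "!!n. s n \<in> carrier U" "v \<in> carrier U"
   "(\<lambda>n. ndist U (s n) v) \<longlonglongrightarrow> 0" and "e > 0"
  for U :: "'z inner_module" and s v e
 proof -
  interpret U: semi_inner U by fact
  obtain N where N: "!!n. n \<ge> N ==> ndist U (s n) v < e / 2"
   using order_tendstoD(2)[OF s(3), of "e / 2"] \<open>e > 0\<close> by (auto simp: eventually_sequentially)
  have "ndist U (s m) (s n) < e" if "m \<ge> N" "n \<ge> N" for m n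
   using U.vnorm_diff_triangle[of "s m" v "s n"] U.vnorm_diff_commute[of v "s n"] s N[of m] N[of n] that
   by simp
  then show ?thesis by blast
 qed
 have ex: "\<exists>w\<in>carrier W. \<forall>a\<in>A. ndist W w (q a) = ndist V v (p a)"
  if v: "v \<in> carrier V" for v
 proof -
  obtain a where a: "!!n. a n \<in> A" and lim: "(\<lambda>n. ndist V (p (a n)) v) \<longlonglongrightarrow> 0"
   using seqV[OF v] by blast
  have "\<exists>N. \<forall>m\<ge>N. \<forall>n\<ge>N. ndist W (q (a m)) (q (a n)) < e" if "e > 0" for e
   using convC[OF V.semi_inner_axioms _ v lim that] a p by (simp add: norm_eq)
  then obtain w where w: "w \<in> carrier W" "(\<lambda>n. ndist W (q (a n)) w) \<longlonglongrightarrow> 0"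
   using W.complete[of "\<lambda>n. q (a n)"] a q by blast
  have "ndist W w (q b) = ndist V v (p b)" if b: "b \<in> A" for b
  proof (rule LIMSEQ_unique)
   show "(\<lambda>n. ndist W (q (a n)) (q b)) \<longlonglongrightarrow> ndist W w (q b)"
    using w a b q by (intro W.tendsto_vnorm_diff) auto
   show "(\<lambda>n. ndist W (q (a n)) (q b)) \<longlonglongrightarrow> ndist V v (p b)"
    using V.tendsto_vnorm_diff[of "\<lambda>n. p (a n)" v "p b"] lim v a b p by (simp add: norm_eq)
  qed
  then show ?thesis using w by blast
 qed
 then obtain T where T: "!!v. v \<in> carrier V ==> T v \<in> carrier W"
  and Tn: "!!v a. v \<in> carrier V ==> a \<in> A ==> ndist W (T v) (q a) = ndist V v (p a)"
  by metis
 have Tlim: "(\<lambda>n. ndist W (q (a n)) (T v)) \<longlonglongrightarrow> 0"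
  if "v \<in> carrier V" "!!n. a n \<in> A" "(\<lambda>n. ndist V (p (a n)) v) \<longlonglongrightarrow> 0" for a v
  using that Tn[of v] by (simp add: T p q W.vnorm_diff_commute[of _ "T v"] V.vnorm_diff_commute[of _ v])
 have Tp: "T (p a) = q a" if "a \<in> A" for a
  using that Tn[of "p a" a] p q T by (intro W.eq_of_vnorm_diff) auto
 have Tip: "ip W (T v) (T w) = ip V v w" if v: "v \<in> carrier V" and w: "w \<in> carrier V" for v w
 proof -
  obtain a where a: "!!n. a n \<in> A" and alim: "(\<lambda>n. ndist V (p (a n)) v) \<longlonglongrightarrow> 0"
   using seqV[OF v] by blast
  obtain b where b: "!!n. b n \<in> A" and blim: "(\<lambda>n. ndist V (p (b n)) w) \<longlonglongrightarrow> 0"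
   using seqV[OF w] by blast
  have "(\<lambda>n. ip W (q (a n)) (q (b n))) \<longlonglongrightarrow> ip W (T v) (T w)"
   using Tlim[OF v a alim] Tlim[OF w b blim] a b v w q T by (intro W.tendsto_ip) auto
  moreover have "(\<lambda>n. ip W (q (a n)) (q (b n))) \<longlonglongrightarrow> ip V v w"
   using V.tendsto_ip[OF _ v alim _ w blim] a b p by (simp add: iso)
  ultimately show ?thesis using LIMSEQ_unique by blast
 qed
 have lin: "linear_map V W T"
  using T Tip by (intro ip_preserving_imp_linear_map V.semi_inner_axioms assms) auto
 have "bij_betw T (carrier V) (carrier W)"
 proof (rule bij_betw_imageI)
  show "inj_on T (carrier V)"
  proof (rule inj_onI)
   fix v w assume vw: "v \<in> carrier V" "w \<in> carrier V" "T v = T w"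
   then have "ndist V v w = ndist W (T v) (T w)"
    using T vw(1,2)
    by (intro vnorm_diff_eq_of_ip_eq V.semi_inner_axioms W.semi_inner_axioms)
     (simp_all add: Tip[symmetric] vw(3))
   then show "v = w" using vw T by (intro V.eq_of_vnorm_diff) auto
  qed
  show "T ` carrier V = carrier W"
  proof
   show "carrier W \<subseteq> T ` carrier V"
   proof
    fix w assume w: "w \<in> carrier W"
    obtain a where a: "!!n. a n \<in> A" and lim: "(\<lambda>n. ndist W (q (a n)) w) \<longlonglongrightarrow> 0"
     using seqW[OF w] by blast
    have "\<exists>N. \<forall>m\<ge>N. \<forall>n\<ge>N. ndist V (p (a m)) (p (a n)) < e" if "e > 0" for e
     using convC[OF W.semi_inner_axioms _ w lim that] a q by (simp add: norm_eq)
    then obtain v where v: "v \<in> carrier V" "(\<lambda>n. ndist V (p (a n)) v) \<longlonglongrightarrow> 0"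
     using V.complete[of "\<lambda>n. p (a n)"] a p by blast
    have "T v = w"
     using Tlim[OF v(1) a v(2)] lim a q T v w by (intro W.limit_unique[of "\<lambda>n. q (a n)"]) auto
    then show "w \<in> T ` carrier V" using v by blast
   qed
  qed (use T in blast)
 qed
 then have "unitary_map V W T"
  using lin Tip by (simp add: unitary_map_def)
 then show ?thesis using that Tp by blast
qed

lemma unitary_mapD:
 assumes "unitary_map V W T"
 shows "v \<in> carrier V ==> T v \<in> carrier W"
  and "v \<in> carrier V ==> w \<in> carrier V ==> ip W (T v) (T w) = ip V v w"
  and "v \<in> carrier V ==> vnorm W (T v) = vnorm V v"
  and "v \<in> carrier V ==> w \<in> carrier V ==> T (v \<oplus>\<^bsub>V\<^esub> w) = T v \<oplus>\<^bsub>W\<^esub> T w"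
  and "v \<in> carrier V ==> T (c \<odot>\<^bsub>V\<^esub> v) = c \<odot>\<^bsub>W\<^esub> T v"
  and "bij_betw T (carrier V) (carrier W)"
 using assms by (auto simp: unitary_map_def linear_map_def vnorm_def)

lemma unitary_map_vnorm_diff:
 assumes "semi_inner V" "semi_inner W" "unitary_map V W T" "v \<in> carrier V" "w \<in> carrier V"
 shows "ndist W (T v) (T w) = ndist V v w"
 using assms unitary_mapD[OF assms(3)] by (intro vnorm_diff_eq_of_ip_eq) auto

lemma unitary_map_zero:
 assumes "hilb V" "hilb W" "unitary_map V W T" "v \<in> carrier V"
 shows "T v = \<zero>\<^bsub>W\<^esub> \<longleftrightarrow> v = \<zero>\<^bsub>V\<^esub>"
proof -
 interpret V: hilb V by fact
 interpret W: hilb W by fact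
 have "vnorm W (T v) = vnorm V v" using unitary_mapD(3)[OF assms(3,4)] .
 then show ?thesis
  using V.vnorm_eq_0D[OF assms(4)] W.vnorm_eq_0D[of "T v"] unitary_mapD(1)[OF assms(3,4)] by auto
qed

lemma unitary_map_inv:
 assumes "semi_inner V" "semi_inner W" "unitary_map V W T"
 shows "unitary_map W V (inv_into (carrier V) T)"
proof -
 interpret V: semi_inner V by fact
 interpret W: semi_inner W by fact
 note T = unitary_mapD[OF assms(3)]
 let ?S = "inv_into (carrier V) T"
 have S: "?S w \<in> carrier V" "T (?S w) = w" if "w \<in> carrier W" for w
  using that T(6) by (metis bij_betw_def inv_into_into, metis bij_betw_inv_into_right)
 have inj: "T v = T v' ==> v = v'" if "v \<in> carrier V" "v' \<in> carrier V" for v v'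
  using T(6) that by (meson bij_betw_def inj_onD)
 show ?thesis
  unfolding unitary_map_def linear_map_def
 proof (intro conjI ballI allI)
  fix v w assume vw: "v \<in> carrier W" "w \<in> carrier W"
  show "?S (v \<oplus>\<^bsub>W\<^esub> w) = ?S v \<oplus>\<^bsub>V\<^esub> ?S w"
   by (rule inj) (use vw S T in \<open>simp_all\<close>)
  show "ip V (?S v) (?S w) = ip W v w"
   using T(2)[of "?S v" "?S w"] S vw by simp
 next
  fix c v assume "v \<in> carrier W"
  then show "?S (c \<odot>\<^bsub>W\<^esub> v) = c \<odot>\<^bsub>V\<^esub> ?S v"
   by (intro inj) (use S T in \<open>simp_all\<close>)
 qed (use S T(6) bij_betw_inv_into in auto)
qed

section \<open>Quotients by null vectors\<close>

lemma with_ip_simps [simp]: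
 "carrier (with_ip M b) = carrier M" "add (with_ip M b) = add M" "zero (with_ip M b) = zero M"
 "module.smult (with_ip M b) = module.smult M" "ip (with_ip M b) = b"
 by (simp_all add: with_ip_def)

lemma a_inv_with_ip [simp]: "a_inv (with_ip M b) = a_inv M"
 by (rule ext) (simp add: a_inv_def m_inv_def)

lemma a_minus_with_ip [simp]: "a_minus (with_ip M b) x y = a_minus M x y"
 by (simp add: a_minus_def)

lemma module_transfer:
 fixes M :: "(complex, 'v, 'm) module_scheme" and M' :: "(complex, 'v, 'n) module_scheme"
 assumes "module complex_ring M" "carrier M' = carrier M" "add M' = add M" "zero M' = zero M"
  "module.smult M' = module.smult M"
 shows "module complex_ring M'"
proof -
 interpret M: module complex_ring M by fact
 show ?thesis
 proof (rule moduleI[OF cring_complex_ring])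
  show "abelian_group M'"
  proof (rule abelian_groupI)
   fix x assume "x \<in> carrier M'"
   then show "\<exists>y\<in>carrier M'. y \<oplus>\<^bsub>M'\<^esub> x = \<zero>\<^bsub>M'\<^esub>"
    using M.l_neg[of x] M.a_inv_closed[of x] by (auto simp: assms)
  qed (auto simp: assms M.M.a_assoc intro: M.M.a_comm)
 qed (use M.smult_l_distr M.smult_r_distr M.smult_assoc1 M.smult_one in \<open>auto simp: assms\<close>)
qed

lemma module_with_ip [simp]: "module complex_ring (with_ip M b) \<longleftrightarrow> module complex_ring M"
 using module_transfer[of M "with_ip M b"] module_transfer[of "with_ip M b" M] by auto

text \<open>Dividing a semi-inner product space by a subspace of null vectors keeps the form: its values
 on cosets are read off from arbitrary representatives.\<close>

locale null_quotient = semi_inner "with_ip M b" for M :: "(complex, 'v) module" and b +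
 fixes N
 assumes N_sub: "N \<subseteq> carrier M"
  and N_zero: "\<zero>\<^bsub>M\<^esub> \<in> N"
  and N_add: "v \<in> N ==> w \<in> N ==> v \<oplus>\<^bsub>M\<^esub> w \<in> N"
  and N_smult: "v \<in> N ==> c \<odot>\<^bsub>M\<^esub> v \<in> N"
  and N_null: "v \<in> N ==> b v v = 0"
begin

abbreviation cl where "cl v \<equiv> N +>\<^bsub>M\<^esub> v"
abbreviation QM where "QM \<equiv> quotient_space M N"
definition qip where "qip A B = the_elem ((\<lambda>(s, t). b s t) ` (A \<times> B))"

lemma module_M: "module complex_ring M"
 using module_axioms by simp

sublocale M0: module complex_ring M by (rule module_M)

lemma N_neg: "v \<in> N ==> \<ominus>\<^bsub>M\<^esub> v \<in> N"
 using N_smult[of v "-1"] minus_one_smult[of v] N_sub by auto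

lemma abelian_subgroup_N: "abelian_subgroup N M"
proof (rule abelian_subgroupI3)
 show "abelian_group M" by (rule M0.abelian_group_axioms)
 have "subgroup N (add_monoid M)"
  by (rule group.subgroupI[OF M0.a_group]) (use N_sub N_zero N_add N_neg in \<open>auto simp: a_inv_def\<close>)
 then show "additive_subgroup N M" by (rule additive_subgroupI)
qed

sublocale AS: abelian_subgroup N M by (rule abelian_subgroup_N)

lemma cl_eq_iff: "v \<in> carrier M ==> w \<in> carrier M ==> cl v = cl w \<longleftrightarrow> v \<ominus>\<^bsub>M\<^esub> w \<in> N"
 using AS.a_rcos_module[of w v] AS.a_repr_independence'[of v w] AS.a_rcos_self[of v]
 by (auto simp: a_minus_def)

lemma mem_cl_iff: "v \<in> carrier M ==> w \<in> cl v \<longleftrightarrow> (\<exists>n\<in>N. w = n \<oplus>\<^bsub>M\<^esub> v)"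
 by (auto simp: a_r_coset_def')

lemma cl_add: "v \<in> carrier M ==> w \<in> carrier M ==> cl v \<oplus>\<^bsub>QM\<^esub> cl w = cl (v \<oplus>\<^bsub>M\<^esub> w)"
 by (simp add: quotient_space_def AS.a_rcos_sum)

lemma cl_zero: "\<zero>\<^bsub>QM\<^esub> = cl \<zero>\<^bsub>M\<^esub>"
 using N_sub by (simp add: quotient_space_def)

lemma carrier_QM: "carrier QM = cl ` carrier M"
 by (auto simp: quotient_space_def A_RCOSETS_def')

lemma cl_carrier [simp]: "v \<in> carrier M ==> cl v \<in> carrier QM"
 by (simp add: carrier_QM)

lemma cl_smult:
 assumes v: "v \<in> carrier M" shows "c \<odot>\<^bsub>QM\<^esub> cl v = cl (c \<odot>\<^bsub>M\<^esub> v)"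
proof -
 have "cl (c \<odot>\<^bsub>M\<^esub> a) = cl (c \<odot>\<^bsub>M\<^esub> v)" if a: "a \<in> cl v" for a
 proof -
  obtain n where n: "n \<in> N" "a = n \<oplus>\<^bsub>M\<^esub> v" using a v by (auto simp: mem_cl_iff)
  have nM: "n \<in> carrier M" using n N_sub by blast
  have "c \<odot>\<^bsub>M\<^esub> a = c \<odot>\<^bsub>M\<^esub> n \<oplus>\<^bsub>M\<^esub> c \<odot>\<^bsub>M\<^esub> v"
   using smult_add_right[of n v c] nM v n by simp
  then have "c \<odot>\<^bsub>M\<^esub> a \<in> cl (c \<odot>\<^bsub>M\<^esub> v)"
   using v N_smult[OF n(1)] smultC[of v c] by (auto simp: mem_cl_iff)
  then show ?thesis
   using AS.a_repr_independence'[of "c \<odot>\<^bsub>M\<^esub> a" "c \<odot>\<^bsub>M\<^esub> v"] v smultC[of v c] by simp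
 qed
 moreover have "v \<in> cl v" using v by (rule AS.a_rcos_self)
 ultimately have "(\<Union>a\<in>cl v. cl (c \<odot>\<^bsub>M\<^esub> a)) = cl (c \<odot>\<^bsub>M\<^esub> v)" by blast
 then show ?thesis by (simp add: quotient_space_def)
qed

lemma module_QM: "module complex_ring QM"
proof (rule moduleI[OF cring_complex_ring])
 show "abelian_group QM"
 proof (rule abelian_groupI)
  fix x assume "x \<in> carrier QM"
  then obtain v where v: "v \<in> carrier M" "x = cl v" by (auto simp: carrier_QM)
  have "cl (\<ominus>\<^bsub>M\<^esub> v) \<oplus>\<^bsub>QM\<^esub> x = \<zero>\<^bsub>QM\<^esub>"
   using v by (simp add: cl_add cl_zero M0.l_neg)
  then show "\<exists>y\<in>carrier QM. y \<oplus>\<^bsub>QM\<^esub> x = \<zero>\<^bsub>QM\<^esub>"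
   using v by (meson M0.M.a_inv_closed cl_carrier)
   fix y assume "y \<in> carrier QM"
  then obtain w where w: "w \<in> carrier M" "y = cl w" by (auto simp: carrier_QM)
  show "x \<oplus>\<^bsub>QM\<^esub> y = y \<oplus>\<^bsub>QM\<^esub> x" using v w by (simp add: cl_add M0.M.a_comm)
 qed (auto simp: carrier_QM cl_add cl_zero M0.M.a_assoc)
qed (use M0.smult_l_distr M0.smult_r_distr M0.smult_assoc1 M0.smult_one smultC
   in \<open>auto simp: carrier_QM cl_add cl_smult\<close>)

lemma form_cl:
 assumes "v \<in> carrier M" "w \<in> carrier M" "v' \<in> cl v" "w' \<in> cl w"
 shows "b v' w' = b v w"
proof -
 obtain m n where mn: "m \<in> N" "n \<in> N" "v' = m \<oplus>\<^bsub>M\<^esub> v" "w' = n \<oplus>\<^bsub>M\<^esub> w"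
  using assms by (auto simp: mem_cl_iff)
 then have c: "m \<in> carrier M" "n \<in> carrier M" using N_sub by auto
 have "b m x = 0" "b x n = 0" if "x \<in> carrier M" for x
  using ip_eq_0_of_vnorm_eq_0[of m x] ip_eq_0_of_vnorm_eq_0[of n x] vnorm_eq_0_iff_ip[of m]
   vnorm_eq_0_iff_ip[of n] N_null mn c that ip_cnj[of n x] by auto
 then show ?thesis
  using c assms(1,2) ip_add[of m v w'] ip_add_right[of v n w] mn by simp
qed

lemma qip_cl:
 assumes "v \<in> carrier M" "w \<in> carrier M"
 shows "qip (cl v) (cl w) = b v w"
proof -
 have "(\<lambda>(s, t). b s t) ` (cl v \<times> cl w) = (\<lambda>_. b v w) ` (cl v \<times> cl w)"
  by (rule image_cong) (auto intro: form_cl[OF assms])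
 also have "\<dots> = {b v w}"
  using AS.a_rcos_self[OF assms(1)] AS.a_rcos_self[OF assms(2)] by (auto simp: image_constant_conv)
 finally have "(\<lambda>(s, t). b s t) ` (cl v \<times> cl w) = {b v w}" .
 then show ?thesis by (simp add: qip_def)
qed

lemma semi_inner_QM: "semi_inner (with_ip QM qip)"
proof -
 interpret Q: module complex_ring "with_ip QM qip" using module_QM by simp
 show ?thesis
 proof
  fix v w assume "v \<in> carrier (with_ip QM qip)" "w \<in> carrier (with_ip QM qip)"
  then obtain v0 w0 where "v0 \<in> carrier M" "v = cl v0" "w0 \<in> carrier M" "w = cl w0"
   by (auto simp: carrier_QM)
  then show "ip (with_ip QM qip) w v = cnj (ip (with_ip QM qip) v w)"
   using ip_cnj[of v0 w0] by (simp add: qip_cl)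
 next
  fix v w v' assume "v \<in> carrier (with_ip QM qip)" "w \<in> carrier (with_ip QM qip)"
   "v' \<in> carrier (with_ip QM qip)"
  then show "ip (with_ip QM qip) (v \<oplus>\<^bsub>with_ip QM qip\<^esub> v') w
   = ip (with_ip QM qip) v w + ip (with_ip QM qip) v' w"
   by (auto simp: carrier_QM qip_cl cl_add ip_add[simplified])
 next
  fix v w c assume "v \<in> carrier (with_ip QM qip)" "w \<in> carrier (with_ip QM qip)"
  then show "ip (with_ip QM qip) (c \<odot>\<^bsub>with_ip QM qip\<^esub> v) w = c * ip (with_ip QM qip) v w"
   by (auto simp: carrier_QM qip_cl cl_smult ip_smult[simplified] smultC[simplified])
 next
  fix v assume "v \<in> carrier (with_ip QM qip)"
  then show "0 \<le> Re (ip (with_ip QM qip) v v)"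
   by (auto simp: carrier_QM qip_cl ip_nonneg[simplified])
 qed
qed

lemma cl_minus:
 assumes v: "v \<in> carrier M" "w \<in> carrier M"
 shows "cl v \<ominus>\<^bsub>QM\<^esub> cl w = cl (v \<ominus>\<^bsub>M\<^esub> w)"
proof -
 interpret Q: module complex_ring QM by (rule module_QM)
 have "\<ominus>\<^bsub>QM\<^esub> cl w = cl (\<ominus>\<^bsub>M\<^esub> w)"
  using v by (intro Q.minus_equality) (simp_all add: cl_add cl_zero M0.l_neg)
 then show ?thesis using v by (simp add: a_minus_def cl_add)
qed

end

section \<open>Hilbert space direct sums\<close>

text \<open>Direct sums, spaces of sections and spaces of sequences all have pointwise operations, so they inherit
 the module axioms from their components.\<close>

lemma pointwise_module:
 fixes M :: "(complex, 'i \<Rightarrow> 'v, 'm) module_scheme" and V :: "'i \<Rightarrow> (complex, 'v, 'n) module_scheme"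
 assumes V: "!!i. i \<in> I ==> module complex_ring (V i)"
  and sub: "carrier M \<subseteq> (\<Pi>\<^sub>E i\<in>I. carrier (V i))"
  and add: "!!v w. v \<oplus>\<^bsub>M\<^esub> w = (\<lambda>i\<in>I. v i \<oplus>\<^bsub>V i\<^esub> w i)"
  and zero: "\<zero>\<^bsub>M\<^esub> = (\<lambda>i\<in>I. \<zero>\<^bsub>V i\<^esub>)"
  and smult: "!!c v. c \<odot>\<^bsub>M\<^esub> v = (\<lambda>i\<in>I. c \<odot>\<^bsub>V i\<^esub> v i)"
  and closed: "!!v w. v \<in> carrier M ==> w \<in> carrier M ==> v \<oplus>\<^bsub>M\<^esub> w \<in> carrier M" "\<zero>\<^bsub>M\<^esub> \<in> carrier M"
   "!!c v. v \<in> carrier M ==> c \<odot>\<^bsub>M\<^esub> v \<in> carrier M"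
 shows "module complex_ring M"
  and "!!v w i. v \<in> carrier M ==> w \<in> carrier M ==> i \<in> I ==> (v \<ominus>\<^bsub>M\<^esub> w) i = v i \<ominus>\<^bsub>V i\<^esub> w i"
proof -
 have comp: "v i \<in> carrier (V i)" if "v \<in> carrier M" "i \<in> I" for v i
  using sub that by (auto simp: PiE_iff)
 have ext: "v = w" if "v \<in> carrier M" "w \<in> carrier M" "!!i. i \<in> I ==> v i = w i" for v w
  using sub that by (intro PiE_ext[of v I "\<lambda>i. carrier (V i)" w]) auto
 have neg: "(-1) \<odot>\<^bsub>V i\<^esub> v \<oplus>\<^bsub>V i\<^esub> v = \<zero>\<^bsub>V i\<^esub>" "(-1) \<odot>\<^bsub>V i\<^esub> v = \<ominus>\<^bsub>V i\<^esub> v"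
  if "i \<in> I" "v \<in> carrier (V i)" for i v
 proof -
  interpret Vi: module complex_ring "V i" using V that by blast
  have "(-1) \<odot>\<^bsub>V i\<^esub> v \<oplus>\<^bsub>V i\<^esub> v = ((-1) \<oplus>\<^bsub>complex_ring\<^esub> 1) \<odot>\<^bsub>V i\<^esub> v"
   using Vi.smult_l_distr[of "-1" 1 v] Vi.smult_one[of v] that by simp
  also have "\<dots> = \<zero>\<^bsub>V i\<^esub>" using Vi.smult_l_null[of v] that by simp
  finally show 1: "(-1) \<odot>\<^bsub>V i\<^esub> v \<oplus>\<^bsub>V i\<^esub> v = \<zero>\<^bsub>V i\<^esub>" .
  show "(-1) \<odot>\<^bsub>V i\<^esub> v = \<ominus>\<^bsub>V i\<^esub> v"
   using Vi.minus_equality[OF 1] that Vi.smult_closed[of "-1" v] by simp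
 qed
 show mod: "module complex_ring M"
 proof (rule moduleI[OF cring_complex_ring])
  show "abelian_group M"
  proof (rule abelian_groupI)
   fix x assume x: "x \<in> carrier M"
   show "\<exists>y\<in>carrier M. y \<oplus>\<^bsub>M\<^esub> x = \<zero>\<^bsub>M\<^esub>"
    using neg(1) comp[OF x] closed(3)[OF x]
    by (intro bexI[of _ "(-1) \<odot>\<^bsub>M\<^esub> x"]) (auto simp: add smult zero intro!: restrict_ext)
   show "\<zero>\<^bsub>M\<^esub> \<oplus>\<^bsub>M\<^esub> x = x"
   proof (rule ext[OF closed(1)[OF closed(2) x] x])
    fix i assume i: "i \<in> I"
    interpret Vi: module complex_ring "V i" using V i by blast
    show "(\<zero>\<^bsub>M\<^esub> \<oplus>\<^bsub>M\<^esub> x) i = x i" using comp[OF x i] i by (simp add: add zero)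
   qed
   fix y assume y: "y \<in> carrier M"
   show "x \<oplus>\<^bsub>M\<^esub> y = y \<oplus>\<^bsub>M\<^esub> x"
    unfolding add
   proof (rule restrict_ext)
    fix i assume i: "i \<in> I"
    interpret Vi: module complex_ring "V i" using V i by blast
    show "x i \<oplus>\<^bsub>V i\<^esub> y i = y i \<oplus>\<^bsub>V i\<^esub> x i" using comp x y i by (simp add: Vi.M.a_comm)
   qed
   fix z assume z: "z \<in> carrier M"
   show "x \<oplus>\<^bsub>M\<^esub> y \<oplus>\<^bsub>M\<^esub> z = x \<oplus>\<^bsub>M\<^esub> (y \<oplus>\<^bsub>M\<^esub> z)"
    unfolding add
   proof (rule restrict_ext)
    fix i assume i: "i \<in> I"
    interpret Vi: module complex_ring "V i" using V i by blast
    show "(\<lambda>i\<in>I. x i \<oplus>\<^bsub>V i\<^esub> y i) i \<oplus>\<^bsub>V i\<^esub> z i = x i \<oplus>\<^bsub>V i\<^esub> (\<lambda>i\<in>I. y i \<oplus>\<^bsub>V i\<^esub> z i) i"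
     using comp x y z i by (simp add: Vi.M.a_assoc)
   qed
  qed (use closed in auto)
 next
  fix a b x y assume x: "x \<in> carrier M"
  show "a \<odot>\<^bsub>M\<^esub> x \<in> carrier M" by (rule closed(3)[OF x])
  have "(a \<oplus>\<^bsub>complex_ring\<^esub> b) \<odot>\<^bsub>V i\<^esub> x i = a \<odot>\<^bsub>V i\<^esub> x i \<oplus>\<^bsub>V i\<^esub> b \<odot>\<^bsub>V i\<^esub> x i"
   "(a \<otimes>\<^bsub>complex_ring\<^esub> b) \<odot>\<^bsub>V i\<^esub> x i = a \<odot>\<^bsub>V i\<^esub> (b \<odot>\<^bsub>V i\<^esub> x i)" if "i \<in> I" for i
   using module.smult_l_distr[OF V[OF that], of a b "x i"] module.smult_assoc1[OF V[OF that], of a b "x i"]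
    comp[OF x that] by auto
  then show "(a \<oplus>\<^bsub>complex_ring\<^esub> b) \<odot>\<^bsub>M\<^esub> x = a \<odot>\<^bsub>M\<^esub> x \<oplus>\<^bsub>M\<^esub> b \<odot>\<^bsub>M\<^esub> x"
   "(a \<otimes>\<^bsub>complex_ring\<^esub> b) \<odot>\<^bsub>M\<^esub> x = a \<odot>\<^bsub>M\<^esub> (b \<odot>\<^bsub>M\<^esub> x)"
   unfolding smult add by (auto intro!: restrict_ext)
  show "\<one>\<^bsub>complex_ring\<^esub> \<odot>\<^bsub>M\<^esub> x = x"
   by (rule ext[OF closed(3)[OF x] x])
    (use module.smult_one[OF V comp[OF x]] in \<open>simp add: smult\<close>)
  assume y: "y \<in> carrier M"
  have "a \<odot>\<^bsub>V i\<^esub> (x i \<oplus>\<^bsub>V i\<^esub> y i) = a \<odot>\<^bsub>V i\<^esub> x i \<oplus>\<^bsub>V i\<^esub> a \<odot>\<^bsub>V i\<^esub> y i" if "i \<in> I" for i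
   using module.smult_r_distr[OF V[OF that], of a "x i" "y i"] comp[OF x that] comp[OF y that] by simp
  then show "a \<odot>\<^bsub>M\<^esub> (x \<oplus>\<^bsub>M\<^esub> y) = a \<odot>\<^bsub>M\<^esub> x \<oplus>\<^bsub>M\<^esub> a \<odot>\<^bsub>M\<^esub> y"
   unfolding smult add by (auto intro!: restrict_ext)
 qed
 interpret M: module complex_ring M by (rule mod)
 fix v w i assume v: "v \<in> carrier M" and w: "w \<in> carrier M" and i: "i \<in> I"
 have "(-1) \<odot>\<^bsub>M\<^esub> w \<oplus>\<^bsub>M\<^esub> w = \<zero>\<^bsub>M\<^esub>"
  unfolding add smult zero by (rule restrict_ext) (use neg(1) comp[OF w] in simp)
 then have "\<ominus>\<^bsub>M\<^esub> w = (-1) \<odot>\<^bsub>M\<^esub> w" using w closed(3) by (intro M.minus_equality) auto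
 then show "(v \<ominus>\<^bsub>M\<^esub> w) i = v i \<ominus>\<^bsub>V i\<^esub> w i"
  using neg(2)[OF i comp[OF w i]] i by (simp add: a_minus_def add smult)
qed

locale hilb_family =
 fixes I :: "'i set" and V :: "'i \<Rightarrow> 'v inner_module"
 assumes hilb_V: "i \<in> I ==> hilb (V i)"
begin

abbreviation S where "S \<equiv> hilbert_sum I V"

lemma S_simps:
 "carrier S = {v \<in> (\<Pi>\<^sub>E i\<in>I. carrier (V i)). (\<lambda>i. (vnorm (V i) (v i))\<^sup>2) summable_on I}"
 "\<zero>\<^bsub>S\<^esub> = (\<lambda>i\<in>I. \<zero>\<^bsub>V i\<^esub>)" "v \<oplus>\<^bsub>S\<^esub> w = (\<lambda>i\<in>I. v i \<oplus>\<^bsub>V i\<^esub> w i)"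
 "c \<odot>\<^bsub>S\<^esub> v = (\<lambda>i\<in>I. c \<odot>\<^bsub>V i\<^esub> v i)" "ip S v w = infsum (\<lambda>i. ip (V i) (v i) (w i)) I"
 by (simp_all add: hilbert_sum_def)

lemma semi_V: "i \<in> I ==> semi_inner (V i)"
 using hilb_V hilb.axioms(1) by blast

lemma module_V: "i \<in> I ==> module complex_ring (V i)"
 using semi_V semi_inner.axioms(1) by blast

lemma S_comp: "v \<in> carrier S ==> i \<in> I ==> v i \<in> carrier (V i)"
 by (auto simp: S_simps)

lemma S_summable: "v \<in> carrier S ==> (\<lambda>i. (vnorm (V i) (v i))\<^sup>2) summable_on I"
 by (simp add: S_simps)

lemma S_ext: "v \<in> carrier S ==> w \<in> carrier S ==> (!!i. i \<in> I ==> v i = w i) ==> v = w"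
 by (auto simp: S_simps intro: PiE_ext)

lemma S_memI:
 assumes "v \<in> (\<Pi>\<^sub>E i\<in>I. carrier (V i))"
  and "!!J. finite J ==> J \<subseteq> I ==> (\<Sum>i\<in>J. (vnorm (V i) (v i))\<^sup>2) \<le> B"
 shows "v \<in> carrier S"
proof -
 have "(\<lambda>i. (vnorm (V i) (v i))\<^sup>2) summable_on I"
  by (rule nonneg_bdd_above_summable_on) (use assms(2) in \<open>auto intro!: bdd_aboveI2\<close>)
 then show ?thesis using assms by (simp add: S_simps)
qed

lemma S_memI_finite:
 assumes "v \<in> (\<Pi>\<^sub>E i\<in>I. carrier (V i))" "finite {i\<in>I. v i \<noteq> \<zero>\<^bsub>V i\<^esub>}"
 shows "v \<in> carrier S"
proof -
 have "vnorm (V i) (v i) = 0" if "i \<in> I - {i\<in>I. v i \<noteq> \<zero>\<^bsub>V i\<^esub>}" for i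
  using semi_inner.vnorm_zero[OF semi_V] that by auto
 then have "(\<lambda>i. (vnorm (V i) (v i))\<^sup>2) summable_on I"
  using summable_on_cong_neutral[of "{i\<in>I. v i \<noteq> \<zero>\<^bsub>V i\<^esub>}" I "\<lambda>i. (vnorm (V i) (v i))\<^sup>2"
    "\<lambda>i. (vnorm (V i) (v i))\<^sup>2"] assms(2) by (auto simp: summable_on_finite)
 then show ?thesis using assms by (simp add: S_simps)
qed

lemma S_add_closed: assumes "v \<in> carrier S" "w \<in> carrier S" shows "v \<oplus>\<^bsub>S\<^esub> w \<in> carrier S"
proof -
 have "(\<lambda>i. 2 * (vnorm (V i) (v i))\<^sup>2 + 2 * (vnorm (V i) (w i))\<^sup>2) summable_on I"
  using assms by (intro summable_on_add summable_on_cmult_right S_summable)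
 then have "(\<lambda>i. (vnorm (V i) ((v \<oplus>\<^bsub>S\<^esub> w) i))\<^sup>2) summable_on I"
 proof (rule summable_on_comparison_test)
  fix i assume i: "i \<in> I"
  interpret Vi: hilb "V i" using hilb_V[OF i] .
  have c: "v i \<in> carrier (V i)" "w i \<in> carrier (V i)" using S_comp assms i by auto
  have "(vnorm (V i) (v i \<oplus>\<^bsub>V i\<^esub> w i))\<^sup>2 \<le> (vnorm (V i) (v i) + vnorm (V i) (w i))\<^sup>2"
   using c by (intro power_mono Vi.vnorm_triangle Vi.vnorm_nonneg) auto
  also have "\<dots> \<le> 2 * (vnorm (V i) (v i))\<^sup>2 + 2 * (vnorm (V i) (w i))\<^sup>2"
   using sum_squares_bound[of "vnorm (V i) (v i)" "vnorm (V i) (w i)"] by (simp add: power2_sum)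
  finally show "(vnorm (V i) ((v \<oplus>\<^bsub>S\<^esub> w) i))\<^sup>2 \<le> 2 * (vnorm (V i) (v i))\<^sup>2 + 2 * (vnorm (V i) (w i))\<^sup>2"
   using i by (simp add: S_simps)
 qed simp
 moreover have "v \<oplus>\<^bsub>S\<^esub> w \<in> (\<Pi>\<^sub>E i\<in>I. carrier (V i))"
  using assms S_comp module_V by (auto simp: S_simps intro!: abelian_monoid.a_closed
    abelian_group.axioms(1) module.axioms(2))
 ultimately show ?thesis by (simp add: S_simps)
qed

lemma S_smult_closed: assumes "v \<in> carrier S" shows "c \<odot>\<^bsub>S\<^esub> v \<in> carrier S"
proof -
 have "(\<lambda>i. (cmod c)\<^sup>2 * (vnorm (V i) (v i))\<^sup>2) summable_on I"
  using assms by (intro summable_on_cmult_right S_summable)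
 then have "(\<lambda>i. (vnorm (V i) ((c \<odot>\<^bsub>S\<^esub> v) i))\<^sup>2) summable_on I"
 proof (rule summable_on_comparison_test)
  fix i assume i: "i \<in> I"
  interpret Vi: hilb "V i" using hilb_V[OF i] .
  have c: "v i \<in> carrier (V i)" using S_comp assms i by auto
  then show "(vnorm (V i) ((c \<odot>\<^bsub>S\<^esub> v) i))\<^sup>2 \<le> (cmod c)\<^sup>2 * (vnorm (V i) (v i))\<^sup>2"
   using i by (simp add: S_simps Vi.vnorm_smult power_mult_distrib)
 qed simp
 moreover have "c \<odot>\<^bsub>S\<^esub> v \<in> (\<Pi>\<^sub>E i\<in>I. carrier (V i))"
  using assms S_comp semi_V by (auto simp: S_simps intro!: semi_inner.smultC)
 ultimately show ?thesis by (simp add: S_simps)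
qed

lemma S_zero_closed: "\<zero>\<^bsub>S\<^esub> \<in> carrier S"
proof -
 have "\<zero>\<^bsub>V i\<^esub> \<in> carrier (V i)" if "i \<in> I" for i
  using module_V[OF that] by (meson abelian_group.axioms(1) abelian_monoid.zero_closed module.axioms(2))
 then show ?thesis by (intro S_memI_finite) (auto simp: S_simps)
qed

lemma module_S: "module complex_ring S"
 and S_minus: "v \<in> carrier S ==> w \<in> carrier S ==> i \<in> I ==> (v \<ominus>\<^bsub>S\<^esub> w) i = v i \<ominus>\<^bsub>V i\<^esub> w i"
proof -
 have c: "carrier S \<subseteq> (\<Pi>\<^sub>E i\<in>I. carrier (V i))" by (auto simp: S_simps(1))
 note pm = pointwise_module[of I V S, OF module_V c S_simps(3,2,4) S_add_closed S_zero_closed S_smult_closed]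
 show "module complex_ring S" by (rule pm(1))
 show "v \<in> carrier S ==> w \<in> carrier S ==> i \<in> I ==> (v \<ominus>\<^bsub>S\<^esub> w) i = v i \<ominus>\<^bsub>V i\<^esub> w i" by (rule pm(2))
qed

lemma ip_summable:
 assumes "v \<in> carrier S" "w \<in> carrier S"
 shows "(\<lambda>i. ip (V i) (v i) (w i)) summable_on I"
proof -
 have "(\<lambda>i. (vnorm (V i) (v i))\<^sup>2 + (vnorm (V i) (w i))\<^sup>2) summable_on I"
  using assms by (intro summable_on_add S_summable)
 then have "(\<lambda>i. norm (ip (V i) (v i) (w i))) summable_on I"
 proof (rule Infinite_Sum.abs_summable_on_comparison_test')
  fix i assume i: "i \<in> I"
  interpret Vi: hilb "V i" using hilb_V[OF i] .
  have c: "v i \<in> carrier (V i)" "w i \<in> carrier (V i)" using S_comp assms i by auto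
  have "2 * (vnorm (V i) (v i) * vnorm (V i) (w i)) \<le> (vnorm (V i) (v i))\<^sup>2 + (vnorm (V i) (w i))\<^sup>2"
   using sum_squares_bound[of "vnorm (V i) (v i)" "vnorm (V i) (w i)"] by simp
  moreover have "0 \<le> vnorm (V i) (v i) * vnorm (V i) (w i)" using c Vi.vnorm_nonneg by simp
  ultimately show "norm (ip (V i) (v i) (w i)) \<le> (vnorm (V i) (v i))\<^sup>2 + (vnorm (V i) (w i))\<^sup>2"
   using Vi.Cauchy_Schwarz[OF c] by linarith
 qed
 then show ?thesis by (rule abs_summable_summable)
qed

lemma semi_inner_S: "semi_inner S"
proof -
 interpret module complex_ring S by (rule module_S)
 show ?thesis
 proof
  fix v w assume v: "v \<in> carrier S" and w: "w \<in> carrier S"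
  have "infsum (\<lambda>i. ip (V i) (w i) (v i)) I = infsum (\<lambda>i. cnj (ip (V i) (v i) (w i))) I"
   using v w by (intro infsum_cong semi_inner.ip_cnj[OF semi_V] S_comp)
  then show "ip S w v = cnj (ip S v w)" by (simp add: S_simps)
  have "infsum (\<lambda>i. ip (V i) ((c \<odot>\<^bsub>S\<^esub> v) i) (w i)) I = infsum (\<lambda>i. c * ip (V i) (v i) (w i)) I" for c
   using v w by (intro infsum_cong) (simp add: S_simps(4) semi_inner.ip_smult[OF semi_V] S_comp)
  then show "ip S (c \<odot>\<^bsub>S\<^esub> v) w = c * ip S v w" for c
   by (simp add: S_simps(5) infsum_cmult_right')
  fix v' assume v': "v' \<in> carrier S"
  have "infsum (\<lambda>i. ip (V i) ((v \<oplus>\<^bsub>S\<^esub> v') i) (w i)) I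
    = infsum (\<lambda>i. ip (V i) (v i) (w i) + ip (V i) (v' i) (w i)) I"
   using v v' w by (intro infsum_cong) (simp add: S_simps(3) semi_inner.ip_add[OF semi_V] S_comp)
  then show "ip S (v \<oplus>\<^bsub>S\<^esub> v') w = ip S v w + ip S v' w"
   using infsum_add[OF ip_summable[OF v w] ip_summable[OF v' w]] by (simp add: S_simps(5))
 next
  fix v assume v: "v \<in> carrier S"
  have "infsum (\<lambda>i. ip (V i) (v i) (v i)) I = infsum (\<lambda>i. of_real ((vnorm (V i) (v i))\<^sup>2)) I"
   using v by (intro infsum_cong semi_inner.ip_self[OF semi_V] S_comp)
  also have "\<dots> = of_real (infsum (\<lambda>i. (vnorm (V i) (v i))\<^sup>2) I)"
   using has_sum_of_real[OF has_sum_infsum[OF S_summable[OF v]]] by (rule infsumI)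
  finally show "0 \<le> Re (ip S v v)"
   by (simp add: S_simps infsum_nonneg)
 qed
qed

sublocale S: semi_inner S by (rule semi_inner_S)

lemma vnorm_S_sq: "v \<in> carrier S ==> ((\<lambda>i. (vnorm (V i) (v i))\<^sup>2) has_sum (vnorm S v)\<^sup>2) I"
proof -
 assume v: "v \<in> carrier S"
 have "((\<lambda>i. ip (V i) (v i) (v i)) has_sum ip S v v) I"
  using has_sum_infsum[OF ip_summable[OF v v]] by (simp add: S_simps)
 then have "((\<lambda>i. of_real ((vnorm (V i) (v i))\<^sup>2) :: complex) has_sum of_real ((vnorm S v)\<^sup>2)) I"
  using v by (subst has_sum_cong[of I _ "\<lambda>i. ip (V i) (v i) (v i)"])
   (simp_all add: semi_inner.ip_self[OF semi_V] S_comp S.ip_self flip: of_real_power)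
 then show ?thesis by (simp only: has_sum_of_real_iff)
qed

lemma S_finite_le: "v \<in> carrier S ==> finite J ==> J \<subseteq> I ==>
  (\<Sum>i\<in>J. (vnorm (V i) (v i))\<^sup>2) \<le> (vnorm S v)\<^sup>2"
 by (rule finite_sum_le_has_sum[OF vnorm_S_sq]) auto

lemma S_comp_le: "v \<in> carrier S ==> i \<in> I ==> vnorm (V i) (v i) \<le> vnorm S v"
 using S_finite_le[of v "{i}"] S.vnorm_nonneg[of v] by (auto intro: power2_le_imp_le)

lemma S_vnorm_le:
 assumes "v \<in> carrier S" "0 \<le> B"
  and "!!J. finite J ==> J \<subseteq> I ==> (\<Sum>i\<in>J. (vnorm (V i) (v i))\<^sup>2) \<le> B\<^sup>2"
 shows "vnorm S v \<le> B"
 using has_sum_le_finite_sums[OF vnorm_S_sq[OF assms(1)], of "B\<^sup>2"] assms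
 by (auto intro: power2_le_imp_le)

text \<open>A Cauchy sequence converges in every component; the bounds on finite partial sums of squares pass to
 the limit, which gives convergence in norm.\<close>

lemma hilb_S: "hilb S"
proof
 fix v assume v: "v \<in> carrier S" and 0: "ip S v v = 0"
 show "v = \<zero>\<^bsub>S\<^esub>"
 proof (rule S_ext[OF v S_zero_closed])
  fix i assume i: "i \<in> I"
  interpret Vi: hilb "V i" using hilb_V[OF i] .
  have "vnorm (V i) (v i) \<le> 0"
   using S_comp_le[OF v i] 0 by (simp add: vnorm_def)
  then show "v i = \<zero>\<^bsub>S\<^esub> i"
   using Vi.vnorm_eq_0D[of "v i"] Vi.vnorm_nonneg[of "v i"] S_comp[OF v i] i by (simp add: S_simps)
 qed
next
 fix s :: "nat \<Rightarrow> 'i \<Rightarrow> 'v" assume s: "!!n. s n \<in> carrier S"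
  and C: "!!e. e > 0 ==> \<exists>N. \<forall>m\<ge>N. \<forall>n\<ge>N. ndist S (s m) (s n) < e"
 have comp_le: "ndist (V i) (s m i) (s n i) \<le> ndist S (s m) (s n)" if "i \<in> I" for i m n
  using S_comp_le[of "s m \<ominus>\<^bsub>S\<^esub> s n" i] s that by (simp add: S_minus)
 have "\<exists>v\<in>carrier (V i). (\<lambda>n. ndist (V i) (s n i) v) \<longlonglongrightarrow> 0" if i: "i \<in> I" for i
 proof (rule hilb.complete[OF hilb_V[OF i]])
  fix e :: real assume "e > 0"
  then show "\<exists>N. \<forall>m\<ge>N. \<forall>n\<ge>N. ndist (V i) (s m i) (s n i) < e"
   using C comp_le[OF i] by (meson le_less_trans)
 qed (use s S_comp i in auto)
 then obtain v0 where v0: "!!i. i \<in> I ==> v0 i \<in> carrier (V i)"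
  "!!i. i \<in> I ==> (\<lambda>n. ndist (V i) (s n i) (v0 i)) \<longlonglongrightarrow> 0" by metis
 define v where "v = (\<lambda>i\<in>I. v0 i)"
 have v: "v \<in> (\<Pi>\<^sub>E i\<in>I. carrier (V i))"
  "!!i. i \<in> I ==> (\<lambda>n. ndist (V i) (s n i) (v i)) \<longlonglongrightarrow> 0"
  using v0 by (auto simp: v_def)
 have bound: "(\<Sum>i\<in>J. (ndist (V i) (s m i) (v i))\<^sup>2) \<le> e\<^sup>2"
  if N: "\<forall>m\<ge>N. \<forall>n\<ge>N. ndist S (s m) (s n) < e" and m: "m \<ge> N" and J: "finite J" "J \<subseteq> I"
  for N m J e
 proof (rule LIMSEQ_le_const2)
  show "(\<lambda>n. \<Sum>i\<in>J. (ndist (V i) (s n i) (s m i))\<^sup>2)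
    \<longlonglongrightarrow> (\<Sum>i\<in>J. (ndist (V i) (s m i) (v i))\<^sup>2)"
  proof (intro tendsto_sum tendsto_power)
   fix i assume "i \<in> J"
   then have i: "i \<in> I" using J by blast
   interpret Vi: hilb "V i" using hilb_V[OF i] .
   have c: "s n i \<in> carrier (V i)" "v i \<in> carrier (V i)" for n
    using S_comp[OF s i] v(1) i by auto
   show "(\<lambda>n. ndist (V i) (s n i) (s m i)) \<longlonglongrightarrow> ndist (V i) (s m i) (v i)"
    using Vi.tendsto_vnorm_diff[OF c(1,2) v(2)[OF i] c(1)[of m]] Vi.vnorm_diff_commute[OF c(2) c(1)[of m]]
    by simp
  qed
  show "\<exists>N. \<forall>n\<ge>N. (\<Sum>i\<in>J. (ndist (V i) (s n i) (s m i))\<^sup>2) \<le> e\<^sup>2"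
  proof (intro exI allI impI)
   fix n assume n: "n \<ge> N"
   have "(\<Sum>i\<in>J. (ndist (V i) (s n i) (s m i))\<^sup>2) = (\<Sum>i\<in>J. (vnorm (V i) ((s n \<ominus>\<^bsub>S\<^esub> s m) i))\<^sup>2)"
    using J s by (intro sum.cong) (auto simp: S_minus)
   also have "\<dots> \<le> (ndist S (s n) (s m))\<^sup>2"
    using J s by (intro S_finite_le) auto
   also have "\<dots> \<le> e\<^sup>2"
    using N n m s S.vnorm_nonneg[of "s n \<ominus>\<^bsub>S\<^esub> s m"] by (intro power_mono) (auto intro: less_imp_le)
   finally show "(\<Sum>i\<in>J. (ndist (V i) (s n i) (s m i))\<^sup>2) \<le> e\<^sup>2" .
  qed
 qed
 obtain N1 where N1: "\<forall>m\<ge>N1. \<forall>n\<ge>N1. ndist S (s m) (s n) < 1" using C[of 1] by auto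
 define d where "d = (\<lambda>i\<in>I. s N1 i \<ominus>\<^bsub>V i\<^esub> v i)"
 have dPi: "d \<in> (\<Pi>\<^sub>E i\<in>I. carrier (V i))"
 proof -
  have "s N1 i \<ominus>\<^bsub>V i\<^esub> v i \<in> carrier (V i)" if i: "i \<in> I" for i
  proof -
   interpret Vi: hilb "V i" using hilb_V[OF i] .
   show ?thesis using S_comp[OF s i, of N1] v(1) i by auto
  qed
  then show ?thesis by (auto simp: d_def)
 qed
 have dS: "d \<in> carrier S"
 proof (rule S_memI[OF dPi])
  fix J assume J: "finite J" "J \<subseteq> I"
  have "(\<Sum>i\<in>J. (vnorm (V i) (d i))\<^sup>2) = (\<Sum>i\<in>J. (ndist (V i) (s N1 i) (v i))\<^sup>2)"
   using J by (intro sum.cong) (auto simp: d_def)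
  then show "(\<Sum>i\<in>J. (vnorm (V i) (d i))\<^sup>2) \<le> 1\<^sup>2"
   using bound[OF N1 order_refl J] by simp
 qed
 have vS: "v \<in> carrier S"
 proof -
  have "s N1 \<ominus>\<^bsub>S\<^esub> d = v"
  proof (rule PiE_ext)
   show "s N1 \<ominus>\<^bsub>S\<^esub> d \<in> (\<Pi>\<^sub>E i\<in>I. carrier (V i))"
    using S.minus_closed[OF s[of N1] dS] by (simp add: S_simps(1))
   fix i assume i: "i \<in> I"
   interpret Vi: hilb "V i" using hilb_V[OF i] .
   have c: "s N1 i \<in> carrier (V i)" "v i \<in> carrier (V i)" using S_comp[OF s i] v(1) i by auto
   have "s N1 i \<ominus>\<^bsub>V i\<^esub> (s N1 i \<ominus>\<^bsub>V i\<^esub> v i) = v i"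
    using c by (metis Vi.diff_add_cancel' Vi.diff_add_diff Vi.diff_self Vi.M.add.inv_solve_right'
      Vi.M.minus_closed Vi.M.r_zero Vi.M.a_comm a_minus_def)
   then show "(s N1 \<ominus>\<^bsub>S\<^esub> d) i = v i"
    using i s dS by (simp add: S_minus) (simp add: d_def)
  qed (rule v(1))
  then show ?thesis using S.minus_closed[OF s dS] by metis
 qed
 have "(\<lambda>n. ndist S (s n) v) \<longlonglongrightarrow> 0"
 proof (rule LIMSEQ_I)
  fix e :: real assume "e > 0"
  then obtain N where N: "\<forall>m\<ge>N. \<forall>n\<ge>N. ndist S (s m) (s n) < e / 2"
   using C[of "e / 2"] by auto
  have "ndist S (s m) v \<le> e / 2" if "m \<ge> N" for m
  proof (rule S_vnorm_le)
   fix J assume J: "finite J" "J \<subseteq> I"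
   have "(\<Sum>i\<in>J. (vnorm (V i) ((s m \<ominus>\<^bsub>S\<^esub> v) i))\<^sup>2) = (\<Sum>i\<in>J. (ndist (V i) (s m i) (v i))\<^sup>2)"
    using J s vS by (intro sum.cong) (auto simp: S_minus)
   then show "(\<Sum>i\<in>J. (vnorm (V i) ((s m \<ominus>\<^bsub>S\<^esub> v) i))\<^sup>2) \<le> (e / 2)\<^sup>2"
    using bound[OF N that J] by simp
  qed (use s vS \<open>e > 0\<close> in auto)
  then show "\<exists>N. \<forall>n\<ge>N. norm (ndist S (s n) v - 0) < e"
   using \<open>e > 0\<close> s vS S.vnorm_nonneg by (intro exI[of _ N]) (force simp: )
 qed
 then show "\<exists>v\<in>carrier S. (\<lambda>n. ndist S (s n) v) \<longlonglongrightarrow> 0" using vS by blast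
qed

end

section \<open>Continuous fields of Hilbert spaces\<close>

lemma continuous_map_metric_iff:
 fixes f :: "'a \<Rightarrow> 'b::metric_space"
 shows "continuous_map X euclidean f \<longleftrightarrow>
  (\<forall>x\<in>topspace X. \<forall>e>0. \<exists>U. openin X U \<and> x \<in> U \<and> (\<forall>w\<in>U. dist (f w) (f x) < e))"
 using Met_TC.continuous_map_to_metric[of X f]
 by (simp add: Met_TC.mball_def mtopology_is_euclidean dist_commute)

lemma continuous_map_local_approx:
 fixes f :: "'a \<Rightarrow> 'b::metric_space"
 assumes "!!x e. x \<in> topspace X ==> e > 0 ==> \<exists>U g. openin X U \<and> x \<in> U \<and>
  continuous_map X euclidean g \<and> (\<forall>w\<in>U. dist (f w) (g w) < e)"
 shows "continuous_map X euclidean f"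
 unfolding continuous_map_metric_iff
proof (intro ballI allI impI)
 fix x and e :: real assume x: "x \<in> topspace X" and "e > 0"
 then obtain U g where U: "openin X U" "x \<in> U" "continuous_map X euclidean g"
  "\<forall>w\<in>U. dist (f w) (g w) < e / 3"
  using assms[of x "e / 3"] by auto
 obtain U' where U': "openin X U'" "x \<in> U'" "\<forall>w\<in>U'. dist (g w) (g x) < e / 3"
  using U(3)[unfolded continuous_map_metric_iff, rule_format, OF x, of "e / 3"] \<open>e > 0\<close> by auto
 have "dist (f w) (f x) < e" if "w \<in> U \<inter> U'" for w
 proof -
  have "dist (f w) (f x) \<le> dist (f w) (g w) + dist (g w) (g x) + dist (f x) (g x)"
   by metric
  moreover have "dist (f w) (g w) < e / 3" "dist (f x) (g x) < e / 3" "dist (g w) (g x) < e / 3"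
   using U(2,4) U'(3) that by auto
  ultimately show ?thesis by linarith
 qed
 then show "\<exists>U. openin X U \<and> x \<in> U \<and> (\<forall>w\<in>U. dist (f w) (f x) < e)"
  using U U' by (intro exI[of _ "U \<inter> U'"]) auto
qed

lemma continuous_map_less_nbhd:
 assumes "continuous_map X euclideanreal f" "x \<in> topspace X" "f x < c"
 obtains U where "openin X U" "x \<in> U" "!!w. w \<in> U ==> f w < c"
proof
 show "openin X {w \<in> topspace X. f w \<in> {..<c}}"
  using assms(1) by (rule openin_continuous_map_preimage) simp
qed (use assms in auto)

lemma continuous_map_gt_nbhd:
 assumes "continuous_map X euclideanreal f" "x \<in> topspace X" "c < f x"
 obtains U where "openin X U" "x \<in> U" "!!w. w \<in> U ==> c < f w"
proof
 show "openin X {w \<in> topspace X. f w \<in> {c<..}}"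
  using assms(1) by (rule openin_continuous_map_preimage) simp
qed (use assms in auto)

lemma continuous_map_ceuclid [continuous_intros]:
 fixes f g :: "'a \<Rightarrow> complex"
 assumes "continuous_map X euclidean f" "continuous_map X euclidean g"
 shows "continuous_map X euclidean (\<lambda>x. f x * g x)" "continuous_map X euclidean (\<lambda>x. f x + g x)"
  "continuous_map X euclidean (\<lambda>x. cnj (f x))" "continuous_map X euclidean (\<lambda>x. Re (f x))"
  "continuous_map X euclidean (\<lambda>x. Im (f x))" "continuous_map X euclidean (\<lambda>x. cmod (f x))"
 using assms unfolding continuous_map_atin by (auto intro: tendsto_intros)

lemma continuous_map_of_real:
 "continuous_map X euclideanreal f ==> continuous_map X euclidean (\<lambda>x. complex_of_real (f x))"
 unfolding continuous_map_atin by (auto intro: tendsto_intros)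

text \<open>A family of Hilbert spaces with a space of sections that satisfies all axioms of a continuous field
 but closedness under locally uniform approximation.\<close>

locale pre_hbun =
 fixes X :: "'b topology" and E :: "('b, 'v) hbundle"
 assumes hilb_fib: "u \<in> topspace X ==> hilb (fib E u)"
  and gam_all: "\<xi> \<in> gam E ==> \<xi> \<in> all_sections X (fib E)"
  and gam_zero: "(\<lambda>u\<in>topspace X. \<zero>\<^bsub>fib E u\<^esub>) \<in> gam E"
  and gam_add: "\<xi> \<in> gam E ==> \<eta> \<in> gam E ==> (\<lambda>u\<in>topspace X. \<xi> u \<oplus>\<^bsub>fib E u\<^esub> \<eta> u) \<in> gam E"
  and gam_smult: "\<xi> \<in> gam E ==> (\<lambda>u\<in>topspace X. c \<odot>\<^bsub>fib E u\<^esub> \<xi> u) \<in> gam E"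
  and gam_dense: "u \<in> topspace X ==> h \<in> carrier (fib E u) ==> e > 0 ==>
   \<exists>\<xi>\<in>gam E. ndist (fib E u) h (\<xi> u) < e"
  and gam_norm_continuous: "\<xi> \<in> gam E ==> continuous_map X euclidean (\<lambda>u. vnorm (fib E u) (\<xi> u))"
begin

lemma semi_fib: "u \<in> topspace X ==> semi_inner (fib E u)"
 using hilb_fib hilb.axioms(1) by blast

lemma gam_carrier: "\<xi> \<in> gam E ==> u \<in> topspace X ==> \<xi> u \<in> carrier (fib E u)"
 using gam_all by (fastforce simp: all_sections_def)

lemma gam_diff:
 assumes "\<xi> \<in> gam E" "\<eta> \<in> gam E"
 shows "(\<lambda>u\<in>topspace X. \<xi> u \<ominus>\<^bsub>fib E u\<^esub> \<eta> u) \<in> gam E"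
proof -
 have "(\<lambda>u\<in>topspace X. \<xi> u \<ominus>\<^bsub>fib E u\<^esub> \<eta> u)
   = (\<lambda>u\<in>topspace X. \<xi> u \<oplus>\<^bsub>fib E u\<^esub> (\<lambda>u\<in>topspace X. (-1) \<odot>\<^bsub>fib E u\<^esub> \<eta> u) u)"
  by (rule restrict_ext)
   (simp add: a_minus_def semi_inner.minus_one_smult[OF semi_fib] gam_carrier[OF assms(2)])
 then show ?thesis using gam_add[OF assms(1) gam_smult[OF assms(2), of "-1"]] by simp
qed

lemma gam_norm_diff_continuous:
 assumes "\<xi> \<in> gam E" "\<eta> \<in> gam E"
 shows "continuous_map X euclidean (\<lambda>u. ndist (fib E u) (\<xi> u) (\<eta> u))"
 using gam_norm_continuous[OF gam_diff[OF assms]]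
 by (rule continuous_map_eq) simp

end

text \<open>Continuous sections along a map \<open>p\<close>, that is of the pullback of the bundle along \<open>p\<close>,
 described by local approximation instead of by the topology of the total space.\<close>

definition cont_field ::
 "'b topology \<Rightarrow> ('b, 'v) hbundle \<Rightarrow> 'y topology \<Rightarrow> ('y \<Rightarrow> 'b) \<Rightarrow> ('y \<Rightarrow> 'v) \<Rightarrow> bool" where
 "cont_field X E Y p s \<longleftrightarrow>
   continuous_map Y X p \<and> (\<forall>y\<in>topspace Y. s y \<in> carrier (fib E (p y))) \<and>
   (\<forall>y\<in>topspace Y. \<forall>e>0. \<exists>U \<xi>. openin Y U \<and> y \<in> U \<and> \<xi> \<in> gam E \<and>
    (\<forall>w\<in>U. ndist (fib E (p w)) (s w) (\<xi> (p w)) < e))"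

context pre_hbun
begin

abbreviation basic_nbhd where
 "basic_nbhd U e \<xi> \<equiv> {(u, h). u \<in> U \<and> h \<in> carrier (fib E u) \<and> ndist (fib E u) h (\<xi> u) < e}"

lemma continuous_map_total_iff:
 "continuous_map Y (total_top X E) f \<longleftrightarrow>
  (\<forall>U e \<xi>. openin X U \<and> e > 0 \<and> \<xi> \<in> gam E --> openin Y (f -` basic_nbhd U e \<xi> \<inter> topspace Y)) \<and>
  (\<forall>y\<in>topspace Y. fst (f y) \<in> topspace X \<and> snd (f y) \<in> carrier (fib E (fst (f y))))"
proof -
 have "f ` topspace Y \<subseteq> \<Union>{basic_nbhd U e \<xi> | U e \<xi>. openin X U \<and> e > 0 \<and> \<xi> \<in> gam E} \<longleftrightarrow>
  (\<forall>y\<in>topspace Y. fst (f y) \<in> topspace X \<and> snd (f y) \<in> carrier (fib E (fst (f y))))" (is "?l \<longleftrightarrow> ?r")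
 proof
  assume l: ?l
  show ?r
  proof
   fix y assume "y \<in> topspace Y"
   then have "f y \<in> \<Union>{basic_nbhd U e \<xi> | U e \<xi>. openin X U \<and> e > 0 \<and> \<xi> \<in> gam E}"
    by (intro subsetD[OF l] imageI)
   then obtain B where "B \<in> {basic_nbhd U e \<xi> | U e \<xi>. openin X U \<and> e > 0 \<and> \<xi> \<in> gam E}" "f y \<in> B"
    by (rule UnionE)
   moreover from this obtain U e \<xi> where "openin X U" "B = basic_nbhd U e \<xi>" by blast
   ultimately have "openin X U" "f y \<in> basic_nbhd U e \<xi>" by simp_all
   then show "fst (f y) \<in> topspace X \<and> snd (f y) \<in> carrier (fib E (fst (f y)))"
    using openin_subset by fastforce
  qed
 next
  assume r: ?r
  show ?l
  proof
   fix z assume "z \<in> f ` topspace Y"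
   then have z: "fst z \<in> topspace X" "snd z \<in> carrier (fib E (fst z))" using r by auto
   obtain \<xi> where "\<xi> \<in> gam E" "ndist (fib E (fst z)) (snd z) (\<xi> (fst z)) < 1"
    using gam_dense[OF z, of 1] by auto
   then have "z \<in> basic_nbhd (topspace X) 1 \<xi>" using z by (auto simp: case_prod_beta)
   then show "z \<in> \<Union>{basic_nbhd U e \<xi> | U e \<xi>. openin X U \<and> e > 0 \<and> \<xi> \<in> gam E}"
    using \<open>\<xi> \<in> gam E\<close> zero_less_one openin_topspace by blast
  qed
 qed
 then show ?thesis
  unfolding total_top_def continuous_on_generated_topo_iff by blast
qed

lemma openin_basic_nbhd:
 assumes "openin X U" "e > 0" "\<xi> \<in> gam E"
 shows "openin (total_top X E) (basic_nbhd U e \<xi>)"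
 unfolding total_top_def using assms by (intro topology_generated_by_Basis) blast

lemma continuous_map_total_iff_cont_field:
 "continuous_map Y (total_top X E) (\<lambda>y. (p y, s y)) \<longleftrightarrow> cont_field X E Y p s"
proof
 assume c: "continuous_map Y (total_top X E) (\<lambda>y. (p y, s y))"
 then have ps: "p y \<in> topspace X" "s y \<in> carrier (fib E (p y))" if "y \<in> topspace Y" for y
  using that by (auto simp: continuous_map_total_iff)
 have op: "openin Y {y \<in> topspace Y. p y \<in> U \<and> ndist (fib E (p y)) (s y) (\<xi> (p y)) < e}"
  if "openin X U" "e > 0" "\<xi> \<in> gam E" for U e \<xi>
 proof -
  have "{y \<in> topspace Y. p y \<in> U \<and> ndist (fib E (p y)) (s y) (\<xi> (p y)) < e}
   = (\<lambda>y. (p y, s y)) -` basic_nbhd U e \<xi> \<inter> topspace Y" using ps by auto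
  then show ?thesis using c that by (simp add: continuous_map_total_iff)
 qed
 have "continuous_map Y X p"
  unfolding continuous_map_def
 proof (intro conjI allI impI)
  fix U assume U: "openin X U"
  show "openin Y {x \<in> topspace Y. p x \<in> U}"
   unfolding openin_subopen[of Y "{x \<in> topspace Y. p x \<in> U}"]
  proof
   fix y assume y: "y \<in> {x \<in> topspace Y. p x \<in> U}"
   obtain \<xi> where \<xi>: "\<xi> \<in> gam E" "ndist (fib E (p y)) (s y) (\<xi> (p y)) < 1"
    using gam_dense[of "p y" "s y" 1] ps y by auto
   show "\<exists>T. openin Y T \<and> y \<in> T \<and> T \<subseteq> {x \<in> topspace Y. p x \<in> U}"
    using op[OF U _ \<xi>(1), of 1] \<xi> y by (intro exI conjI) auto
  qed
 qed (use ps in auto)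
 moreover have "\<exists>U \<xi>. openin Y U \<and> y \<in> U \<and> \<xi> \<in> gam E \<and>
    (\<forall>w\<in>U. ndist (fib E (p w)) (s w) (\<xi> (p w)) < e)"
  if y: "y \<in> topspace Y" and e: "e > 0" for y e
 proof -
  obtain \<xi> where \<xi>: "\<xi> \<in> gam E" "ndist (fib E (p y)) (s y) (\<xi> (p y)) < e"
   using gam_dense[of "p y" "s y" e] ps y e by auto
  show ?thesis using op[OF openin_topspace e \<xi>(1)] ps y \<xi>
   by (intro exI[of _ "{y \<in> topspace Y. p y \<in> topspace X \<and>
     ndist (fib E (p y)) (s y) (\<xi> (p y)) < e}"] exI[of _ \<xi>]) simp
 qed
 ultimately show "cont_field X E Y p s" using ps by (simp add: cont_field_def)
next
 assume cf: "cont_field X E Y p s"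
 then have p: "continuous_map Y X p" and s: "!!y. y \<in> topspace Y ==> s y \<in> carrier (fib E (p y))"
  by (auto simp: cont_field_def)
 have pX: "y \<in> topspace Y ==> p y \<in> topspace X" for y using p by (auto simp: continuous_map_def)
 have "openin Y ((\<lambda>y. (p y, s y)) -` basic_nbhd U e \<xi> \<inter> topspace Y)"
  if U: "openin X U" "e > 0" "\<xi> \<in> gam E" for U e \<xi>
  unfolding openin_subopen[of Y "(\<lambda>y. (p y, s y)) -` basic_nbhd U e \<xi> \<inter> topspace Y"]
 proof
  fix y assume y: "y \<in> (\<lambda>y. (p y, s y)) -` basic_nbhd U e \<xi> \<inter> topspace Y"
  then have yY: "y \<in> topspace Y" and pyU: "p y \<in> U"
   and lt: "ndist (fib E (p y)) (s y) (\<xi> (p y)) < e" by auto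
  define \<delta> where "\<delta> = (e - ndist (fib E (p y)) (s y) (\<xi> (p y))) / 3"
  have d: "\<delta> > 0" using lt by (simp add: \<delta>_def)
  obtain N \<eta> where N: "openin Y N" "y \<in> N" "\<eta> \<in> gam E"
   "\<forall>w\<in>N. ndist (fib E (p w)) (s w) (\<eta> (p w)) < \<delta>"
   using cf yY d unfolding cont_field_def by meson
  have cY: "continuous_map Y euclideanreal (\<lambda>w. ndist (fib E (p w)) (\<eta> (p w)) (\<xi> (p w)))"
   using continuous_map_compose[OF p gam_norm_diff_continuous[OF N(3) U(3)]] by (simp add: o_def)
  interpret Vy: hilb "fib E (p y)" using hilb_fib pX yY by blast
  have "ndist (fib E (p y)) (\<eta> (p y)) (\<xi> (p y)) < e - \<delta>"
  proof -
   have "ndist (fib E (p y)) (\<eta> (p y)) (s y) < \<delta>"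
    using N(2,4) Vy.vnorm_diff_commute[OF s[OF yY] gam_carrier[OF N(3) pX[OF yY]]] by auto
   then have "ndist (fib E (p y)) (\<eta> (p y)) (\<xi> (p y))
     < \<delta> + ndist (fib E (p y)) (s y) (\<xi> (p y))"
    using Vy.vnorm_diff_triangle[OF gam_carrier[OF N(3) pX[OF yY]] s[OF yY] gam_carrier[OF U(3) pX[OF yY]]]
    by linarith
   also have "\<dots> \<le> e - \<delta>" using lt by (simp add: \<delta>_def field_simps)
   finally show ?thesis .
  qed
  then obtain N' where N': "openin Y N'" "y \<in> N'"
   "!!w. w \<in> N' ==> ndist (fib E (p w)) (\<eta> (p w)) (\<xi> (p w)) < e - \<delta>"
   using continuous_map_less_nbhd[OF cY yY] by metis
  let ?T = "N \<inter> N' \<inter> {w \<in> topspace Y. p w \<in> U}"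
  have "ndist (fib E (p w)) (s w) (\<xi> (p w)) < e" if w: "w \<in> ?T" for w
  proof -
   have wY: "w \<in> topspace Y" using w by blast
   interpret Vw: hilb "fib E (p w)" using hilb_fib pX wY by blast
   show ?thesis
    using Vw.vnorm_diff_triangle[OF s[OF wY] gam_carrier[OF N(3) pX[OF wY]] gam_carrier[OF U(3) pX[OF wY]]]
     N(4) N'(3)[of w] w by force
  qed
  moreover have "openin Y ?T"
   using N N' openin_continuous_map_preimage[OF p U(1)] by blast
  ultimately show "\<exists>T. openin Y T \<and> y \<in> T \<and> T \<subseteq> (\<lambda>y. (p y, s y)) -` basic_nbhd U e \<xi> \<inter> topspace Y"
   using N N' yY pyU s by (intro exI[of _ ?T]) auto
 qed
 then show "continuous_map Y (total_top X E) (\<lambda>y. (p y, s y))"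
  using pX s by (simp add: continuous_map_total_iff)
qed

lemma cont_fieldD:
 assumes "cont_field X E Y p s"
 shows "continuous_map Y X p" "y \<in> topspace Y ==> s y \<in> carrier (fib E (p y))"
  "y \<in> topspace Y ==> p y \<in> topspace X"
 using assms by (auto simp: cont_field_def continuous_map_def)

lemma cont_field_approx:
 assumes "cont_field X E Y p s" "y \<in> topspace Y" "e > 0"
 obtains U \<xi> where "openin Y U" "y \<in> U" "\<xi> \<in> gam E"
  "!!w. w \<in> U ==> ndist (fib E (p w)) (s w) (\<xi> (p w)) < e"
 using assms unfolding cont_field_def by meson

lemma cont_field_local_limit:
 assumes p: "continuous_map Y X p" and s: "!!y. y \<in> topspace Y ==> s y \<in> carrier (fib E (p y))"
  and appr: "!!y e. y \<in> topspace Y ==> e > 0 ==> \<exists>U t. openin Y U \<and> y \<in> U \<and> cont_field X E Y p t \<and>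
   (\<forall>w\<in>U. ndist (fib E (p w)) (s w) (t w) < e)"
 shows "cont_field X E Y p s"
 unfolding cont_field_def
proof (intro conjI ballI allI impI p s)
 fix y and e :: real assume y: "y \<in> topspace Y" and "e > 0"
 then obtain U t where U: "openin Y U" "y \<in> U" "cont_field X E Y p t"
   "\<forall>w\<in>U. ndist (fib E (p w)) (s w) (t w) < e / 2"
  using appr[of y "e / 2"] by auto
 obtain U' \<xi> where U': "openin Y U'" "y \<in> U'" "\<xi> \<in> gam E"
   "!!w. w \<in> U' ==> ndist (fib E (p w)) (t w) (\<xi> (p w)) < e / 2"
  using cont_field_approx[OF U(3) y, of "e / 2"] \<open>e > 0\<close> by auto
 have "ndist (fib E (p w)) (s w) (\<xi> (p w)) < e" if w: "w \<in> U \<inter> U'" for w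
 proof -
  have wY: "w \<in> topspace Y" using w U(1) openin_subset by blast
  have pw: "p w \<in> topspace X" using p wY by (auto simp: continuous_map_def)
  interpret Vw: hilb "fib E (p w)" using hilb_fib pw .
  show ?thesis
   using Vw.vnorm_diff_triangle[OF s[OF wY] cont_fieldD(2)[OF U(3) wY] gam_carrier[OF U'(3) pw]]
    U(4) U'(4)[of w] w by force
 qed
 then show "\<exists>U \<xi>. openin Y U \<and> y \<in> U \<and> \<xi> \<in> gam E \<and>
   (\<forall>w\<in>U. ndist (fib E (p w)) (s w) (\<xi> (p w)) < e)"
  using U U' by (intro exI[of _ "U \<inter> U'"] exI[of _ \<xi>]) auto
qed

lemma cont_field_gam:
 assumes "continuous_map Y X p" "\<xi> \<in> gam E"
 shows "cont_field X E Y p (\<lambda>y. \<xi> (p y))"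
 unfolding cont_field_def
proof (intro conjI ballI allI impI assms(1))
 have pX: "y \<in> topspace Y ==> p y \<in> topspace X" for y using assms(1) by (auto simp: continuous_map_def)
 show "\<xi> (p y) \<in> carrier (fib E (p y))" if "y \<in> topspace Y" for y
  using gam_carrier[OF assms(2)] pX that by blast
 fix y and e :: real assume y: "y \<in> topspace Y" and "e > 0"
 have "ndist (fib E (p w)) (\<xi> (p w)) (\<xi> (p w)) = 0" if "w \<in> topspace Y" for w
 proof -
  interpret Vw: hilb "fib E (p w)" using hilb_fib pX that by blast
  show ?thesis using gam_carrier[OF assms(2) pX[OF that]] by simp
 qed
 then show "\<exists>U \<xi>'. openin Y U \<and> y \<in> U \<and> \<xi>' \<in> gam E \<and>
   (\<forall>w\<in>U. ndist (fib E (p w)) (\<xi> (p w)) (\<xi>' (p w)) < e)"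
  using assms(2) y \<open>e > 0\<close> by (intro exI[of _ "topspace Y"] exI[of _ \<xi>]) auto
qed

lemma cont_field_cong:
 assumes "cont_field X E Y p s" "!!y. y \<in> topspace Y ==> s y = t y"
 shows "cont_field X E Y p t"
proof (rule cont_field_local_limit[OF cont_fieldD(1)[OF assms(1)]])
 fix y assume y: "y \<in> topspace Y"
 show "t y \<in> carrier (fib E (p y))" using assms y cont_fieldD(2)[OF assms(1) y] by simp
next
 fix y and e :: real assume y: "y \<in> topspace Y" and e: "e > 0"
 have "ndist (fib E (p w)) (t w) (s w) = 0" if "w \<in> topspace Y" for w
 proof -
  interpret Vw: hilb "fib E (p w)" using hilb_fib cont_fieldD(3)[OF assms(1) that] by blast
  show ?thesis using cont_fieldD(2)[OF assms(1) that] assms(2)[OF that] by simp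
 qed
 then show "\<exists>U t'. openin Y U \<and> y \<in> U \<and> cont_field X E Y p t' \<and>
   (\<forall>w\<in>U. ndist (fib E (p w)) (t w) (t' w) < e)"
  using assms(1) y e by (intro exI[of _ "topspace Y"] exI[of _ s]) auto
qed

lemma cont_field_add:
 assumes "cont_field X E Y p s" "cont_field X E Y p t"
 shows "cont_field X E Y p (\<lambda>y. s y \<oplus>\<^bsub>fib E (p y)\<^esub> t y)"
 unfolding cont_field_def
proof (intro conjI ballI allI impI)
 note s = cont_fieldD[OF assms(1)] and t = cont_fieldD[OF assms(2)]
 show "continuous_map Y X p" by (rule s)
 show "s y \<oplus>\<^bsub>fib E (p y)\<^esub> t y \<in> carrier (fib E (p y))" if "y \<in> topspace Y" for y
 proof -
  interpret Vw: hilb "fib E (p y)" using hilb_fib s(3) that by blast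
  show ?thesis using s t that by simp
 qed
 fix y and e :: real assume y: "y \<in> topspace Y" and e: "e > 0"
 obtain U \<xi> where U: "openin Y U" "y \<in> U" "\<xi> \<in> gam E"
   "!!w. w \<in> U ==> ndist (fib E (p w)) (s w) (\<xi> (p w)) < e / 2"
  using cont_field_approx[OF assms(1) y, of "e / 2"] e by auto
 obtain U' \<xi>' where U': "openin Y U'" "y \<in> U'" "\<xi>' \<in> gam E"
   "!!w. w \<in> U' ==> ndist (fib E (p w)) (t w) (\<xi>' (p w)) < e / 2"
  using cont_field_approx[OF assms(2) y, of "e / 2"] e by auto
 let ?z = "\<lambda>u\<in>topspace X. \<xi> u \<oplus>\<^bsub>fib E u\<^esub> \<xi>' u"
 have "ndist (fib E (p w)) (s w \<oplus>\<^bsub>fib E (p w)\<^esub> t w) (?z (p w)) < e"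
  if w: "w \<in> U \<inter> U'" for w
 proof -
  have wY: "w \<in> topspace Y" using w U(1) openin_subset by blast
  interpret Vw: hilb "fib E (p w)" using hilb_fib s(3) wY by blast
  have c: "s w \<in> carrier (fib E (p w))" "t w \<in> carrier (fib E (p w))"
   "\<xi> (p w) \<in> carrier (fib E (p w))" "\<xi>' (p w) \<in> carrier (fib E (p w))"
   using s(2,3) t(2) wY gam_carrier U(3) U'(3) by auto
  have "ndist (fib E (p w)) (s w \<oplus>\<^bsub>fib E (p w)\<^esub> t w) (?z (p w))
   \<le> ndist (fib E (p w)) (s w) (\<xi> (p w)) + ndist (fib E (p w)) (t w) (\<xi>' (p w))"
   using c s(3)[OF wY] by (simp add: Vw.diff_diff_diff Vw.vnorm_triangle)
  then show ?thesis using U(4)[of w] U'(4)[of w] w by simp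
 qed
 then show "\<exists>U \<xi>. openin Y U \<and> y \<in> U \<and> \<xi> \<in> gam E \<and>
   (\<forall>w\<in>U. ndist (fib E (p w)) (s w \<oplus>\<^bsub>fib E (p w)\<^esub> t w) (\<xi> (p w)) < e)"
  using U U' gam_add by (intro exI[of _ "U \<inter> U'"] exI[of _ ?z]) auto
qed

lemma cont_field_norm:
 assumes "cont_field X E Y p s"
 shows "continuous_map Y euclideanreal (\<lambda>y. vnorm (fib E (p y)) (s y))"
proof (rule continuous_map_local_approx)
 note s = cont_fieldD[OF assms]
 fix y and e :: real assume y: "y \<in> topspace Y" and e: "e > 0"
 obtain U \<xi> where U: "openin Y U" "y \<in> U" "\<xi> \<in> gam E"
   "!!w. w \<in> U ==> ndist (fib E (p w)) (s w) (\<xi> (p w)) < e"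
  using cont_field_approx[OF assms y e] by auto
 have "dist (vnorm (fib E (p w)) (s w)) (vnorm (fib E (p w)) (\<xi> (p w))) < e" if w: "w \<in> U" for w
 proof -
  have wY: "w \<in> topspace Y" using w U(1) openin_subset by blast
  interpret Vw: hilb "fib E (p w)" using hilb_fib s(3) wY by blast
  show ?thesis
   using Vw.abs_vnorm_diff[OF s(2)[OF wY] gam_carrier[OF U(3) s(3)[OF wY]]] U(4)[OF w]
   by (simp add: dist_real_def)
 qed
 moreover have "continuous_map Y euclideanreal (\<lambda>w. vnorm (fib E (p w)) (\<xi> (p w)))"
  using continuous_map_compose[OF s(1) gam_norm_continuous[OF U(3)]] by (simp add: o_def)
 ultimately show "\<exists>U g. openin Y U \<and> y \<in> U \<and> continuous_map Y euclidean g \<and>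
   (\<forall>w\<in>U. dist (vnorm (fib E (p w)) (s w)) (g w) < e)"
  using U by (intro exI[of _ U] exI[of _ "\<lambda>w. vnorm (fib E (p w)) (\<xi> (p w))"]) auto
qed

lemma cont_field_smult:
 assumes s: "cont_field X E Y p s" and c: "continuous_map Y euclidean c"
 shows "cont_field X E Y p (\<lambda>y. c y \<odot>\<^bsub>fib E (p y)\<^esub> s y)"
proof -
 note sD = cont_fieldD[OF s]
 have cc: "a \<odot>\<^bsub>fib E (p y)\<^esub> s y \<in> carrier (fib E (p y))" if "y \<in> topspace Y" for a y
  using semi_inner.smultC[OF semi_fib[OF sD(3)[OF that]] sD(2)[OF that]] .
 have const: "cont_field X E Y p (\<lambda>y. a \<odot>\<^bsub>fib E (p y)\<^esub> s y)" for a
  unfolding cont_field_def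
 proof (intro conjI ballI allI impI sD(1) cc)
  fix y and e :: real assume y: "y \<in> topspace Y" and e: "e > 0"
  have a1: "cmod a + 1 > 0" using norm_ge_zero[of a] by linarith
  obtain U \<xi> where U: "openin Y U" "y \<in> U" "\<xi> \<in> gam E"
   "!!w. w \<in> U ==> ndist (fib E (p w)) (s w) (\<xi> (p w)) < e / (cmod a + 1)"
   using cont_field_approx[OF s y, of "e / (cmod a + 1)"] e a1 by auto
  have "ndist (fib E (p w)) (a \<odot>\<^bsub>fib E (p w)\<^esub> s w) ((\<lambda>u\<in>topspace X. a \<odot>\<^bsub>fib E u\<^esub> \<xi> u) (p w)) < e"
   if w: "w \<in> U" for w
  proof -
   have wY: "w \<in> topspace Y" using w U(1) openin_subset by blast
   interpret Vw: hilb "fib E (p w)" using hilb_fib sD(3) wY by blast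
   have "cmod a * ndist (fib E (p w)) (s w) (\<xi> (p w)) \<le> cmod a * (e / (cmod a + 1))"
    using U(4)[OF w] by (intro mult_left_mono) auto
   also have "\<dots> < e" using a1 e by (simp add: divide_less_eq algebra_simps)
   finally show ?thesis
    using sD(2,3)[OF wY] gam_carrier[OF U(3)] by (simp add: Vw.vnorm_smult flip: Vw.smult_minus_right)
  qed
  then show "\<exists>U \<xi>. openin Y U \<and> y \<in> U \<and> \<xi> \<in> gam E \<and>
    (\<forall>w\<in>U. ndist (fib E (p w)) (a \<odot>\<^bsub>fib E (p w)\<^esub> s w) (\<xi> (p w)) < e)"
   using U(1,2) gam_smult[OF U(3), of a] by blast
 qed
 show ?thesis
 proof (rule cont_field_local_limit[OF sD(1) cc])
  fix y and e :: real assume y: "y \<in> topspace Y" and e: "e > 0"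
  have "continuous_map Y euclidean (\<lambda>w. c w - c y)" by (intro continuous_map_diff c) simp
  then have "continuous_map Y euclideanreal (\<lambda>w. cmod (c w - c y) * vnorm (fib E (p w)) (s w))"
   by (intro continuous_map_real_mult continuous_map_ceuclid(6) cont_field_norm[OF s])
  then obtain U where U: "openin Y U" "y \<in> U" "!!w. w \<in> U ==> cmod (c w - c y) * vnorm (fib E (p w)) (s w) < e"
   by (rule continuous_map_less_nbhd[OF _ y, of _ e]) (use e in auto)
  have "ndist (fib E (p w)) (c w \<odot>\<^bsub>fib E (p w)\<^esub> s w) (c y \<odot>\<^bsub>fib E (p w)\<^esub> s w) < e" if w: "w \<in> U" for w
  proof -
   have wY: "w \<in> topspace Y" using w U(1) openin_subset by blast
   interpret Vw: hilb "fib E (p w)" using hilb_fib sD(3) wY by blast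
   have "(- c y) \<odot>\<^bsub>fib E (p w)\<^esub> s w = \<ominus>\<^bsub>fib E (p w)\<^esub> (c y \<odot>\<^bsub>fib E (p w)\<^esub> s w)"
    using Vw.smult_assoc1[of "-1" "c y" "s w"] sD(2)[OF wY] by (simp add: Vw.minus_one_smult)
   then have "c w \<odot>\<^bsub>fib E (p w)\<^esub> s w \<ominus>\<^bsub>fib E (p w)\<^esub> c y \<odot>\<^bsub>fib E (p w)\<^esub> s w = (c w - c y) \<odot>\<^bsub>fib E (p w)\<^esub> s w"
    using Vw.smult_l_distr[of "c w" "- c y" "s w"] sD(2)[OF wY] by (simp add: a_minus_def)
   then show ?thesis using U(3)[OF w] sD(2)[OF wY] by (simp add: Vw.vnorm_smult)
  qed
  then show "\<exists>U t. openin Y U \<and> y \<in> U \<and> cont_field X E Y p t \<and>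
    (\<forall>w\<in>U. ndist (fib E (p w)) (c w \<odot>\<^bsub>fib E (p w)\<^esub> s w) (t w) < e)"
   using U(1,2) const[of "c y"] by blast
 qed
qed

lemma cont_field_diff:
 assumes "cont_field X E Y p s" "cont_field X E Y p t"
 shows "cont_field X E Y p (\<lambda>y. s y \<ominus>\<^bsub>fib E (p y)\<^esub> t y)"
proof (rule cont_field_cong)
 show "cont_field X E Y p (\<lambda>y. s y \<oplus>\<^bsub>fib E (p y)\<^esub> (-1) \<odot>\<^bsub>fib E (p y)\<^esub> t y)"
  using assms by (intro cont_field_add cont_field_smult) auto
 fix y assume y: "y \<in> topspace Y"
 show "s y \<oplus>\<^bsub>fib E (p y)\<^esub> (-1) \<odot>\<^bsub>fib E (p y)\<^esub> t y = s y \<ominus>\<^bsub>fib E (p y)\<^esub> t y"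
  using semi_inner.minus_one_smult[OF semi_fib[OF cont_fieldD(3)[OF assms(2) y]] cont_fieldD(2)[OF assms(2) y]]
  by (simp add: a_minus_def)
qed

text \<open>Continuity of inner products follows from that of norms by polarization.\<close>

lemma cont_field_ip:
 assumes "cont_field X E Y p s" "cont_field X E Y p t"
 shows "continuous_map Y euclidean (\<lambda>y. ip (fib E (p y)) (s y) (t y))"
proof -
 let ?n = "\<lambda>s y. vnorm (fib E (p y)) (s y)"
 let ?it = "\<lambda>y. \<i> \<odot>\<^bsub>fib E (p y)\<^esub> t y"
 define re where "re = (\<lambda>t y. ((?n s y)\<^sup>2 + (?n t y)\<^sup>2 - (?n (\<lambda>y. s y \<ominus>\<^bsub>fib E (p y)\<^esub> t y) y)\<^sup>2) / 2)"
 have it: "cont_field X E Y p ?it" using assms by (intro cont_field_smult) auto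
 have re: "re t y = Re (ip (fib E (p y)) (s y) (t y))"
  if "y \<in> topspace Y" "cont_field X E Y p t" for y t
  using semi_inner.vnorm_diff_sq[OF semi_fib[OF cont_fieldD(3)[OF that(2,1)]] cont_fieldD(2)[OF assms(1) that(1)]
    cont_fieldD(2)[OF that(2,1)]] by (simp add: re_def)
 have c: "continuous_map Y euclideanreal (re t)" if "cont_field X E Y p t" for t
  unfolding re_def
  using cont_field_norm[OF assms(1)] cont_field_norm[OF that] cont_field_norm[OF cont_field_diff[OF assms(1) that]]
  by (intro continuous_map_real_divide continuous_map_diff continuous_map_add continuous_map_real_pow) auto
 have eq: "complex_of_real (re t y) + \<i> * complex_of_real (re ?it y) = ip (fib E (p y)) (s y) (t y)"
  if y: "y \<in> topspace Y" for y
  using re[OF y assms(2)] re[OF y it]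
   semi_inner.ip_smult_right[OF semi_fib[OF cont_fieldD(3)[OF assms(2) y]] cont_fieldD(2)[OF assms(1) y]
    cont_fieldD(2)[OF assms(2) y], of \<i>]
  by (simp add: complex_eq_iff)
 have "continuous_map Y euclidean (\<lambda>y. complex_of_real (re t y) + \<i> * complex_of_real (re ?it y))"
  by (intro continuous_map_ceuclid continuous_map_of_real c assms(2) it) auto
 then show ?thesis by (rule continuous_map_eq) (use eq in auto)
qed

lemma gam_cont_field: "\<xi> \<in> gam E ==> cont_field X E X (\<lambda>u. u) \<xi>"
 using cont_field_gam[of X "\<lambda>u. u" \<xi>] by simp

lemma luc_iff: "s \<in> locally_uniform_closure X (fib E) (gam E) \<longleftrightarrow>
  s \<in> all_sections X (fib E) \<and> cont_field X E X (\<lambda>u. u) s"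
 by (auto simp: locally_uniform_closure_def cont_field_def all_sections_def)

lemma lucI:
 assumes "cont_field X E X (\<lambda>u. u) s"
 shows "(\<lambda>u\<in>topspace X. s u) \<in> locally_uniform_closure X (fib E) (gam E)"
 unfolding luc_iff using cont_fieldD(2)[OF assms] cont_field_cong[OF assms]
 by (auto simp: all_sections_def)

end

locale hbun =
 fixes X :: "'b topology" and E :: "('b, 'v) hbundle"
 assumes hbun: "hilbert_bundle X E"
begin

sublocale pre_hbun X E
 by (rule pre_hbun.intro) (use hbun in \<open>auto simp: hilbert_bundle_def hilbert_space_iff_hilb\<close>)

lemma gam_luc: "locally_uniform_closure X (fib E) (gam E) \<subseteq> gam E"
 using hbun by (simp add: hilbert_bundle_def)

lemma continuous_sections_eq_gam: "continuous_sections X E = gam E"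
proof
 show "gam E \<subseteq> continuous_sections X E"
 proof
  fix \<xi> assume \<xi>: "\<xi> \<in> gam E"
  have "cont_field X E X (\<lambda>u. u) (\<lambda>u. \<xi> u)" using \<xi> by (intro cont_field_gam) auto
  then show "\<xi> \<in> continuous_sections X E"
   using gam_all[OF \<xi>] by (simp add: continuous_sections_def continuous_map_total_iff_cont_field)
 qed
 show "continuous_sections X E \<subseteq> gam E"
 proof
  fix s assume "s \<in> continuous_sections X E"
  then have "s \<in> all_sections X (fib E)" "cont_field X E X (\<lambda>u. u) s"
   by (auto simp: continuous_sections_def continuous_map_total_iff_cont_field)
  then have "s \<in> locally_uniform_closure X (fib E) (gam E)" by (simp add: luc_iff)
  then show "s \<in> gam E" using gam_luc by blast
 qed
qed

lemma gamI: "cont_field X E X (\<lambda>u. u) s ==> (\<lambda>u\<in>topspace X. s u) \<in> gam E"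
 using lucI gam_luc by blast

end

lemma luc_mono_self:
 assumes "!!u. u \<in> topspace X ==> semi_inner (V u)" "\<Lambda> \<subseteq> all_sections X V"
 shows "\<Lambda> \<subseteq> locally_uniform_closure X V \<Lambda>"
proof
 fix s assume s: "s \<in> \<Lambda>"
 have "ndist (V w) (s w) (s w) = 0" if "w \<in> topspace X" for w
 proof -
  interpret semi_inner "V w" using assms that by blast
  have "s w \<in> carrier (V w)" using assms(2) s that by (auto simp: all_sections_def)
  then show ?thesis by simp
 qed
 then show "s \<in> locally_uniform_closure X V \<Lambda>"
  using assms(2) s by (fastforce simp: locally_uniform_closure_def intro!: exI[of _ "topspace X"] exI[of _ s])
qed

text \<open>A linear space of sections with continuous norms and dense values generates a continuous field:
 its closure consists of the sections that are continuous along the identity map, and these are stable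
 under the operations.\<close>

lemma hilbert_bundle_luc:
 assumes hilb: "!!u. u \<in> topspace X ==> hilb (V u)"
  and sub: "\<Lambda> \<subseteq> all_sections X V"
  and zero: "(\<lambda>u\<in>topspace X. \<zero>\<^bsub>V u\<^esub>) \<in> \<Lambda>"
  and add: "!!\<xi> \<eta>. \<xi> \<in> \<Lambda> ==> \<eta> \<in> \<Lambda> ==> (\<lambda>u\<in>topspace X. \<xi> u \<oplus>\<^bsub>V u\<^esub> \<eta> u) \<in> \<Lambda>"
  and smult: "!!c \<xi>. \<xi> \<in> \<Lambda> ==> (\<lambda>u\<in>topspace X. c \<odot>\<^bsub>V u\<^esub> \<xi> u) \<in> \<Lambda>"
  and dense: "!!u h e. u \<in> topspace X ==> h \<in> carrier (V u) ==> e > 0 ==>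
   \<exists>\<xi>\<in>\<Lambda>. ndist (V u) h (\<xi> u) < e"
  and norm: "!!\<xi>. \<xi> \<in> \<Lambda> ==> continuous_map X euclidean (\<lambda>u. vnorm (V u) (\<xi> u))"
 shows "hilbert_bundle X \<lparr>fib = V, gam = locally_uniform_closure X V \<Lambda>\<rparr>"
proof -
 let ?E = "\<lparr>fib = V, gam = \<Lambda>\<rparr>" and ?G = "locally_uniform_closure X V \<Lambda>"
 interpret pre_hbun X ?E
  by (rule pre_hbun.intro) (use assms in auto)
 have cf: "cont_field X ?E X (\<lambda>u. u) s" "s \<in> all_sections X V" if "s \<in> ?G" for s using luc_iff that by auto
 have I: "(\<lambda>u\<in>topspace X. s u) \<in> ?G" if "cont_field X ?E X (\<lambda>u. u) s" for s using lucI[OF that] by simp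
 have sub': "\<Lambda> \<subseteq> ?G" using luc_iff gam_cont_field sub by auto
 have "s \<in> ?G" if s: "s \<in> locally_uniform_closure X V ?G" for s
 proof -
  have sa: "s \<in> all_sections X V" using s by (simp add: locally_uniform_closure_def)
  have "cont_field X ?E X (\<lambda>u. u) s"
  proof (rule cont_field_local_limit)
   fix u and e :: real assume u: "u \<in> topspace X" and e: "e > 0"
   obtain U \<xi> where "openin X U" "u \<in> U" "\<xi> \<in> ?G" "\<forall>w\<in>U. ndist (V w) (s w) (\<xi> w) < e"
    using s u e unfolding locally_uniform_closure_def[of X V ?G] by blast
   then show "\<exists>U t. openin X U \<and> u \<in> U \<and> cont_field X ?E X (\<lambda>u. u) t \<and>
     (\<forall>w\<in>U. ndist (fib ?E w) (s w) (t w) < e)"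
    using cf(1) by (intro exI[of _ U] exI[of _ \<xi>]) simp
  qed (use sa in \<open>auto simp: all_sections_def\<close>)
  then show ?thesis using luc_iff sa by simp
 qed
 moreover have "(\<lambda>u\<in>topspace X. \<xi> u \<oplus>\<^bsub>V u\<^esub> \<eta> u) \<in> ?G" if "\<xi> \<in> ?G" "\<eta> \<in> ?G" for \<xi> \<eta>
  using I[OF cont_field_add[OF cf(1)[OF that(1)] cf(1)[OF that(2)]]] by simp
 moreover have "(\<lambda>u\<in>topspace X. c \<odot>\<^bsub>V u\<^esub> \<xi> u) \<in> ?G" if "\<xi> \<in> ?G" for c \<xi>
  using I[OF cont_field_smult[OF cf(1)[OF that], of "\<lambda>_. c"]] by simp
 moreover have "continuous_map X euclidean (\<lambda>u. vnorm (V u) (\<xi> u))" if "\<xi> \<in> ?G" for \<xi>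
  using cont_field_norm[OF cf(1)[OF that]] by simp
 moreover have "\<exists>\<xi>\<in>?G. ndist (V u) h (\<xi> u) < e" if "u \<in> topspace X" "h \<in> carrier (V u)" "e > 0" for u h e
  using dense[OF that] sub' by blast
 ultimately show ?thesis
  unfolding hilbert_bundle_def using hilb zero sub' cf(2) by (auto simp: hilbert_space_iff_hilb)
qed

section \<open>Unitary bundle morphisms\<close>

text \<open>Since the topology of a total space is given by sections, a fibrewise unitary map is
 continuous as soon as it carries enough continuous sections to continuous sections.\<close>

lemma unitary_bundle_morphism:
 assumes "hilbert_bundle X E" "hilbert_bundle X F"
  and T: "!!u. u \<in> topspace X ==> unitary_map (fib E u) (fib F u) (T u)"
  and \<Lambda>: "\<Lambda> \<subseteq> gam E"
  and dense: "!!u h e. u \<in> topspace X ==> h \<in> carrier (fib E u) ==> e > 0 ==>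
   \<exists>\<xi>\<in>\<Lambda>. ndist (fib E u) h (\<xi> u) < e"
  and T\<Lambda>: "!!\<xi>. \<xi> \<in> \<Lambda> ==> (\<lambda>u\<in>topspace X. T u (\<xi> u)) \<in> gam F"
 shows "bundle_morphism X E F T"
proof -
 interpret E: hbun X E using assms by unfold_locales
 interpret F: hbun X F using assms by unfold_locales
 have "bounded_linear_map (fib E u) (fib F u) (T u)" if "u \<in> topspace X" for u
  using T[OF that] unitary_mapD(3)[OF T[OF that]]
  by (auto simp: bounded_linear_map_def unitary_map_def intro!: exI[of _ 1])
 moreover have "continuous_map (total_top X E) (total_top X F) (\<lambda>(u, h). (u, T u h))"
 proof -
  have "cont_field X E (total_top X E) fst snd"
   by (subst E.continuous_map_total_iff_cont_field[symmetric]) simp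
  note tot = E.cont_fieldD[OF this]
  have "cont_field X F (total_top X E) fst (\<lambda>y. T (fst y) (snd y))"
   unfolding cont_field_def
  proof (intro conjI ballI allI impI)
   show "continuous_map (total_top X E) X fst" by (rule tot)
   show "T (fst y) (snd y) \<in> carrier (fib F (fst y))" if "y \<in> topspace (total_top X E)" for y
    using tot(2,3)[OF that] unitary_mapD(1)[OF T] by blast
   fix y and e :: real assume y: "y \<in> topspace (total_top X E)" and e: "e > 0"
   obtain \<xi> where \<xi>: "\<xi> \<in> \<Lambda>" "ndist (fib E (fst y)) (snd y) (\<xi> (fst y)) < e"
    using dense[OF tot(3)[OF y] tot(2)[OF y] e] by blast
   let ?U = "E.basic_nbhd (topspace X) e \<xi>"
   have "ndist (fib F (fst w)) (T (fst w) (snd w)) ((\<lambda>u\<in>topspace X. T u (\<xi> u)) (fst w)) < e"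
    if w: "w \<in> ?U" for w
   proof -
    have wX: "fst w \<in> topspace X" and wc: "snd w \<in> carrier (fib E (fst w))"
     and lt: "ndist (fib E (fst w)) (snd w) (\<xi> (fst w)) < e" using w by auto
    have "\<xi> (fst w) \<in> carrier (fib E (fst w))" using E.gam_carrier \<xi>(1) \<Lambda> wX by blast
    then show ?thesis
     using unitary_map_vnorm_diff[OF E.semi_fib[OF wX] F.semi_fib[OF wX] T[OF wX] wc] lt wX by simp
   qed
   moreover have "openin (total_top X E) ?U" using E.openin_basic_nbhd[OF openin_topspace e] \<xi>(1) \<Lambda> by blast
   moreover have "y \<in> ?U" using tot(2,3)[OF y] \<xi>(2) by (auto simp: case_prod_beta)
   ultimately show "\<exists>U \<eta>. openin (total_top X E) U \<and> y \<in> U \<and> \<eta> \<in> gam F \<and>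
     (\<forall>w\<in>U. ndist (fib F (fst w)) (T (fst w) (snd w)) (\<eta> (fst w)) < e)"
    using T\<Lambda>[OF \<xi>(1)] by (intro exI[of _ ?U] exI[of _ "\<lambda>u\<in>topspace X. T u (\<xi> u)"]) simp
  qed
  then show ?thesis
   by (simp add: F.continuous_map_total_iff_cont_field[symmetric] case_prod_beta')
 qed
 ultimately show ?thesis by (simp add: bundle_morphism_def)
qed

lemma bundle_morphism_cont_field:
 assumes "hilbert_bundle X E" "hilbert_bundle X F" "bundle_morphism X E F T" "cont_field X E Y p s"
 shows "cont_field X F Y p (\<lambda>y. T (p y) (s y))"
proof -
 interpret E: hbun X E using assms by unfold_locales
 interpret F: hbun X F using assms by unfold_locales
 have "continuous_map Y (total_top X F) ((\<lambda>(u, h). (u, T u h)) \<circ> (\<lambda>y. (p y, s y)))"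
  using assms(3,4) unfolding E.continuous_map_total_iff_cont_field[symmetric] bundle_morphism_def
  by (blast intro: continuous_map_compose)
 then show ?thesis by (simp add: o_def F.continuous_map_total_iff_cont_field)
qed

text \<open>The image under \<open>T\<close> of a section close to the preimage of \<open>\<eta>\<close> at one point is close to \<open>\<eta>\<close>
 nearby, so the preimages form a continuous section.\<close>

lemma bundle_morphism_inverse:
 assumes "hilbert_bundle X E" "hilbert_bundle X F" "bundle_morphism X E F T"
  and T: "!!u. u \<in> topspace X ==> unitary_map (fib E u) (fib F u) (T u)"
 shows "bundle_morphism X F E (\<lambda>u. inv_into (carrier (fib E u)) (T u))"
proof -
 interpret E: hbun X E using assms by unfold_locales
 interpret F: hbun X F using assms by unfold_locales
 let ?S = "\<lambda>u. inv_into (carrier (fib E u)) (T u)"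
 have S: "unitary_map (fib F u) (fib E u) (?S u)" if "u \<in> topspace X" for u
  using that by (intro unitary_map_inv E.semi_fib F.semi_fib T)
 have TS: "T u (?S u h) = h" if "u \<in> topspace X" "h \<in> carrier (fib F u)" for u h
  using unitary_mapD(6)[OF T[OF that(1)]] that(2) by (simp add: bij_betw_inv_into_right)
 show ?thesis
 proof (rule unitary_bundle_morphism[OF assms(2,1) S order_refl F.gam_dense])
  fix \<eta> assume \<eta>: "\<eta> \<in> gam F"
  show "(\<lambda>u\<in>topspace X. ?S u (\<eta> u)) \<in> gam E"
  proof (rule E.gamI)
   show "cont_field X E X (\<lambda>u. u) (\<lambda>u. ?S u (\<eta> u))"
    unfolding cont_field_def
   proof (intro conjI ballI allI impI)
    show Sc: "?S u (\<eta> u) \<in> carrier (fib E u)" if "u \<in> topspace X" for u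
     using unitary_mapD(1)[OF S[OF that] F.gam_carrier[OF \<eta> that]] .
    fix u and e :: real assume u: "u \<in> topspace X" and e: "e > 0"
    obtain \<xi> where \<xi>: "\<xi> \<in> gam E" "ndist (fib E u) (?S u (\<eta> u)) (\<xi> u) < e"
     using E.gam_dense[OF u Sc[OF u] e] by blast
    have "cont_field X F X (\<lambda>u. u) (\<lambda>u. T u (\<xi> u))"
     using bundle_morphism_cont_field[OF assms(1-3) E.gam_cont_field[OF \<xi>(1)]] .
    then have cn: "continuous_map X euclideanreal (\<lambda>u. ndist (fib F u) (\<eta> u) (T u (\<xi> u)))"
     using F.cont_field_norm[OF F.cont_field_diff[OF F.gam_cont_field[OF \<eta>]]] by simp
    have eq: "ndist (fib F w) (\<eta> w) (T w (\<xi> w)) = ndist (fib E w) (?S w (\<eta> w)) (\<xi> w)"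
     if w: "w \<in> topspace X" for w
     using unitary_map_vnorm_diff[OF E.semi_fib[OF w] F.semi_fib[OF w] T[OF w] Sc[OF w] E.gam_carrier[OF \<xi>(1) w]]
      TS[OF w F.gam_carrier[OF \<eta> w]] by simp
    obtain U where U: "openin X U" "u \<in> U"
     "!!w. w \<in> U ==> ndist (fib F w) (\<eta> w) (T w (\<xi> w)) < e"
     using continuous_map_less_nbhd[OF cn u, of e] \<xi>(2) eq[OF u] by metis
    then show "\<exists>U \<xi>. openin X U \<and> u \<in> U \<and> \<xi> \<in> gam E \<and>
      (\<forall>w\<in>U. ndist (fib E w) (?S w (\<eta> w)) (\<xi> w) < e)"
     using \<xi>(1) eq openin_subset[OF U(1)] by (intro exI[of _ U] exI[of _ \<xi>]) force
   qed auto
  qed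
 qed
qed

section \<open>Direct sums of Hilbert bundles\<close>

lemma continuous_map_sqrt:
 "continuous_map X euclideanreal f ==> continuous_map X euclideanreal (\<lambda>x. sqrt (f x))"
 unfolding continuous_map_atin by (auto intro: tendsto_intros)

context hilb_family
begin

definition trunc where "trunc J v = (\<lambda>i\<in>I. if i \<in> J then v i else \<zero>\<^bsub>V i\<^esub>)"

lemma zero_V [simp]: "i \<in> I ==> \<zero>\<^bsub>V i\<^esub> \<in> carrier (V i)"
 using module_V by (meson abelian_group.axioms(1) abelian_monoid.zero_closed module.axioms(2))

lemma trunc_S:
 assumes "finite J" "!!i. i \<in> J ==> i \<in> I ==> v i \<in> carrier (V i)"
 shows "trunc J v \<in> carrier S"
proof (rule S_memI_finite)
 show "trunc J v \<in> (\<Pi>\<^sub>E i\<in>I. carrier (V i))"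
  using assms(2) by (auto simp: trunc_def)
 show "finite {i \<in> I. trunc J v i \<noteq> \<zero>\<^bsub>V i\<^esub>}"
  using assms(1) by (rule finite_subset[rotated]) (auto simp: trunc_def)
qed

lemma vnorm_finite_support:
 assumes v: "v \<in> carrier S" and J: "finite J" and "0 \<le> \<delta>"
  and "!!i. i \<in> I ==> i \<in> J ==> vnorm (V i) (v i) \<le> \<delta>"
  and "!!i. i \<in> I ==> i \<notin> J ==> v i = \<zero>\<^bsub>V i\<^esub>"
 shows "vnorm S v \<le> (real (card J) + 1) * \<delta>"
proof (rule S_vnorm_le[OF v])
 show "0 \<le> (real (card J) + 1) * \<delta>" using assms(3) by simp
 fix K assume K: "finite K" "K \<subseteq> I"
 have "(\<Sum>i\<in>K. (vnorm (V i) (v i))\<^sup>2) = (\<Sum>i\<in>K \<inter> J. (vnorm (V i) (v i))\<^sup>2)"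
 proof (rule sum.mono_neutral_right)
  show "\<forall>i\<in>K - K \<inter> J. (vnorm (V i) (v i))\<^sup>2 = 0"
  proof
   fix i assume "i \<in> K - K \<inter> J"
   then have "i \<in> I" "i \<notin> J" using K by auto
   then show "(vnorm (V i) (v i))\<^sup>2 = 0"
    using assms(5) semi_inner.vnorm_zero[OF semi_V] by simp
  qed
 qed (use K in auto)
 also have "\<dots> \<le> (\<Sum>i\<in>K \<inter> J. \<delta>\<^sup>2)"
  using K assms(4) S_comp[OF v] semi_inner.vnorm_nonneg[OF semi_V] by (intro sum_mono power_mono) auto
 also have "\<dots> \<le> real (card J) * \<delta>\<^sup>2"
  using J by (simp add: card_mono mult_right_mono)
 also have "\<dots> \<le> ((real (card J) + 1))\<^sup>2 * \<delta>\<^sup>2"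
 proof (rule mult_right_mono)
  have "real (card J) * 1 \<le> (real (card J) + 1) * (real (card J) + 1)"
   by (intro mult_mono) auto
  then show "real (card J) \<le> ((real (card J) + 1))\<^sup>2" by (simp add: power2_eq_square)
 qed simp
 finally show "(\<Sum>i\<in>K. (vnorm (V i) (v i))\<^sup>2) \<le> ((real (card J) + 1) * \<delta>)\<^sup>2"
  by (simp add: power_mult_distrib)
qed

lemma trunc_approx:
 assumes v: "v \<in> carrier S" and e: "e > 0"
 obtains J where "finite J" "J \<subseteq> I" "ndist S v (trunc J v) < e"
proof -
 have "((\<lambda>J. \<Sum>i\<in>J. (vnorm (V i) (v i))\<^sup>2) \<longlongrightarrow> (vnorm S v)\<^sup>2) (finite_subsets_at_top I)"
  using vnorm_S_sq[OF v] by (simp add: has_sum_def)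
 then have "eventually (\<lambda>J. (\<Sum>i\<in>J. (vnorm (V i) (v i))\<^sup>2) > (vnorm S v)\<^sup>2 - (e/2)\<^sup>2) (finite_subsets_at_top I)"
  by (rule order_tendstoD) (use e in simp)
 then obtain J where J: "finite J" "J \<subseteq> I" and "(\<Sum>i\<in>J. (vnorm (V i) (v i))\<^sup>2) > (vnorm S v)\<^sup>2 - (e/2)\<^sup>2"
  unfolding eventually_finite_subsets_at_top by blast
 then have lt: "(vnorm S v)\<^sup>2 - (\<Sum>i\<in>J. (vnorm (V i) (v i))\<^sup>2) \<le> (e/2)\<^sup>2" by linarith
 have tS: "trunc J v \<in> carrier S" using J S_comp[OF v] by (intro trunc_S) auto
 have "ndist S v (trunc J v) \<le> e/2"
 proof (rule S_vnorm_le)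
  fix K assume K: "finite K" "K \<subseteq> I"
  have "(\<Sum>i\<in>K. (vnorm (V i) ((v \<ominus>\<^bsub>S\<^esub> trunc J v) i))\<^sup>2) = (\<Sum>i\<in>K. if i \<in> J then 0 else (vnorm (V i) (v i))\<^sup>2)"
  proof (rule sum.cong)
   fix i assume "i \<in> K"
   then have i: "i \<in> I" using K by blast
   interpret Vi: hilb "V i" using hilb_V[OF i] .
   show "(vnorm (V i) ((v \<ominus>\<^bsub>S\<^esub> trunc J v) i))\<^sup>2 = (if i \<in> J then 0 else (vnorm (V i) (v i))\<^sup>2)"
    using S_comp[OF v i] i by (simp add: S_minus[OF v tS i]) (simp add: trunc_def)
  qed simp
  also have "\<dots> = (\<Sum>i\<in>K - J. (vnorm (V i) (v i))\<^sup>2)"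
   using K by (intro sum.mono_neutral_cong_right) auto
  also have "\<dots> = (\<Sum>i\<in>K \<union> J. (vnorm (V i) (v i))\<^sup>2) - (\<Sum>i\<in>J. (vnorm (V i) (v i))\<^sup>2)"
   using K J sum_diff[of "K \<union> J" J "\<lambda>i. (vnorm (V i) (v i))\<^sup>2"] by (simp add: Un_Diff)
  also have "\<dots> \<le> (vnorm S v)\<^sup>2 - (\<Sum>i\<in>J. (vnorm (V i) (v i))\<^sup>2)"
   using S_finite_le[OF v, of "K \<union> J"] K J by simp
  finally show "(\<Sum>i\<in>K. (vnorm (V i) ((v \<ominus>\<^bsub>S\<^esub> trunc J v) i))\<^sup>2) \<le> (e/2)\<^sup>2"
   using lt by linarith
 qed (use v tS e in auto)
 then show ?thesis using that J e by force
qed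

lemma finite_dense:
 assumes D: "!!i v e. i \<in> I ==> v \<in> carrier (V i) ==> e > 0 ==> \<exists>a\<in>D i. p i a \<in> carrier (V i) \<and> ndist (V i) v (p i a) < e"
  and v: "v \<in> carrier S" and e: "e > 0"
 obtains J a where "finite J" "J \<subseteq> I" "!!i. i \<in> J ==> a i \<in> D i"
  "trunc J (\<lambda>i. p i (a i)) \<in> carrier S" "ndist S v (trunc J (\<lambda>i. p i (a i))) < e"
proof -
 obtain J where J: "finite J" "J \<subseteq> I" and lt: "ndist S v (trunc J v) < e / 2"
  using trunc_approx[OF v, of "e / 2"] e by auto
 define \<delta> where "\<delta> = e / (2 * (real (card J) + 1))"
 have d: "\<delta> > 0" using e by (simp add: \<delta>_def)
 have "\<forall>i\<in>J. \<exists>a. a \<in> D i \<and> p i a \<in> carrier (V i) \<and> ndist (V i) (v i) (p i a) < \<delta>"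
  using D[OF _ S_comp[OF v] d] J(2) by blast
 from bchoice[OF this] obtain a where a: "!!i. i \<in> J ==> a i \<in> D i" "!!i. i \<in> J ==> p i (a i) \<in> carrier (V i)"
  "!!i. i \<in> J ==> ndist (V i) (v i) (p i (a i)) < \<delta>" by blast
 let ?t = "trunc J (\<lambda>i. p i (a i))"
 have tS: "trunc J v \<in> carrier S" using J S_comp[OF v] by (intro trunc_S) auto
 have fS: "?t \<in> carrier S" using J a(2) by (intro trunc_S) auto
 have "ndist S (trunc J v) ?t \<le> (real (card J) + 1) * \<delta>"
 proof (rule vnorm_finite_support)
  fix i assume i: "i \<in> I"
  interpret Vi: hilb "V i" using hilb_V[OF i] .
  show "vnorm (V i) ((trunc J v \<ominus>\<^bsub>S\<^esub> ?t) i) \<le> \<delta>" if "i \<in> J"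
   using a(3)[OF that] that i by (simp add: S_minus[OF tS fS i]) (simp add: trunc_def)
  show "(trunc J v \<ominus>\<^bsub>S\<^esub> ?t) i = \<zero>\<^bsub>V i\<^esub>" if "i \<notin> J"
   using that i by (simp add: S_minus[OF tS fS i]) (simp add: trunc_def Vi.diff_self)
 qed (use J d tS fS in auto)
 also have "\<dots> = e / 2" by (simp add: \<delta>_def field_simps)
 finally have "ndist S v ?t < e" using S.vnorm_diff_triangle[OF v tS fS] lt by linarith
 then show ?thesis using that J a(1) fS by blast
qed

lemma ip_finite:
 assumes "finite J" "J \<subseteq> I" "w \<in> carrier S" "!!i. i \<in> I ==> i \<notin> J ==> v i = \<zero>\<^bsub>V i\<^esub>"
 shows "ip S v w = (\<Sum>i\<in>J. ip (V i) (v i) (w i))"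
proof -
 have "infsum (\<lambda>i. ip (V i) (v i) (w i)) I = infsum (\<lambda>i. ip (V i) (v i) (w i)) J"
  using assms(2,4) semi_inner.ip_zero_left[OF semi_V] S_comp[OF assms(3)] by (intro infsum_cong_neutral) auto
 then show ?thesis using assms(1) by (simp add: S_simps)
qed

end

locale hbun_family =
 fixes X :: "'b topology" and I :: "'i set" and E :: "'i \<Rightarrow> ('b, 'v) hbundle"
 assumes hb: "i \<in> I ==> hilbert_bundle X (E i)"
begin

lemma hbun_E: "i \<in> I ==> hbun X (E i)"
 using hb by unfold_locales

lemma pre_E: "i \<in> I ==> pre_hbun X (E i)"
proof -
 assume "i \<in> I"
 then interpret hbun X "E i" by (rule hbun_E)
 show ?thesis ..
qed

abbreviation F where "F \<equiv> bundle_sum X I E"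
abbreviation fibs where "fibs u \<equiv> (\<lambda>i. fib (E i) u)"

lemma fib_F [simp]: "fib F u = hilbert_sum I (fibs u)"
 by (simp add: bundle_sum_def Let_def)

lemma hilb_family: "u \<in> topspace X ==> hilb_family I (fibs u)"
 using pre_hbun.hilb_fib[OF pre_E] by (intro hilb_family.intro)

lemma zero_E: "i \<in> I ==> u \<in> topspace X ==> \<zero>\<^bsub>fib (E i) u\<^esub> \<in> carrier (fib (E i) u)"
 using hilb_family.zero_V[OF hilb_family] by blast

text \<open>The sections with finitely many nonzero components; the finite set of indices is made explicit.\<close>

definition fin_sec where
 "fin_sec J s = (\<lambda>u\<in>topspace X. \<lambda>i\<in>I. if i \<in> J then s i u else \<zero>\<^bsub>fib (E i) u\<^esub>)"

definition fin_secs where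
 "fin_secs = {fin_sec J s | J s. finite J \<and> J \<subseteq> I \<and> (\<forall>i\<in>J. s i \<in> gam (E i))}"

lemma gam_F: "gam F = locally_uniform_closure X (\<lambda>u. hilbert_sum I (fibs u)) fin_secs"
proof -
 have "{(\<lambda>u\<in>topspace X. \<lambda>i\<in>I. s i u) | s. (\<forall>i\<in>I. s i \<in> continuous_sections X (E i)) \<and>
      finite {i \<in> I. \<exists>u\<in>topspace X. s i u \<noteq> \<zero>\<^bsub>fib (E i) u\<^esub>}} = fin_secs" (is "?L = _")
 proof
  show "?L \<subseteq> fin_secs"
  proof
   fix z assume "z \<in> ?L"
   then obtain s where z: "z = (\<lambda>u\<in>topspace X. \<lambda>i\<in>I. s i u)" and s: "\<forall>i\<in>I. s i \<in> continuous_sections X (E i)"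
    and f: "finite {i \<in> I. \<exists>u\<in>topspace X. s i u \<noteq> \<zero>\<^bsub>fib (E i) u\<^esub>}" by blast
   have "z = fin_sec {i \<in> I. \<exists>u\<in>topspace X. s i u \<noteq> \<zero>\<^bsub>fib (E i) u\<^esub>} s"
    unfolding z fin_sec_def by (intro restrict_ext) auto
   moreover have "\<forall>i\<in>I. s i \<in> gam (E i)"
    using s hbun.continuous_sections_eq_gam[OF hbun_E] by blast
   ultimately show "z \<in> fin_secs" using f by (auto simp: fin_secs_def)
  qed
  show "fin_secs \<subseteq> ?L"
  proof
   fix z assume "z \<in> fin_secs"
   then obtain J s where z: "z = fin_sec J s" and J: "finite J" "J \<subseteq> I" "\<forall>i\<in>J. s i \<in> gam (E i)"
    by (auto simp: fin_secs_def)
   define t where "t i = (if i \<in> J then s i else (\<lambda>u\<in>topspace X. \<zero>\<^bsub>fib (E i) u\<^esub>))" for i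
   have "z = (\<lambda>u\<in>topspace X. \<lambda>i\<in>I. t i u)"
    unfolding z fin_sec_def t_def by (intro restrict_ext) auto
   moreover have "\<forall>i\<in>I. t i \<in> continuous_sections X (E i)"
    using J pre_hbun.gam_zero[OF pre_E] hbun.continuous_sections_eq_gam[OF hbun_E] by (auto simp: t_def)
   moreover have "finite {i \<in> I. \<exists>u\<in>topspace X. t i u \<noteq> \<zero>\<^bsub>fib (E i) u\<^esub>}"
    by (rule finite_subset[OF _ J(1)]) (auto simp: t_def split: if_splits)
   ultimately show "z \<in> ?L" by blast
  qed
 qed
 then show ?thesis by (simp add: bundle_sum_def Let_def)
qed

lemma fin_sec_trunc: "u \<in> topspace X ==> fin_sec J s u = hilb_family.trunc I (fibs u) J (\<lambda>i. s i u)"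
 by (simp add: fin_sec_def hilb_family.trunc_def[OF hilb_family])

lemma fin_sec_carrier:
 assumes "finite J" "J \<subseteq> I" "\<forall>i\<in>J. s i \<in> gam (E i)" "u \<in> topspace X"
 shows "fin_sec J s u \<in> carrier (hilbert_sum I (fibs u))"
 unfolding fin_sec_trunc[OF assms(4)]
 using assms pre_hbun.gam_carrier[OF pre_E] by (intro hilb_family.trunc_S[OF hilb_family]) auto

lemma hilbert_bundle_F: "hilbert_bundle X F"
proof -
 let ?V = "\<lambda>u. hilbert_sum I (fibs u)"
 have "hilbert_bundle X \<lparr>fib = ?V, gam = locally_uniform_closure X ?V fin_secs\<rparr>"
 proof (rule hilbert_bundle_luc)
  show "hilb (?V u)" if "u \<in> topspace X" for u using hilb_family.hilb_S[OF hilb_family[OF that]] .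
  show "fin_secs \<subseteq> all_sections X ?V"
   using fin_sec_carrier by (auto simp: fin_secs_def all_sections_def) (simp add: fin_sec_def)
  show "(\<lambda>u\<in>topspace X. \<zero>\<^bsub>?V u\<^esub>) \<in> fin_secs"
  proof -
   have "(\<lambda>u\<in>topspace X. \<zero>\<^bsub>?V u\<^esub>) = fin_sec {} undefined"
    by (simp add: fin_sec_def hilbert_sum_def)
   then show ?thesis unfolding fin_secs_def by blast
  qed
 next
  fix \<xi> \<eta> assume "\<xi> \<in> fin_secs" "\<eta> \<in> fin_secs"
  then obtain J s K t where st: "\<xi> = fin_sec J s" "\<eta> = fin_sec K t" and J: "finite J" "J \<subseteq> I" "\<forall>i\<in>J. s i \<in> gam (E i)"
   and K: "finite K" "K \<subseteq> I" "\<forall>i\<in>K. t i \<in> gam (E i)" by (auto simp: fin_secs_def)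
  define s' where "s' i = (if i \<in> J then s i else (\<lambda>u\<in>topspace X. \<zero>\<^bsub>fib (E i) u\<^esub>))" for i
  define t' where "t' i = (if i \<in> K then t i else (\<lambda>u\<in>topspace X. \<zero>\<^bsub>fib (E i) u\<^esub>))" for i
  have s': "s' i \<in> gam (E i)" "t' i \<in> gam (E i)" if "i \<in> I" for i
   using J K that pre_hbun.gam_zero[OF pre_E] by (auto simp: s'_def t'_def)
  have z: "\<zero>\<^bsub>fib (E i) u\<^esub> \<oplus>\<^bsub>fib (E i) u\<^esub> \<zero>\<^bsub>fib (E i) u\<^esub> = \<zero>\<^bsub>fib (E i) u\<^esub>" if "i \<in> I" "u \<in> topspace X" for i u
  proof -
   interpret hilb "fib (E i) u" using pre_hbun.hilb_fib[OF pre_E] that by blast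
   show ?thesis by simp
  qed
  have "(\<lambda>u\<in>topspace X. \<xi> u \<oplus>\<^bsub>?V u\<^esub> \<eta> u)
    = fin_sec (J \<union> K) (\<lambda>i. \<lambda>u\<in>topspace X. s' i u \<oplus>\<^bsub>fib (E i) u\<^esub> t' i u)"
   unfolding st fin_sec_def hilbert_sum_def
   by (intro ext) (auto simp: s'_def t'_def z intro!: restrict_ext)
  moreover have "(\<lambda>u\<in>topspace X. s' i u \<oplus>\<^bsub>fib (E i) u\<^esub> t' i u) \<in> gam (E i)" if "i \<in> I" for i
   using pre_hbun.gam_add[OF pre_E[OF that] s'[OF that]] .
  ultimately show "(\<lambda>u\<in>topspace X. \<xi> u \<oplus>\<^bsub>?V u\<^esub> \<eta> u) \<in> fin_secs"
   unfolding fin_secs_def using J K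
   by (intro CollectI exI[of _ "J \<union> K"] exI[of _ "\<lambda>i. \<lambda>u\<in>topspace X. s' i u \<oplus>\<^bsub>fib (E i) u\<^esub> t' i u"]) auto
 next
  fix c \<xi> assume "\<xi> \<in> fin_secs"
  then obtain J s where st: "\<xi> = fin_sec J s" and J: "finite J" "J \<subseteq> I" "\<forall>i\<in>J. s i \<in> gam (E i)"
   by (auto simp: fin_secs_def)
  have z: "c \<odot>\<^bsub>fib (E i) u\<^esub> \<zero>\<^bsub>fib (E i) u\<^esub> = \<zero>\<^bsub>fib (E i) u\<^esub>" if "i \<in> I" "u \<in> topspace X" for i u
  proof -
   interpret hilb "fib (E i) u" using pre_hbun.hilb_fib[OF pre_E] that by blast
   show ?thesis using smult_r_null[of c] by simp
  qed
  have "(\<lambda>u\<in>topspace X. c \<odot>\<^bsub>?V u\<^esub> \<xi> u) = fin_sec J (\<lambda>i. \<lambda>u\<in>topspace X. c \<odot>\<^bsub>fib (E i) u\<^esub> s i u)"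
   unfolding st fin_sec_def hilbert_sum_def by (intro ext) (auto simp: z intro!: restrict_ext)
  moreover have "(\<lambda>u\<in>topspace X. c \<odot>\<^bsub>fib (E i) u\<^esub> s i u) \<in> gam (E i)" if "i \<in> J" for i
   using pre_hbun.gam_smult[OF pre_E] J that by blast
  ultimately show "(\<lambda>u\<in>topspace X. c \<odot>\<^bsub>?V u\<^esub> \<xi> u) \<in> fin_secs"
   unfolding fin_secs_def using J
   by (intro CollectI exI[of _ J] exI[of _ "\<lambda>i. \<lambda>u\<in>topspace X. c \<odot>\<^bsub>fib (E i) u\<^esub> s i u"]) auto
 next
  fix u h and e :: real assume u: "u \<in> topspace X" and h: "h \<in> carrier (?V u)" and e: "e > 0"
  interpret Fu: hilb_family I "fibs u" by (rule hilb_family[OF u])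
  have D: "\<exists>\<xi>\<in>gam (E i). \<xi> u \<in> carrier (fib (E i) u) \<and> ndist (fib (E i) u) v (\<xi> u) < \<delta>"
   if i: "i \<in> I" and v: "v \<in> carrier (fib (E i) u)" "\<delta> > 0" for i v \<delta>
   using pre_hbun.gam_dense[OF pre_E[OF i] u v] pre_hbun.gam_carrier[OF pre_E[OF i] _ u] by blast
  obtain J s where J: "finite J" "J \<subseteq> I" "!!i. i \<in> J ==> s i \<in> gam (E i)" "Fu.trunc J (\<lambda>i. s i u) \<in> carrier Fu.S"
   "ndist Fu.S h (Fu.trunc J (\<lambda>i. s i u)) < e"
   using Fu.finite_dense[of "\<lambda>i. gam (E i)" "\<lambda>i \<xi>. \<xi> u", OF D h e] by blast
  then have "fin_sec J s \<in> fin_secs" unfolding fin_secs_def by blast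
  then show "\<exists>\<xi>\<in>fin_secs. ndist (?V u) h (\<xi> u) < e"
   using J(5) fin_sec_trunc[OF u] by (intro bexI[of _ "fin_sec J s"]) auto
 next
  fix \<xi> assume "\<xi> \<in> fin_secs"
  then obtain J s where st: "\<xi> = fin_sec J s" and J: "finite J" "J \<subseteq> I" "\<forall>i\<in>J. s i \<in> gam (E i)"
   by (auto simp: fin_secs_def)
  have eq: "vnorm (?V u) (\<xi> u) = sqrt (\<Sum>i\<in>J. (vnorm (fib (E i) u) (s i u))\<^sup>2)" if u: "u \<in> topspace X" for u
  proof -
   interpret Fu: hilb_family I "fibs u" by (rule hilb_family[OF u])
   have fS: "\<xi> u \<in> carrier Fu.S" unfolding st using J u by (intro fin_sec_carrier) auto
   have "((\<lambda>i. (vnorm (fib (E i) u) (\<xi> u i))\<^sup>2) has_sum (\<Sum>i\<in>J. (vnorm (fib (E i) u) (s i u))\<^sup>2)) I"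
   proof (rule has_sum_finite_neutralI)
    show "(\<Sum>i\<in>J. (vnorm (fib (E i) u) (s i u))\<^sup>2) = (\<Sum>i\<in>J. (vnorm (fib (E i) u) (\<xi> u i))\<^sup>2)"
     using J u by (intro sum.cong) (auto simp: st fin_sec_def)
   qed (use J u semi_inner.vnorm_zero[OF Fu.semi_V] in \<open>auto simp: st fin_sec_def\<close>)
   then have "(vnorm Fu.S (\<xi> u))\<^sup>2 = (\<Sum>i\<in>J. (vnorm (fib (E i) u) (s i u))\<^sup>2)"
    using has_sum_unique[OF Fu.vnorm_S_sq[OF fS]] by blast
   then show ?thesis using real_sqrt_unique[OF _ Fu.S.vnorm_nonneg[OF fS]] by simp
  qed
  have "continuous_map X euclideanreal (\<lambda>u. sqrt (\<Sum>i\<in>J. (vnorm (fib (E i) u) (s i u))\<^sup>2))"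
   using J pre_hbun.gam_norm_continuous[OF pre_E]
   by (intro continuous_map_sqrt continuous_map_sum continuous_map_real_pow) auto
  then show "continuous_map X euclidean (\<lambda>u. vnorm (?V u) (\<xi> u))"
   by (rule continuous_map_eq) (simp add: eq)
 qed
 then show ?thesis by (simp add: bundle_sum_def Let_def gam_F[unfolded bundle_sum_def Let_def, simplified])
qed

sublocale F: hbun X F by unfold_locales (rule hilbert_bundle_F)

lemma fin_secs_gam: "fin_secs \<subseteq> gam F"
 unfolding gam_F
proof (rule luc_mono_self)
 show "semi_inner (hilbert_sum I (fibs u))" if "u \<in> topspace X" for u
  using hilb_family.semi_inner_S[OF hilb_family[OF that]] .
 show "fin_secs \<subseteq> all_sections X (\<lambda>u. hilbert_sum I (fibs u))"
  using fin_sec_carrier by (auto simp: fin_secs_def all_sections_def) (simp add: fin_sec_def)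
qed

lemma cont_field_F_approx:
 assumes s: "cont_field X F Y p s" and y: "y \<in> topspace Y" and e: "e > 0"
 obtains U J t where "openin Y U" "y \<in> U" "finite J" "J \<subseteq> I" "\<forall>i\<in>J. t i \<in> gam (E i)"
  "!!w. w \<in> U ==> ndist (fib F (p w)) (s w) (fin_sec J t (p w)) < e"
proof -
 note sD = F.cont_fieldD[OF s]
 obtain U \<xi> where U: "openin Y U" "y \<in> U" "\<xi> \<in> gam F"
  "!!w. w \<in> U ==> ndist (fib F (p w)) (s w) (\<xi> (p w)) < e / 2"
  using F.cont_field_approx[OF s y, of "e / 2"] e by auto
 obtain N \<zeta> where N: "openin X N" "p y \<in> N" "\<zeta> \<in> fin_secs"
  "\<forall>u\<in>N. ndist (fib F u) (\<xi> u) (\<zeta> u) < e / 2"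
 proof -
  have "\<xi> \<in> locally_uniform_closure X (\<lambda>u. hilbert_sum I (fibs u)) fin_secs"
   using U(3) gam_F by simp
  then have "\<forall>u\<in>topspace X. \<forall>e>0. \<exists>N \<zeta>. openin X N \<and> u \<in> N \<and> \<zeta> \<in> fin_secs \<and>
    (\<forall>u\<in>N. ndist (fib F u) (\<xi> u) (\<zeta> u) < e)"
   by (simp add: locally_uniform_closure_def)
  then have "\<exists>N \<zeta>. openin X N \<and> p y \<in> N \<and> \<zeta> \<in> fin_secs \<and>
    (\<forall>u\<in>N. ndist (fib F u) (\<xi> u) (\<zeta> u) < e / 2)"
   using sD(3)[OF y] e half_gt_zero by blast
  then show ?thesis using that by blast
 qed
 obtain J t where J: "\<zeta> = fin_sec J t" "finite J" "J \<subseteq> I" "\<forall>i\<in>J. t i \<in> gam (E i)"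
  using N(3) by (auto simp: fin_secs_def)
 show ?thesis
 proof (rule that)
  show "openin Y (U \<inter> {w \<in> topspace Y. p w \<in> N})"
   using U openin_continuous_map_preimage[OF sD(1) N(1)] by blast
  fix w assume w: "w \<in> U \<inter> {w \<in> topspace Y. p w \<in> N}"
  then have wY: "w \<in> topspace Y" by blast
  interpret Fw: hilb "fib F (p w)" using F.hilb_fib[OF sD(3)[OF wY]] .
  have "\<zeta> (p w) \<in> carrier (fib F (p w))" using N(3) fin_secs_gam F.gam_carrier sD(3)[OF wY] by blast
  then have "ndist (fib F (p w)) (s w) (\<zeta> (p w))
    \<le> ndist (fib F (p w)) (s w) (\<xi> (p w)) + ndist (fib F (p w)) (\<xi> (p w)) (\<zeta> (p w))"
   by (rule Fw.vnorm_diff_triangle[OF sD(2)[OF wY] F.gam_carrier[OF U(3) sD(3)[OF wY]]])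
  also have "\<dots> < e / 2 + e / 2"
   using U(4)[of w] N(4) w by (intro add_strict_mono) blast+
  finally have "ndist (fib F (p w)) (s w) (\<zeta> (p w)) < e" by simp
  then show "ndist (fib F (p w)) (s w) (fin_sec J t (p w)) < e" using J(1) by simp
 qed (use U y N J in auto)
qed

lemma cont_field_F_comp:
 assumes s: "cont_field X F Y p s" and i: "i \<in> I"
 shows "cont_field X (E i) Y p (\<lambda>y. s y i)"
 unfolding cont_field_def
proof (intro conjI ballI allI impI)
 note sD = F.cont_fieldD[OF s]
 interpret Ei: hbun X "E i" by (rule hbun_E[OF i])
 show "continuous_map Y X p" by (rule sD)
 show sc: "s y i \<in> carrier (fib (E i) (p y))" if "y \<in> topspace Y" for y
  using hilb_family.S_comp[OF hilb_family[OF sD(3)[OF that]] _ i] sD(2)[OF that] by simp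
 fix y and e :: real assume y: "y \<in> topspace Y" and e: "e > 0"
 obtain U J t where U: "openin Y U" "y \<in> U" "finite J" "J \<subseteq> I" "\<forall>i\<in>J. t i \<in> gam (E i)"
  "!!w. w \<in> U ==> ndist (fib F (p w)) (s w) (fin_sec J t (p w)) < e"
  using cont_field_F_approx[OF s y e] by blast
 define \<xi> where "\<xi> = (if i \<in> J then t i else (\<lambda>u\<in>topspace X. \<zero>\<^bsub>fib (E i) u\<^esub>))"
 have \<xi>: "\<xi> \<in> gam (E i)" using U Ei.gam_zero by (auto simp: \<xi>_def)
 have "ndist (fib (E i) (p w)) (s w i) (\<xi> (p w)) < e" if w: "w \<in> U" for w
 proof -
  have wY: "w \<in> topspace Y" using w U(1) openin_subset by blast
  interpret Fw: hilb_family I "fibs (p w)" by (rule hilb_family[OF sD(3)[OF wY]])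
  have c: "s w \<in> carrier Fw.S" "fin_sec J t (p w) \<in> carrier Fw.S"
   using sD(2)[OF wY] fin_sec_carrier[OF U(3-5) sD(3)[OF wY]] by auto
  have "fin_sec J t (p w) i = \<xi> (p w)" using i sD(3)[OF wY] by (simp add: fin_sec_def \<xi>_def)
  then have "ndist (fib (E i) (p w)) (s w i) (\<xi> (p w))
    \<le> ndist Fw.S (s w) (fin_sec J t (p w))"
   using Fw.S_comp_le[OF Fw.S.minus_closed[OF c] i] Fw.S_minus[OF c i] by simp
  then show ?thesis using U(6)[OF w] by simp
 qed
 then show "\<exists>U \<xi>. openin Y U \<and> y \<in> U \<and> \<xi> \<in> gam (E i) \<and>
   (\<forall>w\<in>U. ndist (fib (E i) (p w)) (s w i) (\<xi> (p w)) < e)"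
  using U \<xi> by blast
qed

lemma cont_field_F_finite:
 assumes J: "finite J" "J \<subseteq> I" and s: "!!i. i \<in> J ==> cont_field X (E i) Y p (s i)" and p: "continuous_map Y X p"
 shows "cont_field X F Y p (\<lambda>y. \<lambda>i\<in>I. if i \<in> J then s i y else \<zero>\<^bsub>fib (E i) (p y)\<^esub>)"
  (is "cont_field X F Y p ?s")
 unfolding cont_field_def
proof (intro conjI ballI allI impI p)
 have pX: "p y \<in> topspace X" if "y \<in> topspace Y" for y using p that by (auto simp: continuous_map_def)
 have str: "?s y = hilb_family.trunc I (fibs (p y)) J (\<lambda>i. s i y)" if "y \<in> topspace Y" for y
  using pX[OF that] by (simp add: hilb_family.trunc_def[OF hilb_family])
 show sc: "?s y \<in> carrier (fib F (p y))" if "y \<in> topspace Y" for y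
  unfolding str[OF that] fib_F
  using J pre_hbun.cont_fieldD(2)[OF pre_E s that]
  by (intro hilb_family.trunc_S[OF hilb_family[OF pX[OF that]]]) auto
 fix y and e :: real assume y: "y \<in> topspace Y" and e: "e > 0"
 define \<delta> where "\<delta> = e / (2 * (real (card J) + 1))"
 have d: "\<delta> > 0" using e by (simp add: \<delta>_def)
 have "\<exists>U \<xi>. openin Y U \<and> y \<in> U \<and> \<xi> \<in> gam (E i) \<and>
   (\<forall>w\<in>U. ndist (fib (E i) (p w)) (s i w) (\<xi> (p w)) < \<delta>)" if "i \<in> J" for i
  using s[OF that] y d by (simp add: cont_field_def)
 then obtain U t where U: "!!i. i \<in> J ==> openin Y (U i)" "!!i. i \<in> J ==> y \<in> U i" "!!i. i \<in> J ==> t i \<in> gam (E i)"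
  "!!i w. i \<in> J ==> w \<in> U i ==> ndist (fib (E i) (p w)) (s i w) (t i (p w)) < \<delta>"
  by metis
 let ?N = "topspace Y \<inter> (\<Inter>i\<in>J. U i)"
 have "openin Y ?N"
  using J U(1) by (cases "J = {}") (auto intro!: openin_Int openin_Inter)
 moreover have "ndist (fib F (p w)) (?s w) (fin_sec J t (p w)) < e" if w: "w \<in> ?N" for w
 proof -
  have wY: "w \<in> topspace Y" using w by blast
  interpret Fw: hilb_family I "fibs (p w)" by (rule hilb_family[OF pX[OF wY]])
  have c: "?s w \<in> carrier Fw.S" "fin_sec J t (p w) \<in> carrier Fw.S"
   using sc[OF wY] fin_sec_carrier[OF J _ pX[OF wY], of t] U(3) by auto
  have "ndist Fw.S (?s w) (fin_sec J t (p w)) \<le> (real (card J) + 1) * \<delta>"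
  proof (rule Fw.vnorm_finite_support)
   fix i assume i: "i \<in> I"
   interpret Vi: hilb "fib (E i) (p w)" using Fw.hilb_V[OF i] .
   show "vnorm (fib (E i) (p w)) ((?s w \<ominus>\<^bsub>Fw.S\<^esub> fin_sec J t (p w)) i) \<le> \<delta>" if "i \<in> J"
    using U(4)[OF that, of w] w that i pX[OF wY] by (simp add: Fw.S_minus[OF c i]) (simp add: fin_sec_def)
   show "(?s w \<ominus>\<^bsub>Fw.S\<^esub> fin_sec J t (p w)) i = \<zero>\<^bsub>fib (E i) (p w)\<^esub>" if "i \<notin> J"
    using that i pX[OF wY] by (simp add: Fw.S_minus[OF c i]) (simp add: fin_sec_def)
  qed (use J d c in auto)
  also have "\<dots> = e / 2" by (simp add: \<delta>_def field_simps)
  also have "\<dots> < e" using e by simp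
  finally show ?thesis by simp
 qed
 moreover have "fin_sec J t \<in> gam F"
  by (rule subsetD[OF fin_secs_gam]) (use J U(3) in \<open>unfold fin_secs_def, blast\<close>)
 ultimately show "\<exists>U \<xi>. openin Y U \<and> y \<in> U \<and> \<xi> \<in> gam F \<and>
   (\<forall>w\<in>U. ndist (fib F (p w)) (?s w) (\<xi> (p w)) < e)"
  using U(2) y by (intro exI[of _ ?N] exI[of _ "fin_sec J t"]) auto
qed

end

section \<open>Locally compact Hausdorff spaces\<close>

locale lch =
 fixes X :: "'a topology"
 assumes locally_compact: "locally_compact_space X" and hausdorff: "Hausdorff_space X"
begin

lemma completely_regular: "completely_regular_space X"
 using locally_compact_regular_imp_completely_regular_space[OF locally_compact] hausdorff by blast

lemma compact_nbhd:
 assumes "compactin X K"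
 obtains U L where "openin X U" "compactin X L" "K \<subseteq> U" "U \<subseteq> L"
 using locally_compact_space_compact_closed_compact[of X] locally_compact hausdorff assms by meson

lemma cutoff:
 assumes K: "compactin X K" and W: "openin X W" "K \<subseteq> W"
 obtains \<kappa> L where "continuous_map X euclideanreal \<kappa>" "compactin X L"
  "!!x. x \<in> topspace X ==> 0 \<le> \<kappa> x \<and> \<kappa> x \<le> 1" "!!x. x \<in> K ==> \<kappa> x = 1"
  "!!x. x \<in> topspace X ==> \<kappa> x \<noteq> 0 ==> x \<in> W \<and> x \<in> L"
proof -
 obtain U L where U: "openin X U" "compactin X L" "K \<subseteq> U" "U \<subseteq> L" using compact_nbhd[OF K] .
 have "closedin X (topspace X - U \<inter> W)" using U W by (intro closedin_diff) auto
 moreover have "disjnt K (topspace X - U \<inter> W)" using U W by (auto simp: disjnt_iff)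
 ultimately obtain f where f: "continuous_map X (top_of_set {0..1}) f"
  "f ` (topspace X - U \<inter> W) \<subseteq> {0::real}" "f ` K \<subseteq> {1}"
  using Urysohn_completely_regular_compact_closed[OF zero_le_one completely_regular K] by metis
 have f01: "continuous_map X euclideanreal f" "!!x. x \<in> topspace X ==> 0 \<le> f x \<and> f x \<le> 1"
  using f(1) by (auto simp: continuous_map_in_subtopology Pi_iff image_subset_iff)
 show ?thesis
 proof (rule that[OF f01(1) U(2) f01(2)])
  fix x assume "x \<in> topspace X" "f x \<noteq> 0"
  then show "x \<in> W \<and> x \<in> L" using f(2) U(4) by auto
 qed (use f(3) in auto)
qed

text \<open>Extension from a closed set is possible for functions vanishing off a compact set: extend from
 the compact part of the closed set near the support, and multiply by a cutoff function.\<close>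

lemma tietze_compact_support:
 fixes f :: "'a \<Rightarrow> real"
 assumes S: "closedin X S" and f: "continuous_map (subtopology X S) euclideanreal f"
  and K: "compactin X K" and supp: "!!x. x \<in> S ==> f x \<noteq> 0 ==> x \<in> K"
 obtains F L where "continuous_map X euclideanreal F" "compactin X L"
  "!!x. x \<in> topspace X ==> F x \<noteq> 0 ==> x \<in> L" "!!x. x \<in> S ==> F x = f x"
proof -
 have KS: "compactin X (K \<inter> S)" using K S by (rule compact_Int_closedin)
 obtain \<kappa> L where chi: "continuous_map X euclideanreal \<kappa>" "compactin X L"
  "!!x. x \<in> K \<inter> S ==> \<kappa> x = 1" "!!x. x \<in> topspace X ==> \<kappa> x \<noteq> 0 ==> x \<in> topspace X \<and> x \<in> L"
  by (rule cutoff[OF KS openin_topspace compactin_subset_topspace[OF KS]]) blast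
 have LS: "compactin X (L \<inter> S)" using chi(2) S by (rule compact_Int_closedin)
 have "continuous_map (subtopology X (L \<inter> S)) euclideanreal f"
  using continuous_map_from_subtopology_mono[OF f] by blast
 then obtain g where g: "continuous_map X euclideanreal g" "!!x. x \<in> L \<inter> S ==> g x = f x"
  by (rule Tietze_extension_completely_regular[OF completely_regular LS is_interval_univ UNIV_not_empty
     _ subset_UNIV]) blast
 show ?thesis
 proof (rule that)
  show "continuous_map X euclideanreal (\<lambda>x. \<kappa> x * g x)"
   using chi(1) g(1) by (rule continuous_map_real_mult)
  show "x \<in> topspace X ==> \<kappa> x * g x \<noteq> 0 ==> x \<in> L" for x using chi(4) by auto
  fix x assume x: "x \<in> S"
  then have xX: "x \<in> topspace X" using S closedin_subset by blast
  show "\<kappa> x * g x = f x"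
  proof (cases "x \<in> K")
   case True
   then have "\<kappa> x = 1" using chi(3) x by blast
   then show ?thesis using chi(4)[OF xX] g(2) x by simp
  next
   case False
   then have "f x = 0" using supp x by blast
   then show ?thesis using chi(4)[OF xX] g(2) x by (cases "\<kappa> x = 0") auto
  qed
 qed (rule chi(2))
qed

lemma partition_of_unity:
 assumes K: "compactin X K" and W: "openin X W" "K \<subseteq> W"
  and O: "!!x. x \<in> K ==> openin X (O' x) \<and> x \<in> O' x"
 obtains J b where "finite J" "J \<subseteq> K" "!!j. j \<in> J ==> continuous_map X euclideanreal (b j)"
  "!!j x. j \<in> J ==> x \<in> topspace X ==> 0 \<le> b j x"
  "!!j x. j \<in> J ==> x \<in> topspace X ==> b j x \<noteq> 0 ==> x \<in> O' j \<and> x \<in> W"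
  "!!x. x \<in> topspace X ==> (\<Sum>j\<in>J. b j x) \<le> 1" "!!x. x \<in> K ==> (\<Sum>j\<in>J. b j x) = (1::real)"
proof -
 have KX: "K \<subseteq> topspace X" using compactin_subset_topspace[OF K] .
 have "\<exists>\<phi>. continuous_map X euclideanreal \<phi> \<and> (\<forall>y\<in>topspace X. 0 \<le> \<phi> y) \<and> \<phi> x = 1 \<and>
   (\<forall>y\<in>topspace X. \<phi> y \<noteq> 0 --> y \<in> O' x \<and> y \<in> W)" if x: "x \<in> K" for x
 proof -
  have "compactin X {x}" using x KX by auto
  moreover have "openin X (O' x \<inter> W)" "{x} \<subseteq> O' x \<inter> W" using O[OF x] W x by auto
  ultimately obtain \<phi> L where "continuous_map X euclideanreal \<phi>" "compactin X L"
   "!!y. y \<in> topspace X ==> 0 \<le> \<phi> y \<and> \<phi> y \<le> 1" "!!y. y \<in> {x} ==> \<phi> y = 1"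
   "!!y. y \<in> topspace X ==> \<phi> y \<noteq> 0 ==> y \<in> O' x \<inter> W \<and> y \<in> L"
   by (rule cutoff) blast
  then show ?thesis by (intro exI[of _ \<phi>]) auto
 qed
 then have "\<exists>\<phi>. \<forall>x\<in>K. continuous_map X euclideanreal (\<phi> x) \<and> (\<forall>y\<in>topspace X. 0 \<le> \<phi> x y) \<and>
   \<phi> x x = 1 \<and> (\<forall>y\<in>topspace X. \<phi> x y \<noteq> 0 --> y \<in> O' x \<and> y \<in> W)"
  by (intro bchoice) simp
 then obtain \<phi> where \<phi>: "!!x. x \<in> K ==> continuous_map X euclideanreal (\<phi> x)"
  "!!x y. x \<in> K ==> y \<in> topspace X ==> 0 \<le> \<phi> x y" "!!x. x \<in> K ==> \<phi> x x = (1::real)"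
  "!!x y. x \<in> K ==> y \<in> topspace X ==> \<phi> x y \<noteq> 0 ==> y \<in> O' x \<and> y \<in> W" by blast
 define N where "N x = {y \<in> topspace X. \<phi> x y \<in> {1/2<..}}" for x
 have N: "openin X (N x)" "x \<in> N x" if "x \<in> K" for x
 proof -
  show "openin X (N x)" unfolding N_def
   by (rule openin_continuous_map_preimage[OF \<phi>(1)[OF that]]) (simp del: greaterThan_iff)
  show "x \<in> N x" using \<phi>(3)[OF that] that KX by (auto simp: N_def)
 qed
 obtain \<F> where F: "finite \<F>" "\<F> \<subseteq> N ` K" "K \<subseteq> \<Union>\<F>"
  using compactinD[OF K, of "N ` K"] N by blast
 obtain J where J: "finite J" "J \<subseteq> K" "K \<subseteq> (\<Union>x\<in>J. N x)"
  using finite_subset_image[OF F(1,2)] F(3) by auto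
 define \<Phi> where "\<Phi> y = (\<Sum>x\<in>J. \<phi> x y)" for y
 have Phi0: "0 \<le> \<Phi> y" if "y \<in> topspace X" for y
  unfolding \<Phi>_def using \<phi>(2) J that by (intro sum_nonneg) auto
 have PhiK: "1/2 \<le> \<Phi> y" if y: "y \<in> K" for y
 proof -
  obtain x where x: "x \<in> J" "y \<in> N x" using J y by blast
  have yX: "y \<in> topspace X" using y KX by blast
  have "\<phi> x y \<le> \<Phi> y" unfolding \<Phi>_def
   using x J \<phi>(2) yX by (intro member_le_sum) auto
  then show ?thesis using x by (simp add: N_def)
 qed
 have Phic: "continuous_map X euclideanreal \<Phi>"
  unfolding \<Phi>_def[abs_def] using J \<phi>(1) by (intro continuous_map_sum) auto
 have summ: "(\<Sum>j\<in>J. \<phi> j x / max (1/2) (\<Phi> x)) = \<Phi> x / max (1/2) (\<Phi> x)" for x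
  by (simp add: \<Phi>_def sum_divide_distrib)
 show ?thesis
 proof (rule that[of J "\<lambda>x y. \<phi> x y / max (1/2) (\<Phi> y)"])
  show "continuous_map X euclideanreal (\<lambda>y. \<phi> j y / max (1/2) (\<Phi> y))" if "j \<in> J" for j
   using that J \<phi>(1) Phic
   by (intro continuous_map_real_divide continuous_map_real_max) (auto simp: less_max_iff_disj dest: sym)
  show "(\<Sum>j\<in>J. \<phi> j x / max (1/2) (\<Phi> x)) \<le> 1" if "x \<in> topspace X" for x
   unfolding summ using Phi0[OF that] by (subst divide_le_eq_1_pos) auto
  show "(\<Sum>j\<in>J. \<phi> j x / max (1/2) (\<Phi> x)) = 1" if "x \<in> K" for x
   unfolding summ using PhiK[OF that] by simp
  show "0 \<le> \<phi> j x / max (1/2) (\<Phi> x)" if "j \<in> J" "x \<in> topspace X" for j x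
   using \<phi>(2)[of j x] that J by (intro divide_nonneg_pos) auto
  show "x \<in> O' j \<and> x \<in> W" if "j \<in> J" "x \<in> topspace X" "\<phi> j x / max (1/2) (\<Phi> x) \<noteq> 0" for j x
   using \<phi>(4)[of j x] that J by auto
 qed (use J in auto)
qed

lemma CcI:
 assumes "continuous_map X euclidean f" "compactin X K" "!!x. x \<in> topspace X ==> f x \<noteq> 0 ==> x \<in> K"
 shows "f \<in> Cc X"
proof -
 have "closedin X K" using compactin_imp_closedin[OF hausdorff assms(2)] .
 then have "X closure_of {x \<in> topspace X. f x \<noteq> 0} \<subseteq> K"
  using assms(3) by (intro closure_of_minimal) auto
 then have "compactin X (X closure_of {x \<in> topspace X. f x \<noteq> 0})"
  by (rule closed_compactin[OF assms(2) _ closedin_closure_of])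
 then show ?thesis using assms(1) by (simp add: Cc_def)
qed

end

section \<open>Radon measures\<close>

lemma borel_of_props: "space (borel_of X) = topspace X" "openin X U ==> U \<in> sets (borel_of X)"
proof -
 have "{U. openin X U} \<subseteq> Pow (topspace X)" by (auto dest: openin_subset)
 then show "space (borel_of X) = topspace X" "openin X U ==> U \<in> sets (borel_of X)"
  unfolding borel_of_def by (auto simp: space_measure_of intro: sigma_sets.Basic)
qed

locale radon = lch X for X :: "'a topology" +
 fixes M :: "'a measure"
 assumes radon: "radon_measure X M"
begin

lemma sets_M: "sets M = sets (borel_of X)"
 using radon by (simp add: radon_measure_def)

lemma space_M: "space M = topspace X"
 using sets_eq_imp_space_eq[OF sets_M] borel_of_props(1)[of X] by (simp add: )

lemma openin_sets: "openin X U ==> U \<in> sets M"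
 using sets_M borel_of_props(2) by auto

lemma closedin_sets: "closedin X C ==> C \<in> sets M"
 using openin_sets[of "topspace X - C"] sets.compl_sets[of "topspace X - C" M] closedin_subset[of X C]
 by (simp add: space_M closedin_def double_diff)

lemma compactin_sets: "compactin X K ==> K \<in> sets M"
 using closedin_sets compactin_imp_closedin[OF hausdorff] by blast

lemma compactin_finite: "compactin X K ==> emeasure M K < \<infinity>"
 using radon by (simp add: radon_measure_def)

lemma continuous_measurable:
 fixes f :: "'a \<Rightarrow> 'b::topological_space"
 assumes "continuous_map X euclidean f"
 shows "f \<in> borel_measurable M"
proof (rule borel_measurableI)
 fix S :: "'b set" assume "open S"
 then have "openin X {x \<in> topspace X. f x \<in> S}"
  using openin_continuous_map_preimage[OF assms, of S] by simp
 moreover have "f -` S \<inter> space M = {x \<in> topspace X. f x \<in> S}" by (auto simp: space_M)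
 ultimately show "f -` S \<inter> space M \<in> sets M" using openin_sets by simp
qed

lemma integrable_compact:
 fixes f :: "'a \<Rightarrow> 'b::{banach, second_countable_topology}"
 assumes f: "continuous_map X euclidean f" and K: "compactin X K"
  and supp: "!!x. x \<in> topspace X ==> f x \<noteq> 0 ==> x \<in> K"
 shows "integrable M f"
proof -
 have "compact (f ` K)" using image_compactin[OF K f] by simp
 then have "bounded (f ` K)" by (rule compact_imp_bounded)
 then obtain B where B: "!!x. x \<in> K ==> norm (f x) \<le> B"
  by (auto simp: bounded_iff)
 show ?thesis
 proof (rule integrableI_bounded_set[of K])
  show "AE x in M. x \<in> K --> norm (f x) \<le> B" using B by auto
  show "AE x in M. x \<notin> K --> f x = 0" using supp by (intro AE_I2) (auto simp: space_M)
 qed (use continuous_measurable[OF f] compactin_sets[OF K] compactin_finite[OF K] in auto)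
qed

lemma emeasure_open_SUP:
 "openin X U ==> emeasure M U = (SUP K\<in>{K. compactin X K \<and> K \<subseteq> U}. emeasure M K)"
 using radon by (simp add: radon_measure_def)

text \<open>By inner regularity the complement of the support is a null set: a compact subset of it is
 covered by finitely many open null sets.\<close>

lemma AE_support: "AE x in M. x \<in> measure_support X M"
proof -
 let ?U = "topspace X - measure_support X M"
 have ex: "\<exists>U. openin X U \<and> x \<in> U \<and> emeasure M U = 0" if "x \<in> ?U" for x
  using that by (auto simp: measure_support_def)
 have disj: "U \<subseteq> ?U" if "openin X U" "emeasure M U = 0" for U
  using that openin_subset[OF that(1)] by (auto simp: measure_support_def)
 have op: "openin X ?U"
  unfolding openin_subopen[of X ?U] using ex disj by meson
 have "emeasure M K = 0" if K: "compactin X K" "K \<subseteq> ?U" for K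
 proof -
  have "K \<subseteq> \<Union>{U. openin X U \<and> emeasure M U = 0}"
   using ex K(2) by fast
  then obtain \<F> where F: "finite \<F>" "\<F> \<subseteq> {U. openin X U \<and> emeasure M U = 0}" "K \<subseteq> \<Union>\<F>"
   using compactinD[OF K(1), of "{U. openin X U \<and> emeasure M U = 0}"] by auto
  have "\<Union>\<F> \<in> null_sets M"
   using F openin_sets by (intro null_sets.finite_Union) (auto simp: null_sets_def)
  then show ?thesis
   using emeasure_mono[OF F(3), of M] by (simp add: null_sets_def)
 qed
 then have "(SUP K\<in>{K. compactin X K \<and> K \<subseteq> ?U}. emeasure M K) \<le> 0"
  by (intro SUP_least) simp
 then have "emeasure M ?U = 0"
  using emeasure_open_SUP[OF op] by simp
 then have "?U \<in> null_sets M" using openin_sets[OF op] by (simp add: null_sets_def)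
 then show ?thesis by (rule AE_I') (auto simp: space_M)
qed

lemma integral_cong_support:
 assumes "f \<in> borel_measurable M" "g \<in> borel_measurable M"
  "!!x. x \<in> measure_support X M ==> f x = g x"
 shows "integral\<^sup>L M f = integral\<^sup>L M g"
 by (rule integral_cong_AE) (use assms AE_support in \<open>auto elim: eventually_mono\<close>)

text \<open>Positivity needs a point of the support: a neighbourhood of it has positive measure.\<close>

lemma integral_pos:
 fixes f :: "'a \<Rightarrow> real"
 assumes f: "continuous_map X euclidean f" and K: "compactin X K"
  and supp: "!!x. x \<in> topspace X ==> f x \<noteq> 0 ==> x \<in> K"
  and nonneg: "!!x. x \<in> topspace X ==> 0 \<le> f x" and x: "x \<in> measure_support X M" "f x > 0"
 shows "integral\<^sup>L M f > 0"
proof (rule ccontr)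
 assume "\<not> ?thesis"
 moreover have int: "integrable M f" using integrable_compact[OF f K supp] .
 moreover have nn: "AE x in M. 0 \<le> f x" using nonneg by (intro AE_I2) (simp add: space_M)
 ultimately have "integral\<^sup>L M f = 0" using integral_nonneg_AE[OF nn] by simp
 then have 0: "AE x in M. f x = 0" using integral_nonneg_eq_0_iff_AE[OF int nn] by simp
 let ?U = "{y \<in> topspace X. f y \<in> {0<..}}"
 have "openin X ?U" using openin_continuous_map_preimage[OF f, of "{0<..}"] by (simp add: )
 moreover have "x \<in> ?U" using x by (auto simp: measure_support_def)
 ultimately have "emeasure M ?U > 0" using x by (auto simp: measure_support_def)
 moreover have "?U \<in> null_sets M"
 proof -
  have "AE x in M. x \<notin> ?U" using 0 by (rule eventually_mono) auto
  then show ?thesis using openin_sets[OF \<open>openin X ?U\<close>] by (simp add: AE_iff_null_sets)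
 qed
 ultimately show False by (simp add: null_sets_def)
qed

lemma integral_bound_support:
 fixes f :: "'a \<Rightarrow> complex"
 assumes "integrable M f" "integrable M g" "!!x. x \<in> measure_support X M ==> cmod (f x) \<le> g x"
 shows "cmod (integral\<^sup>L M f) \<le> integral\<^sup>L M g"
proof -
 have "cmod (integral\<^sup>L M f) \<le> (LINT x|M. cmod (f x))" by (rule integral_norm_bound)
 also have "\<dots> \<le> integral\<^sup>L M g"
  by (rule integral_mono_AE) (use assms AE_support in \<open>auto elim: eventually_mono\<close>)
 finally show ?thesis .
qed

text \<open>Translates by an element of a groupoid make sense on one fibre only; extended by \<open>0\<close> they are still
 Borel functions.\<close>

lemma closed_indicator_measurable:
 fixes g :: "'a \<Rightarrow> complex"
 assumes S: "closedin X S" and g: "continuous_map (subtopology X S) euclidean g"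
 shows "(\<lambda>x. indicator S x *\<^sub>R g x) \<in> borel_measurable M"
proof (rule borel_measurableI)
 fix B :: "complex set" assume "open B"
 then have "openin (subtopology X S) {x \<in> topspace (subtopology X S). g x \<in> B}"
  using openin_continuous_map_preimage[OF g, of B] by simp
 then obtain T where T: "openin X T" "{x \<in> topspace (subtopology X S). g x \<in> B} = T \<inter> S"
  by (auto simp: openin_subtopology)
 have SX: "S \<subseteq> topspace X" using closedin_subset[OF S] .
 have "(\<lambda>x. indicator S x *\<^sub>R g x) -` B \<inter> space M
   = (T \<inter> S) \<union> (if 0 \<in> B then topspace X - S else {})"
  using T(2) SX by (auto simp: space_M indicator_def of_bool_def split: if_splits)
 moreover have "T \<in> sets M" "S \<in> sets M" "topspace X - S \<in> sets M"
  using openin_sets[OF T(1)] closedin_sets[OF S] openin_sets[OF openin_diff[OF openin_topspace S]] by auto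
 ultimately show "(\<lambda>x. indicator S x *\<^sub>R g x) -` B \<inter> space M \<in> sets M" by auto
qed

end

section \<open>Groupoids\<close>

locale gpd =
 fixes G :: "'g groupoid_data"
 assumes gpd: "groupoid G"
begin

abbreviation "A \<equiv> arrows G"
abbreviation "r \<equiv> rng_of G"
abbreviation "d \<equiv> dom_of G"
abbreviation "U0 \<equiv> unit_space G"
abbreviation mul (infixl "\<cdot>" 70) where "x \<cdot> y \<equiv> gmul G x y"
abbreviation "inv' \<equiv> ginv G"

lemma inv_closed [simp]: "x \<in> A ==> inv' x \<in> A"
 and inv_inv [simp]: "x \<in> A ==> inv' (inv' x) = x"
 using gpd by (auto simp: groupoid_def)

lemma r_inv [simp]: "x \<in> A ==> r (inv' x) = d x"
 and d_inv [simp]: "x \<in> A ==> d (inv' x) = r x"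
 by (simp_all add: rng_of_def dom_of_def)

lemma composable_iff: "(x, y) \<in> composable G \<longleftrightarrow> x \<in> A \<and> y \<in> A \<and> d x = r y"
 by (simp add: composable_def)

lemma mul_closed [simp]: "x \<in> A ==> y \<in> A ==> d x = r y ==> x \<cdot> y \<in> A"
 using gpd by (auto simp: groupoid_def composable_iff)

lemma mul_props:
 assumes "x \<in> A" "y \<in> A" "z \<in> A" "d x = r y" "d y = r z"
 shows "d (x \<cdot> y) = r z" "r (y \<cdot> z) = d x" "x \<cdot> y \<cdot> z = x \<cdot> (y \<cdot> z)"
proof -
 have "\<forall>x y z. (x, y) \<in> composable G --> (y, z) \<in> composable G -->
    (gmul G x y, z) \<in> composable G \<and> (x, gmul G y z) \<in> composable G \<and>
    gmul G (gmul G x y) z = gmul G x (gmul G y z)"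
  using gpd unfolding groupoid_def by (elim conjE)
 from this[rule_format, of x y z] assms
 show "d (x \<cdot> y) = r z" "r (y \<cdot> z) = d x" "x \<cdot> y \<cdot> z = x \<cdot> (y \<cdot> z)"
  by (simp_all add: composable_iff)
qed

lemma cancel:
 assumes "x \<in> A" "y \<in> A" "d x = r y"
 shows "inv' x \<cdot> (x \<cdot> y) = y" "x \<cdot> y \<cdot> inv' y = x"
proof -
 have "\<forall>(x, y)\<in>composable G. gmul G (ginv G x) (gmul G x y) = y \<and>
    gmul G (gmul G x y) (ginv G y) = x"
  using gpd unfolding groupoid_def by (elim conjE)
 from bspec[OF this, of "(x, y)"] assms
 show "inv' x \<cdot> (x \<cdot> y) = y" "x \<cdot> y \<cdot> inv' y = x"
  by (simp_all add: composable_iff)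
qed

lemma d_mul [simp]: "x \<in> A ==> y \<in> A ==> d x = r y ==> d (x \<cdot> y) = d y"
 using mul_props(1)[of x y "inv' y"] by simp

lemma r_mul [simp]: "x \<in> A ==> y \<in> A ==> d x = r y ==> r (x \<cdot> y) = r x"
 using mul_props(2)[of "inv' x" x y] by simp

lemma assoc: "x \<in> A ==> y \<in> A ==> z \<in> A ==> d x = r y ==> d y = r z ==> x \<cdot> y \<cdot> z = x \<cdot> (y \<cdot> z)"
 by (rule mul_props(3))

lemma cancel2: "x \<in> A ==> z \<in> A ==> r x = r z ==> x \<cdot> (inv' x \<cdot> z) = z"
 using cancel(1)[of "inv' x" z] by simp

lemma mul_inv_self [simp]: "x \<cdot> inv' x = r x" "inv' x \<cdot> x = d x"
 by (simp_all add: rng_of_def dom_of_def)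

lemma r_closed [simp]: "x \<in> A ==> r x \<in> A"
 using mul_closed[of x "inv' x"] by simp

lemma r_mul_left [simp]: "x \<in> A ==> r x \<cdot> x = x"
 using cancel(2)[of x "inv' x"] by simp

lemma d_mul_right [simp]: "x \<in> A ==> x \<cdot> d x = x"
 using cancel(1)[of "inv' x" x] by simp

lemma unitE:
 assumes "u \<in> U0"
 shows "u \<in> A" "r u = u" "d u = u" "inv' u = u"
proof -
 obtain x where x: "x \<in> A" "u = r x" using assms by (auto simp: unit_space_def)
 show "u \<in> A" using x by simp
 show ru: "r u = u" using x r_mul[of x "inv' x"] by simp
 show du: "d u = u" using x d_mul[of x "inv' x"] by simp
 have "inv' u \<cdot> u = u" using du by simp
 moreover have "inv' u \<cdot> u = inv' u"
  using d_mul_right[of "inv' u"] \<open>u \<in> A\<close> ru by simp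
 ultimately show "inv' u = u" by simp
qed

lemma unitI [simp]: "x \<in> A ==> r x \<in> U0" "x \<in> A ==> d x \<in> U0"
 by (auto simp: unit_space_def) (metis imageI inv_closed r_inv)

end

locale tgpd = lch "gtop G" for G :: "'g groupoid_data" +
 assumes tgpd: "topological_groupoid G"
begin

sublocale gpd G using tgpd by unfold_locales (simp add: topological_groupoid_def)

lemma continuous_inv: "continuous_map (gtop G) (gtop G) inv'"
 using tgpd by (simp add: topological_groupoid_def)

lemma continuous_mul:
 assumes "continuous_map Y (gtop G) f" "continuous_map Y (gtop G) g" "!!y. y \<in> topspace Y ==> d (f y) = r (g y)"
 shows "continuous_map Y (gtop G) (\<lambda>y. f y \<cdot> g y)"
proof -
 have "continuous_map Y (subtopology (prod_topology (gtop G) (gtop G)) (composable G)) (\<lambda>y. (f y, g y))"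
 proof -
  have "f y \<in> A" "g y \<in> A" if "y \<in> topspace Y" for y
   using assms(1,2) that by (auto simp: continuous_map_def)
  then show ?thesis
   using assms by (auto simp: continuous_map_in_subtopology continuous_map_pairedI composable_iff)
 qed
 moreover have "continuous_map (subtopology (prod_topology (gtop G) (gtop G)) (composable G)) (gtop G)
   (\<lambda>(x, y). x \<cdot> y)"
  using tgpd by (simp add: topological_groupoid_def)
 ultimately have "continuous_map Y (gtop G) ((\<lambda>(x, y). x \<cdot> y) \<circ> (\<lambda>y. (f y, g y)))"
  by (rule continuous_map_compose)
 then show ?thesis by (simp add: o_def)
qed

lemma topspace_unit_top [simp]: "topspace (unit_top G) = U0"
 using unitE(1) by (auto simp: unit_top_def)

lemma continuous_r: "continuous_map (gtop G) (unit_top G) r"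
proof -
 have "continuous_map (gtop G) (gtop G) (\<lambda>x. x \<cdot> inv' x)"
  by (rule continuous_mul[OF continuous_map_id[unfolded id_def] continuous_inv]) simp
 then have "continuous_map (gtop G) (gtop G) r" by simp
 then show ?thesis unfolding unit_top_def continuous_map_in_subtopology by auto
qed

lemma continuous_d: "continuous_map (gtop G) (unit_top G) d"
proof -
 have "continuous_map (gtop G) (unit_top G) (r \<circ> inv')"
  by (rule continuous_map_compose[OF continuous_inv continuous_r])
 then show ?thesis by (rule continuous_map_eq) simp
qed

lemma Hausdorff_unit_top: "Hausdorff_space (unit_top G)"
 unfolding unit_top_def by (rule Hausdorff_space_subtopology[OF hausdorff])

lemma closedin_unit_space: "closedin (gtop G) U0"
proof -
 have "continuous_map (gtop G) (gtop G) r"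
  using continuous_r by (simp add: unit_top_def continuous_map_in_subtopology)
 then have "closedin (gtop G) {x \<in> A. r x = x}"
  using closedin_continuous_maps_eq[OF hausdorff, of "gtop G" r "\<lambda>x. x"] by simp
 moreover have "{x \<in> A. r x = x} = U0"
 proof (intro equalityI subsetI)
  fix x assume "x \<in> {x \<in> A. r x = x}"
  then show "x \<in> U0" using unitI(1)[of x] by simp
 next
  fix x assume "x \<in> U0"
  then show "x \<in> {x \<in> A. r x = x}" using unitE(1,2)[of x] by simp
 qed
 ultimately show ?thesis by simp
qed

sublocale U: lch "unit_top G"
 by unfold_locales (use Hausdorff_unit_top closedin_unit_space locally_compact
   in \<open>auto simp: unit_top_def intro: locally_compact_space_closed_subset\<close>)

lemma closedin_range_fibre: "u \<in> U0 ==> closedin (gtop G) (range_fibre G u)"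
 using closedin_continuous_map_preimage[OF continuous_r, of "{u}"] closedin_Hausdorff_singleton[OF Hausdorff_unit_top, of u]
 by (simp add: range_fibre_def)

end

section \<open>Coset spaces\<close>

locale coset_setting = tgpd G for G :: "'g groupoid_data" +
 fixes H :: "'g set" and lamH :: "'g \<Rightarrow> 'g measure" and \<mu> :: "'g \<Rightarrow> 'g set measure"
 assumes wide: "wide_subgroupoid G H" and closed_H: "closedin (gtop G) H"
  and haar: "haar_system (restrict_groupoid G H) lamH"
  and full: "full_equivariant_system G H \<mu>"
begin

abbreviation "HG \<equiv> restrict_groupoid G H"
abbreviation "q \<equiv> coset G H"
abbreviation "CS \<equiv> coset_space G H"
abbreviation "TH \<equiv> subtopology (gtop G) H"

lemma rH: "continuous_map TH (unit_top G) r" and dH: "continuous_map TH (unit_top G) d"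
 by (rule continuous_map_from_subtopology[OF continuous_r] continuous_map_from_subtopology[OF continuous_d])+

lemma H_sub: "h \<in> H ==> h \<in> A"
 and H_inv [simp]: "h \<in> H ==> inv' h \<in> H"
 using wide by (auto simp: wide_subgroupoid_def subgroupoid_def)

lemma H_mul: "h \<in> H ==> k \<in> H ==> d h = r k ==> h \<cdot> k \<in> H"
proof -
 assume hk: "h \<in> H" "k \<in> H" "d h = r k"
 have "\<forall>x\<in>H. \<forall>y\<in>H. (x, y) \<in> composable G --> x \<cdot> y \<in> H"
  using wide unfolding wide_subgroupoid_def subgroupoid_def by (elim conjE)
 then show ?thesis using hk H_sub by (simp add: composable_iff)
qed

lemma HG_simps [simp]:
 "gtop HG = TH" "rng_of HG = r" "dom_of HG = d" "gmul HG = gmul G" "ginv HG = ginv G"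
 by (simp_all add: restrict_groupoid_def rng_of_def dom_of_def fun_eq_iff del: mul_inv_self)

lemma topspace_HG [simp]: "A \<inter> H = H"
 using H_sub by auto

lemma unit_space_HG [simp]: "unit_space HG = U0"
 using wide by (simp add: wide_subgroupoid_def)

lemma unit_H: "u \<in> U0 ==> u \<in> H"
proof -
 assume "u \<in> U0"
 then have "u \<in> unit_space HG" by (simp only: unit_space_HG)
 then obtain h where h: "h \<in> H" "u = r h" unfolding unit_space_def by auto
 have "h \<cdot> inv' h \<in> H" by (rule H_mul) (use h H_sub in simp_all)
 then show ?thesis using h by simp
qed

lemma unit_top_HG [simp]: "unit_top HG = unit_top G"
proof -
 have "H \<inter> U0 = U0" using unit_H by auto
 then show ?thesis by (simp add: unit_top_def subtopology_subtopology)
qed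

lemma composable_HG: "(h, k) \<in> composable HG \<longleftrightarrow> h \<in> H \<and> k \<in> H \<and> d h = r k"
 by (simp add: composable_def)

sublocale HT: lch "TH"
 by unfold_locales (use closed_H locally_compact hausdorff in
   \<open>auto intro: locally_compact_space_closed_subset Hausdorff_space_subtopology\<close>)

lemma radon_lamH: "u \<in> U0 ==> radon TH (lamH u)"
 using haar by unfold_locales (auto simp: haar_system_def)

lemma support_lamH: "u \<in> U0 ==> measure_support TH (lamH u) = {h \<in> H. r h = u}"
 using haar by (auto simp: haar_system_def range_fibre_def)

lemma haar_continuous: "f \<in> Cc TH ==>
  continuous_map (unit_top G) euclidean (\<lambda>u. LINT h|lamH u. f h)"
 using haar by (simp add: haar_system_def)

lemma haar_invariant: "f \<in> Cc TH ==> k \<in> H ==>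
  (LINT h:{h \<in> H. r h = d k}|lamH (d k). f (k \<cdot> h)) = (LINT h|lamH (r k). f h)"
 using haar by (simp add: haar_system_def range_fibre_def)

lemma haar_continuous_real:
 assumes f: "continuous_map TH euclideanreal f" "compactin TH K"
  "!!x. x \<in> H ==> f x \<noteq> 0 ==> x \<in> K"
 shows "continuous_map (unit_top G) euclideanreal (\<lambda>u. LINT h|lamH u. f h)"
proof -
 have "(\<lambda>h. complex_of_real (f h)) \<in> Cc TH"
  using f by (intro HT.CcI[OF continuous_map_of_real f(2)]) auto
 from continuous_map_ceuclid(4)[OF haar_continuous[OF this] haar_continuous[OF this]]
 show ?thesis by simp
qed

text \<open>Since the measures of the Haar system are supported on whole fibres and vary continuously, the
 range map of \<open>H\<close> is open.\<close>

lemma open_r_H: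
 assumes U: "openin TH U"
 shows "openin (unit_top G) (r ` U)"
 unfolding openin_subopen[of "unit_top G" "r ` U"]
proof
 fix u0 assume "u0 \<in> r ` U"
 then obtain h0 where h0: "h0 \<in> U" "u0 = r h0" by blast
 have h0H: "h0 \<in> H" using openin_subset[OF U] h0 by auto
 have u0: "u0 \<in> U0" using h0 h0H H_sub by simp
 have c: "compactin TH {h0}" using h0H H_sub by simp
 obtain f L where f: "continuous_map TH euclideanreal f" "compactin TH L"
  "!!x. x \<in> topspace TH ==> 0 \<le> f x \<and> f x \<le> 1" "!!x. x \<in> {h0} ==> f x = 1"
  "!!x. x \<in> topspace TH ==> f x \<noteq> 0 ==> x \<in> U \<and> x \<in> L"
  by (rule HT.cutoff[OF c U]) (use h0 in blast)+
 interpret R0: radon "TH" "lamH u0" by (rule radon_lamH[OF u0])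
 have "(LINT h|lamH u0. f h) > 0"
  by (rule R0.integral_pos[OF f(1,2), of h0])
   (use f h0 h0H support_lamH[OF u0] in auto)
 moreover have "continuous_map (unit_top G) euclideanreal (\<lambda>u. LINT h|lamH u. f h)"
  using f by (intro haar_continuous_real[OF f(1,2)]) auto
 ultimately obtain N where N: "openin (unit_top G) N" "u0 \<in> N" "!!u. u \<in> N ==> 0 < (LINT h|lamH u. f h)"
  using continuous_map_gt_nbhd[of "unit_top G" "\<lambda>u. LINT h|lamH u. f h" u0 0] u0 by auto
 have "u \<in> r ` U" if uN: "u \<in> N" for u
 proof (rule ccontr)
  assume nin: "u \<notin> r ` U"
  have u: "u \<in> U0" using openin_subset[OF N(1)] uN by auto
  interpret Ru: radon "TH" "lamH u" by (rule radon_lamH[OF u])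
  have "(LINT h|lamH u. f h) = (LINT h|lamH u. 0)"
  proof (rule Ru.integral_cong_support)
   show "f \<in> borel_measurable (lamH u)" by (rule Ru.continuous_measurable[OF f(1)])
   fix h assume "h \<in> measure_support TH (lamH u)"
   then have "h \<in> H" "r h = u" using support_lamH[OF u] by auto
   then show "f h = 0" using f(5)[of h] nin by auto
  qed simp
  then show False using N(3)[OF uN] by simp
 qed
 then show "\<exists>T. openin (unit_top G) T \<and> u0 \<in> T \<and> T \<subseteq> r ` U" using N by blast
qed

lemma coset_self: "x \<in> A ==> x \<in> q x"
 unfolding coset_def by (rule CollectI, rule exI[of _ "d x"]) (simp add: unit_H unitE)

lemma mem_coset: "x \<in> A ==> y \<in> q x \<longleftrightarrow> (\<exists>h\<in>H. r h = d x \<and> y = x \<cdot> h)"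
 by (auto simp: coset_def)

lemma coset_mul: 
 assumes "x \<in> A" "h \<in> H" "r h = d x" shows "q (x \<cdot> h) = q x"
proof
 show "q (x \<cdot> h) \<subseteq> q x"
 proof
  fix z assume "z \<in> q (x \<cdot> h)"
  then obtain k where k: "k \<in> H" "r k = d (x \<cdot> h)" "z = x \<cdot> h \<cdot> k"
   using assms H_sub by (auto simp: mem_coset)
  then have "z = x \<cdot> (h \<cdot> k)" "h \<cdot> k \<in> H" "r (h \<cdot> k) = d x"
   using assms H_sub H_mul by (auto intro: assoc)
  then show "z \<in> q x" using assms by (auto simp: mem_coset)
 qed
 show "q x \<subseteq> q (x \<cdot> h)"
 proof
  fix z assume "z \<in> q x"
  then obtain k where k: "k \<in> H" "r k = d x" "z = x \<cdot> k" using assms by (auto simp: mem_coset)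
  have c: "h \<in> A" "k \<in> A" using assms k H_sub by auto
  have "inv' h \<cdot> k \<in> H" "r (inv' h \<cdot> k) = d (x \<cdot> h)"
   using assms k c by (auto intro: H_mul)
  moreover have "z = x \<cdot> h \<cdot> (inv' h \<cdot> k)"
  proof -
   have "x \<cdot> h \<cdot> (inv' h \<cdot> k) = x \<cdot> (h \<cdot> (inv' h \<cdot> k))" using assms k c by (intro assoc) auto
   then show ?thesis using assms k c by (simp add: cancel2)
  qed
  ultimately show "z \<in> q (x \<cdot> h)" using assms c by (auto simp: mem_coset)
 qed
qed

lemma coset_eq_iff:
 assumes "x \<in> A" "y \<in> A"
 shows "q x = q y \<longleftrightarrow> r x = r y \<and> inv' x \<cdot> y \<in> H"
proof
 assume "q x = q y"
 then have "y \<in> q x" using coset_self assms by simp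
 then obtain h where "h \<in> H" "r h = d x" "y = x \<cdot> h" using assms by (auto simp: mem_coset)
 then show "r x = r y \<and> inv' x \<cdot> y \<in> H" using assms H_sub by (auto simp: cancel)
next
 assume *: "r x = r y \<and> inv' x \<cdot> y \<in> H"
 then have "q (x \<cdot> (inv' x \<cdot> y)) = q x" using assms by (intro coset_mul) auto
 then show "q x = q y" using * assms by (simp add: cancel2)
qed

lemma topspace_CS [simp]: "topspace CS = q ` A"
 by (simp add: coset_space_def)

lemma quotient_map_q: "quotient_map (gtop G) CS q"
 unfolding coset_space_def by (rule quotient_map_quotient_topology)

lemma continuous_q: "continuous_map (gtop G) CS q"
 by (rule quotient_imp_continuous_map[OF quotient_map_q])

lemma mul_nbhd:
 assumes "x \<in> A" "y \<in> A" "d x = r y" "openin (gtop G) U" "x \<cdot> y \<in> U"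
 obtains M N where "openin (gtop G) M" "openin (gtop G) N" "x \<in> M" "y \<in> N"
  "!!a b. a \<in> M ==> b \<in> N ==> d a = r b ==> a \<cdot> b \<in> U"
proof -
 let ?P = "prod_topology (gtop G) (gtop G)"
 have "openin (subtopology ?P (composable G)) {z \<in> topspace (subtopology ?P (composable G)). (\<lambda>(x, y). x \<cdot> y) z \<in> U}"
  using tgpd assms(4) unfolding topological_groupoid_def
  by (intro openin_continuous_map_preimage[where Y = "gtop G"]) auto
 then obtain T where T: "openin ?P T"
  "{z \<in> topspace (subtopology ?P (composable G)). (\<lambda>(x, y). x \<cdot> y) z \<in> U} = T \<inter> composable G"
  by (auto simp: openin_subtopology)
 have iff: "(a, b) \<in> T \<longleftrightarrow> a \<cdot> b \<in> U" if "(a, b) \<in> composable G" for a b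
  using T(2) that by (fastforce simp: set_eq_iff composable_iff)
 have mem: "(x, y) \<in> T" using iff assms by (simp add: composable_iff)
 obtain M N where MN: "openin (gtop G) M" "openin (gtop G) N" "x \<in> M" "y \<in> N" "M \<times> N \<subseteq> T"
  using T(1)[unfolded openin_prod_topology_alt, rule_format, OF mem] by blast
 show ?thesis
 proof (rule that[OF MN(1-4)])
  fix a b assume ab: "a \<in> M" "b \<in> N" "d a = r b"
  then have "(a, b) \<in> composable G" using openin_subset[OF MN(1)] openin_subset[OF MN(2)] by (auto simp: composable_iff)
  then show "a \<cdot> b \<in> U" using iff ab MN(5) by blast
 qed
qed

text \<open>The saturation of an open set is open because the range map of \<open>H\<close> is open.\<close>

lemma open_q:
 assumes U: "openin (gtop G) U"
 shows "openin CS (q ` U)"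
proof -
 have UA: "U \<subseteq> A" using openin_subset[OF U] .
 have "openin (gtop G) {x \<in> A. q x \<in> q ` U}"
  unfolding openin_subopen[of "gtop G" "{x \<in> A. q x \<in> q ` U}"]
 proof
  fix x0 assume "x0 \<in> {x \<in> A. q x \<in> q ` U}"
  then obtain y where y: "x0 \<in> A" "y \<in> U" "q x0 = q y" by blast
  have yA: "y \<in> A" using y UA by blast
  then have "y \<in> q x0" using y coset_self by simp
  then obtain k0 where k0: "k0 \<in> H" "r k0 = d x0" "y = x0 \<cdot> k0"
   using mem_coset[OF y(1)] by blast
  have k0A: "k0 \<in> A" using k0 H_sub by blast
  obtain M N where MN: "openin (gtop G) M" "openin (gtop G) N" "x0 \<in> M" "k0 \<in> N"
   "!!a b. a \<in> M ==> b \<in> N ==> d a = r b ==> a \<cdot> b \<in> U"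
   using mul_nbhd[OF y(1) k0A k0(2)[symmetric] U] k0(3) y(2) by metis
  have "openin TH (N \<inter> H)" using MN(2) by (auto simp: openin_subtopology)
  then have "openin (unit_top G) (r ` (N \<inter> H))" by (rule open_r_H)
  then have op: "openin (gtop G) (M \<inter> {x \<in> A. d x \<in> r ` (N \<inter> H)})"
   using openin_continuous_map_preimage[OF continuous_d] MN(1) by blast
  have "M \<inter> {x \<in> A. d x \<in> r ` (N \<inter> H)} \<subseteq> {x \<in> A. q x \<in> q ` U}"
  proof
   fix x assume x: "x \<in> M \<inter> {x \<in> A. d x \<in> r ` (N \<inter> H)}"
   then obtain k where k: "k \<in> N" "k \<in> H" "d x = r k" by auto
   then have "x \<cdot> k \<in> U" using MN(5) x by blast
   then show "x \<in> {x \<in> A. q x \<in> q ` U}"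
    using coset_mul[of x k] x k by (auto intro!: image_eqI[of _ _ "x \<cdot> k"])
  qed
  moreover have "d x0 \<in> r ` (N \<inter> H)"
   by (rule image_eqI[of _ _ k0]) (use k0 MN in auto)
  then have "x0 \<in> M \<inter> {x \<in> A. d x \<in> r ` (N \<inter> H)}" using MN y by auto
  ultimately show "\<exists>T. openin (gtop G) T \<and> x0 \<in> T \<and> T \<subseteq> {x \<in> A. q x \<in> q ` U}" using op by blast
 qed
 then show ?thesis using UA by (auto simp: coset_space_def openin_quotient_topology)
qed

lemma Hausdorff_CS: "Hausdorff_space CS"
 unfolding Hausdorff_space_def
proof (intro allI impI)
 fix C D assume "C \<in> topspace CS \<and> D \<in> topspace CS \<and> C \<noteq> D"
 then obtain x y where xy: "x \<in> A" "y \<in> A" "C = q x" "D = q y" "q x \<noteq> q y" by auto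
 let ?P = "prod_topology (gtop G) (gtop G)"
 let ?R = "{z \<in> topspace ?P. r (fst z) = r (snd z)}"
 let ?W = "{z \<in> topspace (subtopology ?P ?R). inv' (fst z) \<cdot> snd z \<in> H}"
 have cr: "continuous_map ?P (unit_top G) (\<lambda>z. r (fst z))" "continuous_map ?P (unit_top G) (\<lambda>z. r (snd z))"
  using continuous_map_compose[OF continuous_map_fst continuous_r] continuous_map_compose[OF continuous_map_snd continuous_r]
  by (simp_all add: o_def)
 have clR: "closedin ?P ?R" by (rule closedin_continuous_maps_eq[OF Hausdorff_unit_top cr])
 have "continuous_map (subtopology ?P ?R) (gtop G) (\<lambda>z. inv' (fst z) \<cdot> snd z)"
 proof (rule continuous_mul)
  show "continuous_map (subtopology ?P ?R) (gtop G) (\<lambda>z. inv' (fst z))"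
   using continuous_map_compose[OF continuous_map_from_subtopology[OF continuous_map_fst] continuous_inv]
   by (simp add: o_def)
  show "continuous_map (subtopology ?P ?R) (gtop G) snd"
   by (rule continuous_map_from_subtopology[OF continuous_map_snd])
 qed auto
 then have "closedin (subtopology ?P ?R) ?W"
  using closed_H by (rule closedin_continuous_map_preimage)
 then have "closedin ?P ?W" using clR closedin_trans_full by blast
 then have op: "openin ?P (topspace ?P - ?W)" by blast
 have mem: "(x, y) \<in> topspace ?P - ?W" using xy by (auto simp: coset_eq_iff)
 obtain M N where MN: "openin (gtop G) M" "openin (gtop G) N" "x \<in> M" "y \<in> N" "M \<times> N \<subseteq> topspace ?P - ?W"
  using op[unfolded openin_prod_topology_alt, rule_format, OF mem] by blast
 have "disjnt (q ` M) (q ` N)"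
 proof (rule ccontr)
  assume "\<not> disjnt (q ` M) (q ` N)"
  then obtain a b where ab: "a \<in> M" "b \<in> N" "q a = q b" by (auto simp: disjnt_def)
  have abA: "a \<in> A" "b \<in> A" using ab openin_subset[OF MN(1)] openin_subset[OF MN(2)] by auto
  then have "(a, b) \<in> ?W" using ab(3) by (auto simp: coset_eq_iff)
  then show False using MN(5) ab by blast
 qed
 then show "\<exists>U V. openin CS U \<and> openin CS V \<and> C \<in> U \<and> D \<in> V \<and> disjnt U V"
  using open_q[OF MN(1)] open_q[OF MN(2)] MN(3,4) xy by blast
qed

sublocale CS: lch CS
proof unfold_locales
 show "locally_compact_space CS"
  using locally_compact_space_continuous_open_map_image[OF continuous_q _ _ locally_compact] open_q
  by (simp add: open_map_def)
qed (rule Hausdorff_CS)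

lemma coset_rng_q [simp]: "x \<in> A ==> coset_rng G (q x) = r x"
proof -
 assume x: "x \<in> A"
 have "r z = r x" if z: "z \<in> q x" for z
 proof -
  obtain h where "h \<in> H" "r h = d x" "z = x \<cdot> h" using z mem_coset[OF x] by blast
  then show ?thesis using x H_sub by simp
 qed
 then have "r ` q x = {r x}" using coset_self[OF x] by blast
 then show ?thesis by (simp add: coset_rng_def)
qed

lemma continuous_coset_rng: "continuous_map CS (unit_top G) (coset_rng G)"
proof (rule continuous_compose_quotient_map[OF quotient_map_q])
 show "continuous_map (gtop G) (unit_top G) (coset_rng G \<circ> q)"
  by (rule continuous_map_eq[OF continuous_r]) simp
qed

lemma coset_fibre_eq: "coset_fibre G H u = q ` {x \<in> A. r x = u}"
 by (auto simp: coset_fibre_def)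

lemma left_mul_coset: "x \<in> A ==> y \<in> A ==> d x = r y ==> gmul G x ` q y = q (x \<cdot> y)"
proof -
 assume xy: "x \<in> A" "y \<in> A" "d x = r y"
 have "gmul G x ` q y = {x \<cdot> (y \<cdot> h) | h. h \<in> H \<and> r h = d y}" by (auto simp: coset_def)
 also have "\<dots> = {x \<cdot> y \<cdot> h | h. h \<in> H \<and> r h = d y}"
  unfolding setcompr_eq_image by (rule image_cong) (use xy H_sub in \<open>auto simp: assoc\<close>)
 also have "\<dots> = q (x \<cdot> y)" using xy by (simp add: coset_def)
 finally show ?thesis .
qed

lemma radon_mu: "u \<in> U0 ==> radon CS (\<mu> u)"
 using full by unfold_locales (auto simp: full_equivariant_system_def)

lemma support_mu: "u \<in> U0 ==> measure_support CS (\<mu> u) = q ` {x \<in> A. r x = u}"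
 using full by (simp add: full_equivariant_system_def coset_fibre_eq)

lemma mu_continuous: "f \<in> Cc CS ==> continuous_map (unit_top G) euclidean (\<lambda>u. LINT C|\<mu> u. f C)"
 using full by (simp add: full_equivariant_system_def)

lemma mu_invariant: "f \<in> Cc CS ==> x \<in> A ==>
  (LINT C:q ` {y \<in> A. r y = d x}|\<mu> (d x). f (gmul G x ` C)) = (LINT C|\<mu> (r x). f C)"
 using full by (simp add: full_equivariant_system_def coset_fibre_eq)

text \<open>Functions on the coset space obtained by evaluating a function on \<open>G\<close> at a chosen
 representative.\<close>

definition descend :: "('g \<Rightarrow> 'c) \<Rightarrow> 'g set \<Rightarrow> 'c" where
 "descend \<phi> C = \<phi> (SOME x. x \<in> C)"

definition coset_invariant :: "('g \<Rightarrow> 'c) \<Rightarrow> bool" where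
 "coset_invariant \<phi> \<longleftrightarrow> (\<forall>x\<in>A. \<forall>h\<in>H. r h = d x --> \<phi> (x \<cdot> h) = \<phi> x)"

lemma some_coset:
 assumes "x \<in> A" obtains h where "h \<in> H" "r h = d x" "(SOME y. y \<in> q x) = x \<cdot> h"
 using someI[of "\<lambda>y. y \<in> q x", OF coset_self[OF assms]] assms by (auto simp: mem_coset)

lemma descend_q: "coset_invariant \<phi> ==> x \<in> A ==> descend \<phi> (q x) = \<phi> x"
 by (rule some_coset[of x]) (auto simp: descend_def coset_invariant_def)

lemma continuous_descend:
 assumes "coset_invariant \<phi>" "continuous_map (gtop G) Y \<phi>"
 shows "continuous_map CS Y (descend \<phi>)"
proof (rule continuous_compose_quotient_map[OF quotient_map_q])
 show "continuous_map (gtop G) Y (descend \<phi> \<circ> q)"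
  by (rule continuous_map_eq[OF assms(2)]) (simp add: descend_q[OF assms(1)])
qed

end

section \<open>Strong continuity of unitary representations\<close>

text \<open>The class of representations that are induced: instead of continuity of matrix coefficients,
 continuity of \<open>h \<mapsto> \<sigma>(h) \<xi>(d(h))\<close> as a section along the range map is required.\<close>

locale hrep = coset_setting G H lamH \<mu> + hbun "unit_top G" "bnd \<sigma>"
 for G :: "'g groupoid_data" and H lamH \<mu> and \<sigma> :: "('g, 'v) groupoid_rep" +
 assumes act_unitary: "h \<in> H ==> unitary_map (fib (bnd \<sigma>) (d h)) (fib (bnd \<sigma>) (r h)) (act \<sigma> h)"
  and act_unit: "u \<in> U0 ==> v \<in> carrier (fib (bnd \<sigma>) u) ==> act \<sigma> u v = v"
  and act_mul: "h \<in> H ==> k \<in> H ==> d h = r k ==> v \<in> carrier (fib (bnd \<sigma>) (d k)) ==>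
   act \<sigma> h (act \<sigma> k v) = act \<sigma> (h \<cdot> k) v"
  and act_continuous: "\<xi> \<in> gam (bnd \<sigma>) ==>
   cont_field (unit_top G) (bnd \<sigma>) TH r (\<lambda>h. act \<sigma> h (\<xi> (d h)))"

context coset_setting
begin

text \<open>The definition of a representation tests continuity on sections vanishing at infinity only; near a
 point every continuous section agrees with such a section.\<close>

lemma gam_cutoff:
 assumes E: "hilbert_bundle (unit_top G) E" and \<xi>: "\<xi> \<in> gam E" and u0: "u0 \<in> U0"
 obtains \<xi>' N where "\<xi>' \<in> C0_sections (unit_top G) E" "openin (unit_top G) N" "u0 \<in> N"
  "!!u. u \<in> N ==> \<xi>' u = \<xi> u"
proof -
 interpret E: hbun "unit_top G" E using E by unfold_locales
 obtain N K where N: "openin (unit_top G) N" "compactin (unit_top G) K" "{u0} \<subseteq> N" "N \<subseteq> K"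
  using U.compact_nbhd[of "{u0}"] u0 by auto
 have KU: "K \<subseteq> U0" using compactin_subset_topspace[OF N(2)] by simp
 obtain b L where b: "continuous_map (unit_top G) euclideanreal b" "compactin (unit_top G) L"
  "!!x. x \<in> K ==> b x = 1" "!!x. x \<in> U0 ==> b x \<noteq> 0 ==> x \<in> L"
  by (rule U.cutoff[OF N(2) openin_topspace]) (use KU in auto)
 define \<xi>' where "\<xi>' = (\<lambda>u\<in>topspace (unit_top G). complex_of_real (b u) \<odot>\<^bsub>fib E u\<^esub> \<xi> u)"
 have "\<xi>' \<in> gam E"
  unfolding \<xi>'_def by (rule E.gamI[OF E.cont_field_smult[OF E.gam_cont_field[OF \<xi>] continuous_map_of_real[OF b(1)]]])
 moreover have "vnorm (fib E u) (\<xi>' u) = 0" if "u \<in> U0 - L" for u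
 proof -
  interpret Eu: hilb "fib E u" using E.hilb_fib that by simp
  have "b u = 0" using b(4) that by blast
  then show ?thesis using that Eu.zero_smult[OF E.gam_carrier[OF \<xi>]] by (simp add: \<xi>'_def)
 qed
 ultimately have "\<xi>' \<in> C0_sections (unit_top G) E"
  using b(2) by (auto simp: C0_sections_def E.continuous_sections_eq_gam intro!: exI[of _ L])
 moreover have "\<xi>' u = \<xi> u" if "u \<in> N" for u
 proof -
  have u: "u \<in> U0" "b u = 1" using that N(4) KU b(3) by auto
  interpret Eu: hilb "fib E u" using E.hilb_fib u by simp
  show ?thesis using u Eu.smult_one[OF E.gam_carrier[OF \<xi>]] by (simp add: \<xi>'_def)
 qed
 ultimately show ?thesis using that N by blast
qed

text \<open>For a unitary representation, weak continuity implies strong continuity: the square of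
 \<open>\<parallel>\<pi>(h) \<xi>(d(h)) - \<eta>(r(h))\<parallel>\<close> expands into the norms of \<open>\<xi>\<close> and \<open>\<eta>\<close> and a matrix
 coefficient.\<close>

lemma continuous_unitary_rep_imp_hrep:
 assumes rep: "continuous_unitary_rep HG \<sigma>"
 shows "hrep G H lamH \<mu> \<sigma>"
proof -
 let ?V = "fib (bnd \<sigma>)"
 note rep' = rep[unfolded continuous_unitary_rep_def Let_def unit_top_HG HG_simps unit_space_HG
   topspace_subtopology topspace_HG]
 have E: "hilbert_bundle (unit_top G) (bnd \<sigma>)" using rep' by blast
 interpret E: hbun "unit_top G" "bnd \<sigma>" using E by unfold_locales
 have un: "unitary_map (?V (d h)) (?V (r h)) (act \<sigma> h)" if "h \<in> H" for h using rep' that by blast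
 have wk: "continuous_map TH euclidean
      (\<lambda>x. ip (?V (r x)) (act \<sigma> x (\<xi> (d x))) (\<eta> (r x)))"
  if "\<xi> \<in> C0_sections (unit_top G) (bnd \<sigma>)" "\<eta> \<in> C0_sections (unit_top G) (bnd \<sigma>)" for \<xi> \<eta>
  using rep' that by blast
 have mul: "\<forall>(x, y)\<in>composable HG. \<forall>h\<in>carrier (?V (d y)). act \<sigma> x (act \<sigma> y h) = act \<sigma> (x \<cdot> y) h"
  using rep' by blast
 show ?thesis
 proof
  show "unitary_map (?V (d h)) (?V (r h)) (act \<sigma> h)" if "h \<in> H" for h using un[OF that] .
  show "act \<sigma> u v = v" if "u \<in> U0" "v \<in> carrier (?V u)" for u v using rep' that by blast
  show "act \<sigma> h (act \<sigma> k v) = act \<sigma> (h \<cdot> k) v"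
   if "h \<in> H" "k \<in> H" "d h = r k" "v \<in> carrier (?V (d k))" for h k v
   using bspec[OF mul, of "(h, k)"] that by (simp add: composable_HG)
  fix \<xi> assume \<xi>: "\<xi> \<in> gam (bnd \<sigma>)"
  show "cont_field (unit_top G) (bnd \<sigma>) TH r (\<lambda>h. act \<sigma> h (\<xi> (d h)))"
   unfolding cont_field_def
  proof (intro conjI ballI allI impI rH)
   fix h assume "h \<in> topspace TH"
   then have h: "h \<in> H" by simp
   then have "h \<in> A" by (rule H_sub)
   note h = h this
   show c: "act \<sigma> h (\<xi> (d h)) \<in> carrier (?V (r h))"
    using unitary_mapD(1)[OF un[OF h(1)] E.gam_carrier[OF \<xi>]] h by simp
   fix e :: real assume e: "e > 0"
   obtain \<eta> where \<eta>: "\<eta> \<in> gam (bnd \<sigma>)" "ndist (?V (r h)) (act \<sigma> h (\<xi> (d h))) (\<eta> (r h)) < e"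
    using E.gam_dense[OF _ c e] h by auto
   obtain \<xi>' N where \<xi>': "\<xi>' \<in> C0_sections (unit_top G) (bnd \<sigma>)" "openin (unit_top G) N" "d h \<in> N"
    "!!u. u \<in> N ==> \<xi>' u = \<xi> u" using gam_cutoff[OF E \<xi>] h by (metis unitI(2))
   obtain \<eta>' N' where \<eta>': "\<eta>' \<in> C0_sections (unit_top G) (bnd \<sigma>)" "openin (unit_top G) N'" "r h \<in> N'"
    "!!u. u \<in> N' ==> \<eta>' u = \<eta> u" using gam_cutoff[OF E \<eta>(1)] h by (metis unitI(1))
   have g: "\<xi>' \<in> gam (bnd \<sigma>)" "\<eta>' \<in> gam (bnd \<sigma>)"
    using \<xi>'(1) \<eta>'(1) by (auto simp: C0_sections_def E.continuous_sections_eq_gam)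
   define \<psi> where "\<psi> k = (vnorm (?V (d k)) (\<xi>' (d k)))\<^sup>2 + (vnorm (?V (r k)) (\<eta>' (r k)))\<^sup>2
     - 2 * Re (ip (?V (r k)) (act \<sigma> k (\<xi>' (d k))) (\<eta>' (r k)))" for k
   have "continuous_map TH euclideanreal \<psi>"
   proof -
    have "continuous_map TH euclideanreal (\<lambda>k. vnorm (?V (d k)) (\<xi>' (d k)))"
     "continuous_map TH euclideanreal (\<lambda>k. vnorm (?V (r k)) (\<eta>' (r k)))"
     using continuous_map_compose[OF dH E.gam_norm_continuous[OF g(1)]]
      continuous_map_compose[OF rH E.gam_norm_continuous[OF g(2)]] by (simp_all add: o_def)
    moreover have "continuous_map TH euclideanreal
      (\<lambda>k. Re (ip (?V (r k)) (act \<sigma> k (\<xi>' (d k))) (\<eta>' (r k))))"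
     using wk[OF \<xi>'(1) \<eta>'(1)] by (intro continuous_map_ceuclid(4))
    ultimately show ?thesis unfolding \<psi>_def[abs_def]
     by (intro continuous_map_diff continuous_map_add continuous_map_real_pow continuous_map_real_mult) auto
   qed
   moreover have psi: "\<psi> k = (ndist (?V (r k)) (act \<sigma> k (\<xi>' (d k))) (\<eta>' (r k)))\<^sup>2" if "k \<in> H" for k
   proof -
    have k: "k \<in> A" using that H_sub by blast
    interpret Vr: hilb "?V (r k)" using E.hilb_fib k by simp
    have cd: "\<xi>' (d k) \<in> carrier (?V (d k))" "\<eta>' (r k) \<in> carrier (?V (r k))"
     using E.gam_carrier g k by auto
    show ?thesis
     using Vr.vnorm_diff_sq[OF unitary_mapD(1)[OF un[OF that] cd(1)] cd(2)] unitary_mapD(3)[OF un[OF that] cd(1)]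
     by (simp add: \<psi>_def)
   qed
   moreover have "\<psi> h < e\<^sup>2"
    using psi[OF h(1)] \<xi>'(3,4) \<eta>'(3,4) \<eta>(2) e
     hilb.axioms(1)[OF E.hilb_fib, of "r h"] c h E.gam_carrier[OF \<eta>(1), of "r h"]
    by (auto intro!: power_strict_mono semi_inner.vnorm_nonneg abelian_group.minus_closed module.axioms(2)
      semi_inner.axioms(1))
   ultimately obtain M where M: "openin TH M" "h \<in> M" "!!k. k \<in> M ==> \<psi> k < e\<^sup>2"
    using continuous_map_less_nbhd[of "TH" \<psi> h "e\<^sup>2"] h by auto
   let ?M = "M \<inter> {k \<in> topspace TH. d k \<in> N} \<inter> {k \<in> topspace TH. r k \<in> N'}"
   have "openin TH ?M"
    using M(1) openin_continuous_map_preimage[OF dH \<xi>'(2)] openin_continuous_map_preimage[OF rH \<eta>'(2)] by blast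
   moreover have "ndist (?V (r k)) (act \<sigma> k (\<xi> (d k))) (\<eta> (r k)) < e" if k: "k \<in> ?M" for k
   proof -
    have "k \<in> H" using k by auto
    have "\<psi> k < e\<^sup>2" using k M(3) by blast
    then have "(ndist (?V (r k)) (act \<sigma> k (\<xi> (d k))) (\<eta> (r k)))\<^sup>2 < e\<^sup>2"
     using psi[OF \<open>k \<in> H\<close>] \<xi>'(4) \<eta>'(4) k by simp
    then show ?thesis using e by (simp add: power_less_imp_less_base)
   qed
   ultimately show "\<exists>U \<eta>. openin TH U \<and> h \<in> U \<and> \<eta> \<in> gam (bnd \<sigma>) \<and>
     (\<forall>k\<in>U. ndist (?V (r k)) (act \<sigma> k (\<xi> (d k))) (\<eta> (r k)) < e)"
    using \<eta>(1) M(2) \<xi>'(3) \<eta>'(3) h by (intro exI[of _ ?M] exI[of _ \<eta>]) auto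
  qed
 qed
qed

end

lemma unitary_hilbert_sum:
 assumes V: "hilb_family I V" and W: "hilb_family I W"
  and T: "!!i. i \<in> I ==> unitary_map (V i) (W i) (T i)"
 shows "unitary_map (hilbert_sum I V) (hilbert_sum I W) (\<lambda>v. \<lambda>i\<in>I. T i (v i))"
proof -
 interpret V: hilb_family I V by fact
 interpret W: hilb_family I W by fact
 have mapS: "(\<lambda>i\<in>I. S i (v i)) \<in> carrier (hilbert_sum I Y)"
  if X: "hilb_family I X" and Y: "hilb_family I Y" and S: "!!i. i \<in> I ==> unitary_map (X i) (Y i) (S i)"
   and v: "v \<in> carrier (hilbert_sum I X)" for X Y S v
 proof -
  interpret X: hilb_family I X by fact
  interpret Y: hilb_family I Y by fact
  have "(\<lambda>i. (vnorm (Y i) ((\<lambda>i\<in>I. S i (v i)) i))\<^sup>2) summable_on I"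
   by (rule summable_on_cong[THEN iffD2, OF _ X.S_summable[OF v]])
    (simp add: unitary_mapD(3)[OF S X.S_comp[OF v]])
  moreover have "(\<lambda>i\<in>I. S i (v i)) \<in> (\<Pi>\<^sub>E i\<in>I. carrier (Y i))"
   using unitary_mapD(1)[OF S X.S_comp[OF v]] by auto
  ultimately show ?thesis by (simp add: Y.S_simps)
 qed
 let ?T = "\<lambda>v. \<lambda>i\<in>I. T i (v i)"
 let ?S = "\<lambda>v. \<lambda>i\<in>I. inv_into (carrier (V i)) (T i) (v i)"
 have S: "unitary_map (W i) (V i) (inv_into (carrier (V i)) (T i))" if "i \<in> I" for i
  using that by (intro unitary_map_inv V.semi_V W.semi_V T)
 have iso: "ip (hilbert_sum I W) (?T v) (?T w) = ip (hilbert_sum I V) v w"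
  if "v \<in> carrier (hilbert_sum I V)" "w \<in> carrier (hilbert_sum I V)" for v w
  unfolding V.S_simps W.S_simps
  using that by (intro infsum_cong) (simp add: unitary_mapD(2)[OF T] V.S_comp)
 have "bij_betw ?T (carrier (hilbert_sum I V)) (carrier (hilbert_sum I W))"
 proof (rule bij_betw_byWitness[of _ ?S])
  have "inv_into (carrier (V i)) (T i) (T i (v i)) = v i"
   if "v \<in> carrier (hilbert_sum I V)" "i \<in> I" for v i
   using unitary_mapD(6)[OF T[OF that(2)]] V.S_comp[OF that] by (simp add: bij_betw_def)
  then show "\<forall>v\<in>carrier (hilbert_sum I V). ?S (?T v) = v"
   by (intro ballI V.S_ext[OF mapS[OF W V S mapS[OF V W T]]]) simp_all
  have "T i (inv_into (carrier (V i)) (T i) (v i)) = v i"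
   if "v \<in> carrier (hilbert_sum I W)" "i \<in> I" for v i
   using unitary_mapD(6)[OF T[OF that(2)]] W.S_comp[OF that] by (simp add: bij_betw_inv_into_right)
  then show "\<forall>v\<in>carrier (hilbert_sum I W). ?T (?S v) = v"
   by (intro ballI W.S_ext[OF mapS[OF V W T mapS[OF W V S]]]) simp_all
  show "?T ` carrier (hilbert_sum I V) \<subseteq> carrier (hilbert_sum I W)"
   by (intro image_subsetI mapS[OF V W T])
  show "?S ` carrier (hilbert_sum I W) \<subseteq> carrier (hilbert_sum I V)"
   by (intro image_subsetI mapS[OF W V S])
 qed
 then show ?thesis
  unfolding unitary_map_def
  using iso ip_preserving_imp_linear_map[OF V.semi_inner_S W.hilb_S mapS[OF V W T] iso] by blast
qed

context coset_setting
begin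

text \<open>Approximating by sections with finitely many nonzero components reduces strong continuity of the
 direct sum to that of the summands.\<close>

lemma hrep_sum:
 assumes h: "!!i. i \<in> I ==> hrep G H lamH \<mu> (\<sigma> i)"
 shows "hrep G H lamH \<mu> (rep_sum HG I \<sigma>)"
proof -
 let ?E = "\<lambda>i. bnd (\<sigma> i)"
 have hb: "hilbert_bundle (unit_top G) (?E i)" if "i \<in> I" for i
  using hrep.axioms(2)[OF h[OF that]] by (simp add: hbun_def)
 interpret F: hbun_family "unit_top G" I ?E using hb by unfold_locales
 have bnd: "bnd (rep_sum HG I \<sigma>) = F.F" and act: "act (rep_sum HG I \<sigma>) = (\<lambda>x h. \<lambda>i\<in>I. act (\<sigma> i) x (h i))"
  by (simp_all add: rep_sum_def)
 have fam: "hilb_family I (\<lambda>i. fib (?E i) u)" if "u \<in> U0" for u using F.hilb_family that by simp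
 have un: "unitary_map (fib F.F (d h)) (fib F.F (r h)) (\<lambda>v. \<lambda>i\<in>I. act (\<sigma> i) h (v i))" if "h \<in> H" for h
  unfolding F.fib_F using that H_sub hrep.act_unitary[OF assms]
  by (intro unitary_hilbert_sum fam) auto
 show ?thesis
 proof (intro hrep.intro hrep_axioms.intro)
  show "coset_setting G H lamH \<mu>" ..
  show "hbun (unit_top G) (bnd (rep_sum HG I \<sigma>))" unfolding bnd ..
  show "unitary_map (fib (bnd (rep_sum HG I \<sigma>)) (d h)) (fib (bnd (rep_sum HG I \<sigma>)) (r h)) (act (rep_sum HG I \<sigma>) h)"
   if "h \<in> H" for h unfolding bnd act using un[OF that] .
 next
  fix u v assume u: "u \<in> U0" and v: "v \<in> carrier (fib (bnd (rep_sum HG I \<sigma>)) u)"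
  interpret Fu: hilb_family I "\<lambda>i. fib (?E i) u" by (rule fam[OF u])
  have v': "v \<in> carrier Fu.S" using v by (simp add: bnd)
  have "(\<lambda>i\<in>I. act (\<sigma> i) u (v i)) = (\<lambda>i\<in>I. v i)"
   using hrep.act_unit[OF h u Fu.S_comp[OF v']] by (auto intro!: restrict_ext)
  also have "\<dots> = v" using v' by (auto simp: Fu.S_simps PiE_def intro: extensional_restrict)
  finally show "act (rep_sum HG I \<sigma>) u v = v" by (simp add: act)
 next
  fix h k v assume hk: "h \<in> H" "k \<in> H" "d h = r k" and v: "v \<in> carrier (fib (bnd (rep_sum HG I \<sigma>)) (d k))"
  have dk: "d k \<in> U0" using hk H_sub by simp
  interpret Fu: hilb_family I "\<lambda>i. fib (?E i) (d k)" by (rule fam[OF dk])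
  have v': "v \<in> carrier Fu.S" using v by (simp add: bnd)
  show "act (rep_sum HG I \<sigma>) h (act (rep_sum HG I \<sigma>) k v) = act (rep_sum HG I \<sigma>) (h \<cdot> k) v"
   unfolding act using hrep.act_mul[OF h hk Fu.S_comp[OF v']] by (auto intro!: restrict_ext)
 next
  fix \<xi> assume "\<xi> \<in> gam (bnd (rep_sum HG I \<sigma>))"
  then have \<xi>: "\<xi> \<in> gam F.F" by (simp add: bnd)
  have "cont_field (unit_top G) F.F TH r (\<lambda>h. \<lambda>i\<in>I. act (\<sigma> i) h (\<xi> (d h) i))"
  proof (rule F.F.cont_field_local_limit[OF rH])
   fix h assume "h \<in> topspace TH"
   then show "(\<lambda>i\<in>I. act (\<sigma> i) h (\<xi> (d h) i)) \<in> carrier (fib F.F (r h))"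
    using unitary_mapD(1)[OF un F.F.gam_carrier[OF \<xi>]] H_sub by auto
  next
   fix h0 and e :: real assume h0: "h0 \<in> topspace TH" and e: "e > 0"
   obtain U J t where U: "openin TH U" "h0 \<in> U" "finite J" "J \<subseteq> I" "\<forall>i\<in>J. t i \<in> gam (?E i)"
    "!!w. w \<in> U ==> ndist (fib F.F (d w)) (\<xi> (d w)) (F.fin_sec J t (d w)) < e"
    using F.cont_field_F_approx[OF F.F.cont_field_gam[OF dH \<xi>] h0 e] by blast
   let ?t = "\<lambda>h. \<lambda>i\<in>I. if i \<in> J then act (\<sigma> i) h (t i (d h)) else \<zero>\<^bsub>fib (?E i) (r h)\<^esub>"
   have "cont_field (unit_top G) F.F TH r ?t"
    using U(3-5) hrep.act_continuous[OF h] by (intro F.cont_field_F_finite rH) auto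
   moreover have "ndist (fib F.F (r w)) (\<lambda>i\<in>I. act (\<sigma> i) w (\<xi> (d w) i)) (?t w) < e" if w: "w \<in> U" for w
   proof -
    have wH: "w \<in> H" "w \<in> A" using openin_subset[OF U(1)] w H_sub by auto
    then have u: "d w \<in> U0" "r w \<in> U0" by auto
    have fc: "F.fin_sec J t (d w) \<in> carrier (fib F.F (d w))"
     using F.fin_sec_carrier[OF U(3-5)] u by simp
    have "?t w = (\<lambda>i\<in>I. act (\<sigma> i) w (F.fin_sec J t (d w) i))"
    proof (rule restrict_ext)
     fix i assume i: "i \<in> I"
     have "act (\<sigma> i) w \<zero>\<^bsub>fib (?E i) (d w)\<^esub> = \<zero>\<^bsub>fib (?E i) (r w)\<^esub>"
      using unitary_map_zero[OF pre_hbun.hilb_fib[OF F.pre_E[OF i]] pre_hbun.hilb_fib[OF F.pre_E[OF i]]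
        hrep.act_unitary[OF h[OF i] wH(1)] F.zero_E[OF i]] u by simp
     then show "(if i \<in> J then act (\<sigma> i) w (t i (d w)) else \<zero>\<^bsub>fib (?E i) (r w)\<^esub>)
       = act (\<sigma> i) w (F.fin_sec J t (d w) i)"
      using i u by (simp add: F.fin_sec_def)
    qed
    then show ?thesis
     using unitary_map_vnorm_diff[OF F.F.semi_fib F.F.semi_fib un[OF wH(1)] F.F.gam_carrier[OF \<xi>] fc] u U(6)[OF w]
     by simp
   qed
   ultimately show "\<exists>U t. openin TH U \<and> h0 \<in> U \<and> cont_field (unit_top G) F.F TH r t \<and>
     (\<forall>w\<in>U. ndist (fib F.F (r w)) (\<lambda>i\<in>I. act (\<sigma> i) w (\<xi> (d w) i)) (t w) < e)"
    using U(1,2) by (intro exI[of _ U] exI[of _ ?t]) simp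
  qed
  then show "cont_field (unit_top G) (bnd (rep_sum HG I \<sigma>)) TH r (\<lambda>h. act (rep_sum HG I \<sigma>) h (\<xi> (d h)))"
   by (simp add: bnd act)
 qed
qed

end

section \<open>Equivariant sections\<close>

context coset_setting
begin

text \<open>Because the quotient map is open, the closure of a union of cosets is again a union of cosets;
 hence having compact support modulo \<open>H\<close> just means vanishing off the preimage of a compact set.\<close>

lemma compact_coset_closure:
 assumes S: "S \<subseteq> A" and sat: "!!x h. x \<in> S ==> h \<in> H ==> d x = r h ==> x \<cdot> h \<in> S"
  and K: "compactin CS K" and qS: "q ` S \<subseteq> K"
 shows "compactin CS (q ` (gtop G closure_of S))"
proof -
 let ?Z = "gtop G closure_of S"
 let ?W = "A - ?Z"
 have SZ: "S \<subseteq> ?Z" by (rule closure_of_subset[OF S])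
 have opW: "openin (gtop G) ?W" by (rule openin_diff[OF openin_topspace closedin_closure_of])
 let ?D = "{x \<in> A. q x \<in> q ` ?W}"
 have "x \<notin> ?D" if x: "x \<in> S" for x
 proof
  assume "x \<in> ?D"
  then obtain w where w: "w \<in> ?W" "q x = q w" by auto
  then have "w \<in> q x" using coset_self[of w] by auto
  then obtain h where "h \<in> H" "r h = d x" "w = x \<cdot> h" using mem_coset[of x w] x S by auto
  then have "w \<in> S" using sat[OF x] by simp
  then show False using SZ w by blast
 qed
 moreover have "openin (gtop G) ?D"
  by (rule openin_continuous_map_preimage[OF continuous_q open_q[OF opW]])
 ultimately have "?Z \<subseteq> A - ?D" using S by (intro closure_of_minimal) auto
 then have eq: "q ` ?Z = topspace CS - q ` ?W"
  using closure_of_subset_topspace[of "gtop G" S] by auto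
 have cl: "closedin CS (q ` ?Z)" unfolding eq using open_q[OF opW] by blast
 have "closedin (gtop G) {x \<in> A. q x \<in> K}"
  by (rule closedin_continuous_map_preimage[OF continuous_q compactin_imp_closedin[OF CS.hausdorff K]])
 then have "?Z \<subseteq> {x \<in> A. q x \<in> K}" using S qS by (intro closure_of_minimal) auto
 then show ?thesis using closed_compactin[OF K _ cl] by auto
qed

end

context hrep
begin

abbreviation V where "V u \<equiv> fib (bnd \<sigma>) u"
abbreviation ES where "ES \<equiv> equivariant_sections G H \<sigma>"
abbreviation F0 where "F0 \<equiv> F0_space G H \<sigma>"

lemma V_hilb: "u \<in> U0 ==> hilb (V u)" and V_semi: "u \<in> U0 ==> semi_inner (V u)"
 and V_module: "u \<in> U0 ==> module complex_ring (V u)"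
 using hilb_fib semi_fib semi_inner.axioms(1) by auto

lemma V_zero: "u \<in> U0 ==> \<zero>\<^bsub>V u\<^esub> \<in> carrier (V u)"
 using V_module by (meson abelian_group.axioms(1) abelian_monoid.zero_closed module.axioms(2))

lemma act_carrier: "h \<in> H ==> v \<in> carrier (V (d h)) ==> act \<sigma> h v \<in> carrier (V (r h))"
 using unitary_mapD(1)[OF act_unitary] .

lemma act_zero: "h \<in> H ==> v \<in> carrier (V (d h)) ==> act \<sigma> h v = \<zero>\<^bsub>V (r h)\<^esub> \<longleftrightarrow> v = \<zero>\<^bsub>V (d h)\<^esub>"
 using unitary_map_zero[OF V_hilb V_hilb act_unitary] H_sub by simp

lemma ES_iff: "f \<in> ES \<longleftrightarrow> f \<in> (\<Pi>\<^sub>E x\<in>A. carrier (V (d x))) \<and>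
  cont_field (unit_top G) (bnd \<sigma>) (gtop G) d f \<and>
  (\<forall>x\<in>A. \<forall>h\<in>H. d x = r h --> f (x \<cdot> h) = act \<sigma> (inv' h) (f x)) \<and>
  (\<exists>K. compactin CS K \<and> (\<forall>x\<in>A. f x \<noteq> \<zero>\<^bsub>V (d x)\<^esub> --> q x \<in> K))"
proof -
 have eqv: "(\<forall>(x, h)\<in>composable G. h \<in> H --> f (gmul G x h) = act \<sigma> (ginv G h) (f x)) \<longleftrightarrow>
  (\<forall>x\<in>A. \<forall>h\<in>H. d x = r h --> f (x \<cdot> h) = act \<sigma> (inv' h) (f x))"
 proof (intro iffI ballI impI)
  fix x h assume a: "\<forall>(x, h)\<in>composable G. h \<in> H --> f (gmul G x h) = act \<sigma> (ginv G h) (f x)"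
   and xh: "x \<in> A" "h \<in> H" "d x = r h"
  have "(x, h) \<in> composable G" using xh H_sub by (simp add: composable_iff)
  then show "f (x \<cdot> h) = act \<sigma> (inv' h) (f x)" using bspec[OF a] xh by auto
 qed (auto simp: composable_iff)
 have "compactin CS (q ` (gtop G closure_of {x \<in> A. f x \<noteq> \<zero>\<^bsub>V (d x)\<^esub>})) \<longleftrightarrow>
  (\<exists>K. compactin CS K \<and> (\<forall>x\<in>A. f x \<noteq> \<zero>\<^bsub>V (d x)\<^esub> --> q x \<in> K))" (is "compactin CS (q ` (_ closure_of ?S)) \<longleftrightarrow> ?r")
  if f: "f \<in> (\<Pi>\<^sub>E x\<in>A. carrier (V (d x)))"
   and eq: "\<forall>x\<in>A. \<forall>h\<in>H. d x = r h --> f (x \<cdot> h) = act \<sigma> (inv' h) (f x)"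
 proof
  assume "compactin CS (q ` (gtop G closure_of ?S))"
  moreover have "?S \<subseteq> gtop G closure_of ?S" by (intro closure_of_subset) auto
  ultimately show ?r by (intro exI[of _ "q ` (gtop G closure_of ?S)"]) auto
 next
  assume ?r
  then obtain K where K: "compactin CS K" "\<forall>x\<in>A. f x \<noteq> \<zero>\<^bsub>V (d x)\<^esub> --> q x \<in> K" by blast
  show "compactin CS (q ` (gtop G closure_of ?S))"
  proof (rule compact_coset_closure[OF _ _ K(1)])
   fix x h assume xh: "x \<in> ?S" "h \<in> H" "d x = r h"
   then have x: "x \<in> A" "f x \<in> carrier (V (d x))" "f x \<noteq> \<zero>\<^bsub>V (d x)\<^esub>" using f by (auto simp: PiE_iff)
   have "f (x \<cdot> h) \<noteq> \<zero>\<^bsub>V (d h)\<^esub>"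
    using act_zero[of "inv' h" "f x"] xh x eq H_sub by auto
   then show "x \<cdot> h \<in> ?S" using xh x H_sub by simp
  qed (use K in auto)
 qed
 then show ?thesis
  unfolding equivariant_sections_def Let_def mem_Collect_eq continuous_map_total_iff_cont_field eqv
  by blast
qed

lemma ES_D:
 assumes "f \<in> ES"
 shows "f \<in> (\<Pi>\<^sub>E x\<in>A. carrier (V (d x)))" "x \<in> A ==> f x \<in> carrier (V (d x))"
  "cont_field (unit_top G) (bnd \<sigma>) (gtop G) d f"
  "x \<in> A ==> h \<in> H ==> d x = r h ==> f (x \<cdot> h) = act \<sigma> (inv' h) (f x)"
 using assms by (auto simp: ES_iff PiE_iff)

lemma ES_compact:
 assumes "f \<in> ES"
 obtains K where "compactin CS K" "!!x. x \<in> A ==> f x \<noteq> \<zero>\<^bsub>V (d x)\<^esub> ==> q x \<in> K"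
 using assms by (auto simp: ES_iff)

lemma ES_I:
 assumes "cont_field (unit_top G) (bnd \<sigma>) (gtop G) d f"
  and "!!x h. x \<in> A ==> h \<in> H ==> d x = r h ==> f (x \<cdot> h) = act \<sigma> (inv' h) (f x)"
  and "compactin CS K" "!!x. x \<in> A ==> f x \<noteq> \<zero>\<^bsub>V (d x)\<^esub> ==> q x \<in> K"
 shows "(\<lambda>x\<in>A. f x) \<in> ES"
 unfolding ES_iff
proof (intro conjI)
 show "(\<lambda>x\<in>A. f x) \<in> (\<Pi>\<^sub>E x\<in>A. carrier (V (d x)))" using cont_fieldD(2)[OF assms(1)] by simp
 show "cont_field (unit_top G) (bnd \<sigma>) (gtop G) d (\<lambda>x\<in>A. f x)"
  by (rule cont_field_cong[OF assms(1)]) simp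
qed (use assms H_sub in auto)

lemma act_linear:
 assumes "h \<in> H" "v \<in> carrier (V (r h))" "w \<in> carrier (V (r h))"
 shows "act \<sigma> (inv' h) (v \<oplus>\<^bsub>V (r h)\<^esub> w) = act \<sigma> (inv' h) v \<oplus>\<^bsub>V (d h)\<^esub> act \<sigma> (inv' h) w"
  "act \<sigma> (inv' h) (c \<odot>\<^bsub>V (r h)\<^esub> v) = c \<odot>\<^bsub>V (d h)\<^esub> act \<sigma> (inv' h) v"
 using unitary_mapD(4,5)[OF act_unitary[OF H_inv[OF assms(1)]]] assms H_sub by simp_all

lemma ES_zero: "(\<lambda>x\<in>A. \<zero>\<^bsub>V (d x)\<^esub>) \<in> ES"
proof (rule ES_I[of _ "{}"])
 have "cont_field (unit_top G) (bnd \<sigma>) (gtop G) d (\<lambda>x. (\<lambda>u\<in>topspace (unit_top G). \<zero>\<^bsub>V u\<^esub>) (d x))"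
  by (rule cont_field_gam[OF continuous_d gam_zero])
 then show "cont_field (unit_top G) (bnd \<sigma>) (gtop G) d (\<lambda>x. \<zero>\<^bsub>V (d x)\<^esub>)"
  by (rule cont_field_cong) simp
 fix x h assume xh: "x \<in> A" "h \<in> H" "d x = r h"
 then have "act \<sigma> (inv' h) \<zero>\<^bsub>V (r h)\<^esub> = \<zero>\<^bsub>V (d h)\<^esub>"
  using act_zero[of "inv' h" "\<zero>\<^bsub>V (r h)\<^esub>"] V_zero H_sub by simp
 then show "\<zero>\<^bsub>V (d (x \<cdot> h))\<^esub> = act \<sigma> (inv' h) \<zero>\<^bsub>V (d x)\<^esub>" using xh H_sub by simp
qed auto

lemma ES_add:
 assumes f: "f \<in> ES" and g: "g \<in> ES"
 shows "(\<lambda>x\<in>A. f x \<oplus>\<^bsub>V (d x)\<^esub> g x) \<in> ES"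
proof -
 obtain K where K: "compactin CS K" "!!x. x \<in> A ==> f x \<noteq> \<zero>\<^bsub>V (d x)\<^esub> ==> q x \<in> K" by (rule ES_compact[OF f]) blast
 obtain L where L: "compactin CS L" "!!x. x \<in> A ==> g x \<noteq> \<zero>\<^bsub>V (d x)\<^esub> ==> q x \<in> L" by (rule ES_compact[OF g]) blast
 show ?thesis
 proof (rule ES_I[OF cont_field_add[OF ES_D(3)[OF f] ES_D(3)[OF g]] _ compactin_Un[OF K(1) L(1)]])
  fix x h assume xh: "x \<in> A" "h \<in> H" "d x = r h"
  then show "f (x \<cdot> h) \<oplus>\<^bsub>V (d (x \<cdot> h))\<^esub> g (x \<cdot> h) = act \<sigma> (inv' h) (f x \<oplus>\<^bsub>V (d x)\<^esub> g x)"
   using act_linear(1)[OF xh(2), of "f x" "g x"] ES_D(2)[OF f xh(1)] ES_D(2)[OF g xh(1)]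
    ES_D(4)[OF f xh] ES_D(4)[OF g xh] H_sub by simp
 next
  fix x assume x: "x \<in> A" and ne: "f x \<oplus>\<^bsub>V (d x)\<^esub> g x \<noteq> \<zero>\<^bsub>V (d x)\<^esub>"
  interpret Vx: hilb "V (d x)" using V_hilb x by simp
  show "q x \<in> K \<union> L" using ne K(2)[OF x] L(2)[OF x] by (cases "f x = \<zero>\<^bsub>V (d x)\<^esub>"; cases "g x = \<zero>\<^bsub>V (d x)\<^esub>") auto
 qed
qed

lemma ES_scale:
 assumes f: "f \<in> ES" and c: "continuous_map (gtop G) euclidean c" "coset_invariant c"
 shows "(\<lambda>x\<in>A. c x \<odot>\<^bsub>V (d x)\<^esub> f x) \<in> ES"
proof -
 obtain K where K: "compactin CS K" "!!x. x \<in> A ==> f x \<noteq> \<zero>\<^bsub>V (d x)\<^esub> ==> q x \<in> K" by (rule ES_compact[OF f]) blast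
 show ?thesis
 proof (rule ES_I[OF cont_field_smult[OF ES_D(3)[OF f] c(1)] _ K(1)])
  fix x h assume xh: "x \<in> A" "h \<in> H" "d x = r h"
  then have "c (x \<cdot> h) = c x" using c(2) by (simp add: coset_invariant_def)
  then show "c (x \<cdot> h) \<odot>\<^bsub>V (d (x \<cdot> h))\<^esub> f (x \<cdot> h) = act \<sigma> (inv' h) (c x \<odot>\<^bsub>V (d x)\<^esub> f x)"
   using act_linear(2)[OF xh(2), of "f x" "f x"] ES_D(2)[OF f xh(1)] ES_D(4)[OF f xh] H_sub xh by simp
 next
  fix x assume x: "x \<in> A" and ne: "c x \<odot>\<^bsub>V (d x)\<^esub> f x \<noteq> \<zero>\<^bsub>V (d x)\<^esub>"
  interpret Vx: hilb "V (d x)" using V_hilb x by simp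
  show "q x \<in> K"
   using ne K(2)[OF x] Vx.smult_r_null[of "c x"] by (cases "f x = \<zero>\<^bsub>V (d x)\<^esub>") auto
 qed
qed

lemma F0_simps:
 "carrier F0 = ES" "f \<oplus>\<^bsub>F0\<^esub> g = (\<lambda>x\<in>A. f x \<oplus>\<^bsub>V (d x)\<^esub> g x)" "\<zero>\<^bsub>F0\<^esub> = (\<lambda>x\<in>A. \<zero>\<^bsub>V (d x)\<^esub>)"
 "c \<odot>\<^bsub>F0\<^esub> f = (\<lambda>x\<in>A. c \<odot>\<^bsub>V (d x)\<^esub> f x)"
 by (simp_all add: F0_space_def Let_def)

lemma module_F0: "module complex_ring F0"
 and F0_minus: "f \<in> ES ==> g \<in> ES ==> x \<in> A ==> (f \<ominus>\<^bsub>F0\<^esub> g) x = f x \<ominus>\<^bsub>V (d x)\<^esub> g x"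
proof -
 have c: "carrier F0 \<subseteq> (\<Pi>\<^sub>E x\<in>A. carrier (V (d x)))" using ES_D(1) by (auto simp: F0_simps)
 have sm: "c \<odot>\<^bsub>F0\<^esub> f \<in> carrier F0" if "f \<in> carrier F0" for c f
  using that ES_scale[of f "\<lambda>_. c"] by (simp add: F0_simps coset_invariant_def)
 note pm = pointwise_module[of A "\<lambda>x. V (d x)" F0, OF V_module c F0_simps(2,3,4) _ _ sm]
 show "module complex_ring F0" by (rule pm(1)) (auto simp: F0_simps ES_add ES_zero)
 show "f \<in> ES ==> g \<in> ES ==> x \<in> A ==> (f \<ominus>\<^bsub>F0\<^esub> g) x = f x \<ominus>\<^bsub>V (d x)\<^esub> g x"
  using pm(2) by (auto simp: F0_simps ES_add ES_zero)
qed

definition ipf where "ipf f g x = ip (V (d x)) (f x) (g x)"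

lemma coset_invariant_ipf: "f \<in> ES ==> g \<in> ES ==> coset_invariant (ipf f g)"
 unfolding coset_invariant_def ipf_def
proof (intro ballI impI)
 fix x h assume fg: "f \<in> ES" "g \<in> ES" and x: "x \<in> A" and h: "h \<in> H" and e: "r h = d x"
 have hA: "h \<in> A" using h by (rule H_sub)
 have "ip (V (d h)) (act \<sigma> (inv' h) (f x)) (act \<sigma> (inv' h) (g x)) = ip (V (d x)) (f x) (g x)"
  using unitary_mapD(2)[OF act_unitary[OF H_inv[OF h]], of "f x" "g x"] ES_D(2)[OF fg(1) x] ES_D(2)[OF fg(2) x] hA e
  by simp
 then show "ip (V (d (x \<cdot> h))) (f (x \<cdot> h)) (g (x \<cdot> h)) = ip (V (d x)) (f x) (g x)"
  using ES_D(4)[OF fg(1) x h e[symmetric]] ES_D(4)[OF fg(2) x h e[symmetric]] x hA e by simp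
qed

lemma ipf_continuous: "f \<in> ES ==> g \<in> ES ==> continuous_map (gtop G) euclidean (ipf f g)"
 unfolding ipf_def[abs_def] by (intro cont_field_ip ES_D(3))

lemma F0_ip_eq: "F0_ip G \<mu> \<sigma> f g u = (LINT C|\<mu> u. descend (ipf f g) C)"
 by (simp add: F0_ip_def descend_def ipf_def Let_def)

lemma descend_ipf_compact:
 assumes f: "f \<in> ES" and g: "g \<in> ES" and K: "!!x. x \<in> A ==> f x \<noteq> \<zero>\<^bsub>V (d x)\<^esub> ==> q x \<in> K"
  and C: "C \<in> topspace CS" "descend (ipf f g) C \<noteq> 0"
 shows "C \<in> K"
proof -
 obtain x where x: "x \<in> A" "C = q x" using C by auto
 interpret Vx: hilb "V (d x)" using V_hilb x by simp
 have "ipf f g x \<noteq> 0" using C x descend_q[OF coset_invariant_ipf[OF f g] x(1)] by simp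
 then have "f x \<noteq> \<zero>\<^bsub>V (d x)\<^esub>" using ES_D(2)[OF g x(1)] by (auto simp: ipf_def)
 then show ?thesis using K x by simp
qed

lemma descend_ipf_Cc: "f \<in> ES ==> g \<in> ES ==> descend (ipf f g) \<in> Cc CS"
 using continuous_descend[OF coset_invariant_ipf ipf_continuous] descend_ipf_compact
 by (metis CS.CcI ES_compact)

lemma descend_ipf_integrable:
 assumes f: "f \<in> ES" and g: "g \<in> ES" and u: "u \<in> U0"
 shows "integrable (\<mu> u) (descend (ipf f g))"
proof -
 interpret radon CS "\<mu> u" by (rule radon_mu[OF u])
 obtain K where K: "compactin CS K" "!!x. x \<in> A ==> f x \<noteq> \<zero>\<^bsub>V (d x)\<^esub> ==> q x \<in> K" by (rule ES_compact[OF f]) blast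
 show ?thesis
  using integrable_compact[OF continuous_descend[OF coset_invariant_ipf[OF f g] ipf_continuous[OF f g]] K(1)]
   descend_ipf_compact[OF f g K(2)] by blast
qed

lemma F0_ip_continuous: "f \<in> ES ==> g \<in> ES ==> continuous_map (unit_top G) euclidean (F0_ip G \<mu> \<sigma> f g)"
 using mu_continuous[OF descend_ipf_Cc] unfolding F0_ip_eq[abs_def] by blast

text \<open>Equivariance and unitarity of \<open>\<sigma>\<close> make the fibre norm of a section a function on the coset space.\<close>

lemma ES_vnorm_coset:
 assumes f: "f \<in> ES" and "x \<in> A" "y \<in> A" "q x = q y"
 shows "vnorm (V (d x)) (f x) = vnorm (V (d y)) (f y)"
 using descend_q[OF coset_invariant_ipf[OF f f] assms(2)] descend_q[OF coset_invariant_ipf[OF f f] assms(3)] assms(4)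
 by (simp add: ipf_def vnorm_def)

lemma F0_ip_cong:
 assumes fg: "f \<in> ES" "g \<in> ES" "f' \<in> ES" "g' \<in> ES" and u: "u \<in> U0"
  and eq: "!!x. x \<in> A ==> r x = u ==> f x = f' x \<and> g x = g' x"
 shows "F0_ip G \<mu> \<sigma> f g u = F0_ip G \<mu> \<sigma> f' g' u"
proof -
 interpret radon CS "\<mu> u" by (rule radon_mu[OF u])
 show ?thesis
  unfolding F0_ip_eq
 proof (rule integral_cong_support)
  fix C assume "C \<in> measure_support CS (\<mu> u)"
  then obtain x where x: "x \<in> A" "r x = u" "C = q x" using support_mu[OF u] by auto
  then show "descend (ipf f g) C = descend (ipf f' g') C"
   using descend_q[OF coset_invariant_ipf] fg eq[of x] by (simp add: ipf_def)
 qed (use descend_ipf_integrable[OF fg(1,2) u] descend_ipf_integrable[OF fg(3,4) u] in auto)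
qed

abbreviation W where "W u \<equiv> with_ip F0 (\<lambda>f g. F0_ip G \<mu> \<sigma> f g u)"
abbreviation nrm where "nrm u f \<equiv> vnorm (W u) f"

lemma semi_W: assumes u: "u \<in> U0" shows "semi_inner (W u)"
proof -
 interpret radon CS "\<mu> u" by (rule radon_mu[OF u])
 interpret module complex_ring "W u" using module_F0 by simp
 have sp: "space (\<mu> u) = q ` A" using space_M by simp
 have rep: "\<exists>x. x \<in> A \<and> C = q x" if "C \<in> q ` A" for C using that by blast
 show ?thesis
 proof
  fix f g assume "f \<in> carrier (W u)" "g \<in> carrier (W u)"
  then have fg: "f \<in> ES" "g \<in> ES" by (simp_all add: F0_simps)
  have "descend (ipf g f) C = cnj (descend (ipf f g) C)" if C: "C \<in> q ` A" for C
  proof -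
   obtain x where x: "x \<in> A" "C = q x" using C by blast
   have "ip (V (d x)) (g x) (f x) = cnj (ip (V (d x)) (f x) (g x))"
    by (rule semi_inner.ip_cnj[OF V_semi]) (use x(1) ES_D(2)[OF fg(1)] ES_D(2)[OF fg(2)] in auto)
   then show ?thesis unfolding x(2)
    by (simp only: descend_q[OF coset_invariant_ipf[OF fg] x(1)]
      descend_q[OF coset_invariant_ipf[OF fg(2,1)] x(1)] ipf_def)
  qed
  then have "(LINT C|\<mu> u. descend (ipf g f) C) = (LINT C|\<mu> u. cnj (descend (ipf f g) C))"
   by (intro Bochner_Integration.integral_cong) (auto simp: sp)
  then show "ip (W u) g f = cnj (ip (W u) f g)"
   by (simp add: F0_ip_eq)
  have "ip (V (d x)) (c \<odot>\<^bsub>V (d x)\<^esub> f x) (g x) = c * ip (V (d x)) (f x) (g x)" if "x \<in> A" for x c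
   using that fg ES_D(2) semi_inner.ip_smult[OF V_semi] by simp
  moreover have "c \<odot>\<^bsub>F0\<^esub> f \<in> ES" for c
   using fg smult_closed[of c f] by (simp add: F0_simps)
  ultimately have "descend (ipf (c \<odot>\<^bsub>F0\<^esub> f) g) C = c * descend (ipf f g) C" if "C \<in> q ` A" for C c
   using that fg by (auto simp: descend_q[OF coset_invariant_ipf]) (simp add: ipf_def F0_simps)
  then have "(LINT C|\<mu> u. descend (ipf (c \<odot>\<^bsub>F0\<^esub> f) g) C) = (LINT C|\<mu> u. c * descend (ipf f g) C)" for c
   by (intro Bochner_Integration.integral_cong) (auto simp: sp)
  then show "ip (W u) (c \<odot>\<^bsub>W u\<^esub> f) g = c * ip (W u) f g" for c
   by (simp add: F0_ip_eq)
  fix f' assume "f' \<in> carrier (W u)"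
  then have f': "f' \<in> ES" by (simp add: F0_simps)
  have "ip (V (d x)) (f x \<oplus>\<^bsub>V (d x)\<^esub> f' x) (g x) = ip (V (d x)) (f x) (g x) + ip (V (d x)) (f' x) (g x)"
   if "x \<in> A" for x
   using that fg f' ES_D(2) semi_inner.ip_add[OF V_semi] by simp
  moreover have "f \<oplus>\<^bsub>F0\<^esub> f' \<in> ES"
   using fg f' ES_add by (simp add: F0_simps)
  ultimately have "descend (ipf (f \<oplus>\<^bsub>F0\<^esub> f') g) C = descend (ipf f g) C + descend (ipf f' g) C" if "C \<in> q ` A" for C
   using that fg f' by (auto simp: descend_q[OF coset_invariant_ipf]) (simp add: ipf_def F0_simps)
  then have "(LINT C|\<mu> u. descend (ipf (f \<oplus>\<^bsub>F0\<^esub> f') g) C) = (LINT C|\<mu> u. descend (ipf f g) C + descend (ipf f' g) C)"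
   by (intro Bochner_Integration.integral_cong) (auto simp: sp)
  then show "ip (W u) (f \<oplus>\<^bsub>W u\<^esub> f') g = ip (W u) f g + ip (W u) f' g"
   using descend_ipf_integrable[OF fg u] descend_ipf_integrable[OF f' fg(2) u] by (simp add: F0_ip_eq)
 next
  fix f assume "f \<in> carrier (W u)"
  then have f: "f \<in> ES" by (simp add: F0_simps)
  have "0 \<le> Re (descend (ipf f f) C)" if "C \<in> q ` A" for C
   using that f ES_D(2) semi_inner.ip_nonneg[OF V_semi]
   by (auto simp: descend_q[OF coset_invariant_ipf] ipf_def)
  then have "0 \<le> (LINT C|\<mu> u. Re (descend (ipf f f) C))"
   by (intro integral_nonneg_AE AE_I2) (simp add: sp)
  then show "0 \<le> Re (ip (W u) f f)"
   using descend_ipf_integrable[OF f f u] by (simp add: F0_ip_eq)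
 qed
qed

lemma F0_norm_eq: "F0_norm G \<mu> \<sigma> f = (SUP u\<in>U0. nrm u f)"
 by (simp add: F0_norm_def vnorm_def)

lemma nrm_continuous: "f \<in> ES ==> continuous_map (unit_top G) euclideanreal (\<lambda>u. nrm u f)"
 unfolding vnorm_def using F0_ip_continuous[of f f] by (auto intro!: continuous_map_sqrt continuous_map_ceuclid(4))

lemma nrm_bounded: assumes f: "f \<in> ES" shows "bdd_above ((\<lambda>u. nrm u f) ` U0)"
proof -
 obtain K where K: "compactin CS K" "!!x. x \<in> A ==> f x \<noteq> \<zero>\<^bsub>V (d x)\<^esub> ==> q x \<in> K" by (rule ES_compact[OF f]) blast
 let ?L = "coset_rng G ` K"
 have "compactin (unit_top G) ?L" by (rule image_compactin[OF K(1) continuous_coset_rng])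
 then have "compact ((\<lambda>u. nrm u f) ` ?L)" using image_compactin[OF _ nrm_continuous[OF f]] by simp
 then have "bounded ((\<lambda>u. nrm u f) ` ?L)" by (rule compact_imp_bounded)
 then obtain B where "\<forall>y\<in>(\<lambda>u. nrm u f) ` ?L. norm y \<le> B" unfolding bounded_iff by blast
 then have B: "nrm u f \<le> B" if "u \<in> ?L" for u
  using bspec[OF _ imageI[OF that], of "\<lambda>u. nrm u f" "\<lambda>y. norm y \<le> B"] by simp
 have "nrm u f \<le> max B 0" if u: "u \<in> U0" for u
 proof (cases "u \<in> ?L")
  case False
  have "f x = \<zero>\<^bsub>F0\<^esub> x" if "x \<in> A" "r x = u" for x
  proof -
   have "q x \<notin> K" using False coset_rng_q[OF that(1)] that(2) by force
   then show ?thesis using K(2)[OF that(1)] that(1) by (auto simp: F0_simps)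
  qed
  then have "F0_ip G \<mu> \<sigma> f f u = F0_ip G \<mu> \<sigma> \<zero>\<^bsub>F0\<^esub> \<zero>\<^bsub>F0\<^esub> u"
   using f u ES_zero by (intro F0_ip_cong) (auto simp: F0_simps)
  then have "nrm u f = 0" using semi_inner.vnorm_zero[OF semi_W[OF u]] by (simp add: vnorm_def)
  then show ?thesis by simp
 qed (use B in force)
 then show ?thesis by (auto intro!: bdd_aboveI2)
qed

lemma nrm_le_F0_norm: "f \<in> ES ==> u \<in> U0 ==> nrm u f \<le> F0_norm G \<mu> \<sigma> f"
 unfolding F0_norm_eq using nrm_bounded by (intro cSUP_upper)

lemma F0_norm_leI: "U0 \<noteq> {} ==> (!!u. u \<in> U0 ==> nrm u f \<le> c) ==> F0_norm G \<mu> \<sigma> f \<le> c"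
 unfolding F0_norm_eq by (rule cSUP_least)

end

section \<open>The Hilbert bundle of the induced representation\<close>

context semi_inner
begin

lemma Cauchy_ip_convergent:
 assumes s: "!!n. s n \<in> carrier V" "!!e. e > 0 ==> \<exists>N. \<forall>m\<ge>N. \<forall>n\<ge>N. vnorm V (s m \<ominus> s n) < e"
  and t: "!!n. t n \<in> carrier V" "!!e. e > 0 ==> \<exists>N. \<forall>m\<ge>N. \<forall>n\<ge>N. vnorm V (t m \<ominus> t n) < e"
 shows "convergent (\<lambda>n. ip V (s n) (t n))"
proof -
 have bd: "\<exists>B>0. \<forall>n. vnorm V (z n) \<le> B"
  if z: "!!n. z n \<in> carrier V" "!!e. e > 0 ==> \<exists>N. \<forall>m\<ge>N. \<forall>n\<ge>N. vnorm V (z m \<ominus> z n) < e" for z :: "nat \<Rightarrow> 'v"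
 proof -
  have "Cauchy (\<lambda>n. vnorm V (z n))"
   unfolding Cauchy_def dist_real_def using z abs_vnorm_diff by (meson le_less_trans)
  then have "Bseq (\<lambda>n. vnorm V (z n))" by (rule Cauchy_Bseq)
  then obtain B where "B > 0" "\<forall>n. norm (vnorm V (z n)) \<le> B" by (rule BseqE)
  then show ?thesis using z vnorm_nonneg by (intro exI[of _ B]) simp
 qed
 obtain B where B: "B > 0" "!!n. vnorm V (s n) \<le> B" using bd[OF s] by blast
 obtain D where D: "D > 0" "!!n. vnorm V (t n) \<le> D" using bd[OF t] by blast
 have "Cauchy (\<lambda>n. ip V (s n) (t n))"
  unfolding Cauchy_def dist_norm
 proof (intro allI impI)
  fix e :: real assume e: "e > 0"
  obtain N where N: "\<forall>m\<ge>N. \<forall>n\<ge>N. vnorm V (s m \<ominus> s n) < e / (2 * D)" using s(2)[of "e / (2 * D)"] e D by auto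
  obtain M where M: "\<forall>m\<ge>M. \<forall>n\<ge>M. vnorm V (t m \<ominus> t n) < e / (2 * B)" using t(2)[of "e / (2 * B)"] e B by auto
  have "cmod (ip V (s m) (t m) - ip V (s n) (t n)) < e" if mn: "m \<ge> max N M" "n \<ge> max N M" for m n
  proof -
   have "cmod (ip V (s m) (t m) - ip V (s n) (t n)) \<le>
     vnorm V (s m \<ominus> s n) * vnorm V (t m) + vnorm V (s n) * vnorm V (t m \<ominus> t n)"
    using s t by (intro ip_diff_bound) auto
   also have "\<dots> \<le> vnorm V (s m \<ominus> s n) * D + B * vnorm V (t m \<ominus> t n)"
    using s t B D vnorm_nonneg by (intro add_mono mult_left_mono mult_right_mono) auto
   also have "\<dots> < e / (2 * D) * D + B * (e / (2 * B))"
    using N M mn B D by (intro add_strict_mono mult_strict_left_mono mult_strict_right_mono) auto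
   also have "\<dots> = e" using B D by simp
   finally show ?thesis .
  qed
  then show "\<exists>M. \<forall>m\<ge>M. \<forall>n\<ge>M. cmod (ip V (s m) (t m) - ip V (s n) (t n)) < e" by blast
 qed
 then show ?thesis by (rule Cauchy_convergent)
qed

text \<open>It suffices to test completeness on rapidly converging sequences from a dense set.\<close>

lemma complete_if_dense_rapid:
 assumes D: "D \<subseteq> carrier V" "!!v e. v \<in> carrier V ==> e > 0 ==> \<exists>a\<in>D. vnorm V (a \<ominus> v) < e"
  and rapid: "!!g. (!!n. g n \<in> D) ==> (!!n. vnorm V (g (Suc n) \<ominus> g n) < (1/2)^n) ==>
   \<exists>v\<in>carrier V. (\<lambda>n. vnorm V (g n \<ominus> v)) \<longlonglongrightarrow> 0"
  and s: "!!n. s n \<in> carrier V" "!!e. e > 0 ==> \<exists>N. \<forall>m\<ge>N. \<forall>n\<ge>N. vnorm V (s m \<ominus> s n) < e"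
 shows "\<exists>v\<in>carrier V. (\<lambda>n. vnorm V (s n \<ominus> v)) \<longlonglongrightarrow> 0"
proof -
 have "\<exists>N. \<forall>m\<ge>N. \<forall>n\<ge>N. vnorm V (s m \<ominus> s n) < (1/2)^j / 4" for j :: nat by (rule s(2)) simp
 then obtain N where N: "!!j m n. m \<ge> N j ==> n \<ge> N j ==> vnorm V (s m \<ominus> s n) < (1/2)^j / 4" by metis
 define M where "M j = (\<Sum>i\<le>j. N i)" for j
 have M: "N j \<le> M j" "M j \<le> M (Suc j)" for j by (auto simp: M_def intro: member_le_sum)
 have "\<exists>a\<in>D. vnorm V (a \<ominus> s (M j)) < (1/2)^j / 4" for j by (rule D(2)[OF s(1)]) simp
 then obtain g where g: "!!j. g j \<in> D" "!!j. vnorm V (g j \<ominus> s (M j)) < (1/2)^j / 4" by metis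
 have gc: "g j \<in> carrier V" for j using g(1) D(1) by blast
 have "vnorm V (g (Suc j) \<ominus> g j) < (1/2)^j" for j
 proof -
  have "vnorm V (g (Suc j) \<ominus> g j) \<le> vnorm V (g (Suc j) \<ominus> s (M (Suc j))) + vnorm V (s (M (Suc j)) \<ominus> g j)"
   using gc s by (intro vnorm_diff_triangle) auto
  moreover have "vnorm V (s (M (Suc j)) \<ominus> g j) \<le> vnorm V (s (M (Suc j)) \<ominus> s (M j)) + vnorm V (s (M j) \<ominus> g j)"
   using gc s by (intro vnorm_diff_triangle) auto
  moreover have "vnorm V (s (M (Suc j)) \<ominus> s (M j)) < (1/2)^j / 4"
   using M[of j] by (intro N) auto
  moreover have "vnorm V (g (Suc j) \<ominus> s (M (Suc j))) < (1/2)^j / 4" using g(2)[of "Suc j"] vnorm_nonneg[of "g (Suc j) \<ominus> s (M (Suc j))"] gc s(1) by simp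
  moreover have "vnorm V (s (M j) \<ominus> g j) < (1/2)^j / 4" using g(2)[of j] vnorm_diff_commute[OF gc s(1)] by simp
  moreover have "(0::real) < (1/2)^j" by simp
  ultimately show ?thesis by linarith
 qed
 then have "\<exists>v\<in>carrier V. (\<lambda>n. vnorm V (g n \<ominus> v)) \<longlonglongrightarrow> 0" by (intro rapid g(1))
 then obtain v where v: "v \<in> carrier V" "(\<lambda>n. vnorm V (g n \<ominus> v)) \<longlonglongrightarrow> 0" by blast
 have "(\<lambda>n. vnorm V (s n \<ominus> v)) \<longlonglongrightarrow> 0"
 proof (rule LIMSEQ_I)
  fix e :: real assume e: "e > 0"
  have p0: "(\<lambda>j. (1/2::real)^j) \<longlonglongrightarrow> 0" by (rule LIMSEQ_power_zero) simp
  have "eventually (\<lambda>j. (1/2::real)^j < e) sequentially" by (rule order_tendstoD(2)[OF p0 e])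
  moreover have "eventually (\<lambda>n. vnorm V (g n \<ominus> v) < e / 2) sequentially"
   by (rule order_tendstoD(2)[OF v(2)]) (use e in simp)
  ultimately have "eventually (\<lambda>j. (1/2::real)^j < e \<and> vnorm V (g j \<ominus> v) < e / 2) sequentially"
   by (rule eventually_conj)
  then obtain j where j: "(1/2::real)^j < e" "vnorm V (g j \<ominus> v) < e / 2"
   by (auto simp: eventually_sequentially)
  have "vnorm V (s n \<ominus> v) < e" if n: "n \<ge> M j" for n
  proof -
   have "vnorm V (s n \<ominus> v) \<le> vnorm V (s n \<ominus> s (M j)) + vnorm V (s (M j) \<ominus> v)"
    "vnorm V (s (M j) \<ominus> v) \<le> vnorm V (s (M j) \<ominus> g j) + vnorm V (g j \<ominus> v)"
    using gc s v by (intro vnorm_diff_triangle; auto)+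
   moreover have "vnorm V (s n \<ominus> s (M j)) < (1/2)^j / 4" using n M[of j] by (intro N) auto
   moreover have "vnorm V (s (M j) \<ominus> g j) < (1/2)^j / 4" using g(2)[of j] vnorm_diff_commute[OF gc s(1)] by simp
   ultimately show ?thesis using j by linarith
  qed
  then show "\<exists>no. \<forall>n\<ge>no. norm (vnorm V (s n \<ominus> v) - 0) < e"
   using s v vnorm_nonneg by (intro exI[of _ "M j"]) simp
 qed
 then show ?thesis using v by blast
qed

end

text \<open>The norm on equivariant sections is a supremum over the unit space, which has a meaning only if there
 is a unit.\<close>

locale hrep_ne = hrep +
 assumes ne: "unit_space G \<noteq> {}"
begin

abbreviation FC where "FC \<equiv> F_cauchy G H \<mu> \<sigma>"
abbreviation FN where "FN \<equiv> F_null G H \<mu> \<sigma>"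
abbreviation FS where "FS \<equiv> F_space G H \<mu> \<sigma>"
abbreviation FK where "FK \<equiv> F_kernel G H \<mu> \<sigma>"
abbreviation FF where "FF \<equiv> F_fibre G H \<mu> \<sigma>"
abbreviation N0 where "N0 \<equiv> F0_norm G \<mu> \<sigma>"

sublocale F0: module complex_ring F0 by (rule module_F0)

lemma ES_closed [simp]: "f \<in> ES ==> g \<in> ES ==> f \<oplus>\<^bsub>F0\<^esub> g \<in> ES" "f \<in> ES ==> g \<in> ES ==> f \<ominus>\<^bsub>F0\<^esub> g \<in> ES"
 "f \<in> ES ==> c \<odot>\<^bsub>F0\<^esub> f \<in> ES" "\<zero>\<^bsub>F0\<^esub> \<in> ES"
 using F0.M.a_closed[of f g] F0.M.minus_closed[of f g] F0.smult_closed[of c f] F0.M.zero_closed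
 by (simp_all add: F0_simps(1))

lemma nrm_triangle: "u \<in> U0 ==> f \<in> ES ==> g \<in> ES ==> nrm u (f \<oplus>\<^bsub>F0\<^esub> g) \<le> nrm u f + nrm u g"
 using semi_inner.vnorm_triangle[OF semi_W, of u f g] by (simp add: F0_simps(1))

lemma nrm_smult: "u \<in> U0 ==> f \<in> ES ==> nrm u (c \<odot>\<^bsub>F0\<^esub> f) = cmod c * nrm u f"
 using semi_inner.vnorm_smult[OF semi_W, of u f c] by (simp add: F0_simps(1))

lemma N0_triangle: "f \<in> ES ==> g \<in> ES ==> N0 (f \<oplus>\<^bsub>F0\<^esub> g) \<le> N0 f + N0 g"
 by (rule F0_norm_leI[OF ne], rule order_trans[OF nrm_triangle]) (auto intro: add_mono nrm_le_F0_norm)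

lemma N0_smult: "f \<in> ES ==> N0 (c \<odot>\<^bsub>F0\<^esub> f) \<le> cmod c * N0 f"
 by (rule F0_norm_leI[OF ne]) (simp add: nrm_smult nrm_le_F0_norm mult_left_mono)

lemma N0_nonneg: "f \<in> ES ==> 0 \<le> N0 f"
proof -
 assume f: "f \<in> ES"
 obtain u where u: "u \<in> U0" using ne by blast
 have "0 \<le> nrm u f" using semi_inner.vnorm_nonneg[OF semi_W[OF u], of f] f by (simp add: F0_simps(1))
 then show ?thesis using nrm_le_F0_norm[OF f u] by linarith
qed

lemma N0_zero: "N0 \<zero>\<^bsub>F0\<^esub> = 0"
proof -
 have "N0 \<zero>\<^bsub>F0\<^esub> \<le> 0"
  using semi_inner.vnorm_zero[OF semi_W] by (intro F0_norm_leI[OF ne]) simp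
 then show ?thesis using N0_nonneg[OF ES_closed(4)] by linarith
qed

lemma FC_simps:
 "carrier FC = {s. (\<forall>n. s n \<in> ES) \<and> (\<forall>e>0. \<exists>N. \<forall>m\<ge>N. \<forall>n\<ge>N. N0 (s m \<ominus>\<^bsub>F0\<^esub> s n) < e)}"
 "s \<oplus>\<^bsub>FC\<^esub> t = (\<lambda>n. s n \<oplus>\<^bsub>F0\<^esub> t n)" "\<zero>\<^bsub>FC\<^esub> = (\<lambda>n. \<zero>\<^bsub>F0\<^esub>)" "c \<odot>\<^bsub>FC\<^esub> s = (\<lambda>n. c \<odot>\<^bsub>F0\<^esub> s n)"
 by (simp_all add: F_cauchy_def Let_def F0_simps(1))

lemma FC_ES: "s \<in> carrier FC ==> s n \<in> ES"
 by (simp add: FC_simps)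

lemma FC_Cauchy: "s \<in> carrier FC ==> e > 0 ==> \<exists>N. \<forall>m\<ge>N. \<forall>n\<ge>N. N0 (s m \<ominus>\<^bsub>F0\<^esub> s n) < e"
 by (simp add: FC_simps)

lemma FC_nrm_Cauchy:
 assumes "s \<in> carrier FC" "u \<in> U0" "e > 0" shows "\<exists>N. \<forall>m\<ge>N. \<forall>n\<ge>N. nrm u (s m \<ominus>\<^bsub>F0\<^esub> s n) < e"
proof -
 obtain N where "\<forall>m\<ge>N. \<forall>n\<ge>N. N0 (s m \<ominus>\<^bsub>F0\<^esub> s n) < e" using FC_Cauchy[OF assms(1,3)] by blast
 then have "\<forall>m\<ge>N. \<forall>n\<ge>N. nrm u (s m \<ominus>\<^bsub>F0\<^esub> s n) < e"
  using nrm_le_F0_norm[OF ES_closed(2)[OF FC_ES[OF assms(1)] FC_ES[OF assms(1)]] assms(2)] le_less_trans by blast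
 then show ?thesis by blast
qed

lemma FC_const: "f \<in> ES ==> (\<lambda>n. f) \<in> carrier FC"
proof -
 assume f: "f \<in> ES"
 obtain u where u: "u \<in> U0" using ne by blast
 have "f \<ominus>\<^bsub>F0\<^esub> f = \<zero>\<^bsub>F0\<^esub>"
  using semi_inner.diff_self[OF semi_W[OF u], of f] f by (simp add: F0_simps(1))
 then show ?thesis using f N0_zero by (simp add: FC_simps)
qed

lemma F0_diff_add:
 assumes "f \<in> ES" "g \<in> ES" "f' \<in> ES" "g' \<in> ES"
 shows "(f \<oplus>\<^bsub>F0\<^esub> g) \<ominus>\<^bsub>F0\<^esub> (f' \<oplus>\<^bsub>F0\<^esub> g') = (f \<ominus>\<^bsub>F0\<^esub> f') \<oplus>\<^bsub>F0\<^esub> (g \<ominus>\<^bsub>F0\<^esub> g')"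
proof -
 obtain u where u: "u \<in> U0" using ne by blast
 show ?thesis
  using semi_inner.diff_diff_diff[OF semi_W[OF u], of f g f' g'] assms by (simp add: F0_simps(1))
qed

lemma F0_smult_diff:
 assumes "f \<in> ES" "g \<in> ES"
 shows "c \<odot>\<^bsub>F0\<^esub> f \<ominus>\<^bsub>F0\<^esub> c \<odot>\<^bsub>F0\<^esub> g = c \<odot>\<^bsub>F0\<^esub> (f \<ominus>\<^bsub>F0\<^esub> g)"
proof -
 obtain u where u: "u \<in> U0" using ne by blast
 show ?thesis
  using semi_inner.smult_minus_right[OF semi_W[OF u], of f g c] assms by (simp add: F0_simps(1))
qed

lemma FC_add: assumes s: "s \<in> carrier FC" and t: "t \<in> carrier FC" shows "s \<oplus>\<^bsub>FC\<^esub> t \<in> carrier FC"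
proof -
 note ES = FC_ES[OF s] FC_ES[OF t]
 have "\<exists>N. \<forall>m\<ge>N. \<forall>n\<ge>N. N0 ((s m \<oplus>\<^bsub>F0\<^esub> t m) \<ominus>\<^bsub>F0\<^esub> (s n \<oplus>\<^bsub>F0\<^esub> t n)) < e" if e: "e > 0" for e
 proof -
  obtain N M where N: "\<forall>m\<ge>N. \<forall>n\<ge>N. N0 (s m \<ominus>\<^bsub>F0\<^esub> s n) < e / 2" and M: "\<forall>m\<ge>M. \<forall>n\<ge>M. N0 (t m \<ominus>\<^bsub>F0\<^esub> t n) < e / 2"
   using FC_Cauchy[OF s, of "e / 2"] FC_Cauchy[OF t, of "e / 2"] e by auto
  have "N0 ((s m \<oplus>\<^bsub>F0\<^esub> t m) \<ominus>\<^bsub>F0\<^esub> (s n \<oplus>\<^bsub>F0\<^esub> t n)) < e" if mn: "m \<ge> max N M" "n \<ge> max N M" for m n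
  proof -
   have "N0 (s m \<ominus>\<^bsub>F0\<^esub> s n) < e / 2" "N0 (t m \<ominus>\<^bsub>F0\<^esub> t n) < e / 2" using N M mn by auto
   moreover have "N0 ((s m \<oplus>\<^bsub>F0\<^esub> t m) \<ominus>\<^bsub>F0\<^esub> (s n \<oplus>\<^bsub>F0\<^esub> t n)) \<le> N0 (s m \<ominus>\<^bsub>F0\<^esub> s n) + N0 (t m \<ominus>\<^bsub>F0\<^esub> t n)"
    using ES by (simp add: F0_diff_add N0_triangle)
   ultimately show ?thesis by linarith
  qed
  then show ?thesis by blast
 qed
 then show ?thesis using ES by (simp add: FC_simps)
qed

lemma FC_smult: assumes s: "s \<in> carrier FC" shows "c \<odot>\<^bsub>FC\<^esub> s \<in> carrier FC"
proof -
 note ES = FC_ES[OF s]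
 have c1: "cmod c + 1 > 0" using norm_ge_zero[of c] by linarith
 have "\<exists>N. \<forall>m\<ge>N. \<forall>n\<ge>N. N0 (c \<odot>\<^bsub>F0\<^esub> s m \<ominus>\<^bsub>F0\<^esub> c \<odot>\<^bsub>F0\<^esub> s n) < e" if e: "e > 0" for e
 proof -
  obtain N where N: "\<forall>m\<ge>N. \<forall>n\<ge>N. N0 (s m \<ominus>\<^bsub>F0\<^esub> s n) < e / (cmod c + 1)"
   using FC_Cauchy[OF s, of "e / (cmod c + 1)"] e c1 by auto
  have "N0 (c \<odot>\<^bsub>F0\<^esub> s m \<ominus>\<^bsub>F0\<^esub> c \<odot>\<^bsub>F0\<^esub> s n) < e" if mn: "m \<ge> N" "n \<ge> N" for m n
  proof -
   have "N0 (c \<odot>\<^bsub>F0\<^esub> s m \<ominus>\<^bsub>F0\<^esub> c \<odot>\<^bsub>F0\<^esub> s n) \<le> cmod c * N0 (s m \<ominus>\<^bsub>F0\<^esub> s n)"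
    using ES by (simp add: F0_smult_diff N0_smult)
   also have "\<dots> \<le> (cmod c + 1) * N0 (s m \<ominus>\<^bsub>F0\<^esub> s n)"
    using N0_nonneg ES by (intro mult_right_mono) auto
   also have "\<dots> < (cmod c + 1) * (e / (cmod c + 1))"
    using N mn c1 by (intro mult_strict_left_mono) auto
   finally show ?thesis using c1 by simp
  qed
  then show ?thesis by blast
 qed
 then show ?thesis using ES by (simp add: FC_simps)
qed

lemma module_FC: "module complex_ring FC"
 and FC_minus: "s \<in> carrier FC ==> t \<in> carrier FC ==> (s \<ominus>\<^bsub>FC\<^esub> t) n = s n \<ominus>\<^bsub>F0\<^esub> t n"
proof -
 have c: "carrier FC \<subseteq> (\<Pi>\<^sub>E i\<in>UNIV. carrier F0)" using FC_ES by (auto simp: F0_simps(1))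
 note pm = pointwise_module[of UNIV "\<lambda>_. F0" FC, OF module_F0 c]
 show "module complex_ring FC"
  by (rule pm(1)) (simp_all add: restrict_def FC_simps(2-4) FC_add[unfolded FC_simps(2)] FC_smult[unfolded FC_simps(4)] FC_const)
 show "s \<in> carrier FC ==> t \<in> carrier FC ==> (s \<ominus>\<^bsub>FC\<^esub> t) n = s n \<ominus>\<^bsub>F0\<^esub> t n"
  by (rule pm(2)) (simp_all add: restrict_def FC_simps(2-4) FC_add[unfolded FC_simps(2)] FC_smult[unfolded FC_simps(4)] FC_const)
qed

definition limip where "limip u s t = lim (\<lambda>n. F0_ip G \<mu> \<sigma> (s n) (t n) u)"

lemma limip_tendsto:
 assumes "u \<in> U0" "s \<in> carrier FC" "t \<in> carrier FC"
 shows "(\<lambda>n. F0_ip G \<mu> \<sigma> (s n) (t n) u) \<longlonglongrightarrow> limip u s t"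
proof -
 interpret W: semi_inner "W u" by (rule semi_W[OF assms(1)])
 have "convergent (\<lambda>n. ip (W u) (s n) (t n))"
  using FC_ES[OF assms(2)] FC_ES[OF assms(3)] FC_nrm_Cauchy[OF assms(2,1)] FC_nrm_Cauchy[OF assms(3,1)]
  by (intro W.Cauchy_ip_convergent) (simp_all add: F0_simps(1))
 then show ?thesis by (simp add: convergent_LIMSEQ_iff limip_def)
qed

lemma semi_WC: assumes u: "u \<in> U0" shows "semi_inner (with_ip FC (limip u))"
proof -
 interpret W: semi_inner "W u" by (rule semi_W[OF u])
 interpret module complex_ring "with_ip FC (limip u)" using module_FC by simp
 note lt = limip_tendsto[OF u]
 note unique = LIMSEQ_unique
 have ES: "s n \<in> carrier (W u)" if "s \<in> carrier FC" for s n using FC_ES[OF that] by (simp add: F0_simps(1))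
 show ?thesis
 proof
  fix s t assume "s \<in> carrier (with_ip FC (limip u))" "t \<in> carrier (with_ip FC (limip u))"
  then have st: "s \<in> carrier FC" "t \<in> carrier FC" by simp_all
  have "F0_ip G \<mu> \<sigma> (t n) (s n) u = cnj (F0_ip G \<mu> \<sigma> (s n) (t n) u)" for n
   using W.ip_cnj[OF ES[OF st(1)] ES[OF st(2)]] by (simp only: with_ip_simps)
  then have "(\<lambda>n. F0_ip G \<mu> \<sigma> (t n) (s n) u) \<longlonglongrightarrow> cnj (limip u s t)"
   using tendsto_cnj[OF lt[OF st]] by simp
  then show "ip (with_ip FC (limip u)) t s = cnj (ip (with_ip FC (limip u)) s t)"
   using unique[OF lt[OF st(2,1)]] by simp
  have "(\<lambda>n. F0_ip G \<mu> \<sigma> ((c \<odot>\<^bsub>FC\<^esub> s) n) (t n) u) \<longlonglongrightarrow> c * limip u s t" for c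
   using tendsto_mult_left[OF lt[OF st], of c] W.ip_smult[OF ES[OF st(1)] ES[OF st(2)]] by (simp add: FC_simps)
  then show "ip (with_ip FC (limip u)) (c \<odot>\<^bsub>with_ip FC (limip u)\<^esub> s) t = c * ip (with_ip FC (limip u)) s t" for c
   using unique[OF lt[OF FC_smult[OF st(1)] st(2)]] by simp
  fix s' assume "s' \<in> carrier (with_ip FC (limip u))"
  then have s': "s' \<in> carrier FC" by simp
  have "(\<lambda>n. F0_ip G \<mu> \<sigma> ((s \<oplus>\<^bsub>FC\<^esub> s') n) (t n) u) \<longlonglongrightarrow> limip u s t + limip u s' t"
   using tendsto_add[OF lt[OF st] lt[OF s' st(2)]] W.ip_add[OF ES[OF st(1)] ES[OF s'] ES[OF st(2)]]
   by (simp add: FC_simps)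
  then show "ip (with_ip FC (limip u)) (s \<oplus>\<^bsub>with_ip FC (limip u)\<^esub> s') t
    = ip (with_ip FC (limip u)) s t + ip (with_ip FC (limip u)) s' t"
   using unique[OF lt[OF FC_add[OF st(1) s'] st(2)]] by simp
 next
  fix s assume "s \<in> carrier (with_ip FC (limip u))"
  then have s: "s \<in> carrier FC" by simp
  have "(\<lambda>n. Re (F0_ip G \<mu> \<sigma> (s n) (s n) u)) \<longlonglongrightarrow> Re (limip u s s)" by (rule tendsto_Re[OF lt[OF s s]])
  moreover have "0 \<le> Re (F0_ip G \<mu> \<sigma> (s n) (s n) u)" for n using W.ip_nonneg[OF ES[OF s]] by simp
  ultimately show "0 \<le> Re (ip (with_ip FC (limip u)) s s)" by (auto intro: LIMSEQ_le_const)
 qed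
qed

lemma FN_iff: "s \<in> FN \<longleftrightarrow> s \<in> carrier FC \<and> (\<lambda>n. N0 (s n)) \<longlonglongrightarrow> 0"
 by (simp add: F_null_def)

lemma nq1: assumes u: "u \<in> U0" shows "null_quotient FC (limip u) FN"
proof -
 interpret WC: semi_inner "with_ip FC (limip u)" by (rule semi_WC[OF u])
 show ?thesis
 proof
  show "FN \<subseteq> carrier FC" by (auto simp: FN_iff)
  show "\<zero>\<^bsub>FC\<^esub> \<in> FN" using FC_const[OF ES_closed(4)] by (simp add: FN_iff FC_simps(3) N0_zero)
  fix s assume s: "s \<in> FN"
  then have sC: "s \<in> carrier FC" and s0: "(\<lambda>n. N0 (s n)) \<longlonglongrightarrow> 0" by (auto simp: FN_iff)
  show "c \<odot>\<^bsub>FC\<^esub> s \<in> FN" for c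
  proof -
   have "(\<lambda>n. N0 ((c \<odot>\<^bsub>FC\<^esub> s) n)) \<longlonglongrightarrow> 0"
   proof (rule tendsto_sandwich[OF _ _ tendsto_const])
    show "(\<lambda>n. cmod c * N0 (s n)) \<longlonglongrightarrow> 0" using tendsto_mult_left[OF s0, of "cmod c"] by simp
   qed (use FC_ES[OF sC] in \<open>auto simp: FC_simps(4) N0_smult N0_nonneg\<close>)
   then show ?thesis using FC_smult[OF sC] by (simp add: FN_iff)
  qed
  show "limip u s s = 0"
  proof -
   have "(\<lambda>n. nrm u (s n)) \<longlonglongrightarrow> 0"
    by (rule tendsto_sandwich[OF _ _ tendsto_const s0])
     (use FC_ES[OF sC] nrm_le_F0_norm[OF _ u] semi_inner.vnorm_nonneg[OF semi_W[OF u]] in \<open>auto simp: F0_simps(1)\<close>)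
   then have "(\<lambda>n. complex_of_real ((nrm u (s n))\<^sup>2)) \<longlonglongrightarrow> complex_of_real (0\<^sup>2)"
    by (intro tendsto_of_real tendsto_power)
   moreover have "complex_of_real ((nrm u (s n))\<^sup>2) = F0_ip G \<mu> \<sigma> (s n) (s n) u" for n
    using semi_inner.ip_self[OF semi_W[OF u], of "s n"] FC_ES[OF sC, of n] by (simp add: F0_simps(1))
   ultimately show ?thesis using LIMSEQ_unique[OF limip_tendsto[OF u sC sC]] by simp
  qed
  fix t assume t: "t \<in> FN"
  then have tC: "t \<in> carrier FC" and t0: "(\<lambda>n. N0 (t n)) \<longlonglongrightarrow> 0" by (auto simp: FN_iff)
  have "(\<lambda>n. N0 ((s \<oplus>\<^bsub>FC\<^esub> t) n)) \<longlonglongrightarrow> 0"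
  proof (rule tendsto_sandwich[OF _ _ tendsto_const])
   show "(\<lambda>n. N0 (s n) + N0 (t n)) \<longlonglongrightarrow> 0" using tendsto_add[OF s0 t0] by simp
  qed (use FC_ES[OF sC] FC_ES[OF tC] in \<open>auto simp: FC_simps(2) N0_triangle N0_nonneg\<close>)
  then show "s \<oplus>\<^bsub>FC\<^esub> t \<in> FN" using FC_add[OF sC tC] by (simp add: FN_iff)
 qed
qed

abbreviation Fip where "Fip u B D \<equiv> F_ip G \<mu> \<sigma> B D u"

lemma Fip_apply: "u \<in> U0 ==> F_ip G \<mu> \<sigma> B D u = null_quotient.qip (limip u) B D"
 by (simp only: F_ip_def limip_def null_quotient.qip_def[OF nq1])

lemma Fip_eq: "u \<in> U0 ==> Fip u = null_quotient.qip (limip u)"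
 by (intro ext) (simp only: Fip_apply)

lemma nq2: assumes u: "u \<in> U0" shows "null_quotient FS (Fip u) (FK u)"
proof -
 interpret Q: null_quotient FC "limip u" FN by (rule nq1[OF u])
 have si: "semi_inner (with_ip FS (Fip u))"
  using Q.semi_inner_QM unfolding Fip_eq[OF u] F_space_def .
 interpret S: semi_inner "with_ip FS (Fip u)" by (rule si)
 have K: "B \<in> FK u \<longleftrightarrow> B \<in> carrier FS \<and> vnorm (with_ip FS (Fip u)) B = 0" for B
  using S.vnorm_eq_0_iff_ip[of B] by (auto simp: F_kernel_def)
 show ?thesis
 proof
  show "FK u \<subseteq> carrier FS" by (auto simp: F_kernel_def)
  show "\<zero>\<^bsub>FS\<^esub> \<in> FK u" using S.vnorm_zero S.M.zero_closed by (simp add: K)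
  fix v assume v: "v \<in> FK u"
  show "c \<odot>\<^bsub>FS\<^esub> v \<in> FK u" for c using v S.smultC[of v c] S.vnorm_smult[of v c] by (simp add: K)
  show "Fip u v v = 0" using v by (simp add: F_kernel_def)
  fix w assume w: "w \<in> FK u"
  show "v \<oplus>\<^bsub>FS\<^esub> w \<in> FK u"
   using v w S.M.a_closed[of v w] S.vnorm_triangle[of v w] S.vnorm_nonneg[of "v \<oplus>\<^bsub>FS\<^esub> w"] by (simp add: K)
 qed
qed

lemma FF_eq: "u \<in> U0 ==> FF u = with_ip (quotient_space FS (FK u)) (null_quotient.qip (Fip u))"
proof -
 assume u: "u \<in> U0"
 have "null_quotient.qip (Fip u) = (\<lambda>P Q. the_elem ((\<lambda>(B, D). F_ip G \<mu> \<sigma> B D u) ` (P \<times> Q)))"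
  by (intro ext) (simp only: null_quotient.qip_def[OF nq2[OF u]])
 then show ?thesis by (simp add: F_fibre_def)
qed

definition cls where "cls u s = FK u +>\<^bsub>FS\<^esub> (FN +>\<^bsub>FC\<^esub> s)"

lemma semi_FF: "u \<in> U0 ==> semi_inner (FF u)"
 using null_quotient.semi_inner_QM[OF nq2] by (simp add: FF_eq)

lemma carrier_FS: "carrier FS = (\<lambda>s. FN +>\<^bsub>FC\<^esub> s) ` carrier FC"
proof -
 obtain u where u: "u \<in> U0" using ne by blast
 interpret Q: null_quotient FC "limip u" FN by (rule nq1[OF u])
 show ?thesis using Q.carrier_QM by (simp add: F_space_def)
qed

lemma cls_props:
 assumes u: "u \<in> U0" and s: "s \<in> carrier FC" and t: "t \<in> carrier FC"
 shows "cls u s \<in> carrier (FF u)" "ip (FF u) (cls u s) (cls u t) = limip u s t"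
  "cls u s \<oplus>\<^bsub>FF u\<^esub> cls u t = cls u (s \<oplus>\<^bsub>FC\<^esub> t)" "c \<odot>\<^bsub>FF u\<^esub> cls u s = cls u (c \<odot>\<^bsub>FC\<^esub> s)"
  "\<zero>\<^bsub>FF u\<^esub> = cls u \<zero>\<^bsub>FC\<^esub>" "cls u s \<ominus>\<^bsub>FF u\<^esub> cls u t = cls u (s \<ominus>\<^bsub>FC\<^esub> t)"
proof -
 interpret Q: null_quotient FC "limip u" FN by (rule nq1[OF u])
 interpret R: null_quotient FS "Fip u" "FK u" by (rule nq2[OF u])
 have c: "Q.cl s \<in> carrier FS" "Q.cl t \<in> carrier FS" using s t carrier_FS by auto
 note FSQ = F_space_def[of G H \<mu> \<sigma>]
 show "cls u s \<in> carrier (FF u)" using c by (simp add: FF_eq[OF u] cls_def)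
 show "ip (FF u) (cls u s) (cls u t) = limip u s t"
  unfolding FF_eq[OF u] cls_def with_ip_simps R.qip_cl[OF c] unfolding Fip_apply[OF u] by (rule Q.qip_cl[OF s t])
 show "cls u s \<oplus>\<^bsub>FF u\<^esub> cls u t = cls u (s \<oplus>\<^bsub>FC\<^esub> t)"
  using R.cl_add[OF c] Q.cl_add[OF s t] by (simp add: FF_eq[OF u] cls_def FSQ)
 show "c \<odot>\<^bsub>FF u\<^esub> cls u s = cls u (c \<odot>\<^bsub>FC\<^esub> s)"
  using R.cl_smult[OF c(1)] Q.cl_smult[OF s] by (simp add: FF_eq[OF u] cls_def FSQ)
 show "\<zero>\<^bsub>FF u\<^esub> = cls u \<zero>\<^bsub>FC\<^esub>"
  using R.cl_zero Q.cl_zero by (simp add: FF_eq[OF u] cls_def FSQ)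
 show "cls u s \<ominus>\<^bsub>FF u\<^esub> cls u t = cls u (s \<ominus>\<^bsub>FC\<^esub> t)"
  using R.cl_minus[OF c] Q.cl_minus[OF s t] by (simp add: FF_eq[OF u] cls_def FSQ)
qed

lemma cls_surj:
 assumes u: "u \<in> U0" and "P \<in> carrier (FF u)"
 obtains s where "s \<in> carrier FC" "P = cls u s"
proof -
 interpret R: null_quotient FS "Fip u" "FK u" by (rule nq2[OF u])
 have "P \<in> R.cl ` carrier FS" using assms(2) R.carrier_QM by (simp add: FF_eq[OF u])
 then show ?thesis using carrier_FS that by (auto simp: cls_def)
qed

lemma cls_norm:
 assumes u: "u \<in> U0" and s: "s \<in> carrier FC"
 shows "(\<lambda>n. nrm u (s n)) \<longlonglongrightarrow> vnorm (FF u) (cls u s)"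
 unfolding vnorm_def using tendsto_real_sqrt[OF tendsto_Re[OF limip_tendsto[OF u s s]]] cls_props(2)[OF u s s]
 by simp

lemma cls_norm_le:
 assumes u: "u \<in> U0" and s: "s \<in> carrier FC" and N: "!!n. n \<ge> N ==> nrm u (s n) \<le> B"
 shows "vnorm (FF u) (cls u s) \<le> B"
 using LIMSEQ_le_const2[OF cls_norm[OF u s]] N by blast

lemma F0_class_eq: "u \<in> U0 ==> F0_class G H \<mu> \<sigma> f u = cls u (\<lambda>n. f)"
 by (simp add: F0_class_def F_section_def cls_def)

abbreviation clf where "clf f u \<equiv> F0_class G H \<mu> \<sigma> f u"

lemma clf_carrier: "u \<in> U0 ==> f \<in> ES ==> clf f u \<in> carrier (FF u)"
 by (simp add: F0_class_eq cls_props(1)[OF _ FC_const FC_const])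

lemma clf_ip: "u \<in> U0 ==> f \<in> ES ==> g \<in> ES ==> ip (FF u) (clf f u) (clf g u) = F0_ip G \<mu> \<sigma> f g u"
 by (simp add: F0_class_eq cls_props(2)[OF _ FC_const FC_const] limip_def lim_def[symmetric])

lemma clf_norm_diff:
 assumes "u \<in> U0" "f \<in> ES" "g \<in> ES"
 shows "ndist (FF u) (clf f u) (clf g u) = nrm u (f \<ominus>\<^bsub>F0\<^esub> g)"
 using vnorm_diff_eq_of_ip_eq[OF semi_W[OF assms(1)] semi_FF[OF assms(1)], of f g "clf f u" "clf g u"]
  assms clf_ip clf_carrier by (simp add: F0_simps(1))

lemma cls_clf_le:
 assumes u: "u \<in> U0" and s: "s \<in> carrier FC" and N: "!!m n. m \<ge> N ==> n \<ge> N ==> N0 (s m \<ominus>\<^bsub>F0\<^esub> s n) < e"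
  and n: "n \<ge> N"
 shows "ndist (FF u) (clf (s n) u) (cls u s) \<le> e"
proof -
 have c: "(\<lambda>k. s n) \<in> carrier FC" using FC_const[OF FC_ES[OF s]] .
 interpret WC: semi_inner "with_ip FC (limip u)" by (rule semi_WC[OF u])
 have "(\<lambda>k. s n) \<ominus>\<^bsub>FC\<^esub> s \<in> carrier FC" using WC.M.minus_closed[of "\<lambda>k. s n" s] c s by simp
 moreover have "nrm u (((\<lambda>k. s n) \<ominus>\<^bsub>FC\<^esub> s) m) \<le> e" if "m \<ge> N" for m
  using nrm_le_F0_norm[OF ES_closed(2)[OF FC_ES[OF s] FC_ES[OF s]] u, of n m] N[OF n that]
  by (simp add: FC_minus[OF c s])
 ultimately show ?thesis
  unfolding F0_class_eq[OF u] cls_props(6)[OF u c s] by (rule cls_norm_le[OF u])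
qed

lemma clf_dense:
 assumes u: "u \<in> U0" and P: "P \<in> carrier (FF u)" and e: "e > 0"
 shows "\<exists>f\<in>ES. ndist (FF u) (clf f u) P < e"
proof -
 obtain s where s: "s \<in> carrier FC" "P = cls u s" by (rule cls_surj[OF u P])
 obtain N where N: "\<forall>m\<ge>N. \<forall>n\<ge>N. N0 (s m \<ominus>\<^bsub>F0\<^esub> s n) < e / 2" using FC_Cauchy[OF s(1), of "e / 2"] e by auto
 have "ndist (FF u) (clf (s N) u) P \<le> e / 2"
  unfolding s(2) by (rule cls_clf_le[OF u s(1), of N]) (use N in auto)
 then show ?thesis using e FC_ES[OF s(1)] by (intro bexI[of _ "s N"]) auto
qed

lemma U_scale:
 assumes f: "f \<in> ES" and b: "continuous_map (unit_top G) euclideanreal b"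
 defines "g \<equiv> (\<lambda>x\<in>A. complex_of_real (b (r x)) \<odot>\<^bsub>V (d x)\<^esub> f x)"
 shows "g \<in> ES" "u \<in> U0 ==> nrm u g = \<bar>b u\<bar> * nrm u f"
  "u \<in> U0 ==> b u = 1 ==> nrm u (g \<ominus>\<^bsub>F0\<^esub> f) = 0"
proof -
 have "continuous_map (gtop G) euclidean (\<lambda>x. complex_of_real (b (r x)))"
  using continuous_map_of_real[OF continuous_map_compose[OF continuous_r b]] by (simp add: o_def)
 then show g: "g \<in> ES"
  unfolding g_def using f H_sub by (intro ES_scale) (auto simp: coset_invariant_def)
 have eq: "g x = (complex_of_real (b u) \<odot>\<^bsub>F0\<^esub> f) x" if "x \<in> A" "r x = u" for x u
  using that by (simp add: g_def F0_simps)
 show "nrm u g = \<bar>b u\<bar> * nrm u f" if u: "u \<in> U0"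
 proof -
  have "F0_ip G \<mu> \<sigma> g g u = F0_ip G \<mu> \<sigma> (complex_of_real (b u) \<odot>\<^bsub>F0\<^esub> f) (complex_of_real (b u) \<odot>\<^bsub>F0\<^esub> f) u"
   using g f eq by (intro F0_ip_cong[OF _ _ _ _ u]) auto
  then have "nrm u g = nrm u (complex_of_real (b u) \<odot>\<^bsub>F0\<^esub> f)" by (simp add: vnorm_def)
  then show ?thesis using nrm_smult[OF u f] by simp
 qed
 show "nrm u (g \<ominus>\<^bsub>F0\<^esub> f) = 0" if u: "u \<in> U0" "b u = 1"
 proof -
  have "(g \<ominus>\<^bsub>F0\<^esub> f) x = \<zero>\<^bsub>F0\<^esub> x" if x: "x \<in> A" "r x = u" for x
  proof -
   interpret Vx: hilb "V (d x)" using V_hilb x by simp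
   have "g x = f x" using eq[OF x] x u Vx.smult_one[of "f x"] ES_D(2)[OF f x(1)] by (simp add: F0_simps)
   then show ?thesis using F0_minus[OF g f x(1)] ES_D(2)[OF f x(1)] x by (simp add: F0_simps)
  qed
  then have "F0_ip G \<mu> \<sigma> (g \<ominus>\<^bsub>F0\<^esub> f) (g \<ominus>\<^bsub>F0\<^esub> f) u = F0_ip G \<mu> \<sigma> \<zero>\<^bsub>F0\<^esub> \<zero>\<^bsub>F0\<^esub> u"
   using g f by (intro F0_ip_cong[OF _ _ _ _ u(1)]) auto
  then show ?thesis using semi_inner.vnorm_zero[OF semi_W[OF u(1)]] by (simp add: vnorm_def)
 qed
qed

lemma FF_definite:
 assumes u: "u \<in> U0" and P: "P \<in> carrier (FF u)" and 0: "ip (FF u) P P = 0"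
 shows "P = \<zero>\<^bsub>FF u\<^esub>"
proof -
 interpret R: null_quotient FS "Fip u" "FK u" by (rule nq2[OF u])
 have "P \<in> R.cl ` carrier FS" using P R.carrier_QM by (simp add: FF_eq[OF u])
 then obtain B where B: "B \<in> carrier FS" "P = R.cl B" by blast
 have "ip (FF u) P P = Fip u B B"
  unfolding FF_eq[OF u] B(2) with_ip_simps by (rule R.qip_cl[OF B(1) B(1)])
 from trans[OF this[symmetric] 0] have "Fip u B B = 0" .
 then have "B \<in> FK u" unfolding F_kernel_def using B(1) by blast
 moreover have "B \<ominus>\<^bsub>FS\<^esub> \<zero>\<^bsub>FS\<^esub> = B" using B(1) R.diff_zero[of B] by simp
 ultimately have "R.cl B = R.cl \<zero>\<^bsub>FS\<^esub>" using R.cl_eq_iff[OF B(1) R.M0.M.zero_closed] by (simp only:)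
 then show "P = \<zero>\<^bsub>FF u\<^esub>" by (simp only: FF_eq[OF u] with_ip_simps B(2) R.cl_zero)
qed

text \<open>The quotient of the module at a point is complete although only the module itself is completed:
 the increments of a rapidly converging sequence can be cut off away from the point so that they
 become uniformly small without changing their class at the point.\<close>

lemma hilb_FF: assumes u: "u \<in> U0" shows "hilb (FF u)"
proof -
 interpret FF: semi_inner "FF u" by (rule semi_FF[OF u])
 interpret R: null_quotient FS "Fip u" "FK u" by (rule nq2[OF u])
 interpret Wu: semi_inner "W u" by (rule semi_W[OF u])
 show ?thesis
 proof
  fix P assume "P \<in> carrier (FF u)" "ip (FF u) P P = 0"
  then show "P = \<zero>\<^bsub>FF u\<^esub>" by (rule FF_definite[OF u])
 next
  fix s :: "nat \<Rightarrow> _" assume s: "!!n. s n \<in> carrier (FF u)"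
   "!!e. e > 0 ==> \<exists>N. \<forall>m\<ge>N. \<forall>n\<ge>N. ndist (FF u) (s m) (s n) < e"
  show "\<exists>v\<in>carrier (FF u). (\<lambda>n. ndist (FF u) (s n) v) \<longlonglongrightarrow> 0"
  proof (rule FF.complete_if_dense_rapid[where D = "(\<lambda>f. clf f u) ` ES", OF _ _ _ s])
   show "(\<lambda>f. clf f u) ` ES \<subseteq> carrier (FF u)" using clf_carrier[OF u] by blast
   show "\<exists>a\<in>(\<lambda>f. clf f u) ` ES. ndist (FF u) a v < e"
    if "v \<in> carrier (FF u)" "e > 0" for v e using clf_dense[OF u that] by blast
   fix P assume P: "!!n. P n \<in> (\<lambda>f. clf f u) ` ES" "!!n. ndist (FF u) (P (Suc n)) (P n) < (1/2)^n"
   have "\<exists>g. \<forall>n. g n \<in> ES \<and> P n = clf (g n) u"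
    by (rule choice, rule allI) (use P(1) in blast)
   then obtain g where g: "!!n. g n \<in> ES" "!!n. P n = clf (g n) u" by blast
   define e where "e n = g (Suc n) \<ominus>\<^bsub>F0\<^esub> g n" for n
   have e: "e n \<in> ES" "nrm u (e n) < (1/2)^n" for n
    using g P(2)[of n] clf_norm_diff[OF u] by (simp_all add: e_def)
   have "\<exists>b. \<forall>n. continuous_map (unit_top G) euclideanreal (b n) \<and> b n u = 1 \<and>
     (\<forall>w\<in>U0. \<bar>b n w\<bar> * nrm w (e n) \<le> (1/2)^n)"
   proof (rule choice, rule allI)
    fix n
    obtain N where N: "openin (unit_top G) N" "u \<in> N" "!!w. w \<in> N ==> nrm w (e n) < (1/2)^n"
     using continuous_map_less_nbhd[OF nrm_continuous[OF e(1)[of n]] _ e(2)[of n]] u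
     by (metis topspace_unit_top)
    have "compactin (unit_top G) {u}" "{u} \<subseteq> N" using u N by auto
    then obtain b L where b: "continuous_map (unit_top G) euclideanreal b"
     "!!w. w \<in> topspace (unit_top G) ==> 0 \<le> b w \<and> b w \<le> 1" "!!w. w \<in> {u} ==> b w = 1"
     "!!w. w \<in> topspace (unit_top G) ==> b w \<noteq> 0 ==> w \<in> N \<and> w \<in> L"
     by (rule U.cutoff[OF _ N(1)]) blast
    have "\<bar>b w\<bar> * nrm w (e n) \<le> (1/2)^n" if w: "w \<in> U0" for w
    proof (cases "b w = 0")
     case False
     have nn: "0 \<le> nrm w (e n)" using semi_inner.vnorm_nonneg[OF semi_W[OF w], of "e n"] e(1) by (simp add: F0_simps(1))
     have "nrm w (e n) < (1/2)^n" using b(4)[of w] w False N(3) by simp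
     moreover have "\<bar>b w\<bar> * nrm w (e n) \<le> 1 * nrm w (e n)" using b(2)[of w] w nn by (intro mult_right_mono) auto
     ultimately show ?thesis by linarith
    qed simp
    then show "\<exists>b. continuous_map (unit_top G) euclideanreal b \<and> b u = 1 \<and>
      (\<forall>w\<in>U0. \<bar>b w\<bar> * nrm w (e n) \<le> (1/2)^n)" using b(1,3) by blast
   qed
   then obtain b where b: "!!n. continuous_map (unit_top G) euclideanreal (b n)" "!!n. b n u = 1"
    "!!n w. w \<in> U0 ==> \<bar>b n w\<bar> * nrm w (e n) \<le> (1/2)^n" by blast
   define c where "c n = (\<lambda>x\<in>A. complex_of_real (b n (r x)) \<odot>\<^bsub>V (d x)\<^esub> e n x)" for n
   have c: "c n \<in> ES" "!!w. w \<in> U0 ==> nrm w (c n) \<le> (1/2)^n" "nrm u (c n \<ominus>\<^bsub>F0\<^esub> e n) = 0" for n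
    using U_scale[OF e(1) b(1)] b(2,3) u unfolding c_def by auto
   define z where "z = rec_nat (g 0) (\<lambda>n z. z \<oplus>\<^bsub>F0\<^esub> c n)"
   have z0: "z 0 = g 0" and zS: "z (Suc n) = z n \<oplus>\<^bsub>F0\<^esub> c n" for n by (simp_all add: z_def)
   have z: "z n \<in> ES" for n by (induction n) (use g c in \<open>auto simp: z0 zS\<close>)
   have inc: "nrm w (z (n + k) \<ominus>\<^bsub>F0\<^esub> z n) \<le> 2 * (1/2)^n - 2 * (1/2)^(n + k)" if w: "w \<in> U0" for w n k
   proof (induction k)
    case 0
    interpret Ww: semi_inner "W w" by (rule semi_W[OF w])
    show ?case using Ww.diff_self[of "z n"] Ww.vnorm_zero z by (simp add: F0_simps(1))
   next
    case (Suc k)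
    interpret Ww: semi_inner "W w" by (rule semi_W[OF w])
    have zw: "z n \<in> carrier (W w)" "c n \<in> carrier (W w)" for n using z c by (simp_all add: F0_simps(1))
    have eq: "z (Suc (n + k)) \<ominus>\<^bsub>F0\<^esub> z (n + k) = c (n + k)"
     unfolding zS a_minus_def[of F0]
     using F0.M.a_assoc[of "c (n + k)" "z (n + k)" "\<ominus>\<^bsub>F0\<^esub> z (n + k)"] F0.M.r_neg[of "z (n + k)"]
      F0.M.r_zero[of "c (n + k)"] F0.M.a_comm[of "z (n + k)" "c (n + k)"] F0.M.a_inv_closed[of "z (n + k)"] z[of "n + k"] c(1)[of "n + k"]
     by (simp add: F0_simps(1))
    have "nrm w (z (Suc (n + k)) \<ominus>\<^bsub>F0\<^esub> z n) \<le> nrm w (z (Suc (n + k)) \<ominus>\<^bsub>F0\<^esub> z (n + k)) + nrm w (z (n + k) \<ominus>\<^bsub>F0\<^esub> z n)"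
     using Ww.vnorm_diff_triangle[of "z (Suc (n + k))" "z (n + k)" "z n"] zw by simp
    also have "\<dots> \<le> (1/2)^(n + k) + (2 * (1/2)^n - 2 * (1/2)^(n + k))"
     unfolding eq by (intro add_mono c(2) Suc.IH w)
    finally show ?case by simp
   qed
   have inc': "N0 (z m \<ominus>\<^bsub>F0\<^esub> z n) \<le> 2 * (1/2)^n" if "n \<le> m" for m n
   proof (rule F0_norm_leI[OF ne])
    fix w assume w: "w \<in> U0"
    have "nrm w (z m \<ominus>\<^bsub>F0\<^esub> z n) \<le> 2 * (1/2)^n - 2 * (1/2)^m"
     using inc[OF w, of n "m - n"] that by simp
    also have "\<dots> \<le> 2 * (1/2)^n" by simp
    finally show "nrm w (z m \<ominus>\<^bsub>F0\<^esub> z n) \<le> 2 * (1/2)^n" .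
   qed
   have N0_comm: "N0 (z m \<ominus>\<^bsub>F0\<^esub> z n) = N0 (z n \<ominus>\<^bsub>F0\<^esub> z m)" for m n
    unfolding F0_norm_eq
    using semi_inner.vnorm_diff_commute[OF semi_W, of _ "z m" "z n"] z by (intro SUP_cong) (auto simp: F0_simps(1))
   have N0_half: "N0 (z m \<ominus>\<^bsub>F0\<^esub> z n) \<le> 2 * (1/2)^N" if "m \<ge> N" "n \<ge> N" for m n N
   proof -
    have "N0 (z m \<ominus>\<^bsub>F0\<^esub> z n) \<le> 2 * (1/2)^(min m n)"
     using inc'[of n m] inc'[of m n] N0_comm[of m n] by (cases "n \<le> m") (auto simp: min_def)
    also have "\<dots> \<le> 2 * (1/2)^N" using that by (intro mult_left_mono power_decreasing) auto
    finally show ?thesis .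
   qed
   have zC: "z \<in> carrier FC"
    unfolding FC_simps
   proof (intro CollectI conjI allI impI z)
    fix e :: real assume "e > 0"
    obtain N where "(1/2::real)^N < e / 2" using real_arch_pow_inv[of "e / 2" "1/2"] \<open>e > 0\<close> by auto
    then have "2 * (1/2::real)^N < e" by simp
    then show "\<exists>N. \<forall>m\<ge>N. \<forall>n\<ge>N. N0 (z m \<ominus>\<^bsub>F0\<^esub> z n) < e"
     using N0_half le_less_trans by blast
   qed
   have zg: "nrm u (z n \<ominus>\<^bsub>F0\<^esub> g n) = 0" for n
   proof (induction n)
    case 0
    show ?case using Wu.diff_self[of "g 0"] Wu.vnorm_zero g by (simp add: z0 F0_simps(1))
   next
    case (Suc n)
    have gS: "g (Suc n) = g n \<oplus>\<^bsub>F0\<^esub> e n"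
     using Wu.diff_add_cancel'[of "g (Suc n)" "g n"] g by (simp add: e_def F0_simps(1))
    have "nrm u (z (Suc n) \<ominus>\<^bsub>F0\<^esub> g (Suc n)) \<le> nrm u (z n \<ominus>\<^bsub>F0\<^esub> g n) + nrm u (c n \<ominus>\<^bsub>F0\<^esub> e n)"
     unfolding zS gS F0_diff_add[OF z c(1) g(1) e(1)]
     by (rule nrm_triangle[OF u ES_closed(2)[OF z g(1)] ES_closed(2)[OF c(1) e(1)]])
    moreover have "0 \<le> nrm u (z (Suc n) \<ominus>\<^bsub>F0\<^esub> g (Suc n))"
     using Wu.vnorm_nonneg[of "z (Suc n) \<ominus>\<^bsub>F0\<^esub> g (Suc n)"] z[of "Suc n"] g(1)[of "Suc n"] ES_closed(2)
     by (simp add: F0_simps(1))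
    ultimately show ?case using Suc c(3) by simp
   qed
   have same: "P n = clf (z n) u" for n
   proof -
    have "ip (FF u) (P n \<ominus>\<^bsub>FF u\<^esub> clf (z n) u) (P n \<ominus>\<^bsub>FF u\<^esub> clf (z n) u) = 0"
     using zg[of n] clf_norm_diff[OF u g(1)[of n] z[of n]] Wu.vnorm_diff_commute[of "z n" "g n"] z g
      FF.vnorm_eq_0_iff_ip[of "P n \<ominus>\<^bsub>FF u\<^esub> clf (z n) u"] clf_carrier[OF u]
     by (simp add: F0_simps(1))
    then have "P n \<ominus>\<^bsub>FF u\<^esub> clf (z n) u = \<zero>\<^bsub>FF u\<^esub>"
     by (intro FF_definite[OF u]) (simp_all add: clf_carrier[OF u] g z)
    then show ?thesis
     using FF.diff_add_cancel'[of "P n" "clf (z n) u"] clf_carrier[OF u] g z by simp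
   qed
   have "(\<lambda>n. ndist (FF u) (P n) (cls u z)) \<longlonglongrightarrow> 0"
   proof (rule tendsto_sandwich[OF _ _ tendsto_const])
    have "(\<lambda>n. (1/2::real)^n) \<longlonglongrightarrow> 0" by (rule LIMSEQ_power_zero) simp
    from tendsto_mult_left[OF this, where c = 3] show "(\<lambda>n. 3 * (1/2::real)^n) \<longlonglongrightarrow> 0" by simp
    have "ndist (FF u) (P n) (cls u z) \<le> 3 * (1/2::real)^n" for n
     unfolding same
    proof (rule cls_clf_le[OF u zC _ order_refl])
     fix m k assume "m \<ge> n" "k \<ge> n"
     then have "N0 (z m \<ominus>\<^bsub>F0\<^esub> z k) \<le> 2 * (1/2)^n" by (rule N0_half)
     also have "\<dots> < 3 * (1/2)^n" by simp
     finally show "N0 (z m \<ominus>\<^bsub>F0\<^esub> z k) < 3 * (1/2)^n" .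
    qed
    then show "\<forall>\<^sub>F n in sequentially. ndist (FF u) (P n) (cls u z) \<le> 3 * (1/2)^n" by simp
    show "\<forall>\<^sub>F n in sequentially. 0 \<le> ndist (FF u) (P n) (cls u z)"
     using FF.vnorm_nonneg clf_carrier[OF u] g cls_props(1)[OF u zC zC] by (simp add: g)
   qed
   then show "\<exists>v\<in>carrier (FF u). (\<lambda>n. ndist (FF u) (P n) v) \<longlonglongrightarrow> 0"
    using cls_props(1)[OF u zC zC] by blast
  qed
 qed
qed

abbreviation "IB \<equiv> ind_bundle G H \<mu> \<sigma>"

lemma section_eq: "s \<in> carrier FC ==> F_section G H \<mu> \<sigma> (FN +>\<^bsub>FC\<^esub> s) = (\<lambda>u\<in>U0. cls u s)"
 by (simp add: F_section_def cls_def)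

lemma sections_eq: "F_section G H \<mu> \<sigma> ` carrier FS = (\<lambda>s. \<lambda>u\<in>U0. cls u s) ` carrier FC"
 by (force simp: carrier_FS section_eq image_image)

lemma sections_sub: "(\<lambda>s. \<lambda>u\<in>U0. cls u s) ` carrier FC \<subseteq> all_sections (unit_top G) FF"
 using cls_props(1) by (auto simp: all_sections_def)

lemma hilbert_bundle_IB: "hilbert_bundle (unit_top G) IB"
 unfolding ind_bundle_def sections_eq
proof (rule hilbert_bundle_luc)
 let ?L = "(\<lambda>s. \<lambda>u\<in>U0. cls u s) ` carrier FC"
 show "hilb (FF u)" if "u \<in> topspace (unit_top G)" for u using hilb_FF that by simp
 show "?L \<subseteq> all_sections (unit_top G) FF" by (rule sections_sub)
 have zC: "\<zero>\<^bsub>FC\<^esub> \<in> carrier FC" unfolding FC_simps(3) by (rule FC_const[OF ES_closed(4)])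
 have "(\<lambda>u\<in>topspace (unit_top G). \<zero>\<^bsub>FF u\<^esub>) = (\<lambda>u\<in>U0. cls u \<zero>\<^bsub>FC\<^esub>)"
  using cls_props(5)[OF _ zC zC] by (auto intro: restrict_ext)
 then show "(\<lambda>u\<in>topspace (unit_top G). \<zero>\<^bsub>FF u\<^esub>) \<in> ?L" using zC by simp
 show "(\<lambda>u\<in>topspace (unit_top G). \<xi> u \<oplus>\<^bsub>FF u\<^esub> \<eta> u) \<in> ?L" if \<xi>\<eta>: "\<xi> \<in> ?L" "\<eta> \<in> ?L" for \<xi> \<eta>
 proof -
  obtain s t where st: "s \<in> carrier FC" "\<xi> = (\<lambda>u\<in>U0. cls u s)" "t \<in> carrier FC" "\<eta> = (\<lambda>u\<in>U0. cls u t)"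
   using \<xi>\<eta> by blast
  have "(\<lambda>u\<in>topspace (unit_top G). \<xi> u \<oplus>\<^bsub>FF u\<^esub> \<eta> u) = (\<lambda>u\<in>U0. cls u (s \<oplus>\<^bsub>FC\<^esub> t))"
   using cls_props(3)[OF _ st(1,3)] by (auto simp: st intro: restrict_ext)
  then show ?thesis using FC_add[OF st(1,3)] by simp
 qed
 show "(\<lambda>u\<in>topspace (unit_top G). c \<odot>\<^bsub>FF u\<^esub> \<xi> u) \<in> ?L" if \<xi>: "\<xi> \<in> ?L" for c \<xi>
 proof -
  obtain s where st: "s \<in> carrier FC" "\<xi> = (\<lambda>u\<in>U0. cls u s)" using \<xi> by blast
  have "(\<lambda>u\<in>topspace (unit_top G). c \<odot>\<^bsub>FF u\<^esub> \<xi> u) = (\<lambda>u\<in>U0. cls u (c \<odot>\<^bsub>FC\<^esub> s))"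
   using cls_props(4)[OF _ st(1,1)] by (auto simp: st intro: restrict_ext)
  then show ?thesis using FC_smult[OF st(1)] by simp
 qed
 show "\<exists>\<xi>\<in>?L. ndist (FF u) h (\<xi> u) < e"
  if hu: "u \<in> topspace (unit_top G)" "h \<in> carrier (FF u)" and e: "e > 0" for u h e
 proof -
  have u: "u \<in> U0" using hu by simp
  interpret FF: hilb "FF u" by (rule hilb_FF[OF u])
  obtain s where s: "s \<in> carrier FC" "h = cls u s" by (rule cls_surj[OF u hu(2)])
  then have "ndist (FF u) h ((\<lambda>u\<in>U0. cls u s) u) = 0" using u hu(2) by simp
  then show ?thesis using s(1) e by (intro bexI[of _ "\<lambda>u\<in>U0. cls u s"]) auto
 qed
 show "continuous_map (unit_top G) euclidean (\<lambda>u. vnorm (FF u) (\<xi> u))" if \<xi>: "\<xi> \<in> ?L" for \<xi>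
 proof -
  obtain s where s: "s \<in> carrier FC" "\<xi> = (\<lambda>u\<in>U0. cls u s)" using \<xi> by blast
  show ?thesis
  proof (rule continuous_map_local_approx)
   fix u and e :: real assume u: "u \<in> topspace (unit_top G)" and e: "e > 0"
   obtain N where N: "\<forall>m\<ge>N. \<forall>n\<ge>N. N0 (s m \<ominus>\<^bsub>F0\<^esub> s n) < e / 2" using FC_Cauchy[OF s(1), of "e / 2"] e by auto
   have "dist (vnorm (FF w) (\<xi> w)) (nrm w (s N)) < e" if "w \<in> U0" for w
   proof -
    interpret FF: hilb "FF w" by (rule hilb_FF[OF that])
    have cc: "clf (s N) w \<in> carrier (FF w)" "cls w s \<in> carrier (FF w)"
     using clf_carrier[OF that FC_ES[OF s(1)]] cls_props(1)[OF that s(1) s(1)] by auto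
    have "ndist (FF w) (clf (s N) w) (cls w s) \<le> e / 2"
     by (rule cls_clf_le[OF that s(1), of N]) (use N in auto)
    moreover have "vnorm (FF w) (clf (s N) w) = nrm w (s N)"
     using clf_ip[OF that FC_ES[OF s(1)] FC_ES[OF s(1)]] by (simp add: vnorm_def)
    ultimately show ?thesis
     using FF.abs_vnorm_diff[OF cc] e that by (simp add: s(2) dist_real_def abs_minus_commute)
   qed
   then show "\<exists>U g. openin (unit_top G) U \<and> u \<in> U \<and> continuous_map (unit_top G) euclidean g \<and>
     (\<forall>w\<in>U. dist (vnorm (FF w) (\<xi> w)) (g w) < e)"
    using nrm_continuous[OF FC_ES[OF s(1)], of N] u openin_topspace[of "unit_top G"]
    by (intro exI[of _ "topspace (unit_top G)"] exI[of _ "\<lambda>w. nrm w (s N)"]) auto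
  qed
 qed
qed

lemma fib_IB [simp]: "fib IB = FF"
 by (simp add: ind_bundle_def)

lemma clf_gam: "f \<in> ES ==> (\<lambda>u\<in>topspace (unit_top G). clf f u) \<in> gam IB"
proof -
 assume f: "f \<in> ES"
 have "(\<lambda>u\<in>U0. clf f u) = (\<lambda>u\<in>U0. cls u (\<lambda>n. f))" by (rule restrict_ext) (simp add: F0_class_eq)
 then have "(\<lambda>u\<in>topspace (unit_top G). clf f u) \<in> (\<lambda>s. \<lambda>u\<in>U0. cls u s) ` carrier FC"
  using FC_const[OF f] by simp
 also have "\<dots> \<subseteq> gam IB"
  using luc_mono_self[OF _ sections_sub] semi_FF by (simp add: ind_bundle_def sections_eq)
 finally show ?thesis .
qed

end

section \<open>Averaging over the subgroupoid\<close>

context hbun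
begin

text \<open>Values of continuous sections are dense, so they suffice to test vectors against.\<close>

lemma weak_bound:
 assumes u: "u \<in> topspace X" and x: "x \<in> carrier (fib E u)" and B: "0 \<le> B"
  and le: "!!\<zeta>. \<zeta> \<in> gam E ==> cmod (ip (fib E u) x (\<zeta> u)) \<le> B * vnorm (fib E u) (\<zeta> u)"
 shows "vnorm (fib E u) x \<le> B"
proof (rule ccontr)
 interpret hilb "fib E u" by (rule hilb_fib[OF u])
 let ?n = "vnorm (fib E u) x"
 assume "\<not> ?n \<le> B"
 then have lt: "B < ?n" "0 < ?n" using B by auto
 define \<delta> where "\<delta> = (?n - B) * ?n / (2 * (B + ?n))"
 have d: "\<delta> > 0" using lt B by (simp add: \<delta>_def)
 obtain \<zeta> where \<zeta>: "\<zeta> \<in> gam E" "ndist (fib E u) x (\<zeta> u) < \<delta>" using gam_dense[OF u x d] by blast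
 have z: "\<zeta> u \<in> carrier (fib E u)" by (rule gam_carrier[OF \<zeta>(1) u])
 have "?n\<^sup>2 = cmod (ip (fib E u) x (\<zeta> u) + ip (fib E u) x (x \<ominus>\<^bsub>fib E u\<^esub> \<zeta> u))"
  using x z by (simp add: ip_simps ip_self norm_power flip: of_real_power)
 also have "\<dots> \<le> B * vnorm (fib E u) (\<zeta> u) + ?n * ndist (fib E u) x (\<zeta> u)"
  using le[OF \<zeta>(1)] Cauchy_Schwarz[of x "x \<ominus>\<^bsub>fib E u\<^esub> \<zeta> u"] x z
  by (intro order_trans[OF norm_triangle_ineq] add_mono) auto
 also have "\<dots> \<le> B * (?n + \<delta>) + ?n * \<delta>"
 proof (intro add_mono mult_left_mono B)
  show "vnorm (fib E u) (\<zeta> u) \<le> ?n + \<delta>"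
   using vnorm_le_add_diff[of "\<zeta> u" x] vnorm_diff_commute[of x "\<zeta> u"] x z \<zeta>(2) by simp
 qed (use \<zeta>(2) lt in auto)
 also have "\<dots> = B * ?n + (B + ?n) * \<delta>" by (simp add: algebra_simps)
 also have "(B + ?n) * \<delta> = (?n - B) * ?n / 2" using lt B by (simp add: \<delta>_def field_simps)
 finally have "?n * ?n \<le> B * ?n + (?n - B) * ?n / 2" by (simp add: power2_eq_square)
 then have "(?n - B) * ?n \<le> (?n - B) * ?n / 2" by (simp add: field_simps)
 moreover have "(?n - B) * ?n > 0" using lt by simp
 ultimately show False by linarith
qed

lemma weak_eq:
 assumes u: "u \<in> topspace X" and x: "x \<in> carrier (fib E u)" and y: "y \<in> carrier (fib E u)"
  and eq: "!!\<zeta>. \<zeta> \<in> gam E ==> ip (fib E u) x (\<zeta> u) = ip (fib E u) y (\<zeta> u)"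
 shows "x = y"
proof -
 interpret hilb "fib E u" by (rule hilb_fib[OF u])
 have "ndist (fib E u) x y \<le> 0"
  using x y eq gam_carrier[OF _ u] by (intro weak_bound[OF u]) (auto simp: ip_diff_left)
 then show ?thesis using x y vnorm_nonneg[of "x \<ominus>\<^bsub>fib E u\<^esub> y"] by (intro eq_of_vnorm_diff) auto
qed

lemma gam_combination:
 assumes "finite J" "!!j. j \<in> J ==> continuous_map X euclidean (c j)" "!!j. j \<in> J ==> \<eta> j \<in> gam E"
 shows "\<exists>\<beta>\<in>gam E. \<forall>u\<in>topspace X. \<forall>w\<in>carrier (fib E u).
  ip (fib E u) (\<beta> u) w = (\<Sum>j\<in>J. c j u * ip (fib E u) (\<eta> j u) w)"
 using assms
proof (induction J)
 case empty
 then show ?case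
  using gam_zero semi_inner.ip_zero_left[OF semi_fib] by (intro bexI[of _ "\<lambda>u\<in>topspace X. \<zero>\<^bsub>fib E u\<^esub>"]) auto
next
 case (insert j J)
 then obtain \<beta> where \<beta>: "\<beta> \<in> gam E" "\<forall>u\<in>topspace X. \<forall>w\<in>carrier (fib E u).
  ip (fib E u) (\<beta> u) w = (\<Sum>j\<in>J. c j u * ip (fib E u) (\<eta> j u) w)" by auto
 have \<eta>: "\<eta> j \<in> gam E" and c: "continuous_map X euclidean (c j)" using insert.prems by auto
 define \<gamma> where "\<gamma> = (\<lambda>u\<in>topspace X. \<beta> u \<oplus>\<^bsub>fib E u\<^esub> c j u \<odot>\<^bsub>fib E u\<^esub> \<eta> j u)"
 have "\<gamma> \<in> gam E"
  unfolding \<gamma>_def by (intro gamI cont_field_add cont_field_smult gam_cont_field \<beta>(1) \<eta> c)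
 moreover have "ip (fib E u) (\<gamma> u) w = (\<Sum>j\<in>insert j J. c j u * ip (fib E u) (\<eta> j u) w)"
  if u: "u \<in> topspace X" and w: "w \<in> carrier (fib E u)" for u w
 proof -
  interpret hilb "fib E u" by (rule hilb_fib[OF u])
  show ?thesis
   using gam_carrier[OF \<beta>(1) u] gam_carrier[OF \<eta> u] u w \<beta>(2) insert.hyps by (simp add: \<gamma>_def ip_simps)
 qed
 ultimately show ?case by blast
qed

end

context hrep_ne
begin

abbreviation E where "E \<equiv> bnd \<sigma>"

definition CcH :: "('a \<Rightarrow> real) \<Rightarrow> bool" where
 "CcH \<alpha> \<longleftrightarrow> continuous_map TH euclideanreal \<alpha> \<and> (\<exists>L. compactin TH L \<and> (\<forall>h\<in>H. \<alpha> h \<noteq> 0 --> h \<in> L))"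

definition coef where
 "coef \<alpha> \<xi> \<zeta> h = complex_of_real (\<alpha> h) * ip (V (r h)) (act \<sigma> h (\<xi> (d h))) (\<zeta> (r h))"

text \<open>The vector \<open>v\<close> is the weak integral of \<open>\<alpha>(h) \<sigma>(h) \<xi>(d(h))\<close> over the range fibre of \<open>u\<close>.\<close>

definition is_avg where
 "is_avg u \<alpha> \<xi> v \<longleftrightarrow> v \<in> carrier (V u) \<and>
  (\<forall>\<zeta>\<in>gam E. ip (V u) v (\<zeta> u) = (LINT h|lamH u. coef \<alpha> \<xi> \<zeta> h))"

lemma act_xi_carrier: "\<xi> \<in> gam E ==> h \<in> H ==> act \<sigma> h (\<xi> (d h)) \<in> carrier (V (r h))"
 using act_carrier gam_carrier H_sub by simp

lemma act_xi_norm: "\<xi> \<in> gam E ==> h \<in> H ==> vnorm (V (r h)) (act \<sigma> h (\<xi> (d h))) = vnorm (V (d h)) (\<xi> (d h))"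
 using unitary_mapD(3)[OF act_unitary gam_carrier] H_sub by simp

lemma coef_continuous:
 assumes "CcH \<alpha>" "\<xi> \<in> gam E" "\<zeta> \<in> gam E"
 shows "continuous_map TH euclidean (coef \<alpha> \<xi> \<zeta>)"
 unfolding coef_def[abs_def] using assms
 by (intro continuous_map_ceuclid continuous_map_of_real cont_field_ip act_continuous cont_field_gam rH)
  (auto simp: CcH_def)

lemma coef_Cc:
 assumes "CcH \<alpha>" "\<xi> \<in> gam E" "\<zeta> \<in> gam E"
 shows "coef \<alpha> \<xi> \<zeta> \<in> Cc TH"
proof -
 obtain L where L: "compactin TH L" "\<forall>h\<in>H. \<alpha> h \<noteq> 0 --> h \<in> L" using assms by (auto simp: CcH_def)
 show ?thesis by (rule HT.CcI[OF coef_continuous[OF assms] L(1)]) (use L(2) in \<open>auto simp: coef_def\<close>)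
qed

lemma integrable_H:
 assumes "u \<in> U0" "continuous_map TH euclidean f" "compactin TH L" "!!h. h \<in> H ==> f h \<noteq> 0 ==> h \<in> L"
 shows "integrable (lamH u) (f :: _ \<Rightarrow> 'z::{banach, second_countable_topology})"
 using radon.integrable_compact[OF radon_lamH[OF assms(1)] assms(2,3)] assms(4) by auto

lemma coef_integrable:
 assumes "u \<in> U0" "CcH \<alpha>" "\<xi> \<in> gam E" "\<zeta> \<in> gam E"
 shows "integrable (lamH u) (coef \<alpha> \<xi> \<zeta>)"
proof -
 obtain L where L: "compactin TH L" "\<forall>h\<in>H. \<alpha> h \<noteq> 0 --> h \<in> L" using assms by (auto simp: CcH_def)
 show ?thesis by (rule integrable_H[OF assms(1) coef_continuous[OF assms(2-4)] L(1)]) (use L(2) in \<open>auto simp: coef_def\<close>)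
qed

lemma is_avg_cong:
 assumes u: "u \<in> U0" and "CcH \<alpha>" "CcH \<alpha>'" "\<xi> \<in> gam E" and eq: "!!h. h \<in> H ==> r h = u ==> \<alpha> h = \<alpha>' h"
  and "is_avg u \<alpha> \<xi> v"
 shows "is_avg u \<alpha>' \<xi> v"
 unfolding is_avg_def
proof (intro conjI ballI)
 show "v \<in> carrier (V u)" using assms by (simp add: is_avg_def)
 fix \<zeta> assume \<zeta>: "\<zeta> \<in> gam E"
 interpret radon TH "lamH u" by (rule radon_lamH[OF u])
 have "(LINT h|lamH u. coef \<alpha> \<xi> \<zeta> h) = (LINT h|lamH u. coef \<alpha>' \<xi> \<zeta> h)"
  by (rule integral_cong_support[OF borel_measurable_integrable[OF coef_integrable[OF u assms(2,4) \<zeta>]]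
    borel_measurable_integrable[OF coef_integrable[OF u assms(3,4) \<zeta>]]])
   (use eq in \<open>auto simp: support_lamH[OF u] coef_def\<close>)
 then show "ip (V u) v (\<zeta> u) = (LINT h|lamH u. coef \<alpha>' \<xi> \<zeta> h)"
  using assms(6) \<zeta> by (simp add: is_avg_def)
qed

lemma is_avg_unique: "u \<in> U0 ==> is_avg u \<alpha> \<xi> v ==> is_avg u \<alpha> \<xi> w ==> v = w"
 by (rule weak_eq[of u]) (auto simp: is_avg_def)

lemma is_avg_diff_bound:
 assumes u: "u \<in> U0" and \<alpha>: "CcH \<alpha>" "CcH \<alpha>'" and \<xi>: "\<xi> \<in> gam E" and \<kappa>: "CcH \<kappa>" "!!h. h \<in> H ==> 0 \<le> \<kappa> h"
  and le: "!!h. h \<in> H ==> r h = u ==> \<bar>\<alpha> h - \<alpha>' h\<bar> \<le> \<delta> * \<kappa> h" and \<delta>: "0 \<le> \<delta>"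
  and v: "is_avg u \<alpha> \<xi> v" and w: "is_avg u \<alpha>' \<xi> w"
 shows "ndist (V u) v w \<le> \<delta> * (LINT h|lamH u. \<kappa> h * vnorm (V (d h)) (\<xi> (d h)))"
proof (rule weak_bound)
 interpret radon TH "lamH u" by (rule radon_lamH[OF u])
 interpret Vu: hilb "V u" by (rule V_hilb[OF u])
 obtain L where L: "compactin TH L" "\<forall>h\<in>H. \<kappa> h \<noteq> 0 --> h \<in> L" using \<kappa> by (auto simp: CcH_def)
 have kc: "continuous_map TH euclideanreal (\<lambda>h. \<kappa> h * vnorm (V (d h)) (\<xi> (d h)))"
  using \<kappa>(1) continuous_map_compose[OF dH gam_norm_continuous[OF \<xi>]]
  by (intro continuous_map_real_mult) (auto simp: CcH_def o_def)
 have ki: "integrable (lamH u) (\<lambda>h. \<kappa> h * vnorm (V (d h)) (\<xi> (d h)))"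
  by (rule integrable_H[OF u kc L(1)]) (use L(2) in auto)
 have knn: "0 \<le> \<kappa> h * vnorm (V (d h)) (\<xi> (d h))" if "h \<in> H" for h
  using \<kappa>(2)[OF that] semi_inner.vnorm_nonneg[OF V_semi gam_carrier[OF \<xi>], of "d h"] that H_sub by simp
 show "0 \<le> \<delta> * (LINT h|lamH u. \<kappa> h * vnorm (V (d h)) (\<xi> (d h)))"
  by (rule mult_nonneg_nonneg[OF \<delta> integral_nonneg_AE[OF AE_I2[OF knn]]]) (simp add: space_M)
 have vw: "v \<in> carrier (V u)" "w \<in> carrier (V u)" using v w by (auto simp: is_avg_def)
 then show "v \<ominus>\<^bsub>V u\<^esub> w \<in> carrier (V u)" by simp
 fix \<zeta> assume \<zeta>: "\<zeta> \<in> gam E"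
 have zu: "\<zeta> u \<in> carrier (V u)" using gam_carrier[OF \<zeta>] u by simp
 have i: "integrable (lamH u) (coef \<alpha> \<xi> \<zeta>)" "integrable (lamH u) (coef \<alpha>' \<xi> \<zeta>)"
  using coef_integrable u \<alpha> \<xi> \<zeta> by auto
 have "ip (V u) (v \<ominus>\<^bsub>V u\<^esub> w) (\<zeta> u) = (LINT h|lamH u. coef \<alpha> \<xi> \<zeta> h - coef \<alpha>' \<xi> \<zeta> h)"
  using v w vw zu \<zeta> i by (simp add: is_avg_def Vu.ip_diff_left)
 also have "cmod \<dots> \<le> (LINT h|lamH u. \<delta> * vnorm (V u) (\<zeta> u) * (\<kappa> h * vnorm (V (d h)) (\<xi> (d h))))"
 proof (rule integral_bound_support)
  fix h assume "h \<in> measure_support TH (lamH u)"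
  then have h: "h \<in> H" "r h = u" by (auto simp: support_lamH[OF u])
  have "cmod (coef \<alpha> \<xi> \<zeta> h - coef \<alpha>' \<xi> \<zeta> h) = \<bar>\<alpha> h - \<alpha>' h\<bar> * cmod (ip (V u) (act \<sigma> h (\<xi> (d h))) (\<zeta> u))"
   using h by (simp add: coef_def norm_mult flip: left_diff_distrib of_real_diff)
  also have "\<dots> \<le> (\<delta> * \<kappa> h) * (vnorm (V (d h)) (\<xi> (d h)) * vnorm (V u) (\<zeta> u))"
   using le[OF h] \<delta> \<kappa>(2)[OF h(1)] Vu.Cauchy_Schwarz[of "act \<sigma> h (\<xi> (d h))" "\<zeta> u"] act_xi_norm[OF \<xi> h(1)]
    act_xi_carrier[OF \<xi> h(1)] h zu by (intro mult_mono) auto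
  finally show "cmod (coef \<alpha> \<xi> \<zeta> h - coef \<alpha>' \<xi> \<zeta> h) \<le> \<delta> * vnorm (V u) (\<zeta> u) * (\<kappa> h * vnorm (V (d h)) (\<xi> (d h)))"
   by (simp add: mult_ac)
 qed (use i ki in auto)
 also have "\<dots> = \<delta> * (LINT h|lamH u. \<kappa> h * vnorm (V (d h)) (\<xi> (d h))) * vnorm (V u) (\<zeta> u)"
  by simp
 finally show "cmod (ip (V u) (v \<ominus>\<^bsub>V u\<^esub> w) (\<zeta> u))
   \<le> \<delta> * (LINT h|lamH u. \<kappa> h * vnorm (V (d h)) (\<xi> (d h))) * vnorm (V u) (\<zeta> u)" .
qed (use u in simp)

text \<open>On the support of \<open>\<alpha>\<close> the section \<open>h \<mapsto> \<sigma>(h) \<xi>(d(h))\<close> is uniformly approximated by finite sums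
 \<open>\<Sum>\<^sub>j b\<^sub>j(h) \<eta>\<^sub>j(r(h))\<close>, whose integrals are continuous sections because the Haar system is
 continuous.\<close>

lemma avg_approx:
 assumes \<alpha>: "CcH \<alpha>" and \<xi>: "\<xi> \<in> gam E" and e: "e > 0"
 shows "\<exists>\<beta>\<in>gam E. \<forall>u\<in>U0. \<forall>\<zeta>\<in>gam E.
  cmod (ip (V u) (\<beta> u) (\<zeta> u) - (LINT h|lamH u. coef \<alpha> \<xi> \<zeta> h)) \<le> e * (LINT h|lamH u. \<bar>\<alpha> h\<bar>) * vnorm (V u) (\<zeta> u)"
proof -
 obtain L where L: "compactin TH L" "\<forall>h\<in>H. \<alpha> h \<noteq> 0 --> h \<in> L" using \<alpha> by (auto simp: CcH_def)
 have \<alpha>c: "continuous_map TH euclideanreal \<alpha>" using \<alpha> by (simp add: CcH_def)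
 have LH: "L \<subseteq> H" using compactin_subset_topspace[OF L(1)] by auto
 have "\<exists>O' \<eta>. \<forall>h\<in>L. openin TH (O' h) \<and> h \<in> O' h \<and> \<eta> h \<in> gam E \<and>
   (\<forall>k\<in>O' h. ndist (V (r k)) (act \<sigma> k (\<xi> (d k))) (\<eta> h (r k)) < e)"
 proof -
  have "\<forall>h\<in>L. \<exists>p. openin TH (fst p) \<and> h \<in> fst p \<and> snd p \<in> gam E \<and>
   (\<forall>k\<in>fst p. ndist (V (r k)) (act \<sigma> k (\<xi> (d k))) (snd p (r k)) < e)"
  proof
   fix h assume "h \<in> L"
   then have "h \<in> topspace TH" using LH by auto
   then obtain N \<eta> where "openin TH N" "h \<in> N" "\<eta> \<in> gam E"
    "!!k. k \<in> N ==> ndist (V (r k)) (act \<sigma> k (\<xi> (d k))) (\<eta> (r k)) < e"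
    by (rule cont_field_approx[OF act_continuous[OF \<xi>] _ e]) blast
   then show "\<exists>p. openin TH (fst p) \<and> h \<in> fst p \<and> snd p \<in> gam E \<and>
     (\<forall>k\<in>fst p. ndist (V (r k)) (act \<sigma> k (\<xi> (d k))) (snd p (r k)) < e)"
    by (intro exI[of _ "(N, \<eta>)"]) simp
  qed
  from bchoice[OF this] obtain p where "\<forall>h\<in>L. openin TH (fst (p h)) \<and> h \<in> fst (p h) \<and> snd (p h) \<in> gam E \<and>
   (\<forall>k\<in>fst (p h). ndist (V (r k)) (act \<sigma> k (\<xi> (d k))) (snd (p h) (r k)) < e)" by blast
  then show ?thesis by (intro exI[of _ "\<lambda>h. fst (p h)"] exI[of _ "\<lambda>h. snd (p h)"])
 qed
 then obtain O' \<eta> where O: "!!h. h \<in> L ==> openin TH (O' h) \<and> h \<in> O' h" "!!h. h \<in> L ==> \<eta> h \<in> gam E"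
   "!!h k. h \<in> L ==> k \<in> O' h ==> ndist (V (r k)) (act \<sigma> k (\<xi> (d k))) (\<eta> h (r k)) < e"
  by blast
 obtain J b where b: "finite J" "J \<subseteq> L" "!!j. j \<in> J ==> continuous_map TH euclideanreal (b j)"
  "!!j x. j \<in> J ==> x \<in> topspace TH ==> 0 \<le> b j x"
  "!!j x. j \<in> J ==> x \<in> topspace TH ==> b j x \<noteq> 0 ==> x \<in> O' j \<and> x \<in> topspace TH"
  "!!x. x \<in> topspace TH ==> (\<Sum>j\<in>J. b j x) \<le> 1" "!!x. x \<in> L ==> (\<Sum>j\<in>J. b j x) = (1::real)"
  by (rule HT.partition_of_unity[OF L(1) openin_topspace compactin_subset_topspace[OF L(1)] O(1)]) blast+
 let ?c = "\<lambda>j u. complex_of_real (LINT h|lamH u. \<alpha> h * b j h)"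
 have abc: "continuous_map TH euclideanreal (\<lambda>h. \<alpha> h * b j h)" if "j \<in> J" for j
  by (rule continuous_map_real_mult[OF \<alpha>c b(3)[OF that]])
 have cc: "continuous_map (unit_top G) euclidean (?c j)" if "j \<in> J" for j
  by (intro continuous_map_of_real haar_continuous_real[OF abc[OF that] L(1)]) (use L(2) in auto)
 obtain \<beta> where \<beta>: "\<beta> \<in> gam E" "\<forall>u\<in>topspace (unit_top G). \<forall>w\<in>carrier (V u).
   ip (V u) (\<beta> u) w = (\<Sum>j\<in>J. ?c j u * ip (V u) (\<eta> j u) w)"
  using gam_combination[of J ?c \<eta>] b(1,2) cc O(2) by blast
 have "cmod (ip (V u) (\<beta> u) (\<zeta> u) - (LINT h|lamH u. coef \<alpha> \<xi> \<zeta> h)) \<le> e * (LINT h|lamH u. \<bar>\<alpha> h\<bar>) * vnorm (V u) (\<zeta> u)"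
  if u: "u \<in> U0" and \<zeta>: "\<zeta> \<in> gam E" for u \<zeta>
 proof -
  interpret radon TH "lamH u" by (rule radon_lamH[OF u])
  interpret Vu: hilb "V u" by (rule V_hilb[OF u])
  have zu: "\<zeta> u \<in> carrier (V u)" using gam_carrier[OF \<zeta>] u by simp
  have abi: "integrable (lamH u) (\<lambda>h. \<alpha> h * b j h)" if "j \<in> J" for j
   by (rule integrable_H[OF u abc[OF that] L(1)]) (use L(2) in auto)
  have ai: "integrable (lamH u) (\<lambda>h. \<bar>\<alpha> h\<bar>)"
   by (rule integrable_H[OF u continuous_map_real_abs[OF \<alpha>c] L(1)]) (use L(2) in auto)
  have si: "integrable (lamH u) (\<lambda>h. \<Sum>j\<in>J. complex_of_real (\<alpha> h * b j h) * ip (V u) (\<eta> j u) (\<zeta> u))"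
   using abi by (intro Bochner_Integration.integrable_sum integrable_mult_left integrable_of_real) auto
  have ci: "integrable (lamH u) (coef \<alpha> \<xi> \<zeta>)" by (rule coef_integrable[OF u \<alpha> \<xi> \<zeta>])
  have "ip (V u) (\<beta> u) (\<zeta> u) = (\<Sum>j\<in>J. (LINT h|lamH u. complex_of_real (\<alpha> h * b j h) * ip (V u) (\<eta> j u) (\<zeta> u)))"
   using \<beta>(2) u zu abi by (simp del: of_real_mult)
  also have "\<dots> = (LINT h|lamH u. (\<Sum>j\<in>J. complex_of_real (\<alpha> h * b j h) * ip (V u) (\<eta> j u) (\<zeta> u)))"
   using abi by (intro Bochner_Integration.integral_sum[symmetric] integrable_mult_left integrable_of_real)
  finally have "ip (V u) (\<beta> u) (\<zeta> u) - (LINT h|lamH u. coef \<alpha> \<xi> \<zeta> h) = (LINT h|lamH u.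
    (\<Sum>j\<in>J. complex_of_real (\<alpha> h * b j h) * ip (V u) (\<eta> j u) (\<zeta> u)) - coef \<alpha> \<xi> \<zeta> h)"
   using si ci by simp
  also have "cmod \<dots> \<le> (LINT h|lamH u. e * vnorm (V u) (\<zeta> u) * \<bar>\<alpha> h\<bar>)"
  proof (rule integral_bound_support)
   fix h assume "h \<in> measure_support TH (lamH u)"
   then have h: "h \<in> H" "r h = u" by (auto simp: support_lamH[OF u])
   have hY: "h \<in> topspace TH" using h by simp
   let ?a = "act \<sigma> h (\<xi> (d h))"
   have ac: "?a \<in> carrier (V u)" using act_xi_carrier[OF \<xi> h(1)] h by simp
   have ec: "\<eta> j u \<in> carrier (V u)" if "j \<in> J" for j using gam_carrier[OF O(2)] b(2) that u by auto
   show "cmod ((\<Sum>j\<in>J. complex_of_real (\<alpha> h * b j h) * ip (V u) (\<eta> j u) (\<zeta> u)) - coef \<alpha> \<xi> \<zeta> h)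
     \<le> e * vnorm (V u) (\<zeta> u) * \<bar>\<alpha> h\<bar>"
   proof (cases "h \<in> L")
    case False
    then have "\<alpha> h = 0" using L(2) h by auto
    then show ?thesis by (simp add: coef_def)
   next
    case True
    have "coef \<alpha> \<xi> \<zeta> h = (\<Sum>j\<in>J. complex_of_real (\<alpha> h * b j h) * ip (V u) ?a (\<zeta> u))"
    proof -
     have "(\<Sum>j\<in>J. complex_of_real (\<alpha> h * b j h) * ip (V u) ?a (\<zeta> u))
       = complex_of_real (\<alpha> h * (\<Sum>j\<in>J. b j h)) * ip (V u) ?a (\<zeta> u)"
      by (simp add: sum_distrib_left sum_distrib_right)
     then show ?thesis using b(7)[OF True] h by (simp add: coef_def)
    qed
    then have "(\<Sum>j\<in>J. complex_of_real (\<alpha> h * b j h) * ip (V u) (\<eta> j u) (\<zeta> u)) - coef \<alpha> \<xi> \<zeta> h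
     = (\<Sum>j\<in>J. complex_of_real (\<alpha> h * b j h) * (ip (V u) (\<eta> j u) (\<zeta> u) - ip (V u) ?a (\<zeta> u)))"
     by (simp add: sum_subtractf right_diff_distrib)
    also have "cmod \<dots> \<le> (\<Sum>j\<in>J. \<bar>\<alpha> h\<bar> * b j h * (e * vnorm (V u) (\<zeta> u)))"
    proof (rule order_trans[OF norm_sum sum_mono])
     fix j assume j: "j \<in> J"
     show "cmod (complex_of_real (\<alpha> h * b j h) * (ip (V u) (\<eta> j u) (\<zeta> u) - ip (V u) ?a (\<zeta> u)))
       \<le> \<bar>\<alpha> h\<bar> * b j h * (e * vnorm (V u) (\<zeta> u))"
     proof (cases "b j h = 0")
      case False
      then have "h \<in> O' j" using b(5)[OF j hY] by blast
      then have lt: "ndist (V u) ?a (\<eta> j u) < e" using O(3)[of j h] b(2) j h by auto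
      have "cmod (ip (V u) (\<eta> j u) (\<zeta> u) - ip (V u) ?a (\<zeta> u)) = cmod (ip (V u) (?a \<ominus>\<^bsub>V u\<^esub> \<eta> j u) (\<zeta> u))"
       using ac ec[OF j] zu by (simp add: Vu.ip_diff_left norm_minus_commute)
      also have "\<dots> \<le> ndist (V u) ?a (\<eta> j u) * vnorm (V u) (\<zeta> u)"
       using ac ec[OF j] zu by (intro Vu.Cauchy_Schwarz) auto
      also have "\<dots> \<le> e * vnorm (V u) (\<zeta> u)" using lt Vu.vnorm_nonneg[OF zu] by (intro mult_right_mono) auto
      finally show ?thesis
       using b(4)[OF j hY] by (simp add: norm_mult abs_mult mult_left_mono del: of_real_mult)
     qed simp
    qed
    also have "\<dots> = \<bar>\<alpha> h\<bar> * (\<Sum>j\<in>J. b j h) * (e * vnorm (V u) (\<zeta> u))"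
     by (simp add: sum_distrib_left sum_distrib_right)
    also have "\<dots> = e * vnorm (V u) (\<zeta> u) * \<bar>\<alpha> h\<bar>" using b(7)[OF True] by simp
    finally show ?thesis .
   qed
  qed (use si ci ai in auto)
  also have "\<dots> = e * (LINT h|lamH u. \<bar>\<alpha> h\<bar>) * vnorm (V u) (\<zeta> u)" by simp
  finally show ?thesis .
 qed
 then show ?thesis using \<beta>(1) by blast
qed

text \<open>The approximations form a Cauchy sequence, uniformly where the \<open>L\<^sup>1\<close>-norm of \<open>\<alpha>\<close> is bounded, and a
 locally uniform limit of continuous sections is continuous.\<close>

lemma avg_exists:
 assumes \<alpha>: "CcH \<alpha>" and \<xi>: "\<xi> \<in> gam E"
 obtains \<beta> where "\<beta> \<in> gam E" "!!u. u \<in> U0 ==> is_avg u \<alpha> \<xi> (\<beta> u)"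
proof -
 obtain L where L: "compactin TH L" "\<forall>h\<in>H. \<alpha> h \<noteq> 0 --> h \<in> L" using \<alpha> by (auto simp: CcH_def)
 have \<alpha>c: "continuous_map TH euclideanreal \<alpha>" using \<alpha> by (simp add: CcH_def)
 define m where "m u = (LINT h|lamH u. \<bar>\<alpha> h\<bar>)" for u
 have mc: "continuous_map (unit_top G) euclideanreal m"
  unfolding m_def[abs_def] by (rule haar_continuous_real[OF continuous_map_real_abs[OF \<alpha>c] L(1)]) (use L(2) in auto)
 have m0: "0 \<le> m u" for u unfolding m_def by (intro integral_nonneg_AE AE_I2) simp
 let ?e = "\<lambda>n. inverse (real (Suc n))"
 have "\<exists>\<beta>. \<forall>n. \<beta> n \<in> gam E \<and> (\<forall>u\<in>U0. \<forall>\<zeta>\<in>gam E.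
  cmod (ip (V u) (\<beta> n u) (\<zeta> u) - (LINT h|lamH u. coef \<alpha> \<xi> \<zeta> h)) \<le> ?e n * m u * vnorm (V u) (\<zeta> u))"
  by (rule choice, rule allI) (use avg_approx[OF \<alpha> \<xi>, folded m_def] in \<open>simp add: Bex_def\<close>)
 then obtain \<beta> where \<beta>: "!!n. \<beta> n \<in> gam E" "!!n u \<zeta>. u \<in> U0 ==> \<zeta> \<in> gam E ==>
  cmod (ip (V u) (\<beta> n u) (\<zeta> u) - (LINT h|lamH u. coef \<alpha> \<xi> \<zeta> h)) \<le> ?e n * m u * vnorm (V u) (\<zeta> u)" by blast
 have bc: "\<beta> n u \<in> carrier (V u)" if "u \<in> U0" for n u using gam_carrier[OF \<beta>(1)] that by simp
 have diff: "ndist (V u) (\<beta> i u) (\<beta> j u) \<le> (?e i + ?e j) * m u" if u: "u \<in> U0" for i j u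
 proof (rule weak_bound)
  interpret Vu: hilb "V u" by (rule V_hilb[OF u])
  show "\<beta> i u \<ominus>\<^bsub>V u\<^esub> \<beta> j u \<in> carrier (V u)" using bc[OF u] by simp
  show "0 \<le> (?e i + ?e j) * m u" using m0 by simp
  fix \<zeta> assume \<zeta>: "\<zeta> \<in> gam E"
  have zu: "\<zeta> u \<in> carrier (V u)" using gam_carrier[OF \<zeta>] u by simp
  let ?I = "LINT h|lamH u. coef \<alpha> \<xi> \<zeta> h"
  have "cmod (ip (V u) (\<beta> i u \<ominus>\<^bsub>V u\<^esub> \<beta> j u) (\<zeta> u)) = cmod ((ip (V u) (\<beta> i u) (\<zeta> u) - ?I) - (ip (V u) (\<beta> j u) (\<zeta> u) - ?I))"
   using bc[OF u] zu by (simp add: Vu.ip_diff_left)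
  also have "\<dots> \<le> cmod (ip (V u) (\<beta> i u) (\<zeta> u) - ?I) + cmod (ip (V u) (\<beta> j u) (\<zeta> u) - ?I)" by (rule norm_triangle_ineq4)
  also have "\<dots> \<le> ?e i * m u * vnorm (V u) (\<zeta> u) + ?e j * m u * vnorm (V u) (\<zeta> u)"
   using \<beta>(2)[OF u \<zeta>] by (intro add_mono)
  finally show "cmod (ip (V u) (\<beta> i u \<ominus>\<^bsub>V u\<^esub> \<beta> j u) (\<zeta> u)) \<le> (?e i + ?e j) * m u * vnorm (V u) (\<zeta> u)"
   by (simp add: algebra_simps)
 qed (use u in simp)
 have e0: "(\<lambda>n. ?e n) \<longlonglongrightarrow> 0" by (rule LIMSEQ_inverse_real_of_nat)
 have "\<exists>v\<in>carrier (V u). (\<lambda>n. ndist (V u) (\<beta> n u) v) \<longlonglongrightarrow> 0" if u: "u \<in> U0" for u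
 proof (rule hilb.complete[OF V_hilb[OF u]])
  fix e :: real assume e: "e > 0"
  have "(\<lambda>n. ?e n * (2 * m u)) \<longlonglongrightarrow> 0 * (2 * m u)" by (intro tendsto_mult_right e0)
  then have "eventually (\<lambda>n. ?e n * (2 * m u) < e) sequentially" by (intro order_tendstoD(2)) (use e in auto)
  then obtain N where N: "!!n. n \<ge> N ==> ?e n * (2 * m u) < e" by (auto simp: eventually_sequentially)
  have "ndist (V u) (\<beta> i u) (\<beta> j u) < e" if ij: "i \<ge> N" "j \<ge> N" for i j
  proof -
   have "?e i \<le> ?e N" "?e j \<le> ?e N" using ij by (auto intro!: le_imp_inverse_le)
   then have "(?e i + ?e j) * m u \<le> (?e N + ?e N) * m u" by (rule mult_right_mono[OF add_mono m0])
   also have "\<dots> = ?e N * (2 * m u)" by simp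
   finally show ?thesis using diff[OF u, of i j] N[of N] by linarith
  qed
  then show "\<exists>N. \<forall>i\<ge>N. \<forall>j\<ge>N. ndist (V u) (\<beta> i u) (\<beta> j u) < e" by blast
 qed (use bc u in auto)
 then have "\<forall>u\<in>U0. \<exists>v. v \<in> carrier (V u) \<and> (\<lambda>n. ndist (V u) (\<beta> n u) v) \<longlonglongrightarrow> 0" by blast
 from bchoice[OF this] obtain v where v: "!!u. u \<in> U0 ==> v u \<in> carrier (V u)"
  "!!u. u \<in> U0 ==> (\<lambda>n. ndist (V u) (\<beta> n u) (v u)) \<longlonglongrightarrow> 0" by blast
 have lim: "ndist (V u) (v u) (\<beta> j u) \<le> ?e j * m u" if u: "u \<in> U0" for u j
 proof (rule LIMSEQ_le)
  interpret Vu: hilb "V u" by (rule V_hilb[OF u])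
  show "(\<lambda>i. ndist (V u) (\<beta> i u) (\<beta> j u)) \<longlonglongrightarrow> ndist (V u) (v u) (\<beta> j u)"
   by (rule Vu.tendsto_vnorm_diff[OF bc[OF u] v(1)[OF u] v(2)[OF u] bc[OF u]])
  have "(\<lambda>i. (?e i + ?e j) * m u) \<longlonglongrightarrow> (0 + ?e j) * m u" by (intro tendsto_intros e0)
  then show "(\<lambda>i. (?e i + ?e j) * m u) \<longlonglongrightarrow> ?e j * m u" by simp
 qed (use diff[OF u] in auto)
 show ?thesis
 proof (rule that[of "\<lambda>u\<in>topspace (unit_top G). v u"])
  show "(\<lambda>u\<in>topspace (unit_top G). v u) \<in> gam E"
  proof (rule gamI, rule cont_field_local_limit)
   fix u and e :: real assume u: "u \<in> topspace (unit_top G)" and e: "e > 0"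
   obtain N where N: "openin (unit_top G) N" "u \<in> N" "!!w. w \<in> N ==> m w < m u + 1"
    using continuous_map_less_nbhd[OF mc u, of "m u + 1"] by auto
   have "(\<lambda>n. ?e n * (m u + 1)) \<longlonglongrightarrow> 0 * (m u + 1)" by (intro tendsto_mult_right e0)
   then have "eventually (\<lambda>n. ?e n * (m u + 1) < e) sequentially" by (intro order_tendstoD(2)) (use e in auto)
   then obtain n where n: "?e n * (m u + 1) < e" by (auto simp: eventually_sequentially)
   have "ndist (V w) (v w) (\<beta> n w) < e" if w: "w \<in> N" for w
   proof -
    have "w \<in> U0" using openin_subset[OF N(1)] w by auto
    then have "ndist (V w) (v w) (\<beta> n w) \<le> ?e n * m w" by (rule lim)
    also have "\<dots> \<le> ?e n * (m u + 1)" using N(3)[OF w] by (intro mult_left_mono) auto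
    finally show ?thesis using n by linarith
   qed
   then show "\<exists>U t. openin (unit_top G) U \<and> u \<in> U \<and> cont_field (unit_top G) E (unit_top G) (\<lambda>u. u) t \<and>
     (\<forall>w\<in>U. ndist (V w) (v w) (t w) < e)"
    using N gam_cont_field[OF \<beta>(1)[of n]] by (intro exI[of _ N] exI[of _ "\<beta> n"]) auto
  qed (use v in auto)
  fix u assume u: "u \<in> U0"
  interpret Vu: hilb "V u" by (rule V_hilb[OF u])
  have "ip (V u) (v u) (\<zeta> u) = (LINT h|lamH u. coef \<alpha> \<xi> \<zeta> h)" if \<zeta>: "\<zeta> \<in> gam E" for \<zeta>
  proof (rule LIMSEQ_unique)
   have zu: "\<zeta> u \<in> carrier (V u)" using gam_carrier[OF \<zeta>] u by simp
   show "(\<lambda>n. ip (V u) (\<beta> n u) (\<zeta> u)) \<longlonglongrightarrow> ip (V u) (v u) (\<zeta> u)"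
    using Vu.tendsto_ip[OF bc[OF u] v(1)[OF u] v(2)[OF u], of "\<lambda>_. \<zeta> u" "\<zeta> u"] zu by simp
   show "(\<lambda>n. ip (V u) (\<beta> n u) (\<zeta> u)) \<longlonglongrightarrow> (LINT h|lamH u. coef \<alpha> \<xi> \<zeta> h)"
   proof (rule LIM_zero_cancel, rule Lim_null_comparison)
    show "\<forall>\<^sub>F n in sequentially. norm (ip (V u) (\<beta> n u) (\<zeta> u) - (LINT h|lamH u. coef \<alpha> \<xi> \<zeta> h))
      \<le> ?e n * (m u * vnorm (V u) (\<zeta> u))"
     using \<beta>(2)[OF u \<zeta>] by (simp add: mult.assoc)
    show "(\<lambda>n. ?e n * (m u * vnorm (V u) (\<zeta> u))) \<longlonglongrightarrow> 0"
     using tendsto_mult_right[OF e0] by simp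
   qed
  qed
  then show "is_avg u \<alpha> \<xi> ((\<lambda>u\<in>topspace (unit_top G). v u) u)" using v(1)[OF u] u by (simp add: is_avg_def)
 qed
qed

end

context hrep_ne
begin

abbreviation quot where "quot M K \<equiv> (\<lambda>p. inv' (fst p) \<cdot> snd p) ` {p \<in> M \<times> K. r (fst p) = r (snd p)}"

text \<open>Right multiplication by such an element moves some point of \<open>M\<close> into \<open>K\<close>; so the set bounds the supports of
 all functions \<open>y \<mapsto> a(xy)\<close> with \<open>x\<close> in \<open>M\<close> and \<open>a\<close> supported in \<open>K\<close>.\<close>

lemma compact_div:
 assumes M: "compactin (gtop G) M" and K: "compactin (gtop G) K"
 shows "compactin (gtop G) (quot M K)" "compactin TH (quot M K \<inter> H)"
proof -
 let ?P = "prod_topology (gtop G) (gtop G)"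
 let ?C = "{p \<in> topspace ?P. (r \<circ> fst) p = (r \<circ> snd) p}"
 have C: "closedin ?P ?C"
  by (intro closedin_continuous_maps_eq[OF Hausdorff_unit_top] continuous_map_compose[OF _ continuous_r]
    continuous_map_fst continuous_map_snd)
 have "continuous_map (subtopology ?P ?C) (gtop G) (\<lambda>p. inv' (fst p) \<cdot> snd p)"
  using continuous_map_compose[OF continuous_map_fst continuous_inv]
  by (intro continuous_mul continuous_map_from_subtopology continuous_map_snd) (auto simp: o_def)
 moreover have "compactin (subtopology ?P ?C) (M \<times> K \<inter> ?C)"
  using compact_Int_closedin[OF _ C, of "M \<times> K"] M K by (auto simp: compactin_subtopology compactin_Times)
 moreover have "M \<times> K \<inter> ?C = {p \<in> M \<times> K. r (fst p) = r (snd p)}"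
  using compactin_subset_topspace[OF M] compactin_subset_topspace[OF K] by auto
 ultimately show "compactin (gtop G) (quot M K)"
  using image_compactin[of "subtopology ?P ?C" "M \<times> K \<inter> ?C" "gtop G"] by simp
 then show "compactin TH (quot M K \<inter> H)" using compact_Int_closedin closed_H by (auto simp: compactin_subtopology)
qed

lemma compact_divI:
 assumes "x \<in> M" "x \<in> A" "h \<in> A" "r h = d x" "x \<cdot> h \<in> K"
 shows "h \<in> quot M K"
 using assms cancel(1)[of x h] by (auto intro!: image_eqI[of _ _ "(x, x \<cdot> h)"])

definition CcG :: "('a \<Rightarrow> real) \<Rightarrow> bool" where
 "CcG a \<longleftrightarrow> continuous_map (gtop G) euclideanreal a \<and> (\<exists>K. compactin (gtop G) K \<and> (\<forall>x\<in>A. a x \<noteq> 0 --> x \<in> K))"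

text \<open>The function \<open>\<alpha>\<close> represents \<open>h \<mapsto> a(xh)\<close>, which makes sense on one range fibre only.\<close>

definition trace where "trace a x \<alpha> \<longleftrightarrow> CcH \<alpha> \<and> (\<forall>h\<in>H. r h = d x --> \<alpha> h = a (x \<cdot> h))"

lemma closedin_fibre_H: "u \<in> U0 ==> closedin TH {h \<in> H. r h = u}"
 using closedin_continuous_map_preimage[OF rH, of "{u}"] closedin_Hausdorff_singleton[OF Hausdorff_unit_top, of u] by simp

lemma trace_exists:
 assumes a: "CcG a" and x: "x \<in> A"
 obtains \<alpha> where "trace a x \<alpha>"
proof -
 obtain K where K: "compactin (gtop G) K" "\<forall>x\<in>A. a x \<noteq> 0 --> x \<in> K" using a by (auto simp: CcG_def)
 let ?S = "{h \<in> H. r h = d x}"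
 let ?K = "quot {x} K \<inter> H"
 have "continuous_map (subtopology TH ?S) (gtop G) (\<lambda>h. x \<cdot> h)"
  by (intro continuous_mul) (use x in \<open>auto simp: subtopology_subtopology intro!: continuous_map_from_subtopology\<close>)
 then have c: "continuous_map (subtopology TH ?S) euclideanreal (\<lambda>h. a (x \<cdot> h))"
  using continuous_map_compose a unfolding CcG_def o_def by blast
 have "compactin (gtop G) {x}" using x by simp
 note cK = compact_div(2)[OF this K(1)]
 show ?thesis
 proof (rule HT.tietze_compact_support[OF closedin_fibre_H[OF unitI(2)[OF x]] c cK])
  show "h \<in> ?K" if "h \<in> ?S" "a (x \<cdot> h) \<noteq> 0" for h
   using that K(2) x H_sub by (auto intro!: IntI compact_divI)
  fix \<alpha> L assume "continuous_map TH euclideanreal \<alpha>" "compactin TH L"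
   "!!h. h \<in> topspace TH ==> \<alpha> h \<noteq> 0 ==> h \<in> L" "!!h. h \<in> ?S ==> \<alpha> h = a (x \<cdot> h)"
  then have "trace a x \<alpha>" by (auto simp: trace_def CcH_def)
  then show ?thesis by (rule that)
 qed
qed

text \<open>Near \<open>x\<^sub>0\<close> all translates \<open>h \<mapsto> a(xh)\<close> vanish off one compact set, on which the tube lemma makes them
 uniformly close to each other.\<close>

lemma trace_uniform:
 assumes a: "CcG a" and x0: "x0 \<in> A" and t: "trace a x0 \<alpha>"
 obtains \<kappa> where "CcH \<kappa>" "!!h. h \<in> H ==> 0 \<le> \<kappa> h"
  "!!\<delta>. \<delta> > 0 ==> \<exists>N. openin (gtop G) N \<and> x0 \<in> N \<and> (\<forall>x\<in>N. \<forall>h\<in>H. r h = d x --> \<bar>a (x \<cdot> h) - \<alpha> h\<bar> \<le> \<delta> * \<kappa> h)"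
proof -
 obtain K where K: "compactin (gtop G) K" "\<forall>x\<in>A. a x \<noteq> 0 --> x \<in> K" using a by (auto simp: CcG_def)
 obtain L0 where L0: "compactin TH L0" "\<forall>h\<in>H. \<alpha> h \<noteq> 0 --> h \<in> L0" using t by (auto simp: trace_def CcH_def)
 obtain U M where M: "openin (gtop G) U" "compactin (gtop G) M" "{x0} \<subseteq> U" "U \<subseteq> M"
  using compact_nbhd[of "{x0}"] x0 by auto
 let ?D = "quot M K \<inter> H"
 let ?L = "L0 \<union> ?D"
 have L: "compactin TH ?L" by (intro compactin_Un L0(1) compact_div(2) M(2) K(1))
 obtain \<kappa> L' where \<kappa>: "continuous_map TH euclideanreal \<kappa>" "compactin TH L'"
  "!!h. h \<in> topspace TH ==> 0 \<le> \<kappa> h \<and> \<kappa> h \<le> 1" "!!h. h \<in> ?L ==> \<kappa> h = 1"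
  "!!h. h \<in> topspace TH ==> \<kappa> h \<noteq> 0 ==> h \<in> topspace TH \<and> h \<in> L'"
  by (rule HT.cutoff[OF L openin_topspace compactin_subset_topspace[OF L]]) blast
 show ?thesis
 proof (rule that[of \<kappa>])
  show "CcH \<kappa>" unfolding CcH_def using \<kappa>(1,2,5) by auto
  show "0 \<le> \<kappa> h" if "h \<in> H" for h using \<kappa>(3)[of h] that by simp
  fix \<delta> :: real assume \<delta>: "\<delta> > 0"
  let ?P = "prod_topology (gtop G) TH"
  let ?C = "{p \<in> topspace ?P. (d \<circ> fst) p = (r \<circ> snd) p}"
  let ?f = "\<lambda>p. a (fst p \<cdot> snd p) - \<alpha> (snd p)"
  have C: "closedin ?P ?C"
   by (intro closedin_continuous_maps_eq[OF Hausdorff_unit_top] continuous_map_compose[OF _ continuous_d]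
     continuous_map_compose[OF _ rH] continuous_map_fst continuous_map_snd)
  have sY: "continuous_map ?P (gtop G) snd"
   using continuous_map_snd[of "gtop G" TH] by (simp add: continuous_map_in_subtopology)
  have "continuous_map (subtopology ?P ?C) (gtop G) (\<lambda>p. fst p \<cdot> snd p)"
   by (intro continuous_mul continuous_map_from_subtopology continuous_map_fst sY) auto
  then have f: "continuous_map (subtopology ?P ?C) euclideanreal ?f"
   using continuous_map_compose[of _ "gtop G" "\<lambda>p. fst p \<cdot> snd p" _ a] a t
    continuous_map_compose[OF continuous_map_snd[of "gtop G" TH], of _ \<alpha>]
   by (intro continuous_map_diff) (auto simp: CcG_def trace_def CcH_def o_def intro!: continuous_map_from_subtopology)
  let ?B = "{p \<in> topspace (subtopology ?P ?C). ?f p \<in> - ball 0 \<delta>}"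
  have "closedin (subtopology ?P ?C) ?B" by (rule closedin_continuous_map_preimage[OF f]) auto
  then have B: "closedin ?P ?B" using C by (rule closedin_trans_full)
  have "{x0} \<times> ?L \<subseteq> topspace ?P - ?B"
   using x0 t \<delta> compactin_subset_topspace[OF L] by (auto simp: trace_def)
  from tube_lemma_right[OF openin_diff[OF openin_topspace B] L x0 this]
  obtain N N' where N: "openin (gtop G) N" "x0 \<in> N" "?L \<subseteq> N'" "N \<times> N' \<subseteq> topspace ?P - ?B" by blast
  have "\<bar>a (x \<cdot> h) - \<alpha> h\<bar> \<le> \<delta> * \<kappa> h" if x: "x \<in> N \<inter> U" and h: "h \<in> H" "r h = d x" for x h
  proof (cases "h \<in> ?L")
   case True
   then have "(x, h) \<in> topspace ?P - ?B" using N x by blast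
   then have "\<bar>a (x \<cdot> h) - \<alpha> h\<bar> < \<delta>" using h by auto
   then show ?thesis using \<kappa>(4)[OF True] by simp
  next
   case False
   have xA: "x \<in> A" using x openin_subset[OF N(1)] by auto
   have "a (x \<cdot> h) = 0"
   proof (rule ccontr)
    assume "a (x \<cdot> h) \<noteq> 0"
    then have "x \<cdot> h \<in> K" using K(2) xA h H_sub by auto
    then have "h \<in> ?D" using x M(4) xA h H_sub by (auto intro!: IntI compact_divI)
    then show False using False by blast
   qed
   moreover have "\<alpha> h = 0" using False L0(2) h by blast
   ultimately show ?thesis using \<kappa>(3)[of h] h \<delta> by simp
  qed
  then show "\<exists>N. openin (gtop G) N \<and> x0 \<in> N \<and> (\<forall>x\<in>N. \<forall>h\<in>H. r h = d x --> \<bar>a (x \<cdot> h) - \<alpha> h\<bar> \<le> \<delta> * \<kappa> h)"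
   using N M by (intro exI[of _ "N \<inter> U"]) auto
 qed
qed

lemma act_inv_ip:
 assumes k: "k \<in> H" and v: "v \<in> carrier (V (r k))" and w: "w \<in> carrier (V (d k))"
 shows "ip (V (d k)) (act \<sigma> (inv' k) v) w = ip (V (r k)) v (act \<sigma> k w)"
proof -
 have kA: "k \<in> A" using H_sub[OF k] .
 have c: "act \<sigma> (inv' k) v \<in> carrier (V (d k))" using act_carrier[OF H_inv[OF k], of v] v kA by simp
 have "act \<sigma> k (act \<sigma> (inv' k) v) = v"
  using act_mul[OF k H_inv[OF k], of v] v kA act_unit[of "r k" v] by simp
 then show ?thesis using unitary_mapD(2)[OF act_unitary[OF k] c w] by simp
qed

text \<open>Substituting \<open>h\<close> by \<open>kh\<close> in the weak integral. The vector \<open>\<sigma>(k) \<zeta>(d(k))\<close> against which it is then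
 tested is a value of a continuous section only up to a small error.\<close>

lemma is_avg_translate:
 assumes k: "k \<in> H" and \<alpha>: "CcH \<alpha>" "CcH \<alpha>'" and \<xi>: "\<xi> \<in> gam E" and v: "is_avg (r k) \<alpha> \<xi> v"
  and eq: "!!h. h \<in> H ==> r h = d k ==> \<alpha>' h = \<alpha> (k \<cdot> h)"
 shows "is_avg (d k) \<alpha>' \<xi> (act \<sigma> (inv' k) v)"
 unfolding is_avg_def
proof (intro conjI ballI)
 have kA: "k \<in> A" using H_sub[OF k] .
 have u: "r k \<in> U0" "d k \<in> U0" using kA by auto
 interpret Vr: hilb "V (r k)" by (rule V_hilb[OF u(1)])
 interpret radon TH "lamH (d k)" by (rule radon_lamH[OF u(2)])
 have vc: "v \<in> carrier (V (r k))" using v by (simp add: is_avg_def)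
 show "act \<sigma> (inv' k) v \<in> carrier (V (d k))" using act_carrier[OF H_inv[OF k], of v] vc kA by simp
 fix \<zeta> assume \<zeta>: "\<zeta> \<in> gam E"
 have zc: "\<zeta> (d k) \<in> carrier (V (d k))" using gam_carrier[OF \<zeta>] u by simp
 define w where "w = act \<sigma> k (\<zeta> (d k))"
 have wc: "w \<in> carrier (V (r k))" unfolding w_def by (rule act_carrier[OF k zc])
 define g where "g h = \<bar>\<alpha>' h\<bar> * vnorm (V (d h)) (\<xi> (d h))" for h
 obtain L where L: "compactin TH L" "\<forall>h\<in>H. \<alpha>' h \<noteq> 0 --> h \<in> L" using \<alpha> by (auto simp: CcH_def)
 have gc: "continuous_map TH euclideanreal g"
  unfolding g_def[abs_def] using \<alpha>(2) continuous_map_compose[OF dH gam_norm_continuous[OF \<xi>]]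
  by (intro continuous_map_real_mult continuous_map_real_abs) (auto simp: CcH_def o_def)
 have gi: "integrable (lamH (d k)) g" by (rule integrable_H[OF u(2) gc L(1)]) (use L(2) in \<open>auto simp: g_def\<close>)
 have g0: "0 \<le> (LINT h|lamH (d k). g h)"
  using semi_inner.vnorm_nonneg[OF V_semi gam_carrier[OF \<xi>]] H_sub
  by (intro integral_nonneg_AE AE_I2) (auto simp: g_def space_M)
 let ?T = "LINT h|lamH (d k). coef \<alpha>' \<xi> \<zeta> h"
 have est: "cmod (ip (V (r k)) v w - ?T) \<le> \<delta> * (vnorm (V (r k)) v + (LINT h|lamH (d k). g h))" if \<delta>: "\<delta> > 0" for \<delta>
 proof -
  obtain \<zeta>' where \<zeta>': "\<zeta>' \<in> gam E" "ndist (V (r k)) w (\<zeta>' (r k)) < \<delta>"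
   using gam_dense[of "r k" w \<delta>] wc \<delta> u by auto
  have z'c: "\<zeta>' (r k) \<in> carrier (V (r k))" using gam_carrier[OF \<zeta>'(1)] u by simp
  have pw: "cmod (coef \<alpha> \<xi> \<zeta>' (k \<cdot> h) - coef \<alpha>' \<xi> \<zeta> h) \<le> \<delta> * g h" if h: "h \<in> H" "r h = d k" for h
  proof -
   let ?a = "act \<sigma> h (\<xi> (d h))"
   have hA: "h \<in> A" using H_sub[OF h(1)] .
   have xc: "\<xi> (d h) \<in> carrier (V (d h))" using gam_carrier[OF \<xi>] hA by simp
   have ac: "?a \<in> carrier (V (d k))" using act_carrier[OF h(1) xc] h by simp
   have kc: "act \<sigma> k ?a \<in> carrier (V (r k))" by (rule act_carrier[OF k ac])
   have n: "vnorm (V (r k)) (act \<sigma> k ?a) = vnorm (V (d h)) (\<xi> (d h))"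
    using unitary_mapD(3)[OF act_unitary[OF k] ac] act_xi_norm[OF \<xi> h(1)] h by simp
   have "ip (V (d k)) ?a (\<zeta> (d k)) = ip (V (r k)) (act \<sigma> k ?a) w"
    unfolding w_def using unitary_mapD(2)[OF act_unitary[OF k] ac zc] by simp
   moreover have "act \<sigma> (k \<cdot> h) (\<xi> (d (k \<cdot> h))) = act \<sigma> k ?a"
    using act_mul[OF k h(1)] h xc kA hA by simp
   ultimately have "coef \<alpha> \<xi> \<zeta>' (k \<cdot> h) - coef \<alpha>' \<xi> \<zeta> h
     = complex_of_real (\<alpha>' h) * (ip (V (r k)) (act \<sigma> k ?a) (\<zeta>' (r k)) - ip (V (r k)) (act \<sigma> k ?a) w)"
    using eq[OF h] h kA hA by (simp add: coef_def right_diff_distrib)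
   also have "cmod \<dots> = \<bar>\<alpha>' h\<bar> * cmod (ip (V (r k)) (act \<sigma> k ?a) (w \<ominus>\<^bsub>V (r k)\<^esub> \<zeta>' (r k)))"
    using kc wc z'c by (simp add: norm_mult Vr.ip_diff_right norm_minus_commute)
   also have "\<dots> \<le> \<bar>\<alpha>' h\<bar> * (vnorm (V (d h)) (\<xi> (d h)) * \<delta>)"
    using wc z'c \<zeta>'(2) Vr.vnorm_nonneg[OF kc] n
    by (intro mult_left_mono order_trans[OF Vr.Cauchy_Schwarz[OF kc]]) (auto intro!: mult_left_mono)
   finally show ?thesis by (simp add: g_def mult_ac)
  qed
  let ?S = "{h \<in> H. r h = d k}"
  let ?f = "\<lambda>h. indicator ?S h *\<^sub>R coef \<alpha> \<xi> \<zeta>' (k \<cdot> h)"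
  have "continuous_map (subtopology TH ?S) TH (\<lambda>h. k \<cdot> h)"
   unfolding continuous_map_in_subtopology[of _ "gtop G"]
  proof
   show "continuous_map (subtopology TH ?S) (gtop G) (\<lambda>h. k \<cdot> h)"
    by (intro continuous_mul) (use kA in \<open>auto intro!: continuous_map_from_subtopology\<close>)
  qed (use H_mul[OF k] in auto)
  then have "continuous_map (subtopology TH ?S) euclidean (\<lambda>h. coef \<alpha> \<xi> \<zeta>' (k \<cdot> h))"
   using continuous_map_compose[OF _ coef_continuous[OF \<alpha>(1) \<xi> \<zeta>'(1)]] by (auto simp: o_def)
  from closed_indicator_measurable[OF closedin_fibre_H[OF u(2)] this]
  have fm: "?f \<in> borel_measurable (lamH (d k))" .
  have ci: "integrable (lamH (d k)) (coef \<alpha>' \<xi> \<zeta>)" by (rule coef_integrable[OF u(2) \<alpha>(2) \<xi> \<zeta>])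
  have "AE h in lamH (d k). h \<in> ?S" using AE_support support_lamH[OF u(2)] by simp
  then have "AE h in lamH (d k). norm (?f h) \<le> norm (cmod (coef \<alpha>' \<xi> \<zeta> h) + \<delta> * g h)"
  proof eventually_elim
   case (elim h)
   then show ?case using pw[of h] norm_triangle_ineq2[of "coef \<alpha> \<xi> \<zeta>' (k \<cdot> h)" "coef \<alpha>' \<xi> \<zeta> h"] by (simp add: abs_if)
  qed
  then have fi: "integrable (lamH (d k)) ?f"
   by (intro Bochner_Integration.integrable_bound[OF _ fm, of "\<lambda>h. cmod (coef \<alpha>' \<xi> \<zeta> h) + \<delta> * g h"]) (use ci gi in auto)
  have "ip (V (r k)) v (\<zeta>' (r k)) = (LINT h|lamH (r k). coef \<alpha> \<xi> \<zeta>' h)" using v \<zeta>'(1) by (simp add: is_avg_def)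
  also have "\<dots> = (LINT h|lamH (d k). ?f h)"
   using haar_invariant[OF coef_Cc[OF \<alpha>(1) \<xi> \<zeta>'(1)] k] by (simp add: set_lebesgue_integral_def)
  finally have "ip (V (r k)) v (\<zeta>' (r k)) - ?T = (LINT h|lamH (d k). ?f h - coef \<alpha>' \<xi> \<zeta> h)"
   using fi ci by simp
  also have "cmod \<dots> \<le> (LINT h|lamH (d k). \<delta> * g h)"
   by (rule integral_bound_support) (use fi ci gi pw support_lamH[OF u(2)] in auto)
  finally have 1: "cmod (ip (V (r k)) v (\<zeta>' (r k)) - ?T) \<le> \<delta> * (LINT h|lamH (d k). g h)" by simp
  have "cmod (ip (V (r k)) v w - ip (V (r k)) v (\<zeta>' (r k))) \<le> vnorm (V (r k)) v * \<delta>"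
   using Vr.Cauchy_Schwarz[OF vc, of "w \<ominus>\<^bsub>V (r k)\<^esub> \<zeta>' (r k)"] vc wc z'c \<zeta>'(2) Vr.vnorm_nonneg[OF vc]
    mult_left_mono[of "ndist (V (r k)) w (\<zeta>' (r k))" \<delta> "vnorm (V (r k)) v"] by (simp add: Vr.ip_diff_right)
  then show ?thesis using 1 norm_triangle_ineq[of "ip (V (r k)) v w - ip (V (r k)) v (\<zeta>' (r k))" "ip (V (r k)) v (\<zeta>' (r k)) - ?T"]
   by (simp add: algebra_simps)
 qed
 have "cmod (ip (V (r k)) v w - ?T) \<le> 0"
 proof (rule field_le_epsilon)
  let ?B = "vnorm (V (r k)) v + (LINT h|lamH (d k). g h)"
  fix e :: real assume e: "0 < e"
  have B: "0 \<le> ?B" using Vr.vnorm_nonneg[OF vc] g0 by simp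
  have "cmod (ip (V (r k)) v w - ?T) \<le> e / (?B + 1) * ?B" by (rule est) (use e B in auto)
  also have "\<dots> \<le> e" using e B by (simp add: field_simps)
  finally show "cmod (ip (V (r k)) v w - ?T) \<le> 0 + e" by simp
 qed
 then show "ip (V (d k)) (act \<sigma> (inv' k) v) (\<zeta> (d k)) = ?T"
  using act_inv_ip[OF k vc zc] by (simp add: w_def)
qed

definition avg_of where
 "avg_of a \<xi> f \<longleftrightarrow> CcG a \<and> \<xi> \<in> gam E \<and> f \<in> ES \<and> (\<forall>x\<in>A. \<forall>\<alpha>. trace a x \<alpha> --> is_avg (d x) \<alpha> \<xi> (f x))"

text \<open>The equivariant section \<open>x \<mapsto> \<integral> a(xh) \<sigma>(h) \<xi>(d(h)) d\<lambda>(h)\<close>. Invariance of the Haar system makes it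
 equivariant, and uniform continuity of \<open>a\<close> along compact sets makes it continuous.\<close>

lemma avg_of_exists:
 assumes a: "CcG a" and \<xi>: "\<xi> \<in> gam E"
 obtains f where "avg_of a \<xi> f"
proof -
 have "\<forall>x\<in>A. \<exists>v. \<forall>\<alpha>. trace a x \<alpha> --> is_avg (d x) \<alpha> \<xi> v"
 proof
  fix x assume x: "x \<in> A"
  obtain \<alpha> where \<alpha>: "trace a x \<alpha>" by (rule trace_exists[OF a x])
  obtain \<beta> where \<beta>: "\<beta> \<in> gam E" "!!u. u \<in> U0 ==> is_avg u \<alpha> \<xi> (\<beta> u)"
   by (rule avg_exists[of \<alpha>, OF _ \<xi>]) (use \<alpha> in \<open>auto simp: trace_def\<close>)
  have "is_avg (d x) \<alpha>' \<xi> (\<beta> (d x))" if t: "trace a x \<alpha>'" for \<alpha>'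
   by (rule is_avg_cong[OF unitI(2)[OF x] _ _ \<xi> _ \<beta>(2)[OF unitI(2)[OF x]]]) (use t \<alpha> in \<open>auto simp: trace_def\<close>)
  then show "\<exists>v. \<forall>\<alpha>. trace a x \<alpha> --> is_avg (d x) \<alpha> \<xi> v" by blast
 qed
 from bchoice[OF this] obtain f where f: "!!x \<alpha>. x \<in> A ==> trace a x \<alpha> ==> is_avg (d x) \<alpha> \<xi> (f x)" by blast
 have fc: "f x \<in> carrier (V (d x))" if x: "x \<in> A" for x
  using trace_exists[OF a x] f[OF x] unfolding is_avg_def by blast
 obtain K where K: "compactin (gtop G) K" "\<forall>x\<in>A. a x \<noteq> 0 --> x \<in> K" using a by (auto simp: CcG_def)
 have "(\<lambda>x\<in>A. f x) \<in> ES"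
 proof (rule ES_I)
  show "cont_field (unit_top G) E (gtop G) d f"
  proof (rule cont_field_local_limit[OF continuous_d])
   fix x0 and e :: real assume x0: "x0 \<in> A" and e: "e > 0"
   obtain \<alpha> where \<alpha>: "trace a x0 \<alpha>" by (rule trace_exists[OF a x0])
   then have \<alpha>C: "CcH \<alpha>" by (simp add: trace_def)
   obtain \<beta> where \<beta>: "\<beta> \<in> gam E" "!!u. u \<in> U0 ==> is_avg u \<alpha> \<xi> (\<beta> u)" by (rule avg_exists[OF \<alpha>C \<xi>]) blast
   obtain \<kappa> where \<kappa>: "CcH \<kappa>" "!!h. h \<in> H ==> 0 \<le> \<kappa> h" "!!\<delta>. \<delta> > 0 ==> \<exists>N. openin (gtop G) N \<and> x0 \<in> N \<and>
     (\<forall>x\<in>N. \<forall>h\<in>H. r h = d x --> \<bar>a (x \<cdot> h) - \<alpha> h\<bar> \<le> \<delta> * \<kappa> h)"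
    by (rule trace_uniform[OF a x0 \<alpha>]) blast
   define m where "m u = (LINT h|lamH u. \<kappa> h * vnorm (V (d h)) (\<xi> (d h)))" for u
   obtain L where L: "compactin TH L" "\<forall>h\<in>H. \<kappa> h \<noteq> 0 --> h \<in> L" using \<kappa>(1) by (auto simp: CcH_def)
   have mc: "continuous_map (unit_top G) euclideanreal m"
    unfolding m_def[abs_def] using \<kappa>(1) continuous_map_compose[OF dH gam_norm_continuous[OF \<xi>]] L(2)
    by (intro haar_continuous_real[OF _ L(1)] continuous_map_real_mult) (auto simp: CcH_def o_def)
   have "continuous_map (gtop G) euclideanreal (\<lambda>x. m (d x))"
    using continuous_map_compose[OF continuous_d mc] by (simp add: o_def)
   then obtain N1 where N1: "openin (gtop G) N1" "x0 \<in> N1" "!!x. x \<in> N1 ==> m (d x) < \<bar>m (d x0)\<bar> + 1"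
    by (rule continuous_map_less_nbhd[of _ _ x0 "\<bar>m (d x0)\<bar> + 1"]) (use x0 in auto)
   let ?\<delta> = "e / (\<bar>m (d x0)\<bar> + 1)"
   have d: "?\<delta> > 0" using e by simp
   obtain N2 where N2: "openin (gtop G) N2" "x0 \<in> N2"
    "!!x h. x \<in> N2 ==> h \<in> H ==> r h = d x ==> \<bar>a (x \<cdot> h) - \<alpha> h\<bar> \<le> ?\<delta> * \<kappa> h" using \<kappa>(3)[OF d] by blast
   have "ndist (V (d x)) (f x) (\<beta> (d x)) < e" if x: "x \<in> N1 \<inter> N2" for x
   proof -
    have xA: "x \<in> A" using x openin_subset[OF N1(1)] by auto
    obtain \<alpha>' where \<alpha>': "trace a x \<alpha>'" by (rule trace_exists[OF a xA])
    have "ndist (V (d x)) (f x) (\<beta> (d x)) \<le> ?\<delta> * m (d x)"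
     by (rule is_avg_diff_bound[OF unitI(2)[OF xA] _ \<alpha>C \<xi> \<kappa>(1,2) _ _ f[OF xA \<alpha>'] \<beta>(2)[OF unitI(2)[OF xA]], folded m_def])
      (use \<alpha>' N2(3)[of x] x d in \<open>auto simp: trace_def\<close>)
    also have "\<dots> < ?\<delta> * (\<bar>m (d x0)\<bar> + 1)" using N1(3)[of x] x d by (intro mult_strict_left_mono) auto
    finally show ?thesis by simp
   qed
   then show "\<exists>U t. openin (gtop G) U \<and> x0 \<in> U \<and> cont_field (unit_top G) E (gtop G) d t \<and>
     (\<forall>w\<in>U. ndist (V (d w)) (f w) (t w) < e)"
    using N1 N2 cont_field_gam[OF continuous_d \<beta>(1)] by (intro exI[of _ "N1 \<inter> N2"] exI[of _ "\<lambda>x. \<beta> (d x)"]) auto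
  qed (rule fc)
  show "compactin CS (q ` K)" by (rule image_compactin[OF K(1) continuous_q])
  fix x k assume x: "x \<in> A" and k: "k \<in> H" "d x = r k"
  have kA: "k \<in> A" using H_sub[OF k(1)] .
  obtain \<alpha> where \<alpha>: "trace a x \<alpha>" by (rule trace_exists[OF a x])
  have xk: "x \<cdot> k \<in> A" using x k kA by simp
  obtain \<alpha>' where \<alpha>': "trace a (x \<cdot> k) \<alpha>'" by (rule trace_exists[OF a xk])
  have "is_avg (d k) \<alpha>' \<xi> (act \<sigma> (inv' k) (f x))"
  proof (rule is_avg_translate[OF k(1) _ _ \<xi>])
   fix h assume h: "h \<in> H" "r h = d k"
   then show "\<alpha>' h = \<alpha> (k \<cdot> h)"
    using \<alpha> \<alpha>' H_mul[OF k(1) h(1)] assoc[of x k h] x k kA H_sub[OF h(1)] by (simp add: trace_def)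
  qed (use \<alpha> \<alpha>' f[OF x \<alpha>] k in \<open>auto simp: trace_def\<close>)
  then show "f (x \<cdot> k) = act \<sigma> (inv' k) (f x)"
   using is_avg_unique[of "d k"] f[OF xk \<alpha>'] x k kA by simp
 next
  fix x assume x: "x \<in> A" and ne: "f x \<noteq> \<zero>\<^bsub>V (d x)\<^esub>"
  interpret Vx: hilb "V (d x)" using V_hilb x by simp
  obtain \<alpha> where \<alpha>: "trace a x \<alpha>" by (rule trace_exists[OF a x])
  have "\<exists>h\<in>H. r h = d x \<and> a (x \<cdot> h) \<noteq> 0"
  proof (rule ccontr)
   assume "\<not> ?thesis"
   then have z: "a (x \<cdot> h) = 0" if "h \<in> H" "r h = d x" for h using that by blast
   have "CcH (\<lambda>_. 0)" unfolding CcH_def by (auto intro!: exI[of _ "{}"])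
   then have "trace a x (\<lambda>_. 0)" using z by (auto simp: trace_def)
   from f[OF x this] have "is_avg (d x) (\<lambda>_. 0) \<xi> (f x)" .
   moreover have "is_avg (d x) (\<lambda>_. 0) \<xi> \<zero>\<^bsub>V (d x)\<^esub>" using gam_carrier x by (auto simp: is_avg_def coef_def)
   ultimately show False using is_avg_unique[of "d x"] x ne by auto
  qed
  then obtain h where h: "h \<in> H" "r h = d x" "x \<cdot> h \<in> K" using K(2) x H_sub by auto
  then show "q x \<in> q ` K" using coset_mul[OF x h(1,2)] by (auto intro!: image_eqI[of _ _ "x \<cdot> h"])
 qed
 moreover have "is_avg (d x) \<alpha> \<xi> ((\<lambda>x\<in>A. f x) x)" if "x \<in> A" "trace a x \<alpha>" for x \<alpha> using f that by simp
 ultimately show ?thesis using that a \<xi> unfolding avg_of_def by blast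
qed

end

section \<open>The left translation operators\<close>

context hrep_ne
begin

lemma avg_eqI:
 assumes f: "avg_of a \<xi> f" and x: "x \<in> A" and v: "!!\<alpha>. trace a x \<alpha> ==> is_avg (d x) \<alpha> \<xi> v"
 shows "f x = v"
proof -
 obtain \<alpha> where "trace a x \<alpha>" using trace_exists[OF _ x] f unfolding avg_of_def by blast
 then show ?thesis using is_avg_unique[of "d x" \<alpha> \<xi> "f x" v] v f x by (simp add: avg_of_def)
qed

text \<open>Translating \<open>a\<close> translates its average; only the values of \<open>a\<close> on one range fibre matter.\<close>

lemma avg_translate:
 assumes f: "avg_of a \<xi> f" and x: "x \<in> A"
 obtains f' where "f' \<in> ES" "!!y. y \<in> A ==> r y = r x ==> f' y = f (inv' x \<cdot> y)"
proof -
 have a: "CcG a" and \<xi>: "\<xi> \<in> gam E" using f by (auto simp: avg_of_def)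
 obtain K where K: "compactin (gtop G) K" "\<forall>x\<in>A. a x \<noteq> 0 --> x \<in> K" using a by (auto simp: CcG_def)
 let ?S = "range_fibre G (r x)"
 have S: "y \<in> ?S \<longleftrightarrow> y \<in> A \<and> r y = r x" for y by (simp add: range_fibre_def)
 have "continuous_map (subtopology (gtop G) ?S) (gtop G) (\<lambda>y. inv' x \<cdot> y)"
  by (intro continuous_mul) (use x in \<open>auto simp: S intro!: continuous_map_from_subtopology\<close>)
 then have c: "continuous_map (subtopology (gtop G) ?S) euclideanreal (\<lambda>y. a (inv' x \<cdot> y))"
  using continuous_map_compose a unfolding CcG_def o_def by blast
 have "compactin (gtop G) {inv' x}" using x by simp
 note cK = compact_div(1)[OF this K(1)]
 show ?thesis
 proof (rule tietze_compact_support[OF closedin_range_fibre[OF unitI(1)[OF x]] c cK])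
  show "y \<in> quot {inv' x} K" if "y \<in> ?S" "a (inv' x \<cdot> y) \<noteq> 0" for y
   using that K(2) x by (intro compact_divI[of "inv' x"]) (auto simp: S)
  fix a' L assume a': "continuous_map (gtop G) euclideanreal a'" "compactin (gtop G) L"
   "!!y. y \<in> A ==> a' y \<noteq> 0 ==> y \<in> L" "!!y. y \<in> ?S ==> a' y = a (inv' x \<cdot> y)"
  then have "CcG a'" by (auto simp: CcG_def)
  then obtain f' where f': "avg_of a' \<xi> f'" using avg_of_exists[OF _ \<xi>] by blast
  have "f' y = f (inv' x \<cdot> y)" if y: "y \<in> A" "r y = r x" for y
  proof (rule avg_eqI[OF f' y(1)])
   fix \<alpha> assume t: "trace a' y \<alpha>"
   have "trace a (inv' x \<cdot> y) \<alpha>"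
    unfolding trace_def
   proof (intro conjI ballI impI)
    show "CcH \<alpha>" using t by (simp add: trace_def)
    fix h assume h: "h \<in> H" "r h = d (inv' x \<cdot> y)"
    then show "\<alpha> h = a (inv' x \<cdot> y \<cdot> h)"
     using t a'(4)[of "y \<cdot> h"] x y H_sub[OF h(1)] assoc[of "inv' x" y h] by (simp add: trace_def S)
   qed
   then show "is_avg (d y) \<alpha> \<xi> (f (inv' x \<cdot> y))" using f x y unfolding avg_of_def by force
  qed
  then show ?thesis using that[of f'] f' by (auto simp: avg_of_def)
 qed
qed

lemma avg_scale:
 assumes f: "avg_of a \<xi> f" and b: "continuous_map CS euclideanreal b"
 shows "avg_of (\<lambda>x. b (q x) * a x) \<xi> (\<lambda>x\<in>A. complex_of_real (b (q x)) \<odot>\<^bsub>V (d x)\<^esub> f x)"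
 unfolding avg_of_def
proof (intro conjI ballI allI impI)
 have a: "CcG a" and \<xi>: "\<xi> \<in> gam E" and fE: "f \<in> ES" using f by (auto simp: avg_of_def)
 show "\<xi> \<in> gam E" by (rule \<xi>)
 have bq: "continuous_map (gtop G) euclideanreal (\<lambda>x. b (q x))"
  using continuous_map_compose[OF continuous_q b] by (simp add: o_def)
 then show "CcG (\<lambda>x. b (q x) * a x)" using a by (auto simp: CcG_def intro!: continuous_map_real_mult)
 show "(\<lambda>x\<in>A. complex_of_real (b (q x)) \<odot>\<^bsub>V (d x)\<^esub> f x) \<in> ES"
  by (rule ES_scale[OF fE continuous_map_of_real[OF bq]]) (simp add: coset_invariant_def coset_mul)
 fix x \<alpha> assume x: "x \<in> A" and t: "trace (\<lambda>x. b (q x) * a x) x \<alpha>"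
 interpret Vx: hilb "V (d x)" using V_hilb x by simp
 obtain \<alpha>0 where t0: "trace a x \<alpha>0" by (rule trace_exists[OF a x])
 have av: "is_avg (d x) \<alpha>0 \<xi> (f x)" using f x t0 by (simp add: avg_of_def)
 have C: "CcH (\<lambda>h. b (q x) * \<alpha>0 h)" using t0 by (auto simp: trace_def CcH_def intro!: continuous_map_real_mult)
 have "is_avg (d x) (\<lambda>h. b (q x) * \<alpha>0 h) \<xi> (complex_of_real (b (q x)) \<odot>\<^bsub>V (d x)\<^esub> f x)"
  using av gam_carrier x by (simp add: is_avg_def Vx.ip_smult coef_def mult.assoc)
 then have "is_avg (d x) \<alpha> \<xi> (complex_of_real (b (q x)) \<odot>\<^bsub>V (d x)\<^esub> f x)"
  by (rule is_avg_cong[OF unitI(2)[OF x] C _ \<xi>, rotated 2]) (use t t0 x coset_mul in \<open>auto simp: trace_def\<close>)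
 then show "is_avg (d x) \<alpha> \<xi> ((\<lambda>x\<in>A. complex_of_real (b (q x)) \<odot>\<^bsub>V (d x)\<^esub> f x) x)" using x by simp
qed

text \<open>Averaging against a bump function near the unit \<open>d(y)\<close> hardly changes \<open>\<xi>(d(y))\<close>.\<close>

lemma avg_enough:
 assumes y: "y \<in> A" and v: "v \<in> carrier (V (d y))" and e: "e > 0"
 shows "\<exists>a \<xi> f. avg_of a \<xi> f \<and> ndist (V (d y)) (f y) v < e"
proof -
 let ?u = "d y"
 have u: "?u \<in> U0" using y by simp
 have uH: "?u \<in> H" by (rule unit_H[OF u])
 interpret Vu: hilb "V ?u" by (rule V_hilb[OF u])
 interpret radon TH "lamH ?u" by (rule radon_lamH[OF u])
 obtain \<xi> where \<xi>: "\<xi> \<in> gam E" "ndist (V ?u) v (\<xi> ?u) < e / 2"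
  using gam_dense[of ?u v "e / 2"] v e u by auto
 have xc: "\<xi> ?u \<in> carrier (V ?u)" using gam_carrier[OF \<xi>(1)] u by simp
 have "continuous_map TH euclideanreal (\<lambda>h. ndist (V (r h)) (act \<sigma> h (\<xi> (d h))) (\<xi> (r h)))"
  by (intro cont_field_norm cont_field_diff act_continuous cont_field_gam rH \<xi>(1))
 moreover have "ndist (V (r ?u)) (act \<sigma> ?u (\<xi> (d ?u))) (\<xi> (r ?u)) < e / 2"
  using act_unit[OF u xc] unitE[OF u] xc e Vu.diff_self Vu.vnorm_zero by simp
 ultimately obtain N where N: "openin TH N" "?u \<in> N"
  "!!h. h \<in> N ==> ndist (V (r h)) (act \<sigma> h (\<xi> (d h))) (\<xi> (r h)) < e / 2"
  using continuous_map_less_nbhd[of TH _ ?u "e / 2"] uH H_sub by (metis (no_types, lifting) IntI topspace_subtopology)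
 obtain \<kappa> L where \<kappa>: "continuous_map TH euclideanreal \<kappa>" "compactin TH L"
  "!!h. h \<in> topspace TH ==> 0 \<le> \<kappa> h \<and> \<kappa> h \<le> 1" "!!h. h \<in> {?u} ==> \<kappa> h = 1"
  "!!h. h \<in> topspace TH ==> \<kappa> h \<noteq> 0 ==> h \<in> N \<and> h \<in> L"
  by (rule HT.cutoff[of "{?u}" N]) (use N uH in auto)
 define c where "c = (LINT h|lamH ?u. \<kappa> h)"
 have c: "c > 0"
  unfolding c_def
 proof (rule integral_pos[OF \<kappa>(1,2)])
  show "?u \<in> measure_support TH (lamH ?u)" "\<kappa> ?u > 0" using support_lamH[OF u] uH unitE[OF u] \<kappa>(4) by auto
 qed (use \<kappa> in auto)
 define \<alpha> where "\<alpha> h = \<kappa> h / c" for h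
 have ac: "continuous_map TH euclideanreal \<alpha>"
  using continuous_map_real_mult[OF \<kappa>(1), of "\<lambda>_. 1 / c"] by (simp add: \<alpha>_def[abs_def])
 have \<alpha>: "CcH \<alpha>" unfolding CcH_def using ac \<kappa>(2,5) by (auto simp: \<alpha>_def)
 have a0: "0 \<le> \<alpha> h" if "h \<in> H" for h using \<kappa>(3)[of h] c that by (simp add: \<alpha>_def)
 have ai: "integrable (lamH ?u) \<alpha>" by (rule integrable_H[OF u ac \<kappa>(2)]) (use \<kappa>(5) in \<open>auto simp: \<alpha>_def\<close>)
 have a1: "(LINT h|lamH ?u. \<alpha> h) = 1" using c by (simp add: \<alpha>_def c_def)
 \<comment> \<open>A function on \<open>G\<close> whose trace along the coset of \<open>y\<close> is \<open>\<alpha>\<close>.\<close>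
 let ?S = "{z \<in> range_fibre G (r y). inv' y \<cdot> z \<in> H}"
 have S: "z \<in> ?S \<longleftrightarrow> z \<in> A \<and> r z = r y \<and> inv' y \<cdot> z \<in> H" for z by (auto simp: range_fibre_def)
 have cm: "continuous_map (subtopology (gtop G) (range_fibre G (r y))) (gtop G) (\<lambda>z. inv' y \<cdot> z)"
  by (intro continuous_mul) (use y in \<open>auto simp: range_fibre_def intro!: continuous_map_from_subtopology\<close>)
 have "closedin (subtopology (gtop G) (range_fibre G (r y))) {z \<in> topspace (subtopology (gtop G) (range_fibre G (r y))). inv' y \<cdot> z \<in> H}"
  by (rule closedin_continuous_map_preimage[OF cm closed_H])
 moreover have "{z \<in> topspace (subtopology (gtop G) (range_fibre G (r y))). inv' y \<cdot> z \<in> H} = ?S"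
  by (auto simp: range_fibre_def)
 ultimately have cS: "closedin (gtop G) ?S"
  using closedin_trans_full closedin_range_fibre[OF unitI(1)[OF y]] by metis
 have "continuous_map (subtopology (gtop G) ?S) TH (\<lambda>z. inv' y \<cdot> z)"
  using continuous_map_from_subtopology_mono[OF cm, of ?S] by (auto simp: continuous_map_in_subtopology)
 then have cc: "continuous_map (subtopology (gtop G) ?S) euclideanreal (\<lambda>z. \<alpha> (inv' y \<cdot> z))"
  using continuous_map_compose[OF _ ac] by (auto simp: o_def)
 have "compactin (gtop G) {inv' y}" "compactin (gtop G) L" using y \<kappa>(2) by (auto simp: compactin_subtopology)
 note cK = compact_div(1)[OF this]
 show ?thesis
 proof (rule tietze_compact_support[OF cS cc cK])
  show "z \<in> quot {inv' y} L" if z: "z \<in> ?S" "\<alpha> (inv' y \<cdot> z) \<noteq> 0" for z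
   using z y \<kappa>(5)[of "inv' y \<cdot> z"] H_sub by (intro compact_divI[of "inv' y"]) (auto simp: range_fibre_def \<alpha>_def)
  fix a L' assume a: "continuous_map (gtop G) euclideanreal a" "compactin (gtop G) L'"
   "!!z. z \<in> A ==> a z \<noteq> 0 ==> z \<in> L'" "!!z. z \<in> ?S ==> a z = \<alpha> (inv' y \<cdot> z)"
  then have "CcG a" by (auto simp: CcG_def)
  then obtain f where f: "avg_of a \<xi> f" using avg_of_exists[OF _ \<xi>(1)] by blast
  have "trace a y \<alpha>"
   using \<alpha> a(4) y H_sub cancel(1)[OF y] by (auto simp: trace_def range_fibre_def)
  then have av: "is_avg ?u \<alpha> \<xi> (f y)" using f y by (simp add: avg_of_def)
  then have fc: "f y \<in> carrier (V ?u)" by (simp add: is_avg_def)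
  have "ndist (V ?u) (f y) (\<xi> ?u) \<le> e / 2"
  proof (rule weak_bound)
   fix \<zeta> assume \<zeta>: "\<zeta> \<in> gam E"
   have zc: "\<zeta> ?u \<in> carrier (V ?u)" using gam_carrier[OF \<zeta>] u by simp
   have ci: "integrable (lamH ?u) (coef \<alpha> \<xi> \<zeta>)" by (rule coef_integrable[OF u \<alpha> \<xi>(1) \<zeta>])
   have ii: "integrable (lamH ?u) (\<lambda>h. complex_of_real (\<alpha> h) * ip (V ?u) (\<xi> ?u) (\<zeta> ?u))"
    using ai by (intro integrable_mult_left integrable_of_real)
   have "ip (V ?u) (f y \<ominus>\<^bsub>V ?u\<^esub> \<xi> ?u) (\<zeta> ?u)
     = (LINT h|lamH ?u. coef \<alpha> \<xi> \<zeta> h - complex_of_real (\<alpha> h) * ip (V ?u) (\<xi> ?u) (\<zeta> ?u))"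
    using av fc xc zc \<zeta> ci ii ai a1 by (simp add: Vu.ip_diff_left is_avg_def)
   also have "cmod \<dots> \<le> (LINT h|lamH ?u. \<alpha> h * (e / 2 * vnorm (V ?u) (\<zeta> ?u)))"
   proof (rule integral_bound_support)
    fix h assume "h \<in> measure_support TH (lamH ?u)"
    then have h: "h \<in> H" "r h = ?u" by (auto simp: support_lamH[OF u])
    let ?a = "act \<sigma> h (\<xi> (d h))"
    have hc: "?a \<in> carrier (V ?u)" using act_xi_carrier[OF \<xi>(1) h(1)] h by simp
    have "cmod (coef \<alpha> \<xi> \<zeta> h - complex_of_real (\<alpha> h) * ip (V ?u) (\<xi> ?u) (\<zeta> ?u))
      = \<alpha> h * cmod (ip (V ?u) (?a \<ominus>\<^bsub>V ?u\<^esub> \<xi> ?u) (\<zeta> ?u))"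
     using hc xc zc a0[OF h(1)] h by (simp add: coef_def Vu.ip_diff_left norm_mult flip: right_diff_distrib)
    also have "\<dots> \<le> \<alpha> h * (e / 2 * vnorm (V ?u) (\<zeta> ?u))"
    proof (cases "\<alpha> h = 0")
     case False
     then have "h \<in> N" using \<kappa>(5)[of h] h by (auto simp: \<alpha>_def)
     then have "ndist (V ?u) ?a (\<xi> ?u) \<le> e / 2" using N(3)[of h] h by simp
     then show ?thesis using hc xc zc a0[OF h(1)] Vu.vnorm_nonneg[OF zc]
      by (intro mult_left_mono order_trans[OF Vu.Cauchy_Schwarz[OF _ zc]] mult_right_mono) auto
    qed simp
    finally show "cmod (coef \<alpha> \<xi> \<zeta> h - complex_of_real (\<alpha> h) * ip (V ?u) (\<xi> ?u) (\<zeta> ?u))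
      \<le> \<alpha> h * (e / 2 * vnorm (V ?u) (\<zeta> ?u))" .
   qed (use ci ii ai in auto)
   also have "\<dots> = e / 2 * vnorm (V ?u) (\<zeta> ?u)" using a1 by simp
   finally show "cmod (ip (V ?u) (f y \<ominus>\<^bsub>V ?u\<^esub> \<xi> ?u) (\<zeta> ?u)) \<le> e / 2 * vnorm (V ?u) (\<zeta> ?u)" .
  qed (use u fc xc e in auto)
  then have "ndist (V ?u) (f y) v < e"
   using Vu.vnorm_diff_triangle[OF fc xc v] Vu.vnorm_diff_commute[OF xc v] \<xi>(2) by linarith
  then show ?thesis using f by blast
 qed
qed

end

lemma unitary_map_cong:
 assumes "unitary_map V W T" "abelian_monoid V" "!!c v. v \<in> carrier V ==> c \<odot>\<^bsub>V\<^esub> v \<in> carrier V"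
  and eq: "!!v. v \<in> carrier V ==> T' v = T v"
 shows "unitary_map V W T'"
 using assms abelian_monoid.a_closed[OF assms(2)] bij_betw_cong[of "carrier V" T' T "carrier W"]
 by (auto simp: unitary_map_def linear_map_def Pi_iff)

context hrep_ne
begin

text \<open>The translate of an equivariant section by \<open>x\<close> is defined on a single range fibre; the operator \<open>L(x)\<close>
 is known on those sections whose translate extends again to an equivariant section.\<close>

definition TP where
 "TP x = {(f, f'). f \<in> ES \<and> f' \<in> ES \<and> (\<forall>y\<in>A. r y = r x --> f' y = f (inv' x \<cdot> y))}"

lemma TP_sum:
 assumes x: "x \<in> A" and g: "g \<in> ES" and "finite J"
  and "!!j. j \<in> J ==> avg_of (a j) (\<xi> j) (f j) \<and> continuous_map CS euclideanreal (b j) \<and> (\<forall>C\<in>topspace CS. 0 \<le> b j C)"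
 shows "\<exists>F F'. (F, F') \<in> TP x \<and> (\<forall>y\<in>A. ndist (V (d y)) (F y) (complex_of_real (\<Sum>j\<in>J. b j (q y)) \<odot>\<^bsub>V (d y)\<^esub> g y)
   \<le> (\<Sum>j\<in>J. b j (q y) * ndist (V (d y)) (f j y) (g y)))"
 using assms(3,4)
proof (induction J)
 case empty
 define z where "z = (\<lambda>x\<in>A. \<zero>\<^bsub>V (d x)\<^esub>)"
 have z: "z \<in> ES" "!!y. y \<in> A ==> z y = \<zero>\<^bsub>V (d y)\<^esub>" using ES_zero by (simp_all add: z_def)
 have "ndist (V (d y)) (\<zero>\<^bsub>V (d y)\<^esub>) (0 \<odot>\<^bsub>V (d y)\<^esub> g y) = 0" if y: "y \<in> A" for y
 proof -
  interpret Vy: hilb "V (d y)" using V_hilb y by simp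
  show ?thesis using ES_D(2)[OF g y] Vy.zero_smult[of "g y"] by (simp add: Vy.diff_self Vy.vnorm_zero)
 qed
 then show ?case using z x by (intro exI[of _ z]) (simp add: TP_def)
next
 case (insert j J)
 then obtain F F' where F: "(F, F') \<in> TP x" "!!y. y \<in> A ==> ndist (V (d y)) (F y) (complex_of_real (\<Sum>j\<in>J. b j (q y)) \<odot>\<^bsub>V (d y)\<^esub> g y)
   \<le> (\<Sum>j\<in>J. b j (q y) * ndist (V (d y)) (f j y) (g y))" by auto
 have j: "avg_of (a j) (\<xi> j) (f j)" "continuous_map CS euclideanreal (b j)" "!!C. C \<in> topspace CS ==> 0 \<le> b j C" using insert.prems by auto
 let ?h = "\<lambda>x\<in>A. complex_of_real (b j (q x)) \<odot>\<^bsub>V (d x)\<^esub> f j x"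
 note av = avg_scale[OF j(1,2)]
 obtain h' where h': "h' \<in> ES" "!!y. y \<in> A ==> r y = r x ==> h' y = ?h (inv' x \<cdot> y)"
  by (rule avg_translate[OF av x]) blast
 have fj: "f j \<in> ES" and hE: "?h \<in> ES" using j(1) av by (auto simp: avg_of_def)
 have FE: "F \<in> ES" "F' \<in> ES" "!!y. y \<in> A ==> r y = r x ==> F' y = F (inv' x \<cdot> y)" using F(1) by (auto simp: TP_def)
 let ?F = "\<lambda>y\<in>A. F y \<oplus>\<^bsub>V (d y)\<^esub> ?h y" and ?F' = "\<lambda>y\<in>A. F' y \<oplus>\<^bsub>V (d y)\<^esub> h' y"
 have "(?F, ?F') \<in> TP x"
  using ES_add[OF FE(1) hE] ES_add[OF FE(2) h'(1)] FE(3) h'(2) x by (auto simp: TP_def)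
 moreover have "ndist (V (d y)) (?F y) (complex_of_real (\<Sum>j\<in>insert j J. b j (q y)) \<odot>\<^bsub>V (d y)\<^esub> g y)
   \<le> (\<Sum>j\<in>insert j J. b j (q y) * ndist (V (d y)) (f j y) (g y))" if y: "y \<in> A" for y
 proof -
  interpret Vy: hilb "V (d y)" using V_hilb y by simp
  let ?s = "complex_of_real (\<Sum>j\<in>J. b j (q y))" and ?b = "complex_of_real (b j (q y))"
  have c: "F y \<in> carrier (V (d y))" "f j y \<in> carrier (V (d y))" "g y \<in> carrier (V (d y))"
   using ES_D(2) FE(1) fj g y by auto
  have "(?s + ?b) \<odot>\<^bsub>V (d y)\<^esub> g y = ?s \<odot>\<^bsub>V (d y)\<^esub> g y \<oplus>\<^bsub>V (d y)\<^esub> ?b \<odot>\<^bsub>V (d y)\<^esub> g y"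
   using Vy.smult_l_distr[of ?s ?b "g y"] c by simp
  moreover have "complex_of_real (\<Sum>j\<in>insert j J. b j (q y)) = ?s + ?b" using insert.hyps by simp
  ultimately have eq: "?F y \<ominus>\<^bsub>V (d y)\<^esub> complex_of_real (\<Sum>j\<in>insert j J. b j (q y)) \<odot>\<^bsub>V (d y)\<^esub> g y
   = (F y \<ominus>\<^bsub>V (d y)\<^esub> ?s \<odot>\<^bsub>V (d y)\<^esub> g y) \<oplus>\<^bsub>V (d y)\<^esub> ?b \<odot>\<^bsub>V (d y)\<^esub> (f j y \<ominus>\<^bsub>V (d y)\<^esub> g y)"
   using c y by (simp only: Vy.smult_minus_right) (simp add: a_minus_def Vy.M.minus_add Vy.M.a_ac del: of_real_sum)
  have "ndist (V (d y)) (?F y) (complex_of_real (\<Sum>j\<in>insert j J. b j (q y)) \<odot>\<^bsub>V (d y)\<^esub> g y)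
    \<le> ndist (V (d y)) (F y) (?s \<odot>\<^bsub>V (d y)\<^esub> g y)
    + vnorm (V (d y)) (?b \<odot>\<^bsub>V (d y)\<^esub> (f j y \<ominus>\<^bsub>V (d y)\<^esub> g y))"
   unfolding eq using c by (intro Vy.vnorm_triangle) auto
  also have "\<dots> \<le> (\<Sum>j\<in>J. b j (q y) * ndist (V (d y)) (f j y) (g y))
    + b j (q y) * ndist (V (d y)) (f j y) (g y)"
   using F(2)[OF y] j(3)[of "q y"] y c by (intro add_mono) (auto simp: Vy.vnorm_smult)
  finally show ?thesis using insert.hyps by simp
 qed
 ultimately show ?case by blast
qed

lemma nrm_bound:
 assumes f: "f \<in> ES" and u: "u \<in> U0" and L: "compactin CS L" and \<delta>: "0 \<le> \<delta>"
  and le: "!!y. y \<in> A ==> r y = u ==> vnorm (V (d y)) (f y) \<le> \<delta>"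
  and supp: "!!y. y \<in> A ==> r y = u ==> f y \<noteq> \<zero>\<^bsub>V (d y)\<^esub> ==> q y \<in> L"
 shows "nrm u f \<le> \<delta> * sqrt (measure (\<mu> u) L)"
proof -
 interpret radon CS "\<mu> u" by (rule radon_mu[OF u])
 have Ls: "L \<in> sets (\<mu> u)" "emeasure (\<mu> u) L < \<infinity>" using compactin_sets[OF L] compactin_finite[OF L] by auto
 have "cmod (F0_ip G \<mu> \<sigma> f f u) \<le> (LINT C|\<mu> u. \<delta>\<^sup>2 * indicator L C)"
  unfolding F0_ip_eq
 proof (rule integral_bound_support)
  fix C assume "C \<in> measure_support CS (\<mu> u)"
  then obtain y where y: "y \<in> A" "r y = u" "C = q y" using support_mu[OF u] by auto
  interpret Vy: hilb "V (d y)" using V_hilb y by simp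
  have "cmod (descend (ipf f f) C) = (vnorm (V (d y)) (f y))\<^sup>2"
   using y ES_D(2)[OF f y(1)] by (simp add: descend_q[OF coset_invariant_ipf[OF f f]] ipf_def Vy.ip_self norm_power flip: of_real_power)
  also have "\<dots> \<le> \<delta>\<^sup>2 * indicator L C"
  proof (cases "C \<in> L")
   case True
   then show ?thesis using le[OF y(1,2)] Vy.vnorm_nonneg[OF ES_D(2)[OF f y(1)]] by (simp add: power_mono)
  next
   case False
   then have "f y = \<zero>\<^bsub>V (d y)\<^esub>" using supp[OF y(1,2)] y(3) by blast
   then show ?thesis using False by (simp add: Vy.vnorm_zero)
  qed
  finally show "cmod (descend (ipf f f) C) \<le> \<delta>\<^sup>2 * indicator L C" .
 qed (use descend_ipf_integrable[OF f f u] Ls in auto)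
 also have "\<dots> = \<delta>\<^sup>2 * measure (\<mu> u) L" using Ls by simp
 finally have "Re (F0_ip G \<mu> \<sigma> f f u) \<le> \<delta>\<^sup>2 * measure (\<mu> u) L" using complex_Re_le_cmod order_trans by blast
 then have "sqrt (Re (F0_ip G \<mu> \<sigma> f f u)) \<le> sqrt (\<delta>\<^sup>2 * measure (\<mu> u) L)" by (rule real_sqrt_le_mono)
 then show ?thesis using \<delta> by (simp add: vnorm_def real_sqrt_mult)
qed

text \<open>Translatable sections are dense: near each point of the support of \<open>g\<close> some averaged section is
 close to \<open>g\<close>, and these are glued with a partition of unity on the coset space.\<close>

lemma TP_dense:
 assumes x: "x \<in> A" and g: "g \<in> ES" and u: "u \<in> U0" and e: "e > 0"
 shows "\<exists>F F'. (F, F') \<in> TP x \<and> nrm u (F \<ominus>\<^bsub>F0\<^esub> g) < e"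
proof -
 obtain K where K: "compactin CS K" "!!x. x \<in> A ==> g x \<noteq> \<zero>\<^bsub>V (d x)\<^esub> ==> q x \<in> K" by (rule ES_compact[OF g]) blast
 obtain W L where W: "openin CS W" "compactin CS L" "K \<subseteq> W" "W \<subseteq> L" using CS.compact_nbhd[OF K(1)] by blast
 define \<delta> where "\<delta> = e / (sqrt (measure (\<mu> u) L) + 1)"
 have \<delta>: "\<delta> > 0" using e by (simp add: \<delta>_def add_nonneg_pos)
 have KA: "K \<subseteq> q ` A" using compactin_subset_topspace[OF K(1)] by simp
 have "\<forall>C\<in>K. \<exists>p. avg_of (fst p) (fst (snd p)) (snd (snd p)) \<and> (\<exists>N. openin CS N \<and> C \<in> N \<and>
   (\<forall>y\<in>A. q y \<in> N --> ndist (V (d y)) (snd (snd p) y) (g y) < \<delta>))"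
 proof
  fix C assume "C \<in> K"
  then obtain y where y: "y \<in> A" "C = q y" using KA by blast
  obtain a \<xi> f where f: "avg_of a \<xi> f" "ndist (V (d y)) (f y) (g y) < \<delta>"
   using avg_enough[OF y(1) ES_D(2)[OF g y(1)] \<delta>] by blast
  then have fE: "f \<in> ES" by (simp add: avg_of_def)
  have "continuous_map (gtop G) euclideanreal (\<lambda>y. ndist (V (d y)) (f y) (g y))"
   by (intro cont_field_norm cont_field_diff ES_D(3) fE g)
  from continuous_map_less_nbhd[OF this y(1) f(2)]
  obtain N where N: "openin (gtop G) N" "y \<in> N" "!!z. z \<in> N ==> ndist (V (d z)) (f z) (g z) < \<delta>" by blast
  have "ndist (V (d z)) (f z) (g z) < \<delta>" if z: "z \<in> A" "q z \<in> q ` N" for z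
  proof -
   obtain w where w: "w \<in> N" "q z = q w" using z by blast
   have wA: "w \<in> A" using w openin_subset[OF N(1)] by auto
   have "f \<ominus>\<^bsub>F0\<^esub> g \<in> ES" by (rule ES_closed(2)[OF fE g])
   from ES_vnorm_coset[OF this z(1) wA w(2)] show ?thesis
    using N(3)[OF w(1)] F0_minus[OF fE g z(1)] F0_minus[OF fE g wA] by simp
  qed
  then show "\<exists>p. avg_of (fst p) (fst (snd p)) (snd (snd p)) \<and> (\<exists>N. openin CS N \<and> C \<in> N \<and>
   (\<forall>y\<in>A. q y \<in> N --> ndist (V (d y)) (snd (snd p) y) (g y) < \<delta>))"
   using f(1) open_q[OF N(1)] N(2) y(2) by (intro exI[of _ "(a, \<xi>, f)"]) auto
 qed
 from bchoice[OF this] obtain p where "\<forall>C\<in>K. avg_of (fst (p C)) (fst (snd (p C))) (snd (snd (p C))) \<and> (\<exists>N. openin CS N \<and> C \<in> N \<and>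
   (\<forall>y\<in>A. q y \<in> N --> ndist (V (d y)) (snd (snd (p C)) y) (g y) < \<delta>))" by blast
 then have p: "!!C. C \<in> K ==> avg_of (fst (p C)) (fst (snd (p C))) (snd (snd (p C)))"
  and "\<forall>C\<in>K. \<exists>N. openin CS N \<and> C \<in> N \<and> (\<forall>y\<in>A. q y \<in> N --> ndist (V (d y)) (snd (snd (p C)) y) (g y) < \<delta>)" by auto
 from bchoice[OF this(2)] obtain O' where "\<forall>C\<in>K. openin CS (O' C) \<and> C \<in> O' C \<and>
   (\<forall>y\<in>A. q y \<in> O' C --> ndist (V (d y)) (snd (snd (p C)) y) (g y) < \<delta>)" by blast
 then have O: "!!C. C \<in> K ==> openin CS (O' C) \<and> C \<in> O' C"
  "!!C y. C \<in> K ==> y \<in> A ==> q y \<in> O' C ==> ndist (V (d y)) (snd (snd (p C)) y) (g y) < \<delta>" by auto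
 obtain J b where b: "finite J" "J \<subseteq> K" "!!j. j \<in> J ==> continuous_map CS euclideanreal (b j)"
  "!!j x. j \<in> J ==> x \<in> topspace CS ==> 0 \<le> b j x"
  "!!j x. j \<in> J ==> x \<in> topspace CS ==> b j x \<noteq> 0 ==> x \<in> O' j \<and> x \<in> W"
  "!!x. x \<in> topspace CS ==> (\<Sum>j\<in>J. b j x) \<le> 1" "!!x. x \<in> K ==> (\<Sum>j\<in>J. b j x) = (1::real)"
  by (rule CS.partition_of_unity[OF K(1) W(1,3) O(1)]) blast+
 obtain F F' where F: "(F, F') \<in> TP x" "!!y. y \<in> A ==> ndist (V (d y)) (F y) (complex_of_real (\<Sum>j\<in>J. b j (q y)) \<odot>\<^bsub>V (d y)\<^esub> g y)
   \<le> (\<Sum>j\<in>J. b j (q y) * ndist (V (d y)) (snd (snd (p j)) y) (g y))"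
  using TP_sum[OF x g b(1), of "\<lambda>j. fst (p j)" "\<lambda>j. fst (snd (p j))" "\<lambda>j. snd (snd (p j))" b] p b(2,3,4) by blast
 have FE: "F \<in> ES" using F(1) by (simp add: TP_def)
 have est: "ndist (V (d y)) (F y) (g y) \<le> \<delta> * (\<Sum>j\<in>J. b j (q y))" if y: "y \<in> A" for y
 proof -
  interpret Vy: hilb "V (d y)" using V_hilb y by simp
  have qy: "q y \<in> topspace CS" using y by simp
  have "complex_of_real (\<Sum>j\<in>J. b j (q y)) \<odot>\<^bsub>V (d y)\<^esub> g y = g y"
  proof (cases "g y = \<zero>\<^bsub>V (d y)\<^esub>")
   case False
   then show ?thesis using b(7)[OF K(2)[OF y False]] Vy.smult_one[of "g y"] ES_D(2)[OF g y] by simp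
  qed simp
  then have "ndist (V (d y)) (F y) (g y) \<le> (\<Sum>j\<in>J. b j (q y) * ndist (V (d y)) (snd (snd (p j)) y) (g y))"
   using F(2)[OF y] by (simp del: of_real_sum)
  also have "\<dots> \<le> (\<Sum>j\<in>J. b j (q y) * \<delta>)"
  proof (rule sum_mono)
   fix j assume j: "j \<in> J"
   then have jK: "j \<in> K" using b(2) by blast
   show "b j (q y) * ndist (V (d y)) (snd (snd (p j)) y) (g y) \<le> b j (q y) * \<delta>"
   proof (cases "b j (q y) = 0")
    case False
    then have "q y \<in> O' j" using b(5)[OF j qy] by blast
    from O(2)[OF jK y this] show ?thesis using b(4)[OF j qy] by (intro mult_left_mono) auto
   qed simp
  qed
  finally show ?thesis by (simp add: sum_distrib_left mult.commute)
 qed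
 have FgE: "F \<ominus>\<^bsub>F0\<^esub> g \<in> ES" by (rule ES_closed(2)[OF FE g])
 have "nrm u (F \<ominus>\<^bsub>F0\<^esub> g) \<le> \<delta> * sqrt (measure (\<mu> u) L)"
 proof (rule nrm_bound[OF FgE u W(2)])
  fix y assume y: "y \<in> A"
  interpret Vy: hilb "V (d y)" using V_hilb y by simp
  have eq: "(F \<ominus>\<^bsub>F0\<^esub> g) y = F y \<ominus>\<^bsub>V (d y)\<^esub> g y" by (rule F0_minus[OF FE g y])
  have "\<delta> * (\<Sum>j\<in>J. b j (q y)) \<le> \<delta> * 1" using b(6)[of "q y"] y \<delta> by (intro mult_left_mono) auto
  then show "vnorm (V (d y)) ((F \<ominus>\<^bsub>F0\<^esub> g) y) \<le> \<delta>" using est[OF y] eq by simp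
  assume ne: "(F \<ominus>\<^bsub>F0\<^esub> g) y \<noteq> \<zero>\<^bsub>V (d y)\<^esub>"
  have "(\<Sum>j\<in>J. b j (q y)) \<noteq> 0"
  proof
   assume z: "(\<Sum>j\<in>J. b j (q y)) = 0"
   have c: "F y \<ominus>\<^bsub>V (d y)\<^esub> g y \<in> carrier (V (d y))" using ES_D(2)[OF FE y] ES_D(2)[OF g y] by simp
   then have "ndist (V (d y)) (F y) (g y) = 0" using est[OF y] z Vy.vnorm_nonneg[OF c] by simp
   then show False using Vy.vnorm_eq_0D[OF c] ne eq by simp
  qed
  then obtain j where "j \<in> J" "b j (q y) \<noteq> 0" by (meson sum.neutral)
  then show "q y \<in> L" using b(5)[of j "q y"] y W(4) by auto
 qed (use \<delta> in simp)
 also have "\<dots> < e"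
 proof -
  have "0 < 1 + sqrt (measure (\<mu> u) L)" by (simp add: add_pos_nonneg)
  then show ?thesis using e by (simp add: \<delta>_def divide_less_eq algebra_simps)
 qed
 finally show ?thesis using F(1) by blast
qed

lemma clf_TP_dense:
 assumes x: "x \<in> A" and u: "u \<in> U0" and P: "P \<in> carrier (FF u)" and e: "e > 0"
 shows "\<exists>f g. (f, g) \<in> TP x \<and> ndist (FF u) (clf f u) P < e"
proof -
 interpret Fu: hilb "FF u" by (rule hilb_FF[OF u])
 obtain h where h: "h \<in> ES" "ndist (FF u) (clf h u) P < e / 2" using clf_dense[OF u P, of "e / 2"] e by auto
 obtain f g where f: "(f, g) \<in> TP x" "nrm u (f \<ominus>\<^bsub>F0\<^esub> h) < e / 2" using TP_dense[OF x h(1) u, of "e / 2"] e by auto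
 then have fE: "f \<in> ES" by (simp add: TP_def)
 have "ndist (FF u) (clf f u) P < e"
  using Fu.vnorm_diff_triangle[OF clf_carrier[OF u fE] clf_carrier[OF u h(1)] P] clf_norm_diff[OF u fE h(1)] f(2) h(2) by linarith
 then show ?thesis using f(1) by blast
qed

lemma TP_inv: assumes x: "x \<in> A" and fg: "(f, g) \<in> TP (inv' x)" shows "(g, f) \<in> TP x"
proof -
 have "f y = g (inv' x \<cdot> y)" if y: "y \<in> A" "r y = r x" for y
  using fg x y cancel2[of x y] by (simp add: TP_def)
 then show ?thesis using fg by (auto simp: TP_def)
qed

text \<open>Translation is isometric because the system of measures on the coset space is equivariant.\<close>

lemma TP_isometric:
 assumes x: "x \<in> A" and f: "(f, f') \<in> TP x" and g: "(g, g') \<in> TP x"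
 shows "F0_ip G \<mu> \<sigma> f' g' (r x) = F0_ip G \<mu> \<sigma> f g (d x)"
proof -
 have E: "f \<in> ES" "f' \<in> ES" "g \<in> ES" "g' \<in> ES"
  and eq: "!!y. y \<in> A ==> r y = r x ==> f' y = f (inv' x \<cdot> y) \<and> g' y = g (inv' x \<cdot> y)" using f g by (auto simp: TP_def)
 have u: "d x \<in> U0" using x by simp
 interpret radon CS "\<mu> (d x)" by (rule radon_mu[OF u])
 let ?S = "coset_fibre G H (d x)"
 let ?\<phi> = "descend (ipf f' g')" and ?\<psi> = "descend (ipf f g)"
 have pt: "?\<phi> (gmul G x ` C) = ?\<psi> C" if C: "C \<in> ?S" for C
 proof -
  obtain z where z: "z \<in> A" "r z = d x" "C = q z" using C by (auto simp: coset_fibre_eq)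
  have xz: "x \<cdot> z \<in> A" using x z by simp
  show ?thesis
   using z x xz eq[of "x \<cdot> z"] cancel(1)[of x z]
   by (simp add: left_mul_coset descend_q[OF coset_invariant_ipf[OF E(2,4)] xz]
     descend_q[OF coset_invariant_ipf[OF E(1,3)] z(1)]) (simp add: ipf_def)
 qed
 have S: "?S = {C \<in> topspace CS. coset_rng G C \<in> {d x}}" by (auto simp: coset_fibre_def)
 have "closedin CS ?S"
  unfolding S by (rule closedin_continuous_map_preimage[OF continuous_coset_rng closedin_Hausdorff_singleton[OF Hausdorff_unit_top]]) (use x in simp)
 then have Sm: "?S \<in> sets (\<mu> (d x))" by (rule closedin_sets)
 have "F0_ip G \<mu> \<sigma> f' g' (r x) = (LINT C:?S|\<mu> (d x). ?\<phi> (gmul G x ` C))"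
  using mu_invariant[OF descend_ipf_Cc[OF E(2,4)] x] by (simp add: F0_ip_eq coset_fibre_eq)
 also have "\<dots> = (LINT C|\<mu> (d x). indicator ?S C *\<^sub>R ?\<psi> C)"
  unfolding set_lebesgue_integral_def using pt by (intro Bochner_Integration.integral_cong) (auto simp: indicator_def)
 also have "\<dots> = (LINT C|\<mu> (d x). ?\<psi> C)"
 proof (rule integral_cong_support)
  show "?\<psi> \<in> borel_measurable (\<mu> (d x))" using descend_ipf_integrable[OF E(1,3) u] by auto
  then show "(\<lambda>C. indicator ?S C *\<^sub>R ?\<psi> C) \<in> borel_measurable (\<mu> (d x))" using Sm by measurable
 qed (auto simp: support_mu[OF u] coset_fibre_eq)
 finally show ?thesis by (simp add: F0_ip_eq)
qed

text \<open>Hence translation extends by continuity to a unitary operator between the fibres.\<close>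

lemma ind_act:
 assumes x: "x \<in> A"
 shows "unitary_map (FF (d x)) (FF (r x)) (ind_act G H \<mu> \<sigma> x)"
  and "(f, g) \<in> TP x ==> ind_act G H \<mu> \<sigma> x (clf f (d x)) = clf g (r x)"
proof -
 have u: "d x \<in> U0" "r x \<in> U0" using x by auto
 interpret Fd: hilb "FF (d x)" by (rule hilb_FF[OF u(1)])
 interpret Fr: hilb "FF (r x)" by (rule hilb_FF[OF u(2)])
 obtain T where T: "unitary_map (FF (d x)) (FF (r x)) T" "!!p. p \<in> TP x ==> T (clf (fst p) (d x)) = clf (snd p) (r x)"
 proof (rule unitary_extension[of "FF (d x)" "FF (r x)" "TP x" "\<lambda>p. clf (fst p) (d x)" "\<lambda>p. clf (snd p) (r x)"])
  show "hilb (FF (d x))" "hilb (FF (r x))" by unfold_locales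
  show "clf (fst p) (d x) \<in> carrier (FF (d x))" "clf (snd p) (r x) \<in> carrier (FF (r x))" if "p \<in> TP x" for p
   using that u clf_carrier by (auto simp: TP_def)
  show "ip (FF (r x)) (clf (snd p) (r x)) (clf (snd p') (r x)) = ip (FF (d x)) (clf (fst p) (d x)) (clf (fst p') (d x))"
   if "p \<in> TP x" "p' \<in> TP x" for p p'
   using that TP_isometric[OF x, of "fst p" "snd p" "fst p'" "snd p'"] u by (auto simp: clf_ip TP_def)
  show "\<exists>p\<in>TP x. ndist (FF (d x)) (clf (fst p) (d x)) P < e"
   if P: "P \<in> carrier (FF (d x))" "e > 0" for P e
  proof -
   obtain f g where "(f, g) \<in> TP x" "ndist (FF (d x)) (clf f (d x)) P < e"
    using clf_TP_dense[OF x u(1) P] by blast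
   then show ?thesis by (intro bexI[of _ "(f, g)"]) auto
  qed
  show "\<exists>p\<in>TP x. ndist (FF (r x)) (clf (snd p) (r x)) P < e"
   if P: "P \<in> carrier (FF (r x))" "e > 0" for P e
  proof -
   obtain f g where "(f, g) \<in> TP (inv' x)" "ndist (FF (r x)) (clf f (r x)) P < e"
    using clf_TP_dense[OF inv_closed[OF x] u(2) P] by blast
   then show ?thesis using TP_inv[OF x] by (intro bexI[of _ "(g, f)"]) auto
  qed
 qed blast
 have conv: "Q = T P"
  if P: "P \<in> carrier (FF (d x))" and Q: "Q \<in> carrier (FF (r x))" and p: "!!n. p n \<in> TP x"
   and l: "(\<lambda>n. ndist (FF (d x)) (clf (fst (p n)) (d x)) P) \<longlonglongrightarrow> 0"
   and l': "(\<lambda>n. ndist (FF (r x)) (clf (snd (p n)) (r x)) Q) \<longlonglongrightarrow> 0" for P Q p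
 proof (rule Fr.limit_unique[OF _ Q unitary_mapD(1)[OF T(1) P] l'])
  show "clf (snd (p n)) (r x) \<in> carrier (FF (r x))" for n using p[of n] u clf_carrier by (auto simp: TP_def)
  have "ndist (FF (r x)) (clf (snd (p n)) (r x)) (T P) = ndist (FF (d x)) (clf (fst (p n)) (d x)) P" for n
   using unitary_map_vnorm_diff[OF Fd.semi_inner_axioms Fr.semi_inner_axioms T(1) _ P, of "clf (fst (p n)) (d x)"]
    T(2)[OF p[of n]] p[of n] clf_carrier[OF u(1)] by (auto simp: TP_def)
  then show "(\<lambda>n. ndist (FF (r x)) (clf (snd (p n)) (r x)) (T P)) \<longlonglongrightarrow> 0" using l by simp
 qed
 have TPI: "(\<lambda>n. (f n, g n)) n \<in> TP x"
  if "\<forall>n. f n \<in> ES \<and> g n \<in> ES \<and> (\<forall>y\<in>range_fibre G (r x). g n y = f n (inv' x \<cdot> y))" for f g and n :: nat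
  using that by (auto simp: TP_def range_fibre_def)
 have eq: "ind_act G H \<mu> \<sigma> x P = T P" if P: "P \<in> carrier (FF (d x))" for P
  unfolding ind_act_def Let_def
 proof (rule the_equality)
  have "\<forall>n. \<exists>p. p \<in> TP x \<and> ndist (FF (d x)) (clf (fst p) (d x)) P < inverse (real (Suc n))"
  proof
   fix n
   have "0 < inverse (real (Suc n))" by simp
   from clf_TP_dense[OF x u(1) P this] obtain f g
    where "(f, g) \<in> TP x" "ndist (FF (d x)) (clf f (d x)) P < inverse (real (Suc n))" by blast
   then show "\<exists>p. p \<in> TP x \<and> ndist (FF (d x)) (clf (fst p) (d x)) P < inverse (real (Suc n))"
    by (intro exI[of _ "(f, g)"]) auto
  qed
  from choice[OF this] obtain p where p: "!!n. p n \<in> TP x"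
   "!!n. ndist (FF (d x)) (clf (fst (p n)) (d x)) P < inverse (real (Suc n))" by blast
  have c: "clf (fst (p n)) (d x) \<in> carrier (FF (d x))" for n using p(1)[of n] u clf_carrier by (auto simp: TP_def)
  have l: "(\<lambda>n. ndist (FF (d x)) (clf (fst (p n)) (d x)) P) \<longlonglongrightarrow> 0"
   by (rule Lim_null_comparison[OF always_eventually LIMSEQ_inverse_real_of_nat])
    (use p(2) Fd.vnorm_nonneg c P in \<open>auto intro!: less_imp_le\<close>)
  have "ndist (FF (r x)) (clf (snd (p n)) (r x)) (T P) = ndist (FF (d x)) (clf (fst (p n)) (d x)) P" for n
   using unitary_map_vnorm_diff[OF Fd.semi_inner_axioms Fr.semi_inner_axioms T(1) c[of n] P] T(2)[OF p(1)[of n]] by simp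
  then have l': "(\<lambda>n. ndist (FF (r x)) (clf (snd (p n)) (r x)) (T P)) \<longlonglongrightarrow> 0" using l by simp
  have "\<forall>n. fst (p n) \<in> ES \<and> snd (p n) \<in> ES \<and> (\<forall>y\<in>range_fibre G (r x). snd (p n) y = fst (p n) (inv' x \<cdot> y))"
   using p(1) by (auto simp: TP_def range_fibre_def split_beta)
  with l l' show "T P \<in> carrier (FF (r x)) \<and> (\<exists>f g. (\<forall>n. f n \<in> ES \<and> g n \<in> ES \<and> (\<forall>y\<in>range_fibre G (r x). g n y = f n (inv' x \<cdot> y))) \<and>
    (\<lambda>n. ndist (FF (d x)) (clf (f n) (d x)) P) \<longlonglongrightarrow> 0 \<and>
    (\<lambda>n. ndist (FF (r x)) (clf (g n) (r x)) (T P)) \<longlonglongrightarrow> 0)"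
   by (intro conjI unitary_mapD(1)[OF T(1) P] exI[of _ "\<lambda>n. fst (p n)"] exI[of _ "\<lambda>n. snd (p n)"])
 next
  fix Q assume "Q \<in> carrier (FF (r x)) \<and> (\<exists>f g. (\<forall>n. f n \<in> ES \<and> g n \<in> ES \<and> (\<forall>y\<in>range_fibre G (r x). g n y = f n (inv' x \<cdot> y))) \<and>
    (\<lambda>n. ndist (FF (d x)) (clf (f n) (d x)) P) \<longlonglongrightarrow> 0 \<and>
    (\<lambda>n. ndist (FF (r x)) (clf (g n) (r x)) Q) \<longlonglongrightarrow> 0)"
  then obtain f g where fg: "Q \<in> carrier (FF (r x))"
    "\<forall>n. f n \<in> ES \<and> g n \<in> ES \<and> (\<forall>y\<in>range_fibre G (r x). g n y = f n (inv' x \<cdot> y))"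
    "(\<lambda>n. ndist (FF (d x)) (clf (f n) (d x)) P) \<longlonglongrightarrow> 0"
    "(\<lambda>n. ndist (FF (r x)) (clf (g n) (r x)) Q) \<longlonglongrightarrow> 0" by blast
  show "Q = T P" by (rule conv[OF P fg(1) TPI[OF fg(2)]]) (use fg(3,4) in auto)
 qed
 show "unitary_map (FF (d x)) (FF (r x)) (ind_act G H \<mu> \<sigma> x)"
  by (rule unitary_map_cong[OF T(1) Fd.abelian_monoid_axioms _ eq]) auto
 show "(f, g) \<in> TP x ==> ind_act G H \<mu> \<sigma> x (clf f (d x)) = clf g (r x)"
  using eq[OF clf_carrier[OF u(1), of f]] T(2)[of "(f, g)"] by (simp add: TP_def)
qed

text \<open>The classes of the sections in \<open>D\<close> and their images in \<open>F\<close> have the same Gram matrices, which gives a unitary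
 at every unit. That it intertwines has to be verified on a dense set only, hence it suffices that those
 translatable pairs that lie in \<open>D\<close> are dense.\<close>

lemma equivalent_ind_repI:
 assumes F: "hilbert_bundle (unit_top G) F"
  and D: "D \<subseteq> ES" "!!x u P e. x \<in> A ==> u \<in> U0 ==> P \<in> carrier (FF u) ==> e > 0 ==>
   \<exists>f\<in>D. \<exists>g\<in>D. (f, g) \<in> TP x \<and> ndist (FF u) (clf f u) P < e"
  and sec: "!!f. f \<in> D ==> (\<lambda>u\<in>topspace (unit_top G). \<Theta> f u) \<in> gam F"
  and ip: "!!u f g. u \<in> U0 ==> f \<in> D ==> g \<in> D ==> ip (fib F u) (\<Theta> f u) (\<Theta> g u) = F0_ip G \<mu> \<sigma> f g u"
  and dense: "!!u v e. u \<in> U0 ==> v \<in> carrier (fib F u) ==> e > 0 ==> \<exists>f\<in>D. ndist (fib F u) (\<Theta> f u) v < e"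
  and un: "!!x. x \<in> A ==> unitary_map (fib F (d x)) (fib F (r x)) (\<rho> x)"
  and tr: "!!x f g. x \<in> A ==> f \<in> D ==> g \<in> D ==> (f, g) \<in> TP x ==> \<rho> x (\<Theta> f (d x)) = \<Theta> g (r x)"
 shows "equivalent_reps G (ind_rep G H \<mu> \<sigma>) \<lparr>bnd = F, act = \<rho>\<rparr>"
proof -
 interpret F: hbun "unit_top G" F using F by unfold_locales
 have Fh: "hilb (fib F u)" if "u \<in> U0" for u using F.hilb_fib that by simp
 have Tc: "\<Theta> f u \<in> carrier (fib F u)" if "f \<in> D" "u \<in> U0" for f u
  using F.gam_carrier[OF sec[OF that(1)], of u] that by simp
 have Dd: "\<exists>f\<in>D. ndist (FF u) (clf f u) P < e" if "u \<in> U0" "P \<in> carrier (FF u)" "e > 0" for u P e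
  using D(2)[OF unitE(1)[OF that(1)] that] by blast
 have "\<forall>u\<in>U0. \<exists>T. unitary_map (FF u) (fib F u) T \<and> (\<forall>f\<in>D. T (clf f u) = \<Theta> f u)"
 proof
  fix u assume u: "u \<in> U0"
  have ipD: "ip (FF u) (clf f u) (clf g u) = F0_ip G \<mu> \<sigma> f g u" if "f \<in> D" "g \<in> D" for f g
   using clf_ip[OF u] that D(1) by blast
  show "\<exists>T. unitary_map (FF u) (fib F u) T \<and> (\<forall>f\<in>D. T (clf f u) = \<Theta> f u)"
   by (rule unitary_extension[of "FF u" "fib F u" D "\<lambda>f. clf f u" "\<lambda>f. \<Theta> f u"])
    (use hilb_FF Fh u clf_carrier Tc ipD ip Dd dense D(1) in auto)
 qed
 from bchoice[OF this] obtain T where T: "!!u. u \<in> U0 ==> unitary_map (FF u) (fib F u) (T u)"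
  "!!u f. u \<in> U0 ==> f \<in> D ==> T u (clf f u) = \<Theta> f u" by blast
 have "bundle_morphism (unit_top G) IB F T"
 proof (rule unitary_bundle_morphism[OF hilbert_bundle_IB F, where \<Lambda> = "(\<lambda>f. \<lambda>u\<in>topspace (unit_top G). clf f u) ` D"])
  show "\<exists>\<xi>\<in>(\<lambda>f. \<lambda>u\<in>topspace (unit_top G). clf f u) ` D. ndist (fib IB u) h (\<xi> u) < e"
   if u: "u \<in> topspace (unit_top G)" and h: "h \<in> carrier (fib IB u)" and e: "e > 0" for u h e
  proof -
   interpret Fu: hilb "FF u" using hilb_FF u by simp
   obtain f where "f \<in> D" "ndist (FF u) (clf f u) h < e" using Dd[of u h e] u h e by auto
   then show ?thesis using Fu.vnorm_diff_commute[of h "clf f u"] h clf_carrier[of u f] D(1) u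
    by (intro bexI[OF _ imageI[of f]]) auto
  qed
  show "(\<lambda>u\<in>topspace (unit_top G). T u (\<xi> u)) \<in> gam F"
   if xi: "\<xi> \<in> (\<lambda>f. \<lambda>u\<in>topspace (unit_top G). clf f u) ` D" for \<xi>
  proof -
   obtain f where f: "f \<in> D" "\<xi> = (\<lambda>u\<in>topspace (unit_top G). clf f u)" using xi by blast
   have "(\<lambda>u\<in>topspace (unit_top G). T u (\<xi> u)) = (\<lambda>u\<in>topspace (unit_top G). \<Theta> f u)"
    by (rule restrict_ext) (use f T(2) in simp)
   then show ?thesis using sec[OF f(1)] by simp
  qed
 qed (use T clf_gam D(1) in auto)
 moreover have "T (r x) (ind_act G H \<mu> \<sigma> x P) = \<rho> x (T (d x) P)" if x: "x \<in> A" and P: "P \<in> carrier (FF (d x))" for x P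
 proof -
  have u: "d x \<in> U0" "r x \<in> U0" using x by auto
  interpret Fr: hilb "fib F (r x)" by (rule Fh[OF u(2)])
  note S = ind_act[OF x]
  let ?B = "T (r x) (ind_act G H \<mu> \<sigma> x P)" and ?C = "\<rho> x (T (d x) P)"
  have c: "?B \<in> carrier (fib F (r x))" "?C \<in> carrier (fib F (r x))"
   using P unitary_mapD(1) T(1)[OF u(1)] T(1)[OF u(2)] S(1) un[OF x] by metis+
  have "ndist (fib F (r x)) ?B ?C \<le> 0"
  proof (rule field_le_epsilon)
   fix e :: real assume e: "e > 0"
   obtain f g where E: "f \<in> D" "g \<in> D" and fg: "(f, g) \<in> TP x" "ndist (FF (d x)) (clf f (d x)) P < e / 2"
    using D(2)[OF x u(1) P, of "e / 2"] e by auto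
   have fc: "clf f (d x) \<in> carrier (FF (d x))" "clf g (r x) \<in> carrier (FF (r x))"
    using clf_carrier[OF u(1)] clf_carrier[OF u(2)] E D(1) by auto
   note sm = hilb.axioms(1)[OF hilb_FF] hilb.axioms(1)[OF Fh]
   have "ndist (fib F (r x)) (\<Theta> g (r x)) ?B = ndist (FF (d x)) (clf f (d x)) P"
    using unitary_map_vnorm_diff[OF sm(1)[OF u(2)] sm(2)[OF u(2)] T(1)[OF u(2)] fc(2) unitary_mapD(1)[OF S(1) P]]
     unitary_map_vnorm_diff[OF sm(1)[OF u(1)] sm(1)[OF u(2)] S(1) fc(1) P] S(2)[OF fg(1)] T(2)[OF u(2) E(2)] by simp
   moreover have "ndist (fib F (r x)) (\<Theta> g (r x)) ?C = ndist (FF (d x)) (clf f (d x)) P"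
    using unitary_map_vnorm_diff[OF sm(2)[OF u(1)] sm(2)[OF u(2)] un[OF x] Tc[OF E(1) u(1)] unitary_mapD(1)[OF T(1)[OF u(1)] P]]
     unitary_map_vnorm_diff[OF sm(1)[OF u(1)] sm(2)[OF u(1)] T(1)[OF u(1)] fc(1) P] tr[OF x E fg(1)] T(2)[OF u(1) E(1)] by simp
   ultimately show "ndist (fib F (r x)) ?B ?C \<le> 0 + e"
    using Fr.vnorm_diff_triangle[OF c(1) Tc[OF E(2) u(2)] c(2)] Fr.vnorm_diff_commute[OF c(1) Tc[OF E(2) u(2)]] fg(2) by linarith
  qed
  then show ?thesis using c Fr.vnorm_nonneg[of "?B \<ominus>\<^bsub>fib F (r x)\<^esub> ?C"] by (intro Fr.eq_of_vnorm_diff) auto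
 qed
 ultimately have "T \<in> Mor G (ind_rep G H \<mu> \<sigma>) \<lparr>bnd = F, act = \<rho>\<rparr>" by (simp add: Mor_def ind_rep_def)
 then show ?thesis unfolding equivalent_reps_def by (intro bexI[of _ T]) (use T(1) in \<open>simp_all add: ind_rep_def\<close>)
qed

end

section \<open>Induction preserves equivalence\<close>

context hrep
begin

text \<open>An intertwiner of representations of \<open>H\<close> acts on equivariant sections pointwise; applied to its inverse
 as well this identifies the two spaces of equivariant sections.\<close>

lemma intertwiner_ES:
 assumes \<sigma>': "hrep G H lamH \<mu> \<sigma>'" and T: "bundle_morphism (unit_top G) (bnd \<sigma>) (bnd \<sigma>') T"
  and un: "!!u. u \<in> U0 ==> unitary_map (V u) (fib (bnd \<sigma>') u) (T u)"
  and tw: "!!h v. h \<in> H ==> v \<in> carrier (V (d h)) ==> T (r h) (act \<sigma> h v) = act \<sigma>' h (T (d h) v)"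
  and f: "f \<in> ES"
 shows "(\<lambda>x\<in>A. T (d x) (f x)) \<in> equivariant_sections G H \<sigma>'"
proof -
 interpret S': hrep G H lamH \<mu> \<sigma>' by (rule \<sigma>')
 obtain K where K: "compactin CS K" "!!x. x \<in> A ==> f x \<noteq> \<zero>\<^bsub>V (d x)\<^esub> ==> q x \<in> K" by (rule ES_compact[OF f]) blast
 show ?thesis
 proof (rule S'.ES_I[OF bundle_morphism_cont_field[OF hbun S'.hbun T ES_D(3)[OF f]] _ K(1)])
  fix x h assume xh: "x \<in> A" "h \<in> H" "d x = r h"
  then show "T (d (x \<cdot> h)) (f (x \<cdot> h)) = act \<sigma>' (inv' h) (T (d x) (f x))"
   using tw[OF H_inv[OF xh(2)], of "f x"] ES_D(4)[OF f xh] ES_D(2)[OF f xh(1)] H_sub[OF xh(2)] by simp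
 next
  fix x assume x: "x \<in> A" "T (d x) (f x) \<noteq> \<zero>\<^bsub>fib (bnd \<sigma>') (d x)\<^esub>"
  then show "q x \<in> K"
   using K(2)[OF x(1)] unitary_map_zero[OF V_hilb S'.V_hilb un, of "d x" "f x"] ES_D(2)[OF f x(1)] by auto
 qed
qed

end

context hrep_ne
begin

lemma equivalent_ind_rep:
 assumes \<sigma>': "hrep G H lamH \<mu> \<sigma>'" and eq: "equivalent_reps HG \<sigma> \<sigma>'"
 shows "equivalent_reps G (ind_rep G H \<mu> \<sigma>) (ind_rep G H \<mu> \<sigma>')"
proof -
 interpret S': hrep_ne G H lamH \<mu> \<sigma>' using \<sigma>' ne by (simp add: hrep_ne_def hrep_ne_axioms_def)
 obtain T where T: "bundle_morphism (unit_top G) (bnd \<sigma>) (bnd \<sigma>') T"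
  "!!u. u \<in> U0 ==> unitary_map (V u) (S'.V u) (T u)"
  "!!h v. h \<in> H ==> v \<in> carrier (V (d h)) ==> T (r h) (act \<sigma> h v) = act \<sigma>' h (T (d h) v)"
  using eq by (auto simp: equivalent_reps_def Mor_def)
 define R where "R u = inv_into (carrier (V u)) (T u)" for u
 have bij: "bij_betw (T u) (carrier (V u)) (carrier (S'.V u))" if "u \<in> U0" for u using unitary_mapD(6)[OF T(2)[OF that]] .
 have RT: "R u (T u v) = v" if "u \<in> U0" "v \<in> carrier (V u)" for u v
  unfolding R_def by (rule bij_betw_inv_into_left[OF bij]) (use that in auto)
 have TR: "T u (R u w) = w" "R u w \<in> carrier (V u)" if "u \<in> U0" "w \<in> carrier (S'.V u)" for u w
  using bij_betw_inv_into_right[OF bij[OF that(1)] that(2)] bij_betw_apply[OF bij_betw_inv_into[OF bij[OF that(1)]] that(2)]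
  by (simp_all add: R_def)
 have R: "bundle_morphism (unit_top G) (bnd \<sigma>') (bnd \<sigma>) R" "!!u. u \<in> U0 ==> unitary_map (S'.V u) (V u) (R u)"
  using bundle_morphism_inverse[OF hbun S'.hbun T(1)] T(2) unitary_map_inv[OF V_semi S'.V_semi T(2)] by (simp_all add: R_def[abs_def])
 have Rtw: "R (r h) (act \<sigma>' h w) = act \<sigma> h (R (d h) w)" if h: "h \<in> H" and w: "w \<in> carrier (S'.V (d h))" for h w
 proof -
  have u: "d h \<in> U0" "r h \<in> U0" using H_sub[OF h] by auto
  have "act \<sigma>' h w = T (r h) (act \<sigma> h (R (d h) w))" using T(3)[OF h TR(2)[OF u(1) w]] TR(1)[OF u(1) w] by simp
  then show ?thesis using RT[OF u(2) act_carrier[OF h TR(2)[OF u(1) w]]] by simp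
 qed
 define \<Psi> where "\<Psi> f = (\<lambda>x\<in>A. T (d x) (f x))" for f
 have PE: "\<Psi> f \<in> S'.ES" if "f \<in> ES" for f unfolding \<Psi>_def by (rule intertwiner_ES[OF \<sigma>' T that])
 have "equivalent_reps G (ind_rep G H \<mu> \<sigma>) \<lparr>bnd = S'.IB, act = ind_act G H \<mu> \<sigma>'\<rparr>"
 proof (rule equivalent_ind_repI[OF S'.hilbert_bundle_IB subset_refl, where \<Theta> = "\<lambda>f. S'.clf (\<Psi> f)"])
  show "\<exists>f\<in>ES. \<exists>g\<in>ES. (f, g) \<in> TP x \<and> ndist (FF u) (clf f u) P < e"
   if "x \<in> A" "u \<in> U0" "P \<in> carrier (FF u)" "e > 0" for x u P e
   using clf_TP_dense[OF that] by (auto simp: TP_def)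
  show "(\<lambda>u\<in>topspace (unit_top G). S'.clf (\<Psi> f) u) \<in> gam S'.IB" if "f \<in> ES" for f by (rule S'.clf_gam[OF PE[OF that]])
  show "ip (fib S'.IB u) (S'.clf (\<Psi> f) u) (S'.clf (\<Psi> g) u) = F0_ip G \<mu> \<sigma> f g u" if u: "u \<in> U0" and f: "f \<in> ES" and g: "g \<in> ES" for u f g
  proof -
   interpret radon CS "\<mu> u" by (rule radon_mu[OF u])
   have "descend (S'.ipf (\<Psi> f) (\<Psi> g)) C = descend (ipf f g) C" if C: "C \<in> space (\<mu> u)" for C
   proof -
    obtain x where x: "x \<in> A" "C = q x" using C by (auto simp: space_M)
    show ?thesis
     unfolding x(2) descend_q[OF S'.coset_invariant_ipf[OF PE[OF f] PE[OF g]] x(1)] descend_q[OF coset_invariant_ipf[OF f g] x(1)]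
     using unitary_mapD(2)[OF T(2), of "d x" "f x" "g x"] x(1) ES_D(2)[OF f x(1)] ES_D(2)[OF g x(1)]
     by (simp add: S'.ipf_def ipf_def \<Psi>_def)
   qed
   then have "F0_ip G \<mu> \<sigma>' (\<Psi> f) (\<Psi> g) u = F0_ip G \<mu> \<sigma> f g u"
    unfolding F0_ip_eq S'.F0_ip_eq by (intro Bochner_Integration.integral_cong) auto
   then show ?thesis using S'.clf_ip[OF u PE[OF f] PE[OF g]] by simp
  qed
  show "\<exists>f\<in>ES. ndist (fib S'.IB u) (S'.clf (\<Psi> f) u) v < e"
   if v: "u \<in> U0" "v \<in> carrier (fib S'.IB u)" "e > 0" for u v e
  proof -
   obtain g where g: "g \<in> S'.ES" "ndist (S'.FF u) (S'.clf g u) v < e" using S'.clf_dense[of u v e] v by auto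
   let ?f = "\<lambda>x\<in>A. R (d x) (g x)"
   have "?f \<in> ES" by (rule S'.intertwiner_ES[OF hrep_axioms R Rtw g(1)])
   moreover have "\<Psi> ?f = g"
    by (rule PiE_ext[of _ A "\<lambda>x. carrier (S'.V (d x))" _])
     (use S'.ES_D(1)[OF PE[OF \<open>?f \<in> ES\<close>]] S'.ES_D(1,2)[OF g(1)] TR in \<open>auto simp: \<Psi>_def\<close>)
   ultimately show ?thesis using g(2) by (intro bexI[of _ ?f]) auto
  qed
  show "unitary_map (fib S'.IB (d x)) (fib S'.IB (r x)) (ind_act G H \<mu> \<sigma>' x)" if "x \<in> A" for x using S'.ind_act(1)[OF that] by simp
  show "ind_act G H \<mu> \<sigma>' x (S'.clf (\<Psi> f) (d x)) = S'.clf (\<Psi> g) (r x)" if x: "x \<in> A" and fg: "f \<in> ES" "g \<in> ES" "(f, g) \<in> TP x" for x f g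
  proof (rule S'.ind_act(2)[OF x])
   show "(\<Psi> f, \<Psi> g) \<in> S'.TP x" using fg PE x by (auto simp: TP_def S'.TP_def \<Psi>_def)
  qed
 qed
 then show ?thesis by (simp add: ind_rep_def)
qed

end

section \<open>Induction preserves direct sums\<close>

context hrep_ne
begin

lemma clf_zero: assumes u: "u \<in> U0" shows "clf (\<lambda>x\<in>A. \<zero>\<^bsub>V (d x)\<^esub>) u = \<zero>\<^bsub>FF u\<^esub>"
proof -
 interpret Fu: hilb "FF u" by (rule hilb_FF[OF u])
 interpret Wu: semi_inner "W u" by (rule semi_W[OF u])
 have "F0_ip G \<mu> \<sigma> (\<lambda>x\<in>A. \<zero>\<^bsub>V (d x)\<^esub>) (\<lambda>x\<in>A. \<zero>\<^bsub>V (d x)\<^esub>) u = 0"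
  using Wu.ip_zero_left[of "\<zero>\<^bsub>W u\<^esub>"] ES_zero by (simp add: F0_simps)
 then show ?thesis using clf_ip[OF u ES_zero ES_zero] clf_carrier[OF u ES_zero] Fu.ip_definite by simp
qed

end

locale hrep_family = coset_setting G H lamH \<mu> for G :: "'g groupoid_data" and H lamH \<mu> +
 fixes I :: "'i set" and \<sigma> :: "'i \<Rightarrow> ('g, 'v) groupoid_rep"
 assumes ne: "unit_space G \<noteq> {}" and rep: "i \<in> I ==> hrep G H lamH \<mu> (\<sigma> i)"
begin

abbreviation ESi where "ESi i \<equiv> equivariant_sections G H (\<sigma> i)"
abbreviation Vf where "Vf i \<equiv> fib (bnd (\<sigma> i))"

lemma rep_ne: "i \<in> I ==> hrep_ne G H lamH \<mu> (\<sigma> i)"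
 using rep ne by (simp add: hrep_ne_def hrep_ne_axioms_def)

sublocale B: hbun_family "unit_top G" I "\<lambda>i. bnd (\<sigma> i)"
 using rep by unfold_locales (auto simp: hrep_def hbun_def)

sublocale C: hbun_family "unit_top G" I "\<lambda>i. ind_bundle G H \<mu> (\<sigma> i)"
 using hrep_ne.hilbert_bundle_IB[OF rep_ne] by unfold_locales

sublocale S: hrep_ne G H lamH \<mu> "rep_sum HG I \<sigma>"
 using hrep_sum[OF rep] ne by (simp add: hrep_ne_def hrep_ne_axioms_def)

lemma bnd_S: "bnd (rep_sum HG I \<sigma>) = B.F" and act_S: "act (rep_sum HG I \<sigma>) h v = (\<lambda>i\<in>I. act (\<sigma> i) h (v i))"
 by (simp_all add: rep_sum_def)

lemma V_S: "S.V u = hilbert_sum I (\<lambda>i. Vf i u)"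
 by (simp add: bnd_S)

lemma zero_S: "\<zero>\<^bsub>S.V u\<^esub> = (\<lambda>i\<in>I. \<zero>\<^bsub>Vf i u\<^esub>)"
 by (simp add: V_S hilbert_sum_def)

lemma fam: "u \<in> U0 ==> hilb_family I (\<lambda>i. Vf i u)"
 using B.hilb_family by simp

definition comp where "comp i f = (\<lambda>x\<in>A. f x i)"

definition asm where "asm J F = (\<lambda>x\<in>A. \<lambda>i\<in>I. if i \<in> J then F i x else \<zero>\<^bsub>Vf i (d x)\<^esub>)"

abbreviation tr where "tr J f \<equiv> asm J (\<lambda>i. comp i f)"

lemma comp_ES:
 assumes f: "f \<in> S.ES" and i: "i \<in> I"
 shows "comp i f \<in> ESi i"
proof -
 interpret hi: hrep G H lamH \<mu> "\<sigma> i" by (rule rep[OF i])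
 obtain K where K: "compactin CS K" "!!x. x \<in> A ==> f x \<noteq> \<zero>\<^bsub>S.V (d x)\<^esub> ==> q x \<in> K" by (rule S.ES_compact[OF f]) blast
 show ?thesis
  unfolding comp_def
 proof (rule hi.ES_I[OF B.cont_field_F_comp[OF S.ES_D(3)[OF f, unfolded bnd_S] i] _ K(1)])
  show "f (x \<cdot> h) i = act (\<sigma> i) (inv' h) (f x i)" if "x \<in> A" "h \<in> H" "d x = r h" for x h
   using S.ES_D(4)[OF f that] i by (simp add: act_S)
  show "q x \<in> K" if "x \<in> A" "f x i \<noteq> \<zero>\<^bsub>hi.V (d x)\<^esub>" for x
  proof (rule K(2)[OF that(1)], rule notI)
   assume "f x = \<zero>\<^bsub>S.V (d x)\<^esub>"
   then show False using that(2) i by (simp add: zero_S)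
  qed
 qed
qed

lemma asm_ES:
 assumes J: "finite J" "J \<subseteq> I" and F: "!!i. i \<in> J ==> F i \<in> ESi i"
 shows "asm J F \<in> S.ES"
proof -
 have hJ: "hrep G H lamH \<mu> (\<sigma> i)" if "i \<in> J" for i using rep J that by blast
 have "\<forall>i\<in>J. \<exists>K. compactin CS K \<and> (\<forall>x\<in>A. F i x \<noteq> \<zero>\<^bsub>Vf i (d x)\<^esub> --> q x \<in> K)"
  using hrep.ES_iff[OF hJ] F by blast
 from bchoice[OF this] obtain K where K: "!!i. i \<in> J ==> compactin CS (K i)"
  "!!i x. i \<in> J ==> x \<in> A ==> F i x \<noteq> \<zero>\<^bsub>Vf i (d x)\<^esub> ==> q x \<in> K i" by blast
 have KU: "compactin CS (\<Union>i\<in>J. K i)" using J(1) K(1) by (intro compactin_Union) auto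
 have cf: "cont_field (unit_top G) B.F (gtop G) d (\<lambda>x. \<lambda>i\<in>I. if i \<in> J then F i x else \<zero>\<^bsub>Vf i (d x)\<^esub>)"
  by (rule B.cont_field_F_finite[OF J _ continuous_d]) (use hrep.ES_D(3)[OF hJ F] in blast)
 show ?thesis
  unfolding asm_def
 proof (rule S.ES_I[OF _ _ KU])
  show "cont_field (unit_top G) (bnd (rep_sum HG I \<sigma>)) (gtop G) d (\<lambda>x. \<lambda>i\<in>I. if i \<in> J then F i x else \<zero>\<^bsub>Vf i (d x)\<^esub>)"
   unfolding bnd_S by (rule cf)
  fix x h assume xh: "x \<in> A" "h \<in> H" "d x = r h"
  have "act (\<sigma> i) (inv' h) \<zero>\<^bsub>Vf i (d x)\<^esub> = \<zero>\<^bsub>Vf i (d h)\<^esub>" if "i \<in> I" for i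
   using hrep.act_zero[OF rep[OF that] H_inv[OF xh(2)], of "\<zero>\<^bsub>Vf i (d x)\<^esub>"] hrep.V_zero[OF rep[OF that], of "d x"] xh H_sub by simp
  moreover have "F i (x \<cdot> h) = act (\<sigma> i) (inv' h) (F i x)" if "i \<in> J" for i by (rule hrep.ES_D(4)[OF hJ[OF that] F[OF that] xh])
  ultimately show "(\<lambda>i\<in>I. if i \<in> J then F i (x \<cdot> h) else \<zero>\<^bsub>Vf i (d (x \<cdot> h))\<^esub>)
    = act (rep_sum HG I \<sigma>) (inv' h) (\<lambda>i\<in>I. if i \<in> J then F i x else \<zero>\<^bsub>Vf i (d x)\<^esub>)"
   using xh H_sub by (auto simp: act_S intro!: restrict_ext)
 next
  fix x assume x: "x \<in> A" and ne: "(\<lambda>i\<in>I. if i \<in> J then F i x else \<zero>\<^bsub>Vf i (d x)\<^esub>) \<noteq> \<zero>\<^bsub>S.V (d x)\<^esub>"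
  have "\<exists>i\<in>J. F i x \<noteq> \<zero>\<^bsub>Vf i (d x)\<^esub>"
  proof (rule ccontr)
   assume "\<not> ?thesis"
   then have "(\<lambda>i\<in>I. if i \<in> J then F i x else \<zero>\<^bsub>Vf i (d x)\<^esub>) = \<zero>\<^bsub>S.V (d x)\<^esub>"
    unfolding zero_S by (intro restrict_ext) auto
   then show False using ne by blast
  qed
  then show "q x \<in> (\<Union>i\<in>J. K i)" using K(2) x by blast
 qed
qed

lemma comp_asm:
 assumes "i \<in> I" "i \<in> J ==> F i \<in> ESi i"
 shows "comp i (asm J F) = (if i \<in> J then F i else (\<lambda>x\<in>A. \<zero>\<^bsub>Vf i (d x)\<^esub>))"
proof -
 have "comp i (asm J F) = (\<lambda>x\<in>A. if i \<in> J then F i x else \<zero>\<^bsub>Vf i (d x)\<^esub>)"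
  unfolding comp_def asm_def using assms(1) by (intro restrict_ext) simp
 moreover have "(\<lambda>x\<in>A. F i x) = F i" if "i \<in> J"
  using hrep.ES_D(1)[OF rep[OF assms(1)] assms(2)[OF that]] by (rule PiE_restrict)
 ultimately show ?thesis by auto
qed

text \<open>On this dense class the comparison with the direct sum only involves finite sums.\<close>

definition FS where "FS = {asm J F | J F. finite J \<and> J \<subseteq> I \<and> (\<forall>i\<in>J. F i \<in> ESi i)}"

lemma FS_I: "finite J ==> J \<subseteq> I ==> (!!i. i \<in> J ==> F i \<in> ESi i) ==> asm J F \<in> FS"
 unfolding FS_def by blast

lemma FS_sub: "FS \<subseteq> S.ES"
 using asm_ES by (auto simp: FS_def)

text \<open>Near every point an equivariant section is close to one with finitely many components, and finitely
 many such neighbourhoods cover its support modulo \<open>H\<close>.\<close>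

lemma asm_approx:
 assumes f: "f \<in> S.ES" and u: "u \<in> U0" and e: "e > 0"
 obtains J where "finite J" "J \<subseteq> I" "S.nrm u (tr J f \<ominus>\<^bsub>S.F0\<^esub> f) < e"
proof -
 obtain K where K: "compactin CS K" "!!x. x \<in> A ==> f x \<noteq> \<zero>\<^bsub>S.V (d x)\<^esub> ==> q x \<in> K" by (rule S.ES_compact[OF f]) blast
 define \<delta> where "\<delta> = e / (sqrt (measure (\<mu> u) K) + 1)"
 have \<delta>: "\<delta> > 0" using e by (simp add: \<delta>_def add_nonneg_pos)
 have aE: "tr J f \<in> S.ES" if "finite J" "J \<subseteq> I" for J
  using that comp_ES[OF f] by (intro asm_ES) auto
 have asm_at: "tr J f x = (\<lambda>i\<in>I. if i \<in> J then f x i else \<zero>\<^bsub>Vf i (d x)\<^esub>)" if "x \<in> A" for J x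
  using that by (auto simp: asm_def comp_def)
 have KA: "K \<subseteq> q ` A" using compactin_subset_topspace[OF K(1)] by simp
 have "\<forall>C\<in>K. \<exists>p. openin CS (fst p) \<and> C \<in> fst p \<and> finite (snd p) \<and> snd p \<subseteq> I \<and> (\<forall>J x. finite J \<and> snd p \<subseteq> J \<and> J \<subseteq> I \<and> x \<in> A \<and> q x \<in> fst p -->
   vnorm (S.V (d x)) ((tr J f \<ominus>\<^bsub>S.F0\<^esub> f) x) \<le> \<delta>)"
 proof
  fix C assume "C \<in> K"
  then obtain y where y: "y \<in> A" "C = q y" using KA by blast
  obtain N L t where N: "openin (gtop G) N" "y \<in> N" "finite L" "L \<subseteq> I" "\<forall>i\<in>L. t i \<in> gam (bnd (\<sigma> i))"
   "!!w. w \<in> N ==> ndist (fib B.F (d w)) (f w) (B.fin_sec L t (d w)) < \<delta>"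
   by (rule B.cont_field_F_approx[OF S.ES_D(3)[OF f, unfolded bnd_S] y(1) \<delta>]) blast
  have "vnorm (S.V (d x)) ((tr J f \<ominus>\<^bsub>S.F0\<^esub> f) x) \<le> \<delta>"
   if J: "finite J" "L \<subseteq> J" "J \<subseteq> I" and x: "x \<in> A" "q x \<in> q ` N" for J x
  proof -
   obtain w where w: "w \<in> N" "q x = q w" using x by blast
   have wA: "w \<in> A" using w openin_subset[OF N(1)] by auto
   interpret Vw: hilb_family I "\<lambda>i. Vf i (d w)" using fam wA by simp
   have dE: "tr J f \<ominus>\<^bsub>S.F0\<^esub> f \<in> S.ES"
    using S.F0.minus_closed[of "tr J f" f] aE[OF J(1,3)] f by (simp add: S.F0_simps)
   have c: "f w \<in> carrier Vw.S" "tr J f w \<in> carrier Vw.S"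
    using S.ES_D(2)[OF f wA] S.ES_D(2)[OF aE[OF J(1,3)] wA] by (simp_all add: V_S)
   have tc: "B.fin_sec L t (d w) \<in> carrier Vw.S" using N(3-5) wA by (intro B.fin_sec_carrier) auto
   have "vnorm (S.V (d x)) ((tr J f \<ominus>\<^bsub>S.F0\<^esub> f) x) = ndist Vw.S (tr J f w) (f w)"
    using S.ES_vnorm_coset[OF dE x(1) wA w(2)] S.F0_minus[OF aE[OF J(1,3)] f wA] by (simp add: V_S)
   also have "\<dots> \<le> ndist Vw.S (f w) (B.fin_sec L t (d w))"
   proof (rule Vw.S_vnorm_le)
    fix M assume M: "finite M" "M \<subseteq> I"
    have "(\<Sum>i\<in>M. (vnorm (Vf i (d w)) ((tr J f w \<ominus>\<^bsub>Vw.S\<^esub> f w) i))\<^sup>2)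
      \<le> (\<Sum>i\<in>M. (vnorm (Vf i (d w)) ((f w \<ominus>\<^bsub>Vw.S\<^esub> B.fin_sec L t (d w)) i))\<^sup>2)"
    proof (rule sum_mono)
     fix i assume "i \<in> M"
     then have i: "i \<in> I" using M by blast
     interpret Vi: hilb "Vf i (d w)" using Vw.hilb_V[OF i] .
     have fi: "f w i \<in> carrier (Vf i (d w))" "B.fin_sec L t (d w) i \<in> carrier (Vf i (d w))"
      using Vw.S_comp[OF c(1) i] Vw.S_comp[OF tc i] by auto
     have "vnorm (Vf i (d w)) ((tr J f w \<ominus>\<^bsub>Vw.S\<^esub> f w) i)
       \<le> vnorm (Vf i (d w)) ((f w \<ominus>\<^bsub>Vw.S\<^esub> B.fin_sec L t (d w)) i)"
     proof (cases "i \<in> J")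
      case True
      then show ?thesis using fi i
       by (simp add: Vw.S_minus[OF c(2,1) i] Vw.S_minus[OF c(1) tc i]) (simp add: asm_at[OF wA] Vi.diff_self Vi.vnorm_zero Vi.vnorm_nonneg)
     next
      case False
      then have "B.fin_sec L t (d w) i = \<zero>\<^bsub>Vf i (d w)\<^esub>" using J(2) i wA by (auto simp: B.fin_sec_def)
      then show ?thesis using fi i False Vi.vnorm_diff_commute[of "\<zero>\<^bsub>Vf i (d w)\<^esub>" "f w i"]
       by (simp add: Vw.S_minus[OF c(2,1) i] Vw.S_minus[OF c(1) tc i]) (simp add: asm_at[OF wA])
     qed
     moreover have "0 \<le> vnorm (Vf i (d w)) ((tr J f w \<ominus>\<^bsub>Vw.S\<^esub> f w) i)"
      using fi i Vw.S_comp[OF c(2) i] by (intro Vi.vnorm_nonneg) (simp add: Vw.S_minus[OF c(2,1) i])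
     ultimately show "(vnorm (Vf i (d w)) ((tr J f w \<ominus>\<^bsub>Vw.S\<^esub> f w) i))\<^sup>2
      \<le> (vnorm (Vf i (d w)) ((f w \<ominus>\<^bsub>Vw.S\<^esub> B.fin_sec L t (d w)) i))\<^sup>2" by (rule power_mono)
    qed
    also have "\<dots> \<le> (ndist Vw.S (f w) (B.fin_sec L t (d w)))\<^sup>2"
     using Vw.S_finite_le[OF _ M] c(1) tc by simp
    finally show "(\<Sum>i\<in>M. (vnorm (Vf i (d w)) ((tr J f w \<ominus>\<^bsub>Vw.S\<^esub> f w) i))\<^sup>2)
      \<le> (ndist Vw.S (f w) (B.fin_sec L t (d w)))\<^sup>2" .
   qed (use c tc in \<open>auto intro!: Vw.S.vnorm_nonneg\<close>)
   also have "\<dots> \<le> \<delta>" using N(6)[OF w(1)] by simp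
   finally show ?thesis .
  qed
  then show "\<exists>p. openin CS (fst p) \<and> C \<in> fst p \<and> finite (snd p) \<and> snd p \<subseteq> I \<and> (\<forall>J x. finite J \<and> snd p \<subseteq> J \<and> J \<subseteq> I \<and> x \<in> A \<and> q x \<in> fst p -->
   vnorm (S.V (d x)) ((tr J f \<ominus>\<^bsub>S.F0\<^esub> f) x) \<le> \<delta>)"
   using open_q[OF N(1)] N(2-4) y(2) by (intro exI[of _ "(q ` N, L)"]) auto
 qed
 from bchoice[OF this] obtain p where "\<forall>C\<in>K. openin CS (fst (p C)) \<and> C \<in> fst (p C) \<and> finite (snd (p C)) \<and> snd (p C) \<subseteq> I \<and> (\<forall>J x. finite J \<and> snd (p C) \<subseteq> J \<and> J \<subseteq> I \<and> x \<in> A \<and> q x \<in> fst (p C) -->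
   vnorm (S.V (d x)) ((tr J f \<ominus>\<^bsub>S.F0\<^esub> f) x) \<le> \<delta>)" by blast
 then have p: "!!C. C \<in> K ==> openin CS (fst (p C)) \<and> C \<in> fst (p C) \<and> finite (snd (p C)) \<and> snd (p C) \<subseteq> I"
  "!!C J x. C \<in> K ==> finite J ==> snd (p C) \<subseteq> J ==> J \<subseteq> I ==> x \<in> A ==> q x \<in> fst (p C) ==>
   vnorm (S.V (d x)) ((tr J f \<ominus>\<^bsub>S.F0\<^esub> f) x) \<le> \<delta>" by blast+
 have "\<exists>\<F>. finite \<F> \<and> \<F> \<subseteq> (\<lambda>C. fst (p C)) ` K \<and> K \<subseteq> \<Union>\<F>"
  using K(1) p(1) unfolding compactin_def by (elim conjE allE[of _ "(\<lambda>C. fst (p C)) ` K"]) blast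
 then obtain K' where K': "finite K'" "K' \<subseteq> K" "K \<subseteq> (\<Union>C\<in>K'. fst (p C))" by (auto dest: finite_subset_image)
 define J where "J = (\<Union>C\<in>K'. snd (p C))"
 have J: "finite J" "J \<subseteq> I" using K' p(1) by (auto simp: J_def)
 have z: "(tr J f \<ominus>\<^bsub>S.F0\<^esub> f) x = \<zero>\<^bsub>S.V (d x)\<^esub>" if x: "x \<in> A" "f x = \<zero>\<^bsub>S.V (d x)\<^esub>" for x
 proof -
  interpret Vx: hilb "S.V (d x)" using S.V_hilb x by simp
  have "tr J f x = \<zero>\<^bsub>S.V (d x)\<^esub>" unfolding asm_at[OF x(1)] x(2) zero_S by (rule restrict_ext) simp
  then show ?thesis using S.F0_minus[OF aE[OF J] f x(1)] x(2) Vx.diff_self[of "\<zero>\<^bsub>S.V (d x)\<^esub>"] by simp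
 qed
 have "S.nrm u (tr J f \<ominus>\<^bsub>S.F0\<^esub> f) \<le> \<delta> * sqrt (measure (\<mu> u) K)"
 proof (rule S.nrm_bound[OF _ u K(1)])
  show "tr J f \<ominus>\<^bsub>S.F0\<^esub> f \<in> S.ES"
   using S.F0.minus_closed[of "tr J f" f] aE[OF J] f by (simp add: S.F0_simps)
  fix x assume x: "x \<in> A"
  interpret Vx: hilb "S.V (d x)" using S.V_hilb x by simp
  show "vnorm (S.V (d x)) ((tr J f \<ominus>\<^bsub>S.F0\<^esub> f) x) \<le> \<delta>"
  proof (cases "f x = \<zero>\<^bsub>S.V (d x)\<^esub>")
   case True
   then show ?thesis using z[OF x] \<delta> Vx.vnorm_zero by simp
  next
   case False
   then obtain C where C: "C \<in> K'" "q x \<in> fst (p C)" using K(2)[OF x] K'(3) by blast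
   then have "C \<in> K" "snd (p C) \<subseteq> J" using K'(2) by (auto simp: J_def)
   then show ?thesis using p(2)[of C J x] J x C by blast
  qed
  show "q x \<in> K" if "(tr J f \<ominus>\<^bsub>S.F0\<^esub> f) x \<noteq> \<zero>\<^bsub>S.V (d x)\<^esub>" using z[OF x] that K(2)[OF x] by blast
 qed (use \<delta> in simp)
 also have "\<dots> < e"
 proof -
  have "0 < 1 + sqrt (measure (\<mu> u) K)" by (simp add: add_pos_nonneg)
  then show ?thesis using e by (simp add: \<delta>_def divide_less_eq algebra_simps)
 qed
 finally show ?thesis using that J by blast
qed

lemma ind_rep_sum: "equivalent_reps G (ind_rep G H \<mu> (rep_sum HG I \<sigma>)) (rep_sum G I (\<lambda>i. ind_rep G H \<mu> (\<sigma> i)))"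
proof -
 define cl where "cl i = F0_class G H \<mu> (\<sigma> i)" for i
 define \<Theta> where "\<Theta> f u = (\<lambda>i\<in>I. cl i (comp i f) u)" for f u
 let ?z = "\<lambda>i. \<lambda>x\<in>A. \<zero>\<^bsub>Vf i (d x)\<^esub>"
 let ?FF = "\<lambda>i. F_fibre G H \<mu> (\<sigma> i)"
 have fb: "fib (ind_bundle G H \<mu> (\<sigma> i)) = ?FF i" for i by (simp add: ind_bundle_def)
 have famC: "hilb_family I (\<lambda>i. ?FF i u)" if "u \<in> U0" for u using C.hilb_family[of u] that by (simp add: fb)
 have fF: "fib C.F u = hilbert_sum I (\<lambda>i. ?FF i u)" for u by (simp add: fb)
 have cz: "cl i (?z i) u = \<zero>\<^bsub>?FF i u\<^esub>" if "i \<in> I" "u \<in> U0" for i u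
  unfolding cl_def by (rule hrep_ne.clf_zero[OF rep_ne[OF that(1)] that(2)])
 have Th: "\<Theta> (asm J F) u = hilb_family.trunc I (\<lambda>i. ?FF i u) J (\<lambda>i. cl i (F i) u)"
  if J: "J \<subseteq> I" "\<forall>i\<in>J. F i \<in> ESi i" and u: "u \<in> U0" for J F u
  unfolding \<Theta>_def hilb_family.trunc_def[OF famC[OF u]]
  by (rule restrict_ext) (use J u cz in \<open>simp add: comp_asm\<close>)
 have ThS: "\<Theta> f u \<in> carrier (hilbert_sum I (\<lambda>i. ?FF i u))" if f: "f \<in> FS" and u: "u \<in> U0" for f u
 proof -
  interpret Cu: hilb_family I "\<lambda>i. ?FF i u" by (rule famC[OF u])
  obtain J F where J: "finite J" "J \<subseteq> I" "\<forall>i\<in>J. F i \<in> ESi i" "f = asm J F" using f by (auto simp: FS_def)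
  show ?thesis unfolding J(4) Th[OF J(2,3) u]
   using J hrep_ne.clf_carrier[OF rep_ne u] by (intro Cu.trunc_S) (auto simp: cl_def)
 qed
 have "equivalent_reps G (ind_rep G H \<mu> (rep_sum HG I \<sigma>)) \<lparr>bnd = C.F, act = (\<lambda>x v. \<lambda>i\<in>I. ind_act G H \<mu> (\<sigma> i) x (v i))\<rparr>"
 proof (rule S.equivalent_ind_repI[OF C.hilbert_bundle_F FS_sub, where \<Theta> = \<Theta>])
  fix x u P and e :: real assume x: "x \<in> A" and u: "u \<in> U0" and P: "P \<in> carrier (S.FF u)" and e: "e > 0"
  interpret Fu: hilb "S.FF u" by (rule S.hilb_FF[OF u])
  obtain f g where fg: "(f, g) \<in> S.TP x" "ndist (S.FF u) (S.clf f u) P < e / 2"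
   using S.clf_TP_dense[OF x u P, of "e / 2"] e by auto
  then have E: "f \<in> S.ES" "g \<in> S.ES" by (auto simp: S.TP_def)
  obtain J where J: "finite J" "J \<subseteq> I" "S.nrm u (tr J f \<ominus>\<^bsub>S.F0\<^esub> f) < e / 2"
   using asm_approx[OF E(1) u, of "e / 2"] e by auto
  let ?f = "tr J f" and ?g = "tr J g"
  have D: "?f \<in> FS" "?g \<in> FS" using J comp_ES E by (auto intro!: FS_I)
  have "?g y = ?f (inv' x \<cdot> y)" if y: "y \<in> A" "r y = r x" for y
   using fg(1) x y by (auto simp: S.TP_def asm_def comp_def intro!: restrict_ext)
  then have "(?f, ?g) \<in> S.TP x" using D FS_sub by (auto simp: S.TP_def)
  moreover have "ndist (S.FF u) (S.clf ?f u) P < e"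
   using Fu.vnorm_diff_triangle[OF S.clf_carrier[OF u subsetD[OF FS_sub D(1)]] S.clf_carrier[OF u E(1)] P]
    S.clf_norm_diff[OF u subsetD[OF FS_sub D(1)] E(1)] fg(2) J(3) by linarith
  ultimately show "\<exists>f\<in>FS. \<exists>g\<in>FS. (f, g) \<in> S.TP x \<and> ndist (S.FF u) (S.clf f u) P < e" using D by blast
 next
  fix f assume "f \<in> FS"
  then obtain J F where J: "finite J" "J \<subseteq> I" "\<forall>i\<in>J. F i \<in> ESi i" "f = asm J F" by (auto simp: FS_def)
  have "(\<lambda>u\<in>topspace (unit_top G). \<Theta> f u) = C.fin_sec J (\<lambda>i. \<lambda>u\<in>topspace (unit_top G). cl i (F i) u)"
   unfolding C.fin_sec_def
  proof (rule restrict_ext)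
   fix u assume "u \<in> topspace (unit_top G)"
   then have u: "u \<in> U0" by simp
   show "\<Theta> f u = (\<lambda>i\<in>I. if i \<in> J then (\<lambda>u\<in>topspace (unit_top G). cl i (F i) u) u else \<zero>\<^bsub>fib (ind_bundle G H \<mu> (\<sigma> i)) u\<^esub>)"
    unfolding J(4) Th[OF J(2,3) u] hilb_family.trunc_def[OF famC[OF u]] by (rule restrict_ext) (use u in \<open>simp add: fb\<close>)
  qed
  moreover have "(\<lambda>u\<in>topspace (unit_top G). cl i (F i) u) \<in> gam (ind_bundle G H \<mu> (\<sigma> i))" if "i \<in> J" for i
   unfolding cl_def using hrep_ne.clf_gam[OF rep_ne] J that by blast
  ultimately have "(\<lambda>u\<in>topspace (unit_top G). \<Theta> f u) \<in> C.fin_secs"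
   unfolding C.fin_secs_def using J(1,2) by blast
  then show "(\<lambda>u\<in>topspace (unit_top G). \<Theta> f u) \<in> gam C.F" using C.fin_secs_gam by blast
 next
  fix u f g assume u: "u \<in> U0" and f: "f \<in> FS" and g: "g \<in> FS"
  interpret Cu: hilb_family I "\<lambda>i. ?FF i u" by (rule famC[OF u])
  interpret radon CS "\<mu> u" by (rule radon_mu[OF u])
  obtain J F where J: "finite J" "J \<subseteq> I" "\<forall>i\<in>J. F i \<in> ESi i" "f = asm J F" using f by (auto simp: FS_def)
  have gE: "g \<in> S.ES" and fE: "f \<in> S.ES" using f g FS_sub by auto
  have hJ: "hrep_ne G H lamH \<mu> (\<sigma> i)" "i \<in> I" "F i \<in> ESi i" "comp i g \<in> ESi i" if "i \<in> J" for i
   using that J rep_ne comp_ES[OF gE] by blast+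
  let ?k = "\<lambda>i. descend (hrep.ipf G (\<sigma> i) (F i) (comp i g))"
  note hr = hrep_ne.axioms(1)[OF hJ(1)]
  have "ip (fib C.F u) (\<Theta> f u) (\<Theta> g u) = (\<Sum>i\<in>J. ip (?FF i u) (\<Theta> f u i) (\<Theta> g u i))"
   unfolding fF
  proof (rule Cu.ip_finite[OF J(1,2) ThS[OF g u]])
   show "\<Theta> f u i = \<zero>\<^bsub>?FF i u\<^esub>" if "i \<in> I" "i \<notin> J" for i
    using that J(4) Th[OF J(2,3) u] by (simp add: Cu.trunc_def)
  qed
  also have "\<dots> = (\<Sum>i\<in>J. F0_ip G \<mu> (\<sigma> i) (F i) (comp i g) u)"
  proof (rule sum.cong)
   fix i assume i: "i \<in> J"
   have "\<Theta> f u i = cl i (F i) u" "\<Theta> g u i = cl i (comp i g) u"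
    using J(4) Th[OF J(2,3) u] i hJ(2)[OF i] by (simp_all add: Cu.trunc_def) (simp add: \<Theta>_def)
   then show "ip (?FF i u) (\<Theta> f u i) (\<Theta> g u i) = F0_ip G \<mu> (\<sigma> i) (F i) (comp i g) u"
    using hrep_ne.clf_ip[OF hJ(1)[OF i] u hJ(3,4)[OF i]] by (simp add: cl_def)
  qed simp
  also have "\<dots> = (\<Sum>i\<in>J. LINT C|\<mu> u. ?k i C)" by (rule sum.cong) (simp_all add: hrep.F0_ip_eq[OF hr])
  also have "\<dots> = (LINT C|\<mu> u. (\<Sum>i\<in>J. ?k i C))"
   by (rule Bochner_Integration.integral_sum[symmetric]) (rule hrep.descend_ipf_integrable[OF hr hJ(3,4) u])
  also have "\<dots> = (LINT C|\<mu> u. descend (S.ipf f g) C)"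
  proof (rule Bochner_Integration.integral_cong)
   fix C assume "C \<in> space (\<mu> u)"
   then obtain x where x: "x \<in> A" "C = q x" by (auto simp: space_M)
   interpret Bx: hilb_family I "\<lambda>i. Vf i (d x)" using fam x by simp
   have "(\<Sum>i\<in>J. ?k i C) = (\<Sum>i\<in>J. ip (Vf i (d x)) (f x i) (g x i))"
   proof (rule sum.cong)
    fix i assume i: "i \<in> J"
    show "?k i C = ip (Vf i (d x)) (f x i) (g x i)"
     unfolding x(2) descend_q[OF hrep.coset_invariant_ipf[OF hr[OF i] hJ(3,4)[OF i]] x(1)]
     using x(1) J(4) i hJ(2)[OF i] by (simp add: hrep.ipf_def[OF hr[OF i]] comp_def asm_def)
   qed simp
   also have "\<dots> = S.ipf f g x"
    unfolding S.ipf_def V_S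
    by (rule Bx.ip_finite[OF J(1,2), symmetric]) (use S.ES_D(2)[OF gE x(1)] x(1) J(4) in \<open>auto simp: V_S asm_def\<close>)
   finally show "(\<Sum>i\<in>J. ?k i C) = descend (S.ipf f g) C" using descend_q[OF S.coset_invariant_ipf[OF fE gE] x(1)] x(2) by simp
  qed simp
  finally show "ip (fib C.F u) (\<Theta> f u) (\<Theta> g u) = F0_ip G \<mu> (rep_sum HG I \<sigma>) f g u" by (simp add: S.F0_ip_eq)
 next
  fix u v and e :: real assume u: "u \<in> U0" and v: "v \<in> carrier (fib C.F u)" and e: "e > 0"
  interpret Cu: hilb_family I "\<lambda>i. ?FF i u" by (rule famC[OF u])
  have vS: "v \<in> carrier Cu.S" using v unfolding fF .
  have D: "\<exists>a\<in>ESi i. cl i a u \<in> carrier (?FF i u) \<and> ndist (?FF i u) w (cl i a u) < \<delta>"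
   if i: "i \<in> I" and w: "w \<in> carrier (?FF i u)" and d: "\<delta> > 0" for i w \<delta>
  proof -
   interpret hi: hrep_ne G H lamH \<mu> "\<sigma> i" by (rule rep_ne[OF i])
   interpret Fi: hilb "?FF i u" by (rule hi.hilb_FF[OF u])
   obtain a where a: "a \<in> hi.ES" "ndist (?FF i u) (hi.clf a u) w < \<delta>" using hi.clf_dense[OF u w d] by blast
   then show ?thesis using hi.clf_carrier[OF u a(1)] Fi.vnorm_diff_commute[OF w, of "hi.clf a u"] by (intro bexI[of _ a]) (auto simp: cl_def)
  qed
  obtain J F where J: "finite J" "J \<subseteq> I" "!!i. i \<in> J ==> F i \<in> ESi i"
   "Cu.trunc J (\<lambda>i. cl i (F i) u) \<in> carrier Cu.S" "ndist Cu.S v (Cu.trunc J (\<lambda>i. cl i (F i) u)) < e"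
   using Cu.finite_dense[of "\<lambda>i. ESi i" "\<lambda>i a. cl i a u", OF D vS e] by blast
  have "asm J F \<in> FS" by (rule FS_I[OF J(1-3)])
  moreover have "ndist (fib C.F u) (\<Theta> (asm J F) u) v < e"
   unfolding fF using Th[OF J(2) _ u, of F] J(3,5) Cu.S.vnorm_diff_commute[OF vS J(4)] by simp
  ultimately show "\<exists>f\<in>FS. ndist (fib C.F u) (\<Theta> f u) v < e" by blast
 next
  fix x assume x: "x \<in> A"
  show "unitary_map (fib C.F (d x)) (fib C.F (r x)) (\<lambda>v. \<lambda>i\<in>I. ind_act G H \<mu> (\<sigma> i) x (v i))"
   unfolding fF by (rule unitary_hilbert_sum[OF famC famC hrep_ne.ind_act(1)[OF rep_ne x]]) (use x in auto)
  fix f g assume fg: "f \<in> FS" "g \<in> FS" "(f, g) \<in> S.TP x"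
  have "ind_act G H \<mu> (\<sigma> i) x (cl i (comp i f) (d x)) = cl i (comp i g) (r x)" if i: "i \<in> I" for i
  proof -
   interpret hi: hrep_ne G H lamH \<mu> "\<sigma> i" by (rule rep_ne[OF i])
   have "(comp i f, comp i g) \<in> hi.TP x"
    using fg FS_sub comp_ES[OF _ i] x by (auto simp: S.TP_def hi.TP_def comp_def)
   then show ?thesis unfolding cl_def by (rule hi.ind_act(2)[OF x])
  qed
  then show "(\<lambda>i\<in>I. ind_act G H \<mu> (\<sigma> i) x (\<Theta> f (d x) i)) = \<Theta> g (r x)" by (auto simp: \<Theta>_def intro!: restrict_ext)
 qed
 then show ?thesis by (simp add: rep_sum_def ind_rep_def)
qed

end

lemma topspace_total_top_empty: "topspace X = {} ==> topspace (total_top X E) = {}"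
 unfolding total_top_def topology_generated_by_topspace using openin_subset[of X] by blast

text \<open>Without units there are no fibres, and all conditions on a morphism are void.\<close>

lemma equivalent_reps_empty:
 assumes "arrows G = {}"
 shows "equivalent_reps G \<pi> \<pi>'"
proof -
 have e: "unit_space G = {}" "topspace (unit_top G) = {}" using assms by (auto simp: unit_space_def unit_top_def)
 have "bundle_morphism (unit_top G) (bnd \<pi>) (bnd \<pi>') (\<lambda>_ _. undefined)"
  by (simp add: bundle_morphism_def continuous_map_def e(2) topspace_total_top_empty[OF e(2)] del: null_topspace_iff_trivial)
 then show ?thesis using e assms by (auto simp: equivalent_reps_def Mor_def)
qed

theorem theorem3p8:
 fixes G :: "'g groupoid_data" and H :: "'g set"
  and lam lamH :: "'g \<Rightarrow> 'g measure" and \<mu> :: "'g \<Rightarrow> 'g set measure"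
 assumes "topological_groupoid G"
  and "second_countable (gtop G)" and "locally_compact_space (gtop G)"
  and "Hausdorff_space (gtop G)"
  and "haar_system G lam"
  and "wide_subgroupoid G H" and "closedin (gtop G) H"
  and "haar_system (restrict_groupoid G H) lamH"
  and "full_equivariant_system G H \<mu>"
 shows
  "(\<forall>(\<sigma> :: ('g, 'v) groupoid_rep) (\<sigma>' :: ('g, 'w) groupoid_rep).
    continuous_unitary_rep (restrict_groupoid G H) \<sigma> \<and>
    continuous_unitary_rep (restrict_groupoid G H) \<sigma>' \<and>
    equivalent_reps (restrict_groupoid G H) \<sigma> \<sigma>' \<longrightarrow>
    equivalent_reps G (ind_rep G H \<mu> \<sigma>) (ind_rep G H \<mu> \<sigma>')) \<and>
   (\<forall>(I :: 'i set) (\<sigma> :: 'i \<Rightarrow> ('g, 'x) groupoid_rep).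
    (\<forall>i\<in>I. continuous_unitary_rep (restrict_groupoid G H) (\<sigma> i)) \<longrightarrow>
    equivalent_reps G
     (ind_rep G H \<mu> (rep_sum (restrict_groupoid G H) I \<sigma>))
     (rep_sum G I (\<lambda>i. ind_rep G H \<mu> (\<sigma> i))))"
proof (cases "arrows G = {}")
 case True
 then show ?thesis by (simp add: equivalent_reps_empty)
next
 case False
 interpret coset_setting G H lamH \<mu> using assms by unfold_locales
 have ne: "unit_space G \<noteq> {}" using False by (simp add: unit_space_def)
 show ?thesis
 proof (intro conjI allI impI)
  fix \<sigma> :: "('g, 'v) groupoid_rep" and \<sigma>' :: "('g, 'w) groupoid_rep"
  assume a: "continuous_unitary_rep (restrict_groupoid G H) \<sigma> \<and> continuous_unitary_rep (restrict_groupoid G H) \<sigma>' \<and>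
    equivalent_reps (restrict_groupoid G H) \<sigma> \<sigma>'"
  then interpret hrep_ne G H lamH \<mu> \<sigma>
   using ne by (simp add: hrep_ne_def hrep_ne_axioms_def continuous_unitary_rep_imp_hrep)
  show "equivalent_reps G (ind_rep G H \<mu> \<sigma>) (ind_rep G H \<mu> \<sigma>')"
   using equivalent_ind_rep[OF continuous_unitary_rep_imp_hrep] a by blast
 next
  fix I :: "'i set" and \<sigma> :: "'i \<Rightarrow> ('g, 'x) groupoid_rep"
  assume "\<forall>i\<in>I. continuous_unitary_rep (restrict_groupoid G H) (\<sigma> i)"
  then interpret hrep_family G H lamH \<mu> I \<sigma>
   using ne by (auto simp: hrep_family_def hrep_family_axioms_def continuous_unitary_rep_imp_hrep coset_setting_axioms)
  show "equivalent_reps G (ind_rep G H \<mu> (rep_sum (restrict_groupoid G H) I \<sigma>))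
    (rep_sum G I (\<lambda>i. ind_rep G H \<mu> (\<sigma> i)))" by (rule ind_rep_sum)
 qed
qed

end
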